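(* Let $(M,g)$ be a compact Riemannian manifold without boundary, $n=\dim M$, and let $H\subset M$ be a compact embedded submanifold, $d=\dim H<n$. Let $\mathcal R$ be the set of recurrent directions: those $(x,\xi)\in SN^*H$ such that, for each open neighborhood $U$ of $(x,\xi)$ in $SN^*H$, there exists $t\neq0$ with $G^t(x,\xi)\in U$. If $\mathcal R$ has measure zero in $SN^*H$, then, with $\mathcal T$ and $q$ as defined in the context, $$\lim_{T\to\infty}\frac1T\sum_{t\in\mathcal T\cap[-T,T]}|q(t)|=0.$$
   Context: Dynamics. $p(x,\xi)=|\xi|_{g(x)}$ on $\dot T^*M=T^*M\setminus 0$; $G^t$ is the time-$t$ flow of the Hamilton vector field $H_p=\sum_j(\partial_{\xi_j}p\,\partial_{x_j}-\partial_{x_j}p\,\partial_{\xi_j})$; $\dot N^*H$ is the conormal bundle of $H$ minus the zero section; $SN^*H=\dot N^*H\cap p^{-1}(1)$. For $t\neq0$, $\Sigma_t$ is the set of $(x,\xi)\in\dot N^*H$ such that $G^t(x,\xi)\in\dot N^*H$ and $dG^t$ maps $T_{(x,\xi)}\dot N^*H$ isomorphically onto $T_{G^t(x,\xi)}\dot N^*H$; $S\Sigma_t=\Sigma_t\cap SN^*H$. In local coordinates $x=(x',x'')\in\mathbb R^d\times\mathbb R^{n-d}$ with $H=\{x''=0\}$ and dual coordinates $\xi=(\xi',\xi'')$, $\dot N^*H$ is parametrized by $(x',\xi'')$ and carries the natural density $|g_H(x')||g(x)|^{-1/2}|dx'\,d\xi''|$ at $x=(x',0)$ ($g_H$ the induced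 metric on $H$, $|\cdot|$ determinants). For $(x,\xi)\in\Sigma_t$, $J_t(x,\xi)>0$ is the absolute value of the determinant of $dG^t:T_{(x,\xi)}\dot N^*H\to T_{G^t(x,\xi)}\dot N^*H$ with respect to these densities, i.e. with $(y,\eta)=G^t(x,\xi)$, $|g_H(y')||g(y)|^{-1/2}|dy'd\eta''|$ corresponds to $J_t(x,\xi)|g_H(x')||g(x)|^{-1/2}|dx'd\xi''|$. $SN^*H$ carries the Leray measure induced by $p=1$ (if the $x''$ coordinate vectors are an orthonormal normal frame along $H$, it is $|g_H(x')|^{1/2}dx'\,d\omega$, with $\xi''=|\xi''|\omega$, $\omega\in S^{n-d-1}$). $\mathcal T\subset\mathbb R\setminus\{0\}$ is the countable set of nonzero $t$ for which $S\Sigma_t$ has positive measure. Maslov factor. Let $P=\sqrt{-\Delta_g}$, and let $\delta_H$ be the half-density distribution $f|dV_M|^{1/2}\mapsto\int_Hf\,dV_H$. Then $e^{itP}\delta_H$ is a Lagrangian distribution associated with $G^{-t}(\dot N^*H)$. If $(x,\xi)\in\Sigma_t$, this Lagrangian contains $(x,\xi)$ and is tangent to $\dot N^*H$ there, so in coordinates with $H=\{x''=0\}$ it is locally $\{x''=\psi'_{\xi''},\ \xi'=-\psi'_{x'}\}$ with $\psi(x',\xi'')$ smooth and positive-homogeneous of degree 1 in $\xi''$, and microlocally $e^{itP}\delta_H=\left(\int e^{i(\langle x'',\xi''\rangle-\psi(x',\xi''))}b(x,\xi'')\,d\xi''\right)|dx|^{1/2}$ with $b$ a classical symbol of order $0$.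 The factor $i^{\sigma_t(x,\xi)}$, $\sigma_t(x,\xi)\in\mathbb Z/4$, is the phase of the principal part of $b$ at $(x,\xi)$ (which is a positive multiple of $i^{\sigma_t(x,\xi)}$). For $t\in\mathcal T$, $q(t)=(2\pi)^{-n+d}\int_{S\Sigma_t}i^{\sigma_t}\sqrt{J_t}$. *)

theory Defs
  imports "HOL-Analysis.Analysis"
begin

section \<open>Smooth maps between Euclidean spaces\<close>

text \<open>\<^term>\<open>S\<close> is always an open subset of a finite-dimensional space below.\<close>

primrec Ck_on :: "nat \<Rightarrow> 'b::real_normed_vector set \<Rightarrow> ('b \<Rightarrow> 'c::real_normed_vector) \<Rightarrow> bool" where
  "Ck_on 0 S f \<longleftrightarrow> continuous_on S f"
| "Ck_on (Suc k) S f \<longleftrightarrow> (\<forall>x\<in>S. f differentiable (at x)) \<and>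
     (\<forall>v. Ck_on k S (\<lambda>x. frechet_derivative f (at x) v))"

definition smooth_on :: "'b::real_normed_vector set \<Rightarrow> ('b \<Rightarrow> 'c::real_normed_vector) \<Rightarrow> bool" where
  "smooth_on S f \<longleftrightarrow> (\<forall>k. Ck_on k S f)"

definition pd :: "(real^'n \<Rightarrow> 'c::real_normed_vector) \<Rightarrow> 'n::finite \<Rightarrow> real^'n \<Rightarrow> 'c" where
  "pd f i x = frechet_derivative f (at x) (axis i 1)"

primrec iter_deriv :: "'b::real_normed_vector list \<Rightarrow> ('b \<Rightarrow> 'c::real_normed_vector) \<Rightarrow> 'b \<Rightarrow> 'c" where
  "iter_deriv [] f = f"
| "iter_deriv (v # vs) f = (\<lambda>x. frechet_derivative (iter_deriv vs f) (at x) v)"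


section \<open>Splitting of coordinates\<close>

text \<open>
  A splitting \<open>x = (x', x'')\<close> of the coordinates on \<open>\<real>\<^sup>n\<close> is given by the set \<open>D\<close> of
  indices of the \<open>x'\<close>-coordinates (so \<open>D\<close> may be empty). The parameters \<open>(x', \<xi>'')\<close> of a
  conormal bundle are recorded as one vector \<open>z\<close> in \<open>\<real>\<^sup>n\<close>, with \<open>z\<^sub>i = x\<^sub>i\<close> for \<open>i \<in> D\<close> and
  \<open>z\<^sub>i = \<xi>\<^sub>i\<close> for \<open>i \<notin> D\<close>; thus \<open>dx' d\<xi>''\<close> is Lebesgue measure in \<open>z\<close>.
\<close>

definition proj :: "'n set \<Rightarrow> real^'n \<Rightarrow> real^'n::finite" where
  "proj D x = (\<chi> i. if i \<in> D then x $ i else 0)"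

definition merge :: "'n set \<Rightarrow> (real^'n) \<times> (real^'n) \<Rightarrow> real^'n::finite" where
  "merge D = (\<lambda>(x, \<xi>). \<chi> i. if i \<in> D then x $ i else \<xi> $ i)"

definition conormal_param :: "'n set \<Rightarrow> real^'n \<Rightarrow> (real^'n) \<times> (real^'n::finite)" where
  "conormal_param D z = (proj D z, proj (- D) z)"

text \<open>\<open>(coord_lebesgue D, emb D)\<close> is Lebesgue measure on \<open>\<real>\<^sup>D\<close> with the inclusion into \<open>\<real>\<^sup>n\<close>;
  for \<open>D = {}\<close> it is a point of mass one.\<close>

definition coord_lebesgue :: "'n set \<Rightarrow> ('n \<Rightarrow> real) measure" where
  "coord_lebesgue D = PiM D (\<lambda>_. lborel)"

definition emb :: "'n set \<Rightarrow> ('n \<Rightarrow> real) \<Rightarrow> real^'n::finite" where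
  "emb D y = (\<chi> i. if i \<in> D then y i else 0)"


section \<open>Oscillatory integrals and microlocal equality on an open subset of Euclidean space\<close>

definition test_function :: "(real^'n) set \<Rightarrow> (real^'n::finite \<Rightarrow> complex) \<Rightarrow> bool" where
  "test_function X \<phi> \<longleftrightarrow> smooth_on UNIV \<phi> \<and> compact (closure {x. \<phi> x \<noteq> 0}) \<and> closure {x. \<phi> x \<noteq> 0} \<subseteq> X"

text \<open>\<open>(x\<^sub>0, \<xi>\<^sub>0)\<close> is not in the wave front set of the distribution \<open>w\<close> on \<open>X\<close>.\<close>

definition not_in_WF ::
  "(real^'n) set \<Rightarrow> ((real^'n::finite \<Rightarrow> complex) \<Rightarrow> complex) \<Rightarrow> (real^'n) \<times> (real^'n) \<Rightarrow> bool" where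
  "not_in_WF X w = (\<lambda>(x0, \<xi>0). \<exists>\<phi> V. test_function X \<phi> \<and> \<phi> x0 \<noteq> 0 \<and>
     open V \<and> (\<forall>s>0. \<forall>\<xi>\<in>V. s *\<^sub>R \<xi> \<in> V) \<and> \<xi>0 \<in> V \<and>
     (\<forall>N::nat. \<exists>C. \<forall>\<xi>\<in>V. norm (w (\<lambda>x. \<phi> x * cis (- (x \<bullet> \<xi>)))) \<le> C * (1 + norm \<xi>) powr (- real N)))"

text \<open>
  A function \<open>a(x, \<xi>'')\<close> is encoded as a function of \<open>(x, \<xi>)\<close> which depends on \<open>\<xi>\<close> only through
  \<open>\<xi>'' = proj (- D) \<xi>\<close>. The symbol estimates of order \<open>m\<close> are imposed on \<open>\<bar>\<xi>''\<bar> \<ge> 1\<close>, so that the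
  homogeneous terms of a classical expansion need no cutoff near \<open>\<xi>'' = 0\<close>.
\<close>

definition indep_of_xi' :: "'n set \<Rightarrow> ((real^'n) \<times> (real^'n::finite) \<Rightarrow> complex) \<Rightarrow> bool" where
  "indep_of_xi' D a \<longleftrightarrow> (\<forall>x \<xi>. a (x, \<xi>) = a (x, proj (- D) \<xi>))"

definition symbol_estimates ::
  "(real^'n) set \<Rightarrow> 'n set \<Rightarrow> real \<Rightarrow> ((real^'n) \<times> (real^'n::finite) \<Rightarrow> complex) \<Rightarrow> bool" where
  "symbol_estimates X D m a \<longleftrightarrow>
     (\<forall>K vs ws. compact K \<and> K \<subseteq> X \<longrightarrow>
        (\<exists>C. \<forall>x\<in>K. \<forall>\<xi>. norm (proj (- D) \<xi>) \<ge> 1 \<longrightarrow>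
           norm (iter_deriv (map (\<lambda>v. (v, 0)) vs @ map (\<lambda>w. (0, w)) ws) a (x, \<xi>))
             \<le> C * norm (proj (- D) \<xi>) powr (m - real (length ws))))"

text \<open>\<open>b\<close> is a classical symbol of order 0 with homogeneous terms \<open>bs j\<close> of degree \<open>- j\<close>;
  \<open>bs 0\<close> is the principal part.\<close>

definition classical_symbol0 ::
  "(real^'n) set \<Rightarrow> 'n set \<Rightarrow> ((real^'n) \<times> (real^'n::finite) \<Rightarrow> complex)
     \<Rightarrow> (nat \<Rightarrow> (real^'n) \<times> (real^'n) \<Rightarrow> complex) \<Rightarrow> bool" where
  "classical_symbol0 X D b bs \<longleftrightarrow>
     smooth_on (X \<times> UNIV) b \<and> indep_of_xi' D b \<and>
     (\<forall>j. smooth_on (X \<times> {\<xi>. proj (- D) \<xi> \<noteq> 0}) (bs j) \<and> indep_of_xi' D (bs j) \<and>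
          (\<forall>x\<in>X. \<forall>\<xi> s. proj (- D) \<xi> \<noteq> 0 \<and> s > 0 \<longrightarrow>
              bs j (x, s *\<^sub>R \<xi>) = of_real (s powr (- real j)) * bs j (x, \<xi>))) \<and>
     (\<forall>N. symbol_estimates X D (- real N) (\<lambda>z. b z - (\<Sum>j<N. bs j z)))"

text \<open>Sets in the parameters \<open>z = (x', \<xi>'')\<close> which are conic in \<open>\<xi>''\<close>.\<close>

definition conic :: "'n set \<Rightarrow> (real^'n::finite) set \<Rightarrow> bool" where
  "conic D \<Gamma> \<longleftrightarrow> (\<forall>z\<in>\<Gamma>. \<forall>s>0. proj D z + s *\<^sub>R proj (- D) z \<in> \<Gamma>)"

definition homogeneous_phase :: "'n set \<Rightarrow> (real^'n) set \<Rightarrow> (real^'n::finite \<Rightarrow> real) \<Rightarrow> bool" where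
  "homogeneous_phase D \<Gamma> \<psi> \<longleftrightarrow>
     open \<Gamma> \<and> conic D \<Gamma> \<and> (\<forall>z\<in>\<Gamma>. proj (- D) z \<noteq> 0) \<and> smooth_on \<Gamma> \<psi> \<and>
     (\<forall>z\<in>\<Gamma>. \<forall>s>0. \<psi> (proj D z + s *\<^sub>R proj (- D) z) = s * \<psi> z)"

text \<open>\<open>b\<close> is supported in a closed cone contained in the open cone \<open>\<Gamma>\<close>, on which the phase is smooth.\<close>

definition conically_supported ::
  "'n set \<Rightarrow> (real^'n) set \<Rightarrow> ((real^'n) \<times> (real^'n::finite) \<Rightarrow> complex) \<Rightarrow> bool" where
  "conically_supported D \<Gamma> b \<longleftrightarrow>
     (\<exists>F. closed F \<and> conic D F \<and> {z \<in> F. proj (- D) z \<noteq> 0} \<subseteq> \<Gamma> \<and>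
          (\<forall>x \<xi>. b (x, \<xi>) \<noteq> 0 \<longrightarrow> proj (- D) \<xi> \<noteq> 0 \<and> merge D (x, \<xi>) \<in> F))"

text \<open>
  The distribution given by the oscillatory integral of
  \<open>exp(i(\<langle>x'', \<xi>''\<rangle> - \<psi>(x', \<xi>''))) b(x, \<xi>'')\<close> over \<open>\<xi>''\<close>, paired with a test function. As the phase has
  \<open>x''\<close>-gradient \<open>\<xi>''\<close>, the inner integral decays rapidly in \<open>\<xi>''\<close> and no regularization is needed.
\<close>

definition oscillatory_integral ::
  "'n set \<Rightarrow> (real^'n \<Rightarrow> real) \<Rightarrow> ((real^'n) \<times> (real^'n) \<Rightarrow> complex)
     \<Rightarrow> (real^'n::finite \<Rightarrow> complex) \<Rightarrow> complex" where
  "oscillatory_integral D \<psi> b \<phi> =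
     (LINT \<eta>|coord_lebesgue (- D). LINT x|lborel.
        cis (x \<bullet> emb (- D) \<eta> - \<psi> (merge D (x, emb (- D) \<eta>))) * b (x, emb (- D) \<eta>) * \<phi> x)"


section \<open>Smooth manifolds and Riemannian metrics\<close>

text \<open>A chart is its domain together with the coordinate map (values off the domain are irrelevant).\<close>

type_synonym ('a, 'n) chart = "'a set \<times> ('a \<Rightarrow> real^'n)"

definition cdom :: "('a, 'n) chart \<Rightarrow> 'a set" where
  "cdom c = fst c"

definition cmap :: "('a, 'n) chart \<Rightarrow> 'a \<Rightarrow> real^'n" where
  "cmap c = snd c"

definition crange :: "('a, 'n) chart \<Rightarrow> (real^'n) set" where
  "crange c = cmap c ` cdom c"

definition cinv :: "('a, 'n) chart \<Rightarrow> real^'n \<Rightarrow> 'a" where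
  "cinv c = inv_into (cdom c) (cmap c)"

definition is_chart :: "('a::topological_space, 'n::finite) chart \<Rightarrow> bool" where
  "is_chart c \<longleftrightarrow> open (cdom c) \<and> open (crange c) \<and> homeomorphism (cdom c) (crange c) (cmap c) (cinv c)"

definition transition :: "('a, 'n) chart \<Rightarrow> ('a, 'n) chart \<Rightarrow> real^'n \<Rightarrow> real^'n" where
  "transition c c' = cmap c' \<circ> cinv c"

definition compatible :: "('a, 'n::finite) chart \<Rightarrow> ('a, 'n) chart \<Rightarrow> bool" where
  "compatible c c' \<longleftrightarrow>
     smooth_on (cmap c ` (cdom c \<inter> cdom c')) (transition c c') \<and>
     smooth_on (cmap c' ` (cdom c \<inter> cdom c')) (transition c' c)"

definition maximal_smooth_atlas :: "('a::topological_space, 'n::finite) chart set \<Rightarrow> bool" where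
  "maximal_smooth_atlas A \<longleftrightarrow>
     (\<forall>c\<in>A. is_chart c) \<and> (\<Union>c\<in>A. cdom c) = UNIV \<and> (\<forall>c\<in>A. \<forall>c'\<in>A. compatible c c') \<and>
     (\<forall>c. is_chart c \<and> (\<forall>c'\<in>A. compatible c c') \<longrightarrow> c \<in> A)"

text \<open>\<open>g c x\<close> is the matrix \<open>(g\<^sub>i\<^sub>j(x))\<close> in the chart \<open>c\<close>; the last clause is the transformation law
  of a covariant 2-tensor.\<close>

definition riemannian_metric ::
  "('a, 'n::finite) chart set \<Rightarrow> (('a, 'n) chart \<Rightarrow> real^'n \<Rightarrow> real^'n^'n) \<Rightarrow> bool" where
  "riemannian_metric A g \<longleftrightarrow>
     (\<forall>c\<in>A. smooth_on (crange c) (g c) \<and>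
        (\<forall>x\<in>crange c. transpose (g c x) = g c x \<and> (\<forall>v. v \<noteq> 0 \<longrightarrow> v \<bullet> (g c x *v v) > 0))) \<and>
     (\<forall>c\<in>A. \<forall>c'\<in>A. \<forall>p\<in>cdom c \<inter> cdom c'.
        (let T = jacobian (transition c' c) (at (cmap c' p))
         in g c' (cmap c' p) = transpose T ** g c (cmap c p) ** T))"


section \<open>Cotangent bundle, geodesic flow and half-wave group\<close>

text \<open>The manifold is the whole type \<^typ>\<open>'a\<close>; its dimension is \<^term>\<open>CARD('n)\<close>.\<close>

locale compact_riemannian =
  fixes A :: "('a::t2_space, 'n::finite) chart set"
    and g :: "('a, 'n) chart \<Rightarrow> real^'n \<Rightarrow> real^'n^'n"
  assumes compact_M: "compact (UNIV :: 'a set)"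
    and atlas: "maximal_smooth_atlas A"
    and metric: "riemannian_metric A g"
begin

definition chart_at :: "'a \<Rightarrow> ('a, 'n) chart" where
  "chart_at p = (SOME c. c \<in> A \<and> p \<in> cdom c)"

text \<open>
  A point of \<open>T\<^sup>*M\<close> is a base point together with the components of a covector in all charts
  around it, related by the transformation law of covectors (and 0 in the other charts).
\<close>

definition cotangent :: "('a \<times> (('a, 'n) chart \<Rightarrow> real^'n)) set" where
  "cotangent = {(p, \<omega>).
     (\<forall>c\<in>A. \<forall>c'\<in>A. p \<in> cdom c \<inter> cdom c' \<longrightarrow>
        \<omega> c' = transpose (jacobian (transition c' c) (at (cmap c' p))) *v \<omega> c) \<and>
     (\<forall>c. c \<notin> A \<or> p \<notin> cdom c \<longrightarrow> \<omega> c = 0)}"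

definition coord :: "('a, 'n) chart \<Rightarrow> 'a \<times> (('a, 'n) chart \<Rightarrow> real^'n) \<Rightarrow> (real^'n) \<times> (real^'n)" where
  "coord c \<alpha> = (cmap c (fst \<alpha>), snd \<alpha> c)"

definition of_coord :: "('a, 'n) chart \<Rightarrow> (real^'n) \<times> (real^'n) \<Rightarrow> 'a \<times> (('a, 'n) chart \<Rightarrow> real^'n)" where
  "of_coord c = (\<lambda>(x, \<xi>). (cinv c x, \<lambda>c'. if c' \<in> A \<and> cinv c x \<in> cdom c'
     then transpose (jacobian (transition c' c) (at (cmap c' (cinv c x)))) *v \<xi> else 0))"

definition dot_cotangent :: "('a \<times> (('a, 'n) chart \<Rightarrow> real^'n)) set" where
  "dot_cotangent = {\<alpha> \<in> cotangent. snd \<alpha> \<noteq> (\<lambda>_. 0)}"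

definition cot_topology :: "('a \<times> (('a, 'n) chart \<Rightarrow> real^'n)) topology" where
  "cot_topology = topology (\<lambda>S. S \<subseteq> cotangent \<and> (\<forall>c\<in>A. open (coord c ` {\<alpha> \<in> S. fst \<alpha> \<in> cdom c})))"

definition scale :: "real \<Rightarrow> 'a \<times> (('a, 'n) chart \<Rightarrow> real^'n) \<Rightarrow> 'a \<times> (('a, 'n) chart \<Rightarrow> real^'n)" where
  "scale r \<alpha> = (fst \<alpha>, \<lambda>c. r *\<^sub>R snd \<alpha> c)"

definition p_loc :: "('a, 'n) chart \<Rightarrow> (real^'n) \<times> (real^'n) \<Rightarrow> real" where
  "p_loc c = (\<lambda>(x, \<xi>). sqrt (\<xi> \<bullet> (matrix_inv (g c x) *v \<xi>)))"

definition p :: "'a \<times> (('a, 'n) chart \<Rightarrow> real^'n) \<Rightarrow> real" where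
  "p \<alpha> = p_loc (chart_at (fst \<alpha>)) (coord (chart_at (fst \<alpha>)) \<alpha>)"

definition H_p :: "('a, 'n) chart \<Rightarrow> (real^'n) \<times> (real^'n) \<Rightarrow> (real^'n) \<times> (real^'n)" where
  "H_p c z = ((\<chi> j. frechet_derivative (p_loc c) (at z) (0, axis j 1)),
              (\<chi> j. - frechet_derivative (p_loc c) (at z) (axis j 1, 0)))"

definition integral_curve :: "(real \<Rightarrow> 'a \<times> (('a, 'n) chart \<Rightarrow> real^'n)) \<Rightarrow> bool" where
  "integral_curve \<gamma> \<longleftrightarrow> (\<forall>t. \<gamma> t \<in> dot_cotangent) \<and> continuous_on UNIV (fst \<circ> \<gamma>) \<and>
     (\<forall>c\<in>A. \<forall>t. fst (\<gamma> t) \<in> cdom c \<longrightarrow>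
        ((\<lambda>s. coord c (\<gamma> s)) has_vector_derivative H_p c (coord c (\<gamma> t))) (at t))"

definition G :: "real \<Rightarrow> 'a \<times> (('a, 'n) chart \<Rightarrow> real^'n) \<Rightarrow> 'a \<times> (('a, 'n) chart \<Rightarrow> real^'n)" where
  "G t \<alpha> = (THE \<beta>. \<exists>\<gamma>. integral_curve \<gamma> \<and> \<gamma> 0 = \<alpha> \<and> \<gamma> t = \<beta>)"

definition vol :: "'a measure" where
  "vol = (THE \<nu>. space \<nu> = UNIV \<and> sets \<nu> = sets borel \<and>
     (\<forall>c\<in>A. \<forall>S\<in>sets borel. S \<subseteq> cdom c \<longrightarrow>
        emeasure \<nu> S = (\<integral>\<^sup>+ x. ennreal (sqrt (det (g c x))) * indicator (cmap c ` S) x \<partial>lborel)))"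

definition laplacian :: "('a \<Rightarrow> real) \<Rightarrow> 'a \<Rightarrow> real" where
  "laplacian f q = (let c = chart_at q; x = cmap c q in
     (\<Sum>i\<in>UNIV. pd (\<lambda>y. sqrt (det (g c y)) *
          (\<Sum>j\<in>UNIV. matrix_inv (g c y) $ i $ j * pd (f \<circ> cinv c) j y)) i x) / sqrt (det (g c x)))"

text \<open>A real orthonormal basis of \<open>L\<^sup>2(M)\<close> of eigenfunctions of \<open>P = \<surd>(-\<Delta>)\<close>, with eigenvalues \<open>l j\<close>.\<close>

definition eigenbasis :: "(nat \<Rightarrow> 'a \<Rightarrow> real) \<Rightarrow> (nat \<Rightarrow> real) \<Rightarrow> bool" where
  "eigenbasis e l \<longleftrightarrow>
     (\<forall>j. l j \<ge> 0 \<and> (\<forall>c\<in>A. smooth_on (crange c) (e j \<circ> cinv c)) \<and>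
          (\<forall>x. - laplacian (e j) x = (l j)\<^sup>2 * e j x)) \<and>
     (\<forall>j k. (LINT x|vol. e j x * e k x) = (if j = k then 1 else 0)) \<and>
     (\<forall>f\<in>borel_measurable vol. integrable vol (\<lambda>x. (f x)\<^sup>2) \<and> (\<forall>j. (LINT x|vol. e j x * f x) = 0)
        \<longrightarrow> (AE x in vol. f x = (0::real)))"

text \<open>\<open>e\<^sup>i\<^sup>t\<^sup>P f\<close>, for smooth \<open>f\<close>.\<close>

definition half_wave :: "real \<Rightarrow> ('a \<Rightarrow> complex) \<Rightarrow> 'a \<Rightarrow> complex" where
  "half_wave t f x = (let (e, l) = (SOME (e, l). eigenbasis e l) in
     (\<Sum>\<^sub>\<infinity>j. cis (t * l j) * (LINT y|vol. of_real (e j y) * f y) * of_real (e j x)))"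


section \<open>Submanifolds and conormal bundles\<close>

text \<open>In the chart \<open>c\<close>, the set \<open>H\<close> is \<open>{x'' = 0}\<close> for the splitting \<open>D\<close> with \<open>d\<close> coordinates \<open>x'\<close>.\<close>

definition adapted :: "'a set \<Rightarrow> nat \<Rightarrow> ('a, 'n) chart \<Rightarrow> 'n set \<Rightarrow> bool" where
  "adapted H d c D \<longleftrightarrow> c \<in> A \<and> card D = d \<and>
     cmap c ` (H \<inter> cdom c) = {x \<in> crange c. \<forall>i. i \<notin> D \<longrightarrow> x $ i = 0}"

end

locale compact_riemannian_submanifold = compact_riemannian A g
  for A :: "('a::t2_space, 'n::finite) chart set"
    and g :: "('a, 'n) chart \<Rightarrow> real^'n \<Rightarrow> real^'n^'n" +
  fixes H :: "'a set" and d :: nat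
  assumes compact_H: "compact H"
    and submanifold: "\<And>q. q \<in> H \<Longrightarrow> \<exists>c D. adapted H d c D \<and> q \<in> cdom c"
    and d_less: "d < CARD('n)"
begin

text \<open>\<open>T\<^sub>qH\<close> is spanned by the coordinate vectors \<open>\<partial>\<^sub>i\<close>, \<open>i \<in> D\<close>, of an adapted chart.\<close>

definition dot_conormal :: "('a \<times> (('a, 'n) chart \<Rightarrow> real^'n)) set" where
  "dot_conormal = {\<alpha> \<in> dot_cotangent. fst \<alpha> \<in> H \<and>
     (\<forall>c D. adapted H d c D \<and> fst \<alpha> \<in> cdom c \<longrightarrow> (\<forall>i\<in>D. snd \<alpha> c $ i = 0))}"

definition SN :: "('a \<times> (('a, 'n) chart \<Rightarrow> real^'n)) set" where
  "SN = {\<alpha> \<in> dot_conormal. p \<alpha> = 1}"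

text \<open>The determinant \<open>\<bar>g\<^sub>H\<bar>\<close> of the block \<open>(g\<^sub>i\<^sub>j)\<close>, \<open>i, j \<in> D\<close>, padded by an identity block.\<close>

definition det_gH :: "('a, 'n) chart \<Rightarrow> 'n set \<Rightarrow> real^'n \<Rightarrow> real" where
  "det_gH c D x =
     det ((\<chi> i j. if i \<in> D \<and> j \<in> D then g c x $ i $ j else if i = j then 1 else 0) :: real^'n^'n)"

definition vol_H :: "'a measure" where
  "vol_H = (THE \<nu>. space \<nu> = H \<and> sets \<nu> = sets (restrict_space borel H) \<and>
     (\<forall>c D. \<forall>S\<in>sets \<nu>. adapted H d c D \<and> S \<subseteq> cdom c \<longrightarrow>
        emeasure \<nu> S = (\<integral>\<^sup>+ y. ennreal (sqrt (det_gH c D (emb D y))) * indicator (cmap c ` S) (emb D y)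
                          \<partial>coord_lebesgue D)))"

text \<open>The natural density on the conormal bundle, relative to \<open>dx' d\<xi>''\<close>, at the point \<open>x = (x', 0)\<close>.\<close>

definition density_N :: "('a, 'n) chart \<Rightarrow> 'n set \<Rightarrow> real^'n \<Rightarrow> real" where
  "density_N c D x = det_gH c D x / sqrt (det (g c x))"

definition borel_sets :: "('a \<times> (('a, 'n) chart \<Rightarrow> real^'n)) set \<Rightarrow> ('a \<times> (('a, 'n) chart \<Rightarrow> real^'n)) set set" where
  "borel_sets W = sigma_sets W {S. openin (subtopology cot_topology W) S}"

definition conormal_measure :: "('a \<times> (('a, 'n) chart \<Rightarrow> real^'n)) measure" where
  "conormal_measure = (THE \<mu>. space \<mu> = dot_conormal \<and> sets \<mu> = borel_sets dot_conormal \<and>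
     (\<forall>c D. \<forall>S\<in>sets \<mu>. adapted H d c D \<and> fst ` S \<subseteq> cdom c \<longrightarrow>
        emeasure \<mu> S = (\<integral>\<^sup>+ z. ennreal (density_N c D (proj D z)) *
                           indicator ((\<lambda>\<alpha>. merge D (coord c \<alpha>)) ` S) z \<partial>lborel)))"

text \<open>
  The Leray measure on \<open>{p = 1}\<close> is the quotient of the conormal measure \<open>\<mu>\<close> by \<open>dp\<close>: the
  derivative at \<open>s = 1\<close> of the \<open>\<mu>\<close>-measure of the part of \<open>{p \<le> s}\<close> lying over \<open>E \<subseteq> SN\<close> along the
  rays \<open>r \<mapsto> (x, r \<xi>)\<close>. These are transversal to \<open>{p = 1}\<close> and \<open>p(x, r \<xi>) = r\<close> on them.
\<close>

definition leray :: "('a \<times> (('a, 'n) chart \<Rightarrow> real^'n)) measure" where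
  "leray = measure_of SN (borel_sets SN)
     (\<lambda>E. ennreal (deriv (\<lambda>s. measure conormal_measure {scale r \<alpha> |r \<alpha>. 0 < r \<and> r \<le> s \<and> \<alpha> \<in> E}) 1))"

definition recurrent :: "('a \<times> (('a, 'n) chart \<Rightarrow> real^'n)) set" where
  "recurrent = {\<alpha> \<in> SN. \<forall>U. openin (subtopology cot_topology SN) U \<and> \<alpha> \<in> U \<longrightarrow> (\<exists>t. t \<noteq> 0 \<and> G t \<alpha> \<in> U)}"


section \<open>Conormal directions returning with tangency\<close>

text \<open>
  \<open>L\<close> is \<open>dG\<^sup>t\<close> at \<open>\<alpha>\<close> in coordinates adapted to \<open>H\<close> at \<open>\<alpha>\<close> and at \<open>G\<^sup>t(\<alpha>)\<close>, in which the tangent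
  spaces of the conormal bundle are the ranges of \<open>conormal_param D\<close> and \<open>conormal_param D'\<close>.
\<close>

definition transports ::
  "real \<Rightarrow> 'a \<times> (('a, 'n) chart \<Rightarrow> real^'n) \<Rightarrow> ('a, 'n) chart \<Rightarrow> 'n set \<Rightarrow> ('a, 'n) chart \<Rightarrow> 'n set
     \<Rightarrow> ((real^'n) \<times> (real^'n) \<Rightarrow> (real^'n) \<times> (real^'n)) \<Rightarrow> bool" where
  "transports t \<alpha> c D c' D' L \<longleftrightarrow>
     adapted H d c D \<and> fst \<alpha> \<in> cdom c \<and> adapted H d c' D' \<and> fst (G t \<alpha>) \<in> cdom c' \<and>
     ((\<lambda>z. coord c' (G t (of_coord c z))) has_derivative L) (at (coord c \<alpha>)) \<and>
     bij_betw L (range (conormal_param D)) (range (conormal_param D'))"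

definition Sigma_t :: "real \<Rightarrow> ('a \<times> (('a, 'n) chart \<Rightarrow> real^'n)) set" where
  "Sigma_t t = {\<alpha> \<in> dot_conormal. G t \<alpha> \<in> dot_conormal \<and> (\<exists>c D c' D' L. transports t \<alpha> c D c' D' L)}"

definition SSigma_t :: "real \<Rightarrow> ('a \<times> (('a, 'n) chart \<Rightarrow> real^'n)) set" where
  "SSigma_t t = Sigma_t t \<inter> SN"

text \<open>The value does not depend on the choice of the charts.\<close>

definition J :: "real \<Rightarrow> 'a \<times> (('a, 'n) chart \<Rightarrow> real^'n) \<Rightarrow> real" where
  "J t \<alpha> = (SOME r. \<exists>c D c' D' L. transports t \<alpha> c D c' D' L \<and>
     r = density_N c' D' (cmap c' (fst (G t \<alpha>))) / density_N c D (cmap c (fst \<alpha>)) *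
         \<bar>det (matrix (\<lambda>z. merge D' (L (conormal_param D z))))\<bar>)"

definition return_times :: "real set" where
  "return_times = {t. t \<noteq> 0 \<and> emeasure leray (SSigma_t t) > 0}"


section \<open>The Maslov factor\<close>

text \<open>
  The half-density distribution \<open>e\<^sup>i\<^sup>t\<^sup>P\<delta>\<^sub>H\<close>, paired with the half-density \<open>f \<bar>dV\<^sub>M\<bar>\<^sup>1\<^sup>/\<^sup>2\<close>: since \<open>P\<close> is
  real and self-adjoint, \<open>e\<^sup>i\<^sup>t\<^sup>P\<close> is its own transpose for the bilinear pairing.
\<close>

definition wave_delta :: "real \<Rightarrow> ('a \<Rightarrow> complex) \<Rightarrow> complex" where
  "wave_delta t f = (LINT x|vol_H. half_wave t f x)"

text \<open>Its coordinate expression \<open>u \<bar>dx\<bar>\<^sup>1\<^sup>/\<^sup>2\<close>, paired with \<open>\<phi> \<bar>dx\<bar>\<^sup>1\<^sup>/\<^sup>2 = \<phi> \<bar>g\<bar>\<^sup>-\<^sup>1\<^sup>/\<^sup>4 \<bar>dV\<^sub>M\<bar>\<^sup>1\<^sup>/\<^sup>2\<close>.\<close>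

definition wave_delta_loc :: "real \<Rightarrow> ('a, 'n) chart \<Rightarrow> (real^'n \<Rightarrow> complex) \<Rightarrow> complex" where
  "wave_delta_loc t c \<phi> = wave_delta t
     (\<lambda>q. if q \<in> cdom c then \<phi> (cmap c q) * of_real (det (g c (cmap c q)) powr (- 1/4)) else 0)"

text \<open>The phase \<open>\<psi>\<close> parametrizes \<open>G\<^sup>-\<^sup>t\<close> of the conormal bundle near \<open>\<alpha>\<close>.\<close>

definition parametrizes ::
  "real \<Rightarrow> 'a \<times> (('a, 'n) chart \<Rightarrow> real^'n) \<Rightarrow> ('a, 'n) chart \<Rightarrow> 'n set
     \<Rightarrow> (real^'n) set \<Rightarrow> (real^'n \<Rightarrow> real) \<Rightarrow> bool" where
  "parametrizes t \<alpha> c D \<Gamma> \<psi> \<longleftrightarrow>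
     homogeneous_phase D \<Gamma> \<psi> \<and>
     (\<exists>W. openin cot_topology W \<and> \<alpha> \<in> W \<and>
        (\<forall>\<beta>\<in>W. fst \<beta> \<in> cdom c \<and>
           (let (x, \<xi>) = coord c \<beta>; z = merge D (x, \<xi>) in
              z \<in> \<Gamma> \<and>
              (\<beta> \<in> G (- t) ` dot_conormal \<longleftrightarrow>
                 (\<forall>i. i \<notin> D \<longrightarrow> x $ i = pd \<psi> i z) \<and> (\<forall>i\<in>D. \<xi> $ i = - pd \<psi> i z)))))"

definition maslov_phase :: "real \<Rightarrow> 'a \<times> (('a, 'n) chart \<Rightarrow> real^'n) \<Rightarrow> nat \<Rightarrow> bool" where
  "maslov_phase t \<alpha> k \<longleftrightarrow>
     (\<exists>c D \<Gamma> \<psi> b bs. adapted H d c D \<and> fst \<alpha> \<in> cdom c \<and> parametrizes t \<alpha> c D \<Gamma> \<psi> \<and>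
        classical_symbol0 (crange c) D b bs \<and> conically_supported D \<Gamma> b \<and>
        not_in_WF (crange c) (\<lambda>\<phi>. wave_delta_loc t c \<phi> - oscillatory_integral D \<psi> b \<phi>) (coord c \<alpha>) \<and>
        (\<exists>r>0. bs 0 (coord c \<alpha>) = of_real r * \<i> ^ k))"

text \<open>The representative in \<open>{0, 1, 2, 3}\<close> of an element of \<open>\<int>/4\<close>.\<close>

definition maslov :: "real \<Rightarrow> 'a \<times> (('a, 'n) chart \<Rightarrow> real^'n) \<Rightarrow> nat" where
  "maslov t \<alpha> = (SOME k. k < 4 \<and> maslov_phase t \<alpha> k)"

definition q :: "real \<Rightarrow> complex" where
  "q t = of_real ((2 * pi) powi (- int CARD('n) + int d)) *
     (LINT \<alpha>:SSigma_t t|leray. \<i> ^ maslov t \<alpha> * of_real (sqrt (J t \<alpha>)))"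

end

end

theory Submission
  imports Defs
begin

text \<open>
  Why the averages tend to 0. On \<open>SN\<close> the time-\<open>t\<close> flow maps a part \<open>E\<close> of \<open>S\<Sigma>\<^sub>t\<close> to a set of Leray measure
  \<open>\<integral>\<^sub>E J\<^sub>t\<close> (\<open>emeasure_leray_flow\<close>): the densities in the definition of \<open>J\<^sub>t\<close> are those of the conormal
  measure, for which this is the change of variables formula, and the flow commutes with dilations of the
  fibers, under which the conormal measure is homogeneous. As \<open>\<bar>i\<^sup>\<sigma>\<bar> = 1\<close>, the number \<open>\<bar>q(t)\<bar>\<close> is at most a
  constant times \<open>\<integral> \<surd>J\<^sub>t\<close> over \<open>S\<Sigma>\<^sub>t\<close>, and for every \<open>\<kappa> > 0\<close> the inequality \<open>\<surd>J \<le> \<kappa> + J / \<kappa>\<close> bounds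
  \<open>\<integral>\<^sub>E \<surd>J\<^sub>t\<close> by \<open>\<kappa> \<bar>E\<bar> + \<bar>G\<^sup>t(E)\<bar> / \<kappa>\<close>.

  Geodesics leave \<open>H\<close> orthogonally and hence cannot be conormal to it again before a fixed time \<open>\<delta>\<close>
  (\<open>return_gap\<close>). So for a point of \<open>SN\<close> the number of times \<open>t \<in> [-T, T]\<close> for which it lies in \<open>S\<Sigma>\<^sub>t\<close>, or
  in \<open>G\<^sup>t(S\<Sigma>\<^sub>t)\<close>, is \<open>O(T)\<close>, and the sum of the \<open>\<integral> \<surd>J\<^sub>t\<close> is \<open>O(T)\<close>.

  Nonrecurrence improves this to \<open>o(T)\<close>. Let \<open>U\<^sub>k\<close> be a countable basis of \<open>SN\<close> and \<open>W\<^sub>k \<subseteq> U\<^sub>k\<close> the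
  directions whose orbits do not return to \<open>U\<^sub>k\<close>. Almost every direction lies in some \<open>W\<^sub>k\<close>, hence in one of
  the first \<open>m\<close> of them up to small measure \<open>\<eta>\<close>. From a given point at most one return ends in \<open>W\<^sub>k\<close>, because
  another return to \<open>U\<^sub>k\<close> would lie on its orbit. With total measure \<open>V\<close> and \<open>\<kappa> = \<surd>T\<close>, the returns to the
  first \<open>m\<close> sets therefore contribute at most \<open>\<kappa> m V + O(T) V / \<kappa> = O(\<surd>T)\<close>. The other returns contribute
  \<open>O(T) (V / \<mu> + \<mu> \<eta>)\<close>, which is a small multiple of \<open>T\<close> if \<open>\<mu>\<close> is large and \<open>\<eta>\<close> is small depending on
  \<open>\<mu>\<close>. This part is \<open>sum_sqrt_jacobian_sublinear\<close>, a statement about partial maps of a finite measure space.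

  The objects of the theorem are given by descriptions, so they must be shown to be what they describe. The
  Hamilton vector field is independent of the chart because coordinate changes are symplectic
  (\<open>H_p_transform\<close>); its integral curves are complete because the level sets of \<open>p\<close> are compact
  (\<open>ex_global_curve\<close>). The conormal density is the same in all adapted charts (\<open>density_change\<close>), so the
  conormal measure exists and is unique (\<open>is_conormal_measure\<close>), and \<open>J\<^sub>t\<close> can be computed in any charts
  (\<open>J_eq\<close>). The Leray measure is \<open>n - d\<close> times the conormal measure of the unit cone over a set, or it
  vanishes identically (\<open>emeasure_leray_cases\<close>); in the latter case there are no return times.
\<close>

section \<open>Change of variables for nonnegative integrands\<close>

text \<open>
  Lebesgue's change of variables theorem for \<^typ>\<open>real^'n\<close> uses a well-ordering of the coordinates. The
  initial segment of \<open>\<nat>\<close> of size \<^term>\<open>CARD('n)\<close> provides well-ordered coordinates for an arbitrary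
  finite index type.
\<close>

typedef ('n::finite) ordered_index = "{..<CARD('n)}"
  by (rule exI[of _ 0]) simp

instantiation ordered_index :: (finite) linorder
begin
definition "x \<le> y \<longleftrightarrow> Rep_ordered_index x \<le> Rep_ordered_index y"
definition "x < y \<longleftrightarrow> Rep_ordered_index x < Rep_ordered_index y"
instance
  by intro_classes (auto simp: less_eq_ordered_index_def less_ordered_index_def Rep_ordered_index_inject)
end

instance ordered_index :: (finite) finite
proof
  have "(UNIV :: 'a ordered_index set) = Abs_ordered_index ` {..<CARD('a)}"
    by (metis type_definition.Abs_image type_definition_ordered_index)
  then show "finite (UNIV :: 'a ordered_index set)"
    by (metis finite_imageI finite_lessThan)
qed

instance ordered_index :: (finite) wellorder
proof -
  have "wf {(x :: 'a ordered_index, y). x < y}"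
    by (auto simp: trancl_def tranclp_less intro!: finite_acyclic_wf acyclicI)
  then show "OFCLASS('a ordered_index, wellorder_class)"
    by (rule wf_wellorderI) intro_classes
qed

lemma card_ordered_index: "CARD('n::finite ordered_index) = CARD('n)"
  using type_definition.card[OF type_definition_ordered_index] by simp

lemma ex_bij_ordered_index: "\<exists>h :: 'n::finite ordered_index \<Rightarrow> 'n. bij h"
  by (rule finite_same_card_bij) (auto simp: card_ordered_index)

definition reindex :: "('m \<Rightarrow> 'n) \<Rightarrow> real^'n \<Rightarrow> real^'m" where
  "reindex h x = (\<chi> i. x $ h i)"

lemma linear_reindex: "linear (reindex h :: real^'n::finite \<Rightarrow> real^'m::finite)"
  by (auto simp: reindex_def linear_iff vec_eq_iff)

lemma reindex_inv:
  assumes "bij h"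
  shows "reindex h (reindex (inv h) x) = x" "reindex (inv h) (reindex h y) = y"
  using assms by (auto simp: reindex_def vec_eq_iff bij_inv_eq_iff bij_is_surj surj_f_inv_f bij_is_inj)

lemma measurable_reindex [measurable]:
  "(reindex h :: real^'n::finite \<Rightarrow> real^'m::finite) \<in> borel \<rightarrow>\<^sub>M borel"
  by (intro borel_measurable_continuous_onI linear_continuous_on linear_conv_bounded_linear[THEN iffD1] linear_reindex)

lemma prod_Basis_vec: "(\<Prod>b\<in>Basis. (x::real^'n::finite) \<bullet> b) = (\<Prod>i\<in>UNIV. x $ i)"
proof -
  have "Basis = range (\<lambda>i. axis i 1 :: real^'n)"
    by (auto simp: Basis_vec_def)
  then have "(\<Prod>b\<in>Basis. x \<bullet> b) = (\<Prod>b\<in>range (\<lambda>i. axis i 1 :: real^'n). x \<bullet> b)"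
    by (rule arg_cong)
  also have "\<dots> = (\<Prod>i\<in>UNIV. x \<bullet> axis i 1)"
    by (subst prod.reindex) (auto simp: inj_on_def axis_eq_axis)
  finally show ?thesis
    by (simp add: inner_axis)
qed

text \<open>Boxes go to boxes with permuted sides.\<close>

lemma lborel_distr_reindex:
  assumes h: "bij (h :: 'm::finite \<Rightarrow> 'n::finite)"
  shows "distr lborel borel (reindex h :: real^'n \<Rightarrow> real^'m) = lborel"
proof (rule lborel_eqI[symmetric])
  fix l u :: "real^'m" assume le: "\<And>b. b \<in> Basis \<Longrightarrow> l \<bullet> b \<le> u \<bullet> b"
  have le': "l $ i \<le> u $ i" for i
    using le[of "axis i 1"] by (simp add: inner_axis)
  have surj: "surj h" "inj h" using h by (auto simp: bij_def)
  have *: "reindex h -` box l u = box (reindex (inv h) l) (reindex (inv h) u)"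
  proof -
    have "(\<forall>i. l $ i < x $ h i \<and> x $ h i < u $ i) \<longleftrightarrow>
        (\<forall>j. l $ inv h j < x $ j \<and> x $ j < u $ inv h j)" for x :: "real^'n"
      using surj by (metis inv_f_f surj_f_inv_f)
    then show ?thesis
      by (auto simp: mem_box_cart reindex_def)
  qed
  have "emeasure (distr lborel borel (reindex h)) (box l u)
      = emeasure lborel (box (reindex (inv h) l) (reindex (inv h) u :: real^'n))"
    by (subst emeasure_distr) (auto simp: *)
  also have "\<dots> = (\<Prod>b\<in>Basis. (reindex (inv h) u - reindex (inv h) l) \<bullet> b)"
    by (rule emeasure_lborel_box) (auto simp: Basis_vec_def inner_axis reindex_def le')
  also have "(\<Prod>b\<in>Basis. (reindex (inv h) u - reindex (inv h) l :: real^'n) \<bullet> b)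
      = (\<Prod>i\<in>UNIV. (u - l) $ inv h i)"
    by (simp add: prod_Basis_vec reindex_def)
  also have "\<dots> = (\<Prod>i\<in>UNIV. (u - l) $ i)"
    using prod.reindex_bij_betw[OF bij_imp_bij_inv[OF h], of "\<lambda>i. (u - l) $ i"] by simp
  finally show "emeasure (distr lborel borel (reindex h)) (box l u) = (\<Prod>b\<in>Basis. (u - l) \<bullet> b)"
    by (simp add: prod_Basis_vec)
qed simp

text \<open>
  Both sides are sums over the permutations of an index type, which conjugation by the bijection matches.
\<close>

lemma det_reindex:
  fixes A :: "real^'n::finite^'n" and h :: "'m::finite \<Rightarrow> 'n"
  assumes h: "bij h"
  shows "det (\<chi> i j. A $ h i $ h j) = det A"
proof -
  have hj: "inj h" and hs: "range h = UNIV" using h by (auto simp: bij_def)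
  have eq: "of_int (sign p) * (\<Prod>i\<in>UNIV. A $ h i $ h (p i))
     = of_int (sign (map_permutation UNIV h p)) * (\<Prod>j\<in>UNIV. A $ j $ map_permutation UNIV h p j)"
    if "p permutes UNIV" for p :: "'m \<Rightarrow> 'm"
  proof -
    have "(\<Prod>j\<in>UNIV. A $ j $ map_permutation UNIV h p j) = (\<Prod>i\<in>UNIV. A $ h i $ map_permutation UNIV h p (h i))"
      using prod.reindex[OF hj, of "\<lambda>j. A $ j $ map_permutation UNIV h p j"] by (simp add: hs)
    then show ?thesis
      using that hj by (simp add: map_permutation_apply sign_map_permutation)
  qed
  have bij: "bij_betw (map_permutation UNIV h) {p. p permutes (UNIV::'m set)} {p. p permutes (UNIV::'n set)}"
  proof (rule bij_betw_byWitness[where f' = "map_permutation UNIV (inv h)"])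
    have mh: "map_permutation UNIV h p = h \<circ> p \<circ> inv h" for p
      by (simp add: map_permutation_def hs restrict_id_def fun_eq_iff)
    have mi: "map_permutation UNIV (inv h) p = inv h \<circ> p \<circ> h" for p
      using bij_imp_bij_inv[OF h] by (simp add: map_permutation_def restrict_id_def fun_eq_iff bij_is_surj inv_inv_eq[OF h])
    show "\<forall>p\<in>{p. p permutes UNIV}. map_permutation UNIV (inv h) (map_permutation UNIV h p) = p"
      unfolding mh mi using hj by (auto simp: fun_eq_iff)
    show "\<forall>p\<in>{p. p permutes UNIV}. map_permutation UNIV h (map_permutation UNIV (inv h) p) = p"
      unfolding mh mi using hs by (auto simp: fun_eq_iff surj_f_inv_f)
  qed (auto intro: map_permutation_permutes h bij_imp_bij_inv)
  have "det (\<chi> i j. A $ h i $ h j) =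
      (\<Sum>p | p permutes UNIV. of_int (sign p) * (\<Prod>i\<in>UNIV. A $ h i $ h (p i)))"
    by (simp add: det_def)
  also have "\<dots> = (\<Sum>p | p permutes UNIV. of_int (sign (map_permutation UNIV h p)) *
      (\<Prod>j\<in>UNIV. A $ j $ map_permutation UNIV h p j))"
    by (rule sum.cong) (use eq in auto)
  also have "\<dots> = det A"
    unfolding det_def by (rule sum.reindex_bij_betw[OF bij])
  finally show ?thesis .
qed

lemma nn_integral_change_of_variables_wellorder:
  fixes f :: "real^'n::{finite,wellorder} \<Rightarrow> real^'n::_" and h :: "real^'n::_ \<Rightarrow> real"
  assumes Z: "Z \<in> sets borel" and fZ: "f ` Z \<in> sets borel"
    and der: "\<And>z. z \<in> Z \<Longrightarrow> (f has_derivative f' z) (at z within Z)"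
    and inj: "inj_on f Z"
    and h: "h \<in> borel_measurable borel" and h0: "\<And>x. h x \<ge> 0"
  shows "(\<integral>\<^sup>+x. ennreal (h x) * indicator (f ` Z) x \<partial>lborel) =
         (\<integral>\<^sup>+x. ennreal (\<bar>det (matrix (f' x))\<bar> * h (f x)) * indicator Z x \<partial>lborel)"
    (is "?I1 = ?I2")
proof -
  define D where "D x = \<bar>det (matrix (f' x))\<bar> * h (f x)" for x
  have D0: "D x \<ge> 0" for x using h0 by (simp add: D_def)
  have ZL: "Z \<in> sets lebesgue" using Z by simp
  have fZL: "f ` Z \<in> sets lebesgue" using fZ by simp
  define vf where "vf x = (vec (h x) :: real^1)" for x
  have cv: "D absolutely_integrable_on Z \<and> integral Z D = b
    \<longleftrightarrow> h absolutely_integrable_on (f ` Z) \<and> integral (f ` Z) h = b" for b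
    using has_absolute_integral_change_of_variables[OF ZL der inj, of "\<lambda>x. vec (h x) :: real^1" "vec b"]
    by (simp add: absolutely_integrable_on_1_iff integral_on_1_eq D_def[abs_def] vec_eq_iff)
  have nn: "(\<integral>\<^sup>+x. ennreal (u x) * indicator S x \<partial>lborel) = ennreal (integral S u)"
    if "u absolutely_integrable_on S" "\<And>x. u x \<ge> 0" for u :: "real^'n::_ \<Rightarrow> real" and S
  proof -
    have "(\<integral>\<^sup>+x. ennreal (u x) * indicator S x \<partial>lborel) = (\<integral>\<^sup>+x. ennreal (u x) * indicator S x \<partial>lebesgue)"
      by (simp add: nn_integral_completion)
    also have "\<dots> = (\<integral>\<^sup>+x. ennreal (indicator S x *\<^sub>R u x) \<partial>lebesgue)"
      by (intro nn_integral_cong) (auto simp: indicator_def)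
    also have "\<dots> = ennreal (LINT x|lebesgue. indicator S x *\<^sub>R u x)"
      using that by (intro nn_integral_eq_integral) (auto simp: set_integrable_def)
    also have "(LINT x|lebesgue. indicator S x *\<^sub>R u x) = integral S u"
      using set_lebesgue_integral_eq_integral(2)[OF that(1)] by (simp add: set_lebesgue_integral_def)
    finally show ?thesis .
  qed
  have fin: "u absolutely_integrable_on S"
    if "(\<lambda>x. indicator S x * u x) \<in> borel_measurable lebesgue" "\<And>x. u x \<ge> 0"
      "(\<integral>\<^sup>+x. ennreal (u x) * indicator S x \<partial>lborel) < \<infinity>" for u :: "real^'n::_ \<Rightarrow> real" and S
  proof -
    have "(\<integral>\<^sup>+x. ennreal (norm (indicator S x *\<^sub>R u x)) \<partial>lebesgue) = (\<integral>\<^sup>+x. ennreal (u x) * indicator S x \<partial>lebesgue)"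
      using that(2) by (intro nn_integral_cong) (auto simp: indicator_def)
    also have "\<dots> = (\<integral>\<^sup>+x. ennreal (u x) * indicator S x \<partial>lborel)"
      by (simp add: nn_integral_completion)
    finally show ?thesis
      using that unfolding set_integrable_def by (intro integrableI_bounded) auto
  qed
  have mh: "(\<lambda>x. indicator (f ` Z) x * h x) \<in> borel_measurable lebesgue"
    using h fZ by (intro measurable_completion borel_measurable_times borel_measurable_indicator) auto
  have mD: "(\<lambda>x. indicator Z x * D x) \<in> borel_measurable lebesgue"
  proof -
    have "continuous_on Z f"
      using der by (meson has_derivative_continuous continuous_on_eq_continuous_within)
    then have "(\<lambda>x. h (f x)) \<in> borel_measurable (restrict_space borel Z)"
      using h by (intro measurable_compose[OF borel_measurable_continuous_on_restrict])
    then have "(\<lambda>x. indicator Z x * h (f x)) \<in> borel_measurable borel"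
      using Z by (simp add: borel_measurable_restrict_space_iff)
    then have 1: "(\<lambda>x. indicator Z x * h (f x)) \<in> borel_measurable lebesgue"
      by (intro measurable_completion) auto
    have "(\<lambda>x. det (matrix (f' x))) \<in> borel_measurable (lebesgue_on Z)"
      by (rule borel_measurable_det_Jacobian[OF ZL der])
    then have 2: "(\<lambda>x. indicator Z x * det (matrix (f' x))) \<in> borel_measurable lebesgue"
      using ZL by (simp add: borel_measurable_restrict_space_iff)
    have "(\<lambda>x. indicator Z x * D x) = (\<lambda>x. \<bar>indicator Z x * det (matrix (f' x))\<bar> * (indicator Z x * h (f x)))"
      by (auto simp: D_def indicator_def fun_eq_iff)
    then show ?thesis using 1 2 by (simp add: borel_measurable_times borel_measurable_abs)
  qed
  show ?thesis
  proof (cases "?I1 < \<infinity> \<or> ?I2 < \<infinity>")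
    case True
    moreover have "h absolutely_integrable_on (f ` Z)" if "?I1 < \<infinity>"
      by (rule fin[OF mh h0 that])
    moreover have "D absolutely_integrable_on Z" if "?I2 < \<infinity>"
      by (rule fin[OF mD D0]) (use that in \<open>simp add: D_def\<close>)
    ultimately have "h absolutely_integrable_on (f ` Z) \<or> D absolutely_integrable_on Z"
      by blast
    with cv have "h absolutely_integrable_on (f ` Z)" "D absolutely_integrable_on Z"
      "integral (f ` Z) h = integral Z D"
      by blast+
    then show ?thesis
      using nn[OF _ h0] nn[OF _ D0] unfolding D_def by simp
  next
    case False
    then show ?thesis by (simp add: not_less top_unique)
  qed
qed

lemma nn_integral_change_of_variables:
  fixes f :: "real^'n::finite \<Rightarrow> real^'n" and h :: "real^'n \<Rightarrow> real"
  assumes Z: "Z \<in> sets borel" and fZ: "f ` Z \<in> sets borel"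
    and der: "\<And>z. z \<in> Z \<Longrightarrow> (f has_derivative f' z) (at z within Z)"
    and inj: "inj_on f Z"
    and h: "h \<in> borel_measurable borel" and h0: "\<And>x. h x \<ge> 0"
  shows "(\<integral>\<^sup>+x. ennreal (h x) * indicator (f ` Z) x \<partial>lborel) =
         (\<integral>\<^sup>+x. ennreal (\<bar>det (matrix (f' x))\<bar> * h (f x)) * indicator Z x \<partial>lborel)"
proof -
  obtain k :: "'n ordered_index \<Rightarrow> 'n" where k: "bij k"
    using ex_bij_ordered_index by blast
  let ?P = "reindex k :: real^'n \<Rightarrow> real^('n ordered_index)"
  let ?Q = "reindex (inv k) :: real^('n ordered_index) \<Rightarrow> real^'n"
  have PQ [simp]: "?P (?Q x) = x" "?Q (?P y) = y" for x y
    using reindex_inv[OF k] by auto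
  have img: "?P ` S = ?Q -` S" for S
    by (auto simp: image_iff) (metis PQ(1))
  have PS: "?P ` S \<in> sets borel" if "S \<in> sets borel" for S
    using measurable_sets[OF measurable_reindex that] unfolding img by simp
  let ?f = "?P \<circ> f \<circ> ?Q"
  let ?f' = "\<lambda>y. ?P \<circ> f' (?Q y) \<circ> ?Q"
  have der': "(?f has_derivative ?f' z) (at z within ?P ` Z)" if "z \<in> ?P ` Z" for z
  proof -
    have z: "?Q z \<in> Z" using that by auto
    have QPZ: "?Q ` ?P ` Z = Z" by (auto simp: image_iff)
    have "((f \<circ> ?Q) has_derivative f' (?Q z) \<circ> ?Q) (at z within ?P ` Z)"
      by (rule diff_chain_within[OF linear_imp_has_derivative[OF linear_reindex[of "inv k"]]])
        (use der[OF z] QPZ in simp)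
    from diff_chain_within[OF this linear_imp_has_derivative[OF linear_reindex[of k]]]
    show ?thesis by (simp add: comp_assoc)
  qed
  have det: "det (matrix (?f' y)) = det (matrix (f' (?Q y)))" if "y \<in> ?P ` Z" for y
  proof -
    have "matrix (?f' y) = (\<chi> i j. matrix (f' (?Q y)) $ k i $ k j)"
    proof -
      have "?Q (axis j 1) = axis (k j) 1" for j
        using bij_is_surj[OF k] bij_is_inj[OF k]
        by (auto simp: reindex_def vec_eq_iff axis_def surj_f_inv_f)
      then show ?thesis
        by (simp add: matrix_def vec_eq_iff) (simp add: reindex_def)
    qed
    then show ?thesis by (simp add: det_reindex[OF k])
  qed
  have tr: "(\<integral>\<^sup>+x. u x \<partial>lborel) = (\<integral>\<^sup>+y. u (?Q y) \<partial>lborel)" for u :: "real^'n \<Rightarrow> ennreal"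
  proof -
    have "(\<integral>\<^sup>+y. u (?Q y) \<partial>lborel) = (\<integral>\<^sup>+y. u (?Q y) \<partial>distr lborel borel ?P)"
      by (simp add: lborel_distr_reindex[OF k])
    show ?thesis
    proof (rule antisym)
      show "(\<integral>\<^sup>+x. u x \<partial>lborel) \<le> (\<integral>\<^sup>+y. u (?Q y) \<partial>lborel)"
        unfolding nn_integral_def[of lborel u]
      proof (safe intro!: SUP_least)
        fix s assume s: "simple_function lborel s" "s \<le> u"
        have [measurable]: "s \<in> borel_measurable borel"
          using borel_measurable_simple_function[OF s(1)] by simp
        have "integral\<^sup>S lborel s = (\<integral>\<^sup>+x. s x \<partial>lborel)"
          using s by (simp add: nn_integral_eq_simple_integral)
        also have "\<dots> = (\<integral>\<^sup>+x. s (?Q (?P x)) \<partial>lborel)" by simp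
        also have "\<dots> = (\<integral>\<^sup>+y. s (?Q y) \<partial>distr lborel borel ?P)"
          by (subst nn_integral_distr) auto
        also have "\<dots> \<le> (\<integral>\<^sup>+y. u (?Q y) \<partial>lborel)"
          using s(2) by (simp add: lborel_distr_reindex[OF k] le_fun_def nn_integral_mono)
        finally show "integral\<^sup>S lborel s \<le> (\<integral>\<^sup>+y. u (?Q y) \<partial>lborel)" .
      qed
      show "(\<integral>\<^sup>+y. u (?Q y) \<partial>lborel) \<le> (\<integral>\<^sup>+x. u x \<partial>lborel)"
        unfolding nn_integral_def[of lborel "\<lambda>y. u (?Q y)"]
      proof (safe intro!: SUP_least)
        fix s assume s: "simple_function lborel s" "s \<le> (\<lambda>y. u (?Q y))"
        have [measurable]: "s \<in> borel_measurable borel"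
          using borel_measurable_simple_function[OF s(1)] by simp
        have "integral\<^sup>S lborel s = (\<integral>\<^sup>+x. s x \<partial>lborel)"
          using s by (simp add: nn_integral_eq_simple_integral)
        also have "\<dots> = (\<integral>\<^sup>+x. s x \<partial>distr lborel borel ?P)"
          by (simp add: lborel_distr_reindex[OF k])
        also have "\<dots> = (\<integral>\<^sup>+x. s (?P x) \<partial>lborel)"
          by (subst nn_integral_distr) auto
        also have "\<dots> \<le> (\<integral>\<^sup>+x. u x \<partial>lborel)"
        proof (rule nn_integral_mono)
          fix x show "s (?P x) \<le> u x" using s(2) by (simp add: le_fun_def) (metis PQ(2))
        qed
        finally show "integral\<^sup>S lborel s \<le> (\<integral>\<^sup>+x. u x \<partial>lborel)" .
      qed
    qed
  qed
  have fP: "?f ` ?P ` Z = ?P ` f ` Z" by (auto simp: image_iff)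
  have "(\<integral>\<^sup>+x. ennreal (h x) * indicator (f ` Z) x \<partial>lborel)
      = (\<integral>\<^sup>+y. ennreal (h (?Q y)) * indicator (f ` Z) (?Q y) \<partial>lborel)"
    by (rule tr)
  also have "\<dots> = (\<integral>\<^sup>+y. ennreal (h (?Q y)) * indicator (?f ` ?P ` Z) y \<partial>lborel)"
    unfolding fP unfolding img by (auto simp: indicator_def intro!: nn_integral_cong)
  also have "\<dots> = (\<integral>\<^sup>+y. ennreal (\<bar>det (matrix (?f' y))\<bar> * h (?Q (?f y))) * indicator (?P ` Z) y \<partial>lborel)"
  proof (rule nn_integral_change_of_variables_wellorder)
    show "?f ` ?P ` Z \<in> sets borel" unfolding fP by (rule PS[OF fZ])
    show "inj_on ?f (?P ` Z)"
      using inj by (auto simp: inj_on_def) (metis PQ(2))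
    show "(\<lambda>y. h (?Q y)) \<in> borel_measurable borel"
      using h by (intro measurable_compose[OF measurable_reindex])
  qed (use PS[OF Z] der' h0 in auto)
  also have "\<dots> = (\<integral>\<^sup>+y. ennreal (\<bar>det (matrix (f' (?Q y)))\<bar> * h (f (?Q y))) * indicator Z (?Q y) \<partial>lborel)"
  proof (rule nn_integral_cong)
    fix y show "ennreal (\<bar>det (matrix (?f' y))\<bar> * h (?Q (?f y))) * indicator (?P ` Z) y
      = ennreal (\<bar>det (matrix (f' (?Q y)))\<bar> * h (f (?Q y))) * indicator Z (?Q y)"
      using det[of y] unfolding img by (auto simp: indicator_def)
  qed
  also have "\<dots> = (\<integral>\<^sup>+x. ennreal (\<bar>det (matrix (f' x))\<bar> * h (f x)) * indicator Z x \<partial>lborel)"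
    by (rule tr[symmetric])
  finally show ?thesis .
qed

section \<open>Averages of return integrals\<close>

text \<open>
  The weight \<open>\<kappa>\<close> is free, which does the work of the inequality of Cauchy and Schwarz.
\<close>

lemma sqrt_le_weighted:
  assumes "\<kappa> > 0" "0 \<le> (a::real)"
  shows "sqrt a \<le> \<kappa> + a / \<kappa>"
proof (cases "sqrt a \<le> \<kappa>")
  case True
  then show ?thesis using assms by (simp add: add_increasing2)
next
  case False
  have "\<kappa> * sqrt a \<le> sqrt a * sqrt a" using False assms by (intro mult_right_mono) auto
  then have "sqrt a \<le> a / \<kappa>" using assms by (simp add: field_simps)
  then show ?thesis using assms by linarith
qed

text \<open>Integrate the number of sets that contain a point.\<close>

lemma sum_emeasure_le_multiplicity:
  assumes T: "finite T" and S: "\<And>t. t \<in> T \<Longrightarrow> S t \<in> sets M" "\<And>t. t \<in> T \<Longrightarrow> S t \<subseteq> B" and B: "B \<in> sets M"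
    and mult: "\<And>x. x \<in> space M \<Longrightarrow> real (card {t \<in> T. x \<in> S t}) \<le> N"
  shows "(\<Sum>t\<in>T. emeasure M (S t)) \<le> ennreal N * emeasure M B"
proof -
  have "(\<Sum>t\<in>T. emeasure M (S t)) = (\<Sum>t\<in>T. \<integral>\<^sup>+x. indicator (S t) x \<partial>M)"
    using S by (intro sum.cong) auto
  also have "\<dots> = (\<integral>\<^sup>+x. (\<Sum>t\<in>T. indicator (S t) x) \<partial>M)"
    using S by (intro nn_integral_sum[symmetric]) auto
  also have "\<dots> \<le> (\<integral>\<^sup>+x. ennreal N * indicator B x \<partial>M)"
  proof (rule nn_integral_mono)
    fix x assume x: "x \<in> space M"
    have "(\<Sum>t\<in>T. indicator (S t) x) = (of_nat (card {t \<in> T. x \<in> S t}) :: ennreal)"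
    proof -
      have "(\<Sum>t\<in>T. indicator (S t) x) = (\<Sum>t\<in>{t \<in> T. x \<in> S t}. (1::ennreal))"
        using T by (intro sum.mono_neutral_cong_right) (auto simp: indicator_def)
      then show ?thesis by simp
    qed
    also have "\<dots> = ennreal (card {t \<in> T. x \<in> S t})"
      by (simp add: ennreal_of_nat_eq_real_of_nat)
    also have "\<dots> \<le> ennreal N * indicator B x"
    proof (cases "x \<in> B")
      case True
      then show ?thesis using mult[OF x] by (simp add: ennreal_leI)
    next
      case False
      then have "{t \<in> T. x \<in> S t} = {}" using S by auto
      then show ?thesis by (simp only: card.empty) simp
    qed
    finally show "(\<Sum>t\<in>T. indicator (S t) x) \<le> ennreal N * indicator B x" .
  qed
  also have "\<dots> = ennreal N * emeasure M B"
    using B by (simp add: nn_integral_cmult_indicator)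
  finally show ?thesis .
qed

text \<open>
  Partial maps \<open>\<phi> t\<close> with domains \<open>A t\<close> and Jacobians \<open>j t\<close>. The returns that end in \<open>F\<close> are estimated
  through their number, which is at most \<open>m\<close> for each starting point; the others through the measure
  of the complement of \<open>F\<close>. The weights \<open>\<kappa>\<close> and \<open>\<mu>\<close> of the arithmetic-geometric inequality, which
  replaces the inequality of Cauchy and Schwarz, are at our disposal.
\<close>

lemma sum_sqrt_jacobian_le:
  fixes M :: "'x measure" and A :: "'t \<Rightarrow> 'x set" and \<phi> :: "'t \<Rightarrow> 'x \<Rightarrow> 'x" and j :: "'t \<Rightarrow> 'x \<Rightarrow> real"
  assumes T: "finite T"
    and A: "\<And>t. t \<in> T \<Longrightarrow> A t \<in> sets M"
    and \<phi>m: "\<And>t B. t \<in> T \<Longrightarrow> B \<in> sets M \<Longrightarrow> {x \<in> A t. \<phi> t x \<in> B} \<in> sets M"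
    and \<phi>s: "\<And>t x. t \<in> T \<Longrightarrow> x \<in> A t \<Longrightarrow> \<phi> t x \<in> space M"
    and j0: "\<And>t x. t \<in> T \<Longrightarrow> x \<in> A t \<Longrightarrow> j t x \<ge> 0"
    and jm: "\<And>t. t \<in> T \<Longrightarrow> (\<lambda>x. indicator (A t) x * j t x) \<in> borel_measurable M"
    and img: "\<And>t E. t \<in> T \<Longrightarrow> E \<in> sets M \<Longrightarrow> E \<subseteq> A t \<Longrightarrow> \<phi> t ` E \<in> sets M"
    and imgm: "\<And>t E. t \<in> T \<Longrightarrow> E \<in> sets M \<Longrightarrow> E \<subseteq> A t \<Longrightarrow>
                 emeasure M (\<phi> t ` E) = (\<integral>\<^sup>+x. ennreal (j t x) * indicator E x \<partial>M)"
    and cnt1: "\<And>x. x \<in> space M \<Longrightarrow> real (card {t \<in> T. x \<in> A t}) \<le> N"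
    and cnt2: "\<And>x. x \<in> space M \<Longrightarrow> real (card {t \<in> T. x \<in> \<phi> t ` A t}) \<le> N"
    and F: "F \<in> sets M" and cnt3: "\<And>x. x \<in> space M \<Longrightarrow> real (card {t \<in> T. x \<in> A t \<and> \<phi> t x \<in> F}) \<le> m"
    and pos: "\<kappa> > 0" "\<mu> > 0"
  shows "(\<Sum>t\<in>T. \<integral>\<^sup>+x. ennreal (sqrt (j t x)) * indicator (A t) x \<partial>M)
     \<le> ennreal \<kappa> * (ennreal m * emeasure M (space M)) + ennreal (1 / \<kappa>) * (ennreal N * emeasure M (space M))
       + ennreal (1 / \<mu>) * (ennreal N * emeasure M (space M)) + ennreal \<mu> * (ennreal N * emeasure M (space M - F))"
proof -
  define P where "P t = {x \<in> A t. \<phi> t x \<in> F}" for t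
  define Q where "Q t = {x \<in> A t. \<phi> t x \<in> space M - F}" for t
  have P: "P t \<in> sets M" "P t \<subseteq> A t" and Q: "Q t \<in> sets M" "Q t \<subseteq> A t" if "t \<in> T" for t
    using \<phi>m[OF that F] \<phi>m[OF that, of "space M - F"] F by (auto simp: P_def Q_def)
  have part: "(\<integral>\<^sup>+x. ennreal (sqrt (j t x)) * indicator E x \<partial>M)
      \<le> ennreal c * emeasure M E + ennreal (1 / c) * emeasure M (\<phi> t ` E)"
    if t: "t \<in> T" and E: "E \<in> sets M" "E \<subseteq> A t" and c: "c > 0" for t E c
  proof -
    have [measurable]: "(\<lambda>x. ennreal (j t x) * indicator E x) \<in> borel_measurable M"
    proof -
      have "(\<lambda>x. ennreal (indicator (A t) x * j t x) * indicator E x) \<in> borel_measurable M"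
        using jm[OF t] E by (intro borel_measurable_times_ennreal measurable_compose[OF jm[OF t] measurable_ennreal]) auto
      also have "(\<lambda>x. ennreal (indicator (A t) x * j t x) * indicator E x) = (\<lambda>x. ennreal (j t x) * indicator E x)"
        using E by (auto simp: indicator_def fun_eq_iff)
      finally show ?thesis .
    qed
    have [measurable]: "E \<in> sets M" by fact
    have "(\<integral>\<^sup>+x. ennreal (sqrt (j t x)) * indicator E x \<partial>M) \<le>
      (\<integral>\<^sup>+x. ennreal c * indicator E x + ennreal (1 / c) * (ennreal (j t x) * indicator E x) \<partial>M)"
    proof (rule nn_integral_mono)
      fix x
      have "ennreal (sqrt (j t x)) \<le> ennreal c + ennreal (1 / c) * ennreal (j t x)" if "x \<in> E"
      proof -
        have jt: "j t x \<ge> 0" using that E j0[OF t] by auto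
        have "ennreal (sqrt (j t x)) \<le> ennreal (c + 1 / c * j t x)"
          using sqrt_le_weighted[OF c jt] by (intro ennreal_leI) (simp add: field_simps)
        also have "\<dots> = ennreal c + ennreal (1 / c) * ennreal (j t x)"
          using c jt ennreal_plus[of c "1 / c * j t x"] ennreal_mult[of "1 / c" "j t x"] by simp
        finally show ?thesis .
      qed
      then show "ennreal (sqrt (j t x)) * indicator E x \<le>
        ennreal c * indicator E x + ennreal (1 / c) * (ennreal (j t x) * indicator E x)"
        by (auto simp: indicator_def)
    qed
    also have "\<dots> = ennreal c * emeasure M E + ennreal (1 / c) * emeasure M (\<phi> t ` E)"
      using E imgm[OF t E] by (simp add: nn_integral_add nn_integral_cmult nn_integral_cmult_indicator)
    finally show ?thesis .
  qed
  have split: "(\<integral>\<^sup>+x. ennreal (sqrt (j t x)) * indicator (A t) x \<partial>M)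
     = (\<integral>\<^sup>+x. ennreal (sqrt (j t x)) * indicator (P t) x \<partial>M) + (\<integral>\<^sup>+x. ennreal (sqrt (j t x)) * indicator (Q t) x \<partial>M)"
    if t: "t \<in> T" for t
  proof -
    have m: "(\<lambda>x. ennreal (sqrt (j t x)) * indicator E x) \<in> borel_measurable M"
      if E: "E \<in> sets M" "E \<subseteq> A t" for E
    proof -
      have [measurable]: "(\<lambda>x. indicator (A t) x * j t x) \<in> borel_measurable M" "E \<in> sets M"
        using jm[OF t] E by auto
      have "(\<lambda>x. ennreal (sqrt (indicator (A t) x * j t x)) * indicator E x) \<in> borel_measurable M"
        by measurable
      also have "(\<lambda>x. ennreal (sqrt (indicator (A t) x * j t x)) * indicator E x) = (\<lambda>x. ennreal (sqrt (j t x)) * indicator E x)"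
        using E by (auto simp: indicator_def fun_eq_iff)
      finally show ?thesis .
    qed
    have "(\<integral>\<^sup>+x. ennreal (sqrt (j t x)) * indicator (A t) x \<partial>M)
      = (\<integral>\<^sup>+x. ennreal (sqrt (j t x)) * indicator (P t) x + ennreal (sqrt (j t x)) * indicator (Q t) x \<partial>M)"
      using \<phi>s[OF t] by (intro nn_integral_cong) (auto simp: indicator_def P_def Q_def)
    also have "\<dots> = (\<integral>\<^sup>+x. ennreal (sqrt (j t x)) * indicator (P t) x \<partial>M) + (\<integral>\<^sup>+x. ennreal (sqrt (j t x)) * indicator (Q t) x \<partial>M)"
      using P[OF t] Q[OF t] by (intro nn_integral_add m) auto
    finally show ?thesis .
  qed
  have AS: "A t \<subseteq> space M" if "t \<in> T" for t using A[OF that] sets.sets_into_space by blast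
  have iQ: "\<phi> t ` Q t \<subseteq> space M - F" "\<phi> t ` Q t \<subseteq> \<phi> t ` A t" for t
    by (auto simp: Q_def)
  have "(\<Sum>t\<in>T. \<integral>\<^sup>+x. ennreal (sqrt (j t x)) * indicator (A t) x \<partial>M)
     \<le> (\<Sum>t\<in>T. (ennreal \<kappa> * emeasure M (P t) + ennreal (1 / \<kappa>) * emeasure M (\<phi> t ` A t))
         + (ennreal (1 / \<mu>) * emeasure M (A t) + ennreal \<mu> * emeasure M (\<phi> t ` Q t)))"
  proof (rule sum_mono)
    fix t assume t: "t \<in> T"
    have 1: "(\<integral>\<^sup>+x. ennreal (sqrt (j t x)) * indicator (P t) x \<partial>M)
       \<le> ennreal \<kappa> * emeasure M (P t) + ennreal (1 / \<kappa>) * emeasure M (\<phi> t ` A t)"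
      using P[OF t] by (intro order_trans[OF part[OF t P[OF t] pos(1)]] add_mono mult_left_mono emeasure_mono img[OF t] A[OF t]) auto
    have 2: "(\<integral>\<^sup>+x. ennreal (sqrt (j t x)) * indicator (Q t) x \<partial>M)
       \<le> ennreal (1 / \<mu>) * emeasure M (A t) + ennreal \<mu> * emeasure M (\<phi> t ` Q t)"
      using part[OF t Q[OF t], of "1 / \<mu>"] pos Q[OF t]
      by (intro order_trans[OF part[OF t Q[OF t], of "1 / \<mu>"]] add_mono mult_left_mono emeasure_mono A[OF t]) auto
    show "(\<integral>\<^sup>+x. ennreal (sqrt (j t x)) * indicator (A t) x \<partial>M)
      \<le> (ennreal \<kappa> * emeasure M (P t) + ennreal (1 / \<kappa>) * emeasure M (\<phi> t ` A t))
         + (ennreal (1 / \<mu>) * emeasure M (A t) + ennreal \<mu> * emeasure M (\<phi> t ` Q t))"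
      unfolding split[OF t] by (rule add_mono[OF 1 2])
  qed
  also have "\<dots> = ennreal \<kappa> * (\<Sum>t\<in>T. emeasure M (P t)) + ennreal (1 / \<kappa>) * (\<Sum>t\<in>T. emeasure M (\<phi> t ` A t))
     + (ennreal (1 / \<mu>) * (\<Sum>t\<in>T. emeasure M (A t)) + ennreal \<mu> * (\<Sum>t\<in>T. emeasure M (\<phi> t ` Q t)))"
    by (simp add: sum.distrib sum_distrib_left)
  also have "\<dots> \<le> ennreal \<kappa> * (ennreal m * emeasure M (space M)) + ennreal (1 / \<kappa>) * (ennreal N * emeasure M (space M))
     + (ennreal (1 / \<mu>) * (ennreal N * emeasure M (space M)) + ennreal \<mu> * (ennreal N * emeasure M (space M - F)))"
  proof (intro add_mono mult_left_mono)
    show "(\<Sum>t\<in>T. emeasure M (P t)) \<le> ennreal m * emeasure M (space M)"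
      using P AS cnt3 by (intro sum_emeasure_le_multiplicity[OF T]) (auto simp: P_def)
    show "(\<Sum>t\<in>T. emeasure M (\<phi> t ` A t)) \<le> ennreal N * emeasure M (space M)"
      using \<phi>s by (intro sum_emeasure_le_multiplicity[OF T] img A cnt2) auto
    show "(\<Sum>t\<in>T. emeasure M (A t)) \<le> ennreal N * emeasure M (space M)"
      using AS by (intro sum_emeasure_le_multiplicity[OF T] A cnt1) auto
    show "(\<Sum>t\<in>T. emeasure M (\<phi> t ` Q t)) \<le> ennreal N * emeasure M (space M - F)"
    proof (rule sum_emeasure_le_multiplicity[OF T])
      fix x assume x: "x \<in> space M"
      have "card {t \<in> T. x \<in> \<phi> t ` Q t} \<le> card {t \<in> T. x \<in> \<phi> t ` A t}"
        using T iQ(2) by (intro card_mono) auto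
      with cnt2[OF x] show "real (card {t \<in> T. x \<in> \<phi> t ` Q t}) \<le> N" by linarith
    qed (use F iQ img Q in auto)
  qed auto
  finally show ?thesis by (simp add: add.assoc)
qed

text \<open>
  The sets \<open>W k\<close> consist of points of \<open>U k\<close> that no two returns to \<open>U k\<close> can reach from the same point.
  Finitely many of them fill the space up to small measure, in the sense of outer measure; for a finite
  set of times they are enlarged to measurable sets with the same property.
\<close>

lemma sum_sqrt_jacobian_sublinear:
  fixes M :: "'x measure" and A :: "real \<Rightarrow> 'x set" and \<phi> :: "real \<Rightarrow> 'x \<Rightarrow> 'x" and j :: "real \<Rightarrow> 'x \<Rightarrow> real"
  assumes fin: "finite_measure M"
    and A: "\<And>t. t \<in> \<T> \<Longrightarrow> A t \<in> sets M"
    and \<phi>m: "\<And>t B. t \<in> \<T> \<Longrightarrow> B \<in> sets M \<Longrightarrow> {x \<in> A t. \<phi> t x \<in> B} \<in> sets M"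
    and \<phi>s: "\<And>t x. t \<in> \<T> \<Longrightarrow> x \<in> A t \<Longrightarrow> \<phi> t x \<in> space M"
    and j0: "\<And>t x. t \<in> \<T> \<Longrightarrow> x \<in> A t \<Longrightarrow> j t x \<ge> 0"
    and jm: "\<And>t. t \<in> \<T> \<Longrightarrow> (\<lambda>x. indicator (A t) x * j t x) \<in> borel_measurable M"
    and img: "\<And>t E. t \<in> \<T> \<Longrightarrow> E \<in> sets M \<Longrightarrow> E \<subseteq> A t \<Longrightarrow> \<phi> t ` E \<in> sets M"
    and imgm: "\<And>t E. t \<in> \<T> \<Longrightarrow> E \<in> sets M \<Longrightarrow> E \<subseteq> A t \<Longrightarrow>
                 emeasure M (\<phi> t ` E) = (\<integral>\<^sup>+x. ennreal (j t x) * indicator E x \<partial>M)"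
    and cnt1: "\<And>x R T. x \<in> space M \<Longrightarrow> R \<ge> 1 \<Longrightarrow> finite T \<Longrightarrow> T \<subseteq> \<T> \<inter> {-R..R} \<Longrightarrow> real (card {t \<in> T. x \<in> A t}) \<le> C * R"
    and cnt2: "\<And>x R T. x \<in> space M \<Longrightarrow> R \<ge> 1 \<Longrightarrow> finite T \<Longrightarrow> T \<subseteq> \<T> \<inter> {-R..R} \<Longrightarrow> real (card {t \<in> T. x \<in> \<phi> t ` A t}) \<le> C * R"
    and U: "\<And>k::nat. U k \<in> sets M" and W: "\<And>k. W k \<subseteq> U k"
    and wander: "\<And>s t x k. s \<in> \<T> \<Longrightarrow> t \<in> \<T> \<Longrightarrow> s \<noteq> t \<Longrightarrow> x \<in> A s \<Longrightarrow> x \<in> A t \<Longrightarrow> \<phi> s x \<in> U k \<Longrightarrow>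
                    \<phi> t x \<in> U k \<Longrightarrow> \<phi> s x \<notin> W k"
    and cover: "Z \<in> null_sets M" "space M \<subseteq> Z \<union> (\<Union>k. W k)"
    and \<epsilon>: "\<epsilon> > 0"
  shows "\<exists>R0\<ge>1. \<forall>R\<ge>R0. \<forall>T. finite T \<longrightarrow> T \<subseteq> \<T> \<inter> {-R..R} \<longrightarrow>
     (\<Sum>t\<in>T. \<integral>\<^sup>+x. ennreal (sqrt (j t x)) * indicator (A t) x \<partial>M) \<le> ennreal (\<epsilon> * R)"
proof -
  interpret finite_measure M by (rule fin)
  define V where "V = measure M (space M)"
  have V: "emeasure M (space M) = ennreal V" "V \<ge> 0" by (auto simp: V_def emeasure_eq_measure)
  define C' where "C' = max C 0"
  have C': "C' \<ge> 0" "C \<le> C'" by (auto simp: C'_def)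
  \<comment> \<open>The bound splits into three parts, each of which is to be at most a third of \<open>\<epsilon> R\<close>.\<close>
  define \<mu> where "\<mu> = 3 * (C' * V + 1) / \<epsilon>"
  have \<mu>: "\<mu> > 0" and \<mu>2: "C' * V / \<mu> \<le> \<epsilon> / 3"
  proof -
    have "C' * V \<ge> 0" using C' V by simp
    then show "\<mu> > 0" using \<epsilon> unfolding \<mu>_def by (intro divide_pos_pos mult_pos_pos add_nonneg_pos) auto
    show "C' * V / \<mu> \<le> \<epsilon> / 3"
      using \<open>C' * V \<ge> 0\<close> \<epsilon> unfolding \<mu>_def by (simp add: field_simps)
  qed
  define \<eta> where "\<eta> = \<epsilon> / (3 * \<mu> * (C' + 1))"
  have \<eta>: "\<eta> > 0" and \<eta>2: "\<mu> * (C' * \<eta>) \<le> \<epsilon> / 3"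
  proof -
    show "\<eta> > 0" using \<epsilon> \<mu> C' by (simp add: \<eta>_def)
    have "\<mu> * (C' * \<eta>) = \<epsilon> / 3 * (C' / (C' + 1))" using \<mu> C' by (simp add: \<eta>_def)
    also have "\<dots> \<le> \<epsilon> / 3 * 1" using \<epsilon> C' by (intro mult_left_mono) auto
    finally show "\<mu> * (C' * \<eta>) \<le> \<epsilon> / 3" by simp
  qed
  \<comment> \<open>Outer measure is continuous along increasing sequences of arbitrary sets.\<close>
  have "\<exists>m. V - \<eta> \<le> enn2real (outer_measure_of M (\<Union>k<m. W k)) \<and> outer_measure_of M (\<Union>k<m. W k) \<noteq> \<infinity>"
  proof -
    have Ws: "W k \<subseteq> space M" for k using W U sets.sets_into_space by blast
    have "(SUP m. outer_measure_of M (\<Union>k<m. W k)) = outer_measure_of M (\<Union>m. \<Union>k<m. W k)"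
      by (rule SUP_outer_measure_of_incseq) (use Ws in \<open>auto simp: incseq_def less_le_trans\<close>, force)
    also have "(\<Union>m. \<Union>k<m. W k) = (\<Union>k. W k)" by auto
    also have "outer_measure_of M (\<Union>k. W k) \<ge> ennreal V"
    proof -
      have "(\<Union>k. W k) \<subseteq> space M" using Ws by auto
      from outer_measure_of_attain[OF this] obtain E where E: "E \<in> sets M" "(\<Union>k. W k) \<subseteq> E"
        "outer_measure_of M (\<Union>k. W k) = emeasure M E" by blast
      have "emeasure M (space M) \<le> emeasure M (E \<union> Z)"
        using E cover by (intro emeasure_mono) auto
      also have "\<dots> = emeasure M E"
        using cover E by (metis Un_commute emeasure_Un_null_set)
      finally show ?thesis using E V by simp
    qed
    finally have S: "ennreal V \<le> (SUP m. outer_measure_of M (\<Union>k<m. W k))" .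
    have fin: "outer_measure_of M (\<Union>k<m. W k) \<le> ennreal V" for m
    proof -
      have "outer_measure_of M (\<Union>k<m. W k) \<le> outer_measure_of M (space M)"
        by (rule outer_measure_of_mono) (use Ws in auto)
      then show ?thesis using V by simp
    qed
    show ?thesis
    proof (cases "V < \<eta>")
      case True
      then show ?thesis using fin[of 0]
        by (intro exI[of _ 0]) (auto simp: order.trans[of _ 0] top_unique)
    next
      case False
      then have "ennreal (V - \<eta>) < ennreal V" using \<eta> V by (intro ennreal_lessI) auto
      also note S
      finally obtain m where m: "ennreal (V - \<eta>) < outer_measure_of M (\<Union>k<m. W k)"
        by (auto simp: less_SUP_iff)
      have ne: "outer_measure_of M (\<Union>k<m. W k) \<noteq> \<infinity>"
        using fin[of m] by (auto simp: top_unique)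
      have "V - \<eta> \<le> enn2real (outer_measure_of M (\<Union>k<m. W k))"
        using m ne False by (metis enn2real_ennreal enn2real_mono infinity_ennreal_def less_imp_le not_less diff_ge_0_iff_ge top.not_eq_extremum)
      with ne show ?thesis by blast
    qed
  qed
  then obtain m where m: "V - \<eta> \<le> enn2real (outer_measure_of M (\<Union>k<m. W k))" "outer_measure_of M (\<Union>k<m. W k) \<noteq> \<infinity>"
    by blast
  define B where "B = real m * V + C' * V"
  have B: "B \<ge> 0" using V C' by (simp add: B_def)
  define R0 where "R0 = max 1 ((3 * B / \<epsilon>)\<^sup>2)"
  show ?thesis
  proof (intro exI[of _ R0] conjI allI impI)
    show "R0 \<ge> 1" by (simp add: R0_def)
    fix R T assume R: "R0 \<le> R" and T: "finite T" "T \<subseteq> \<T> \<inter> {-R..R}"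
    have R1: "R \<ge> 1" and sR: "3 * B / \<epsilon> \<le> sqrt R"
      using R B \<epsilon> by (auto simp: R0_def intro!: real_le_rsqrt)
    \<comment> \<open>This choice balances \<open>\<kappa> m V\<close> and \<open>C' R V / \<kappa>\<close>.\<close>
    define \<kappa> where "\<kappa> = sqrt R"
    have \<kappa>: "\<kappa> > 0" "\<kappa> * \<kappa> = R" using R1 by (auto simp: \<kappa>_def)
    have TT: "t \<in> \<T>" if "t \<in> T" for t using that T by auto
    \<comment> \<open>The ends in \<open>U k\<close> of returns from a point which has another return to \<open>U k\<close>; removing them from \<open>U k\<close> keeps \<open>W k\<close>.\<close>
    define X where "X k = (\<Union>s\<in>T. \<Union>t\<in>T - {s}. \<phi> s ` {x \<in> A s \<inter> A t. \<phi> s x \<in> U k \<and> \<phi> t x \<in> U k})" for k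
    define F where "F = (\<Union>k<m. U k - X k)"
    have X: "X k \<in> sets M" for k
    proof -
      have "{x \<in> A s \<inter> A t. \<phi> s x \<in> U k \<and> \<phi> t x \<in> U k} \<in> sets M" if "s \<in> T" "t \<in> T" for s t
      proof -
        have "{x \<in> A s \<inter> A t. \<phi> s x \<in> U k \<and> \<phi> t x \<in> U k} = {x \<in> A s. \<phi> s x \<in> U k} \<inter> {x \<in> A t. \<phi> t x \<in> U k}"
          by auto
        then show ?thesis using that TT \<phi>m U by auto
      qed
      then show ?thesis unfolding X_def
        using T TT by (intro sets.finite_UN finite_Diff img) auto
    qed
    have F: "F \<in> sets M" unfolding F_def using X U by auto
    have WF: "(\<Union>k<m. W k) \<subseteq> F"
    proof
      fix y assume "y \<in> (\<Union>k<m. W k)"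
      then obtain k where k: "k < m" "y \<in> W k" by auto
      have "y \<notin> X k"
      proof
        assume "y \<in> X k"
        then obtain s t x where "s \<in> T" "t \<in> T" "t \<noteq> s" "x \<in> A s" "x \<in> A t" "\<phi> s x \<in> U k" "\<phi> t x \<in> U k" "y = \<phi> s x"
          unfolding X_def by auto
        with wander[of s t x k] TT k show False by auto
      qed
      with k W show "y \<in> F" by (auto simp: F_def)
    qed
    have MF: "emeasure M (space M - F) \<le> ennreal \<eta>"
    proof -
      have "outer_measure_of M (\<Union>k<m. W k) \<le> emeasure M F"
        using outer_measure_of_mono[OF WF, of M] F by simp
      then have "enn2real (outer_measure_of M (\<Union>k<m. W k)) \<le> measure M F"
        unfolding measure_def by (intro enn2real_mono) (auto simp: less_top[symmetric])
      then have "measure M (space M - F) \<le> \<eta>"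
        using m finite_measure_compl[OF F] by (simp add: V_def)
      then show ?thesis by (simp add: emeasure_eq_measure ennreal_leI)
    qed
    have cnt3: "real (card {t \<in> T. x \<in> A t \<and> \<phi> t x \<in> F}) \<le> real m" for x
    proof -
      have one: "card {t \<in> T. x \<in> A t \<and> \<phi> t x \<in> U k - X k} \<le> 1" for k
      proof -
        have "s = t" if "s \<in> T" "x \<in> A s" "\<phi> s x \<in> U k - X k" "t \<in> T" "x \<in> A t" "\<phi> t x \<in> U k - X k" for s t
        proof (rule ccontr)
          assume "s \<noteq> t"
          with that have "\<phi> s x \<in> X k" unfolding X_def by blast
          with that show False by auto
        qed
        then show ?thesis using T by (auto simp: card_le_Suc0_iff_eq)
      qed
      have "{t \<in> T. x \<in> A t \<and> \<phi> t x \<in> F} = (\<Union>k<m. {t \<in> T. x \<in> A t \<and> \<phi> t x \<in> U k - X k})"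
        by (auto simp: F_def)
      then have "card {t \<in> T. x \<in> A t \<and> \<phi> t x \<in> F} \<le> (\<Sum>k<m. card {t \<in> T. x \<in> A t \<and> \<phi> t x \<in> U k - X k})"
        using card_UN_le[of "{..<m}" "\<lambda>k. {t \<in> T. x \<in> A t \<and> \<phi> t x \<in> U k - X k}"] by simp
      also have "\<dots> \<le> (\<Sum>k<m. 1)" by (rule sum_mono) (use one in auto)
      finally show ?thesis by simp
    qed
    have N0: "C' * R \<ge> 0" using C' R1 by simp
    have CR: "C * R \<le> C' * R" using C' R1 by (intro mult_right_mono) auto
    have "(\<Sum>t\<in>T. \<integral>\<^sup>+x. ennreal (sqrt (j t x)) * indicator (A t) x \<partial>M)
     \<le> ennreal \<kappa> * (ennreal (real m) * emeasure M (space M)) + ennreal (1 / \<kappa>) * (ennreal (C' * R) * emeasure M (space M))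
       + ennreal (1 / \<mu>) * (ennreal (C' * R) * emeasure M (space M)) + ennreal \<mu> * (ennreal (C' * R) * emeasure M (space M - F))"
    proof (rule sum_sqrt_jacobian_le[where \<phi>=\<phi>, OF T(1)])
      fix x assume x: "x \<in> space M"
      show "real (card {t \<in> T. x \<in> A t}) \<le> C' * R" "real (card {t \<in> T. x \<in> \<phi> t ` A t}) \<le> C' * R"
        using cnt1[OF x R1 T] cnt2[OF x R1 T] CR by linarith+
    qed (use A \<phi>m \<phi>s j0 jm img imgm TT cnt3 F \<kappa>(1) \<mu> in auto)
    also have "\<dots> \<le> ennreal \<kappa> * (ennreal (real m) * ennreal V) + ennreal (1 / \<kappa>) * (ennreal (C' * R) * ennreal V)
       + ennreal (1 / \<mu>) * (ennreal (C' * R) * ennreal V) + ennreal \<mu> * (ennreal (C' * R) * ennreal \<eta>)"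
      unfolding V by (intro add_mono mult_left_mono MF order_refl) auto
    also have "\<dots> = ennreal (\<kappa> * (real m * V) + (1 / \<kappa>) * (C' * R * V) + (1 / \<mu>) * (C' * R * V) + \<mu> * (C' * R * \<eta>))"
      using \<kappa> \<mu> \<eta> V N0 by (simp add: ennreal_mult'[symmetric] ennreal_plus[symmetric] del: ennreal_plus)
    also have "\<dots> \<le> ennreal (\<epsilon> * R)"
    proof (rule ennreal_leI)
      have "(1 / \<kappa>) * (C' * R * V) = \<kappa> * (C' * V)" using \<kappa> by (simp add: field_simps flip: \<kappa>(2))
      then have "\<kappa> * (real m * V) + (1 / \<kappa>) * (C' * R * V) = \<kappa> * B" by (simp add: B_def algebra_simps)
      also have "\<dots> \<le> \<kappa> * (\<epsilon> / 3 * \<kappa>)"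
        using sR \<epsilon> \<kappa>(1) unfolding \<kappa>_def[symmetric] by (intro mult_left_mono) (auto simp: field_simps)
      also have "\<dots> = \<epsilon> / 3 * R" using \<kappa> by (simp add: algebra_simps)
      finally have 1: "\<kappa> * (real m * V) + (1 / \<kappa>) * (C' * R * V) \<le> \<epsilon> / 3 * R" .
      have "(1 / \<mu>) * (C' * R * V) = C' * V / \<mu> * R" by simp
      also have "\<dots> \<le> \<epsilon> / 3 * R" using \<mu>2 R1 by (intro mult_right_mono) auto
      finally have 2: "(1 / \<mu>) * (C' * R * V) \<le> \<epsilon> / 3 * R" .
      have "\<mu> * (C' * R * \<eta>) = \<mu> * (C' * \<eta>) * R" by simp
      also have "\<dots> \<le> \<epsilon> / 3 * R" using \<eta>2 R1 by (intro mult_right_mono) auto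
      finally have 3: "\<mu> * (C' * R * \<eta>) \<le> \<epsilon> / 3 * R" .
      show "\<kappa> * (real m * V) + (1 / \<kappa>) * (C' * R * V) + (1 / \<mu>) * (C' * R * V) + \<mu> * (C' * R * \<eta>) \<le> \<epsilon> * R"
        using 1 2 3 by linarith
    qed
    finally show "(\<Sum>t\<in>T. \<integral>\<^sup>+x. ennreal (sqrt (j t x)) * indicator (A t) x \<partial>M) \<le> ennreal (\<epsilon> * R)" .
  qed
qed

section \<open>Ordinary differential equations with Lipschitz right-hand side\<close>

lemma norm_diff_le_vector_derivative_bound:
  fixes w :: "real \<Rightarrow> 'b::real_normed_vector"
  assumes der: "\<And>t. t \<in> S \<Longrightarrow> (w has_vector_derivative w' t) (at t within S)"
    and B: "\<And>t. t \<in> S \<Longrightarrow> norm (w' t) \<le> B" and S: "convex S" "x \<in> S" "y \<in> S"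
  shows "norm (w x - w y) \<le> B * \<bar>x - y\<bar>"
proof -
  have "norm (w x - w y) \<le> B * norm (x - y)"
  proof (rule differentiable_bound[OF S(1) _ _ S(2,3)])
    fix t assume t: "t \<in> S"
    show "(w has_derivative (\<lambda>h. h *\<^sub>R w' t)) (at t within S)"
      using der[OF t] by (simp add: has_vector_derivative_def)
    show "onorm (\<lambda>h. h *\<^sub>R w' t) \<le> B"
      using B[OF t] by (intro onorm_le) (auto simp: mult.commute[of B] intro!: mult_left_mono)
  qed
  then show ?thesis by simp
qed

text \<open>
  On a short time interval Gronwall's inequality reduces to the mean value inequality: the largest
  distance of two solutions exceeds the initial one by at most half of itself.
\<close>

lemma ode_dependence:
  fixes u v :: "real \<Rightarrow> 'b::real_normed_vector"
  assumes \<delta>: "\<delta> \<ge> 0" "\<delta> * L \<le> 1 / 2" and L: "L \<ge> 0"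
    and lip: "\<And>x y. x \<in> S \<Longrightarrow> y \<in> S \<Longrightarrow> norm (X x - X y) \<le> L * norm (x - y)"
    and u: "\<And>t. t \<in> {-\<delta>..\<delta>} \<Longrightarrow> u t \<in> S" "\<And>t. t \<in> {-\<delta>..\<delta>} \<Longrightarrow> (u has_vector_derivative X (u t)) (at t within {-\<delta>..\<delta>})"
    and v: "\<And>t. t \<in> {-\<delta>..\<delta>} \<Longrightarrow> v t \<in> S" "\<And>t. t \<in> {-\<delta>..\<delta>} \<Longrightarrow> (v has_vector_derivative X (v t)) (at t within {-\<delta>..\<delta>})"
    and t: "t \<in> {-\<delta>..\<delta>}"
  shows "norm (u t - v t) \<le> 2 * norm (u 0 - v 0)"
proof -
  let ?I = "{-\<delta>..\<delta>}"
  define w where "w t = u t - v t" for t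
  have der: "(w has_vector_derivative (X (u t) - X (v t))) (at t within ?I)" if "t \<in> ?I" for t
    unfolding w_def using u(2)[OF that] v(2)[OF that] by (rule has_vector_derivative_diff)
  then have "continuous_on ?I w"
    by (meson has_vector_derivative_continuous continuous_on_eq_continuous_within)
  then have "continuous_on ?I (\<lambda>t. norm (w t))" by (rule continuous_on_norm)
  from continuous_attains_sup[OF _ _ this] obtain s where s: "s \<in> ?I" "\<And>t. t \<in> ?I \<Longrightarrow> norm (w t) \<le> norm (w s)"
    using \<delta> by auto
  have "norm (w s - w 0) \<le> (L * norm (w s)) * \<bar>s - 0\<bar>"
  proof (rule norm_diff_le_vector_derivative_bound[OF der])
    fix t assume t: "t \<in> ?I"
    have "norm (X (u t) - X (v t)) \<le> L * norm (w t)" unfolding w_def using lip u v t by blast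
    also have "\<dots> \<le> L * norm (w s)" using s(2)[OF t] L by (intro mult_left_mono)
    finally show "norm (X (u t) - X (v t)) \<le> L * norm (w s)" .
  qed (use s \<delta> in auto)
  also have "\<dots> \<le> (L * norm (w s)) * \<delta>" using s L by (intro mult_left_mono) auto
  also have "\<dots> = (\<delta> * L) * norm (w s)" by simp
  also have "\<dots> \<le> 1 / 2 * norm (w s)" using \<delta> by (intro mult_right_mono) auto
  finally have "norm (w s - w 0) \<le> norm (w s) / 2" by simp
  moreover have "norm (w s) \<le> norm (w s - w 0) + norm (w 0)"
    using norm_triangle_sub[of "w s" "w 0"] by simp
  ultimately have "norm (w s) \<le> 2 * norm (w 0)" by linarith
  with s(2)[OF t] show ?thesis by (simp add: w_def)
qed

text \<open>
  Picard iteration as a contraction of the bounded continuous functions on the line; times outside the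
  interval are moved to its nearest endpoint.
\<close>

lemma picard_global_lipschitz:
  fixes Y :: "'b::euclidean_space \<Rightarrow> 'b"
  assumes lip: "\<And>x y. norm (Y x - Y y) \<le> L * norm (x - y)" and L: "L \<ge> 0"
    and \<delta>: "\<delta> > 0" "8 * \<delta> * L \<le> 1"
  shows "\<exists>u. u 0 = z \<and> (\<forall>t\<in>{-\<delta>..\<delta>}. (u has_vector_derivative Y (u t)) (at t within {-\<delta>..\<delta>}))"
proof -
  let ?I = "{-\<delta>..\<delta>}"
  define cl where "cl t = max (-\<delta>) (min \<delta> t)" for t :: real
  have cl: "cl t \<in> ?I" "t \<in> ?I \<Longrightarrow> cl t = t" for t using \<delta> by (auto simp: cl_def)
  have ccl: "continuous_on UNIV cl" unfolding cl_def[abs_def] by (intro continuous_intros)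
  define In where "In u s = integral {-\<delta>..s} (\<lambda>r. Y (u r))" for u :: "real \<Rightarrow> 'b" and s
  define F where "F u t = z + (In u (cl t) - In u 0)" for u t
  have cY: "continuous_on UNIV Y"
    using L by (intro lipschitz_on_continuous_on[of L]) (auto simp: lipschitz_on_def dist_norm lip)
  have cYu: "continuous_on S (\<lambda>r. Y (u r))" if "continuous_on UNIV u" for u :: "real \<Rightarrow> 'b" and S
    using continuous_on_compose2[OF cY continuous_on_subset[OF that]] by auto
  have cF: "continuous_on UNIV (F u)" and bF: "bounded (range (F u))" if u: "continuous_on UNIV u" for u
  proof -
    have c: "continuous_on ?I (In u)"
      unfolding In_def[abs_def] by (intro indefinite_integral_continuous_1 integrable_continuous_real cYu u)
    show "continuous_on UNIV (F u)" unfolding F_def[abs_def]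
      by (intro continuous_intros continuous_on_compose2[OF c ccl]) (use cl in auto)
    have "compact ((\<lambda>s. z + (In u s - In u 0)) ` ?I)"
      by (intro compact_continuous_image continuous_intros c) auto
    then show "bounded (range (F u))"
      by (rule bounded_subset[OF compact_imp_bounded]) (use cl in \<open>auto simp: F_def\<close>)
  qed
  define \<Phi> where "\<Phi> u = Bcontfun (F (apply_bcontfun u))" for u :: "real \<Rightarrow>\<^sub>C 'b"
  have cu: "continuous_on UNIV (apply_bcontfun u)" for u :: "real \<Rightarrow>\<^sub>C 'b"
    using apply_bcontfun[of u] by (auto simp: bcontfun_def)
  have ap: "apply_bcontfun (\<Phi> u) = F (apply_bcontfun u)" for u
    unfolding \<Phi>_def using cF[OF cu] bF[OF cu] by (intro Bcontfun_inverse) (auto simp: bcontfun_def)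
  have "\<exists>!u. \<Phi> u = u"
  proof (rule banach_fix_type[of "1/2"])
    show "\<forall>u v. dist (\<Phi> u) (\<Phi> v) \<le> 1 / 2 * dist u v"
    proof (intro allI dist_bound)
      fix u v :: "real \<Rightarrow>\<^sub>C 'b" and t
      have In: "norm (In u s - In v s) \<le> 1 / 4 * dist u v" if s: "s \<in> ?I" for s
      proof -
        have "In u s - In v s = integral {-\<delta>..s} (\<lambda>r. Y (u r) - Y (v r))"
          unfolding In_def by (intro integral_diff[symmetric] integrable_continuous_real cYu cu)
        also have "norm \<dots> \<le> (L * dist u v) * (s - (-\<delta>))"
        proof (rule integral_bound)
          show "continuous_on {-\<delta>..s} (\<lambda>r. Y (u r) - Y (v r))"
            by (intro continuous_on_diff cYu cu)
          fix r show "norm (Y (u r) - Y (v r)) \<le> L * dist u v"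
            using dist_bounded[of u r v] L by (intro order_trans[OF lip] mult_left_mono) (auto simp: dist_norm)
        qed (use s in auto)
        also have "\<dots> \<le> (L * dist u v) * (2 * \<delta>)" using s L by (intro mult_left_mono) auto
        also have "\<dots> = (8 * \<delta> * L) * (dist u v / 4)" by simp
        also have "\<dots> \<le> 1 * (dist u v / 4)" using \<delta> by (intro mult_right_mono) auto
        finally show ?thesis by simp
      qed
      have "F u t - F v t = (In u (cl t) - In v (cl t)) - (In u 0 - In v 0)"
        by (simp add: F_def)
      also have "norm \<dots> \<le> norm (In u (cl t) - In v (cl t)) + norm (In u 0 - In v 0)"
        by (rule norm_triangle_ineq4)
      also have "\<dots> \<le> 1 / 2 * dist u v" using In[OF cl(1)[of t]] In[of 0] \<delta> by auto
      finally show "dist (\<Phi> u t) (\<Phi> v t) \<le> 1 / 2 * dist u v" by (simp add: ap dist_norm)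
    qed
  qed auto
  then obtain u where u: "\<Phi> u = u" by blast
  then have uF: "apply_bcontfun u t = F u t" for t by (metis ap)
  show ?thesis
  proof (intro exI[of _ "apply_bcontfun u"] conjI ballI)
    show "u 0 = z" using uF[of 0] cl(2)[of 0] \<delta> by (simp add: F_def)
    fix t assume t: "t \<in> ?I"
    have "((\<lambda>s. z + (In u s - In u 0)) has_vector_derivative (0 + (Y (u t) - 0))) (at t within ?I)"
      unfolding In_def
      by (intro has_vector_derivative_add has_vector_derivative_diff has_vector_derivative_const
          integral_has_vector_derivative cYu cu t)
    then have der: "((\<lambda>s. z + (In u s - In u 0)) has_vector_derivative Y (u t)) (at t within ?I)"
      by simp
    show "(u has_vector_derivative Y (u t)) (at t within ?I)"
    proof (rule has_vector_derivative_transform[OF t _ der])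
      fix s assume s: "s \<in> ?I"
      show "apply_bcontfun u s = z + (In u s - In u 0)"
        using uF[of s] cl(2)[OF s] by (simp add: F_def)
    qed
  qed
qed

text \<open>
  A vector field which is Lipschitz on a ball is extended to the whole space by the radial retraction
  to the ball; solutions that start in the half ball stay in the ball for a short time, where the
  extension changes nothing.
\<close>

lemma local_flow:
  fixes X :: "'b::euclidean_space \<Rightarrow> 'b"
  assumes lip: "\<And>x y. x \<in> cball z0 r \<Longrightarrow> y \<in> cball z0 r \<Longrightarrow> norm (X x - X y) \<le> L * norm (x - y)"
    and L: "L \<ge> 0" and r: "r > 0"
  shows "\<exists>\<delta>>0. \<exists>u. \<delta> * L \<le> 1 / 2 \<and>
    (\<forall>z\<in>cball z0 (r / 2). u z 0 = z \<and> (\<forall>t\<in>{-\<delta>..\<delta>}. u z t \<in> cball z0 r \<and>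
          (u z has_vector_derivative X (u z t)) (at t within {-\<delta>..\<delta>}))) \<and>
    (\<forall>z\<in>cball z0 (r / 2). \<forall>z'\<in>cball z0 (r / 2). \<forall>t\<in>{-\<delta>..\<delta>}. norm (u z t - u z' t) \<le> 2 * norm (z - z'))"
proof -
  let ?C = "cball z0 r"
  \<comment> \<open>A global Lipschitz field that agrees with \<open>X\<close> on the ball.\<close>
  define Y where "Y x = X (closest_point ?C x)" for x
  have C: "closed ?C" "convex ?C" "?C \<noteq> {}" using r by auto
  have cp: "closest_point ?C x \<in> ?C" for x using C by (intro closest_point_in_set)
  have Ylip: "norm (Y x - Y y) \<le> L * norm (x - y)" for x y
  proof -
    have "norm (Y x - Y y) \<le> L * norm (closest_point ?C x - closest_point ?C y)"
      unfolding Y_def by (intro lip cp)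
    also have "\<dots> \<le> L * norm (x - y)"
      using closest_point_lipschitz[OF C(2,1,3), of x y] L by (intro mult_left_mono) (auto simp: dist_norm)
    finally show ?thesis .
  qed
  define B where "B = norm (X z0) + L * r + 1"
  have B: "B > 0" using L r by (auto simp: B_def intro!: add_nonneg_pos)
  have YB: "norm (Y x) \<le> B" for x
  proof -
    have "norm (Y x) \<le> norm (X z0) + norm (Y x - X z0)" by norm
    also have "norm (Y x - X z0) \<le> L * norm (closest_point ?C x - z0)"
      unfolding Y_def using cp r by (intro lip) auto
    also have "\<dots> \<le> L * r" using cp[of x] L by (intro mult_left_mono) (auto simp: dist_norm norm_minus_commute)
    finally show ?thesis by (simp add: B_def)
  qed
  define \<delta> where "\<delta> = min (r / (2 * B)) (1 / (8 * (L + 1)))"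
  have \<delta>: "\<delta> > 0" using B L r by (simp add: \<delta>_def)
  have \<delta>1: "\<delta> * B \<le> r / 2"
  proof -
    have "\<delta> * B \<le> r / (2 * B) * B" using B by (intro mult_right_mono) (auto simp: \<delta>_def)
    then show ?thesis using B by simp
  qed
  have \<delta>2: "8 * \<delta> * L \<le> 1"
  proof -
    have "8 * \<delta> * L \<le> 8 * (1 / (8 * (L + 1))) * L" using L by (intro mult_right_mono mult_left_mono) (auto simp: \<delta>_def)
    also have "\<dots> \<le> 1" using L by (simp add: field_simps)
    finally show ?thesis .
  qed
  obtain u where u: "\<And>z. u z 0 = z" "\<And>z t. t \<in> {-\<delta>..\<delta>} \<Longrightarrow> (u z has_vector_derivative Y (u z t)) (at t within {-\<delta>..\<delta>})"
    using picard_global_lipschitz[OF Ylip L \<delta> \<delta>2] by metis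
  have uC: "u z t \<in> ?C" if z: "z \<in> cball z0 (r / 2)" and t: "t \<in> {-\<delta>..\<delta>}" for z t
  proof -
    have "norm (u z t - u z 0) \<le> B * \<bar>t - 0\<bar>"
      by (rule norm_diff_le_vector_derivative_bound[OF u(2) YB]) (use t \<delta> in auto)
    also have "\<dots> \<le> B * \<delta>" using t B by (intro mult_left_mono) auto
    also have "\<dots> \<le> r / 2" using \<delta>1 by (simp add: mult.commute)
    finally have "dist (u z t) z \<le> r / 2" by (simp add: u dist_norm)
    moreover have "dist z0 z \<le> r / 2" using z by simp
    ultimately show ?thesis using dist_triangle2[of z0 "u z t" z] by (simp add: dist_commute)
  qed
  have YX: "Y x = X x" if "x \<in> ?C" for x using that by (simp add: Y_def closest_point_self)
  have "norm (u z t - u z' t) \<le> 2 * norm (z - z')"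
    if "z \<in> cball z0 (r / 2)" "z' \<in> cball z0 (r / 2)" "t \<in> {-\<delta>..\<delta>}" for z z' t
    using ode_dependence[of \<delta> L UNIV Y "u z" "u z'" t] u Ylip L \<delta> \<delta>2 that by auto
  moreover have "(u z has_vector_derivative X (u z t)) (at t within {-\<delta>..\<delta>})"
    if "z \<in> cball z0 (r / 2)" "t \<in> {-\<delta>..\<delta>}" for z t
    using u(2)[OF that(2), of z] YX[OF uC[OF that]] by simp
  ultimately show ?thesis
    using \<delta> \<delta>2 u uC by (intro exI[of _ \<delta>] conjI exI[of _ u]) auto
qed

section \<open>Continuously differentiable functions\<close>

definition C1_on :: "'b::euclidean_space set \<Rightarrow> ('b \<Rightarrow> real) \<Rightarrow> bool" where
  "C1_on S f \<longleftrightarrow> (\<exists>f'. (\<forall>x\<in>S. (f has_derivative f' x) (at x)) \<and> (\<forall>v. continuous_on S (\<lambda>x. f' x v)))"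

lemma C1_onI:
  assumes "\<And>x. x \<in> S \<Longrightarrow> (f has_derivative f' x) (at x)" "\<And>v. continuous_on S (\<lambda>x. f' x v)"
  shows "C1_on S f"
  using assms unfolding C1_on_def by blast

lemma C1_on_differentiable: "C1_on S f \<Longrightarrow> x \<in> S \<Longrightarrow> f differentiable (at x)"
  unfolding C1_on_def differentiable_def by blast

lemma C1_on_continuous: "C1_on S f \<Longrightarrow> continuous_on S f"
  by (meson C1_on_differentiable differentiable_imp_continuous_within continuous_at_imp_continuous_on)

lemma C1_on_cong:
  assumes "C1_on S f" "open S" "\<And>x. x \<in> S \<Longrightarrow> f x = g x"
  shows "C1_on S g"
proof -
  obtain f' where f': "\<And>x. x \<in> S \<Longrightarrow> (f has_derivative f' x) (at x)" "\<And>v. continuous_on S (\<lambda>x. f' x v)"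
    using assms unfolding C1_on_def by blast
  show ?thesis
    by (rule C1_onI[of S g f', OF has_derivative_transform_within_open[OF f'(1)]]) (use assms f' in auto)
qed

lemma C1_on_const [intro]: "C1_on S (\<lambda>x. c)"
  by (rule C1_onI[of _ _ "\<lambda>x v. 0"]) auto

lemma C1_on_add [intro]:
  assumes "C1_on S f" "C1_on S g" shows "C1_on S (\<lambda>x. f x + g x)"
proof -
  obtain f' where f': "\<And>x. x \<in> S \<Longrightarrow> (f has_derivative f' x) (at x)" "\<And>v. continuous_on S (\<lambda>x. f' x v)"
    using assms unfolding C1_on_def by blast
  obtain g' where g': "\<And>x. x \<in> S \<Longrightarrow> (g has_derivative g' x) (at x)" "\<And>v. continuous_on S (\<lambda>x. g' x v)"
    using assms unfolding C1_on_def by blast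
  show ?thesis
    by (rule C1_onI[of _ _ "\<lambda>x v. f' x v + g' x v"]) (auto intro!: f' g' has_derivative_add continuous_intros)
qed

lemma C1_on_mult [intro]:
  assumes f: "C1_on S f" and g: "C1_on S g" shows "C1_on S (\<lambda>x. f x * g x)"
proof -
  obtain f' where f': "\<And>x. x \<in> S \<Longrightarrow> (f has_derivative f' x) (at x)" "\<And>v. continuous_on S (\<lambda>x. f' x v)"
    using assms unfolding C1_on_def by blast
  obtain g' where g': "\<And>x. x \<in> S \<Longrightarrow> (g has_derivative g' x) (at x)" "\<And>v. continuous_on S (\<lambda>x. g' x v)"
    using assms unfolding C1_on_def by blast
  show ?thesis
    by (rule C1_onI[of _ _ "\<lambda>x v. f x * g' x v + f' x v * g x"])
      (auto intro: f' g' has_derivative_mult intro!: continuous_on_add continuous_on_mult C1_on_continuous[OF f] C1_on_continuous[OF g])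
qed

lemma C1_on_inverse:
  assumes f: "C1_on S f" and nz: "\<And>x. x \<in> S \<Longrightarrow> f x \<noteq> 0" shows "C1_on S (\<lambda>x. inverse (f x))"
proof -
  obtain f' where f': "\<And>x. x \<in> S \<Longrightarrow> (f has_derivative f' x) (at x)" "\<And>v. continuous_on S (\<lambda>x. f' x v)"
    using assms unfolding C1_on_def by blast
  show ?thesis
  proof (rule C1_onI[of _ _ "\<lambda>x v. - (inverse (f x) * f' x v * inverse (f x))"])
    fix x assume "x \<in> S"
    then show "((\<lambda>x. inverse (f x)) has_derivative (\<lambda>v. - (inverse (f x) * f' x v * inverse (f x)))) (at x)"
      by (intro Deriv.has_derivative_inverse nz f')
  next
    fix v show "continuous_on S (\<lambda>x. - (inverse (f x) * f' x v * inverse (f x)))"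
      using nz by (intro continuous_intros f' C1_on_continuous[OF f]) auto
  qed
qed

lemma C1_on_sqrt:
  assumes f: "C1_on S f" and nz: "\<And>x. x \<in> S \<Longrightarrow> f x > 0" shows "C1_on S (\<lambda>x. sqrt (f x))"
proof -
  obtain f' where f': "\<And>x. x \<in> S \<Longrightarrow> (f has_derivative f' x) (at x)" "\<And>v. continuous_on S (\<lambda>x. f' x v)"
    using assms unfolding C1_on_def by blast
  show ?thesis
  proof (rule C1_onI[of _ _ "\<lambda>x v. f' x v * (inverse (sqrt (f x)) / 2)"])
    fix x assume x: "x \<in> S"
    show "((\<lambda>x. sqrt (f x)) has_derivative (\<lambda>v. f' x v * (inverse (sqrt (f x)) / 2))) (at x)"
      using has_derivative_compose[OF f'(1)[OF x] DERIV_real_sqrt[OF nz[OF x], unfolded has_field_derivative_def]]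
      by (simp add: mult.commute)
  next
    fix v show "continuous_on S (\<lambda>x. f' x v * (inverse (sqrt (f x)) / 2))"
      using nz by (intro continuous_intros f' C1_on_continuous[OF f]) (auto simp: less_le)
  qed
qed

lemma C1_on_sum [intro]: "(\<And>i. i \<in> I \<Longrightarrow> C1_on S (f i)) \<Longrightarrow> C1_on S (\<lambda>x. \<Sum>i\<in>I. f i x)"
  by (induction I rule: infinite_finite_induct) auto

lemma C1_on_prod [intro]: "(\<And>i. i \<in> I \<Longrightarrow> C1_on S (f i)) \<Longrightarrow> C1_on S (\<lambda>x. \<Prod>i\<in>I. f i x)"
  by (induction I rule: infinite_finite_induct) auto

lemma C1_on_linear: "bounded_linear f \<Longrightarrow> C1_on S f"
  by (rule C1_onI[of _ _ "\<lambda>x. f"]) (auto intro: bounded_linear_imp_has_derivative)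

lemma C1_on_compose_linear:
  assumes f: "C1_on T f" and h: "bounded_linear h" and ST: "h ` S \<subseteq> T"
  shows "C1_on S (\<lambda>x. f (h x))"
proof -
  obtain f' where f': "\<And>x. x \<in> T \<Longrightarrow> (f has_derivative f' x) (at x)" "\<And>v. continuous_on T (\<lambda>x. f' x v)"
    using f unfolding C1_on_def by blast
  show ?thesis
  proof (rule C1_onI[of _ _ "\<lambda>x v. f' (h x) (h v)"])
    fix x assume "x \<in> S"
    then show "((\<lambda>x. f (h x)) has_derivative (\<lambda>v. f' (h x) (h v))) (at x)"
      using ST by (intro has_derivative_compose[OF bounded_linear_imp_has_derivative[OF h]] f') auto
  next
    fix v show "continuous_on S (\<lambda>x. f' (h x) (h v))"
      by (rule continuous_on_compose2[OF f'(2) _ ST]) (intro linear_continuous_on h)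
  qed
qed

lemma C1_on_if_smooth_component:
  fixes f :: "'b::euclidean_space \<Rightarrow> 'c::real_normed_vector" and l :: "'c \<Rightarrow> real"
  assumes f: "smooth_on S f" and l: "bounded_linear l"
  shows "C1_on S (\<lambda>x. l (f x))" "C1_on S (\<lambda>x. l (frechet_derivative f (at x) v))"
proof -
  have *: "C1_on S (\<lambda>x. l (h x))" if "Ck_on (Suc 0) S h" for h :: "'b \<Rightarrow> 'c"
  proof (rule C1_onI[of _ _ "\<lambda>x v. l (frechet_derivative h (at x) v)"])
    fix x assume "x \<in> S"
    then have "(h has_derivative frechet_derivative h (at x)) (at x)"
      using that by (auto simp: frechet_derivative_works)
    then show "((\<lambda>x. l (h x)) has_derivative (\<lambda>v. l (frechet_derivative h (at x) v))) (at x)"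
      by (rule bounded_linear.has_derivative[OF l])
  next
    fix v
    have "continuous_on S (\<lambda>x. frechet_derivative h (at x) v)" using that by simp
    then show "continuous_on S (\<lambda>x. l (frechet_derivative h (at x) v))"
      by (rule bounded_linear.continuous_on[OF l])
  qed
  have "Ck_on (Suc 0) S f" using f by (simp only: smooth_on_def)
  then show "C1_on S (\<lambda>x. l (f x))" by (rule *)
  have "Ck_on (Suc (Suc 0)) S f" using f unfolding smooth_on_def by blast
  then have "Ck_on (Suc 0) S (\<lambda>x. frechet_derivative f (at x) v)" by (subst (asm) Ck_on.simps) blast
  then show "C1_on S (\<lambda>x. l (frechet_derivative f (at x) v))" by (rule *)
qed

lemma C1_on_lipschitz:
  fixes f :: "'b::euclidean_space \<Rightarrow> real"
  assumes f: "C1_on S f" and K: "K \<subseteq> S" "compact K" "convex K"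
  shows "\<exists>L\<ge>0. \<forall>x\<in>K. \<forall>y\<in>K. \<bar>f x - f y\<bar> \<le> L * norm (x - y)"
proof -
  obtain f' where f': "\<And>x. x \<in> S \<Longrightarrow> (f has_derivative f' x) (at x)" "\<And>v. continuous_on S (\<lambda>x. f' x v)"
    using f unfolding C1_on_def by blast
  have "\<exists>B\<ge>0. \<forall>x\<in>K. \<bar>f' x b\<bar> \<le> B" for b
  proof -
    have "bounded ((\<lambda>x. f' x b) ` K)"
      using K by (intro compact_imp_bounded compact_continuous_image continuous_on_subset[OF f'(2)])
    then obtain B where "\<forall>x\<in>K. \<bar>f' x b\<bar> \<le> B" by (auto simp: bounded_iff)
    then show ?thesis by (intro exI[of _ "max B 0"]) auto
  qed
  then obtain B where B: "\<And>b. B b \<ge> 0" "\<And>b x. x \<in> K \<Longrightarrow> \<bar>f' x b\<bar> \<le> B b" by metis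
  define L where "L = (\<Sum>b\<in>Basis. B b)"
  have L: "L \<ge> 0" using B by (auto simp: L_def intro: sum_nonneg)
  have "norm (f x - f y) \<le> L * norm (x - y)" if "x \<in> K" "y \<in> K" for x y
  proof (rule differentiable_bound[OF K(3) _ _ that])
    fix x assume x: "x \<in> K"
    then have D: "(f has_derivative f' x) (at x)" using K f' by auto
    then show "(f has_derivative f' x) (at x within K)" by (rule has_derivative_at_withinI)
    have lin: "linear (f' x)" using D has_derivative_linear by blast
    show "onorm (f' x) \<le> L"
    proof (rule onorm_le)
      fix h
      have "f' x h = f' x (\<Sum>b\<in>Basis. (h \<bullet> b) *\<^sub>R b)" by (simp add: euclidean_representation)
      also have "\<dots> = (\<Sum>b\<in>Basis. (h \<bullet> b) * f' x b)"
        by (simp add: linear_sum[OF lin] linear_cmul[OF lin])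
      finally have "norm (f' x h) \<le> (\<Sum>b\<in>Basis. \<bar>(h \<bullet> b) * f' x b\<bar>)" by (simp add: sum_abs)
      also have "\<dots> \<le> (\<Sum>b\<in>Basis. norm h * B b)"
        using Basis_le_norm B(2)[OF x] B(1) by (intro sum_mono) (auto simp: abs_mult intro!: mult_mono)
      finally show "norm (f' x h) \<le> L * norm h" by (simp add: L_def sum_distrib_left sum_distrib_right mult.commute)
    qed
  qed
  with L show ?thesis by auto
qed

section \<open>Determinants\<close>

declare transpose_matrix_vector [simp del]

text \<open>
  The rows in \<open>D'\<close> vanish off the columns in \<open>D\<close>, so a permutation with nonzero product maps \<open>D'\<close> into
  \<open>D\<close>, hence onto \<open>D\<close>, and the complement of \<open>D'\<close> onto the complement of \<open>D\<close>.
\<close>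

lemma det_block_triangular:
  fixes A :: "real^'n::finite^'n"
  assumes card: "card D = card D'" and zero: "\<And>i j. i \<in> D' \<Longrightarrow> j \<notin> D \<Longrightarrow> A $ i $ j = 0"
  shows "det (\<chi> i j. if i \<in> D' \<longleftrightarrow> j \<in> D then A $ i $ j else 0) = det A"
  unfolding det_def
proof (rule sum.cong)
  fix p :: "'n \<Rightarrow> 'n" assume "p \<in> {p. p permutes UNIV}"
  then have p: "p permutes UNIV" by simp
  let ?B = "(\<chi> i j. if i \<in> D' \<longleftrightarrow> j \<in> D then A $ i $ j else 0) :: real^'n^'n"
  show "of_int (sign p) * (\<Prod>i\<in>UNIV. ?B $ i $ p i) = of_int (sign p) * (\<Prod>i\<in>UNIV. A $ i $ p i)"
  proof (cases "p ` D' \<subseteq> D")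
    case True
    have "card (p ` D') = card D'" using p by (meson card_image permutes_inj inj_on_subset subset_UNIV)
    then have "p ` D' = D" using True card by (intro card_subset_eq) auto
    then have "i \<in> D' \<longleftrightarrow> p i \<in> D" for i using permutes_inj[OF p] by (auto simp: inj_eq)
    then show ?thesis by simp
  next
    case False
    then obtain i where "i \<in> D'" "p i \<notin> D" by auto
    then have "?B $ i $ p i = 0" "A $ i $ p i = 0" using zero by auto
    then have "(\<Prod>i\<in>UNIV. ?B $ i $ p i) = 0" "(\<Prod>i\<in>UNIV. A $ i $ p i) = 0"
      by (meson UNIV_I finite_class.finite_UNIV prod_zero)+
    then show ?thesis by (simp only:)
  qed
qed simp

lemma continuous_on_det:
  assumes "\<And>i j. continuous_on S (\<lambda>x. A x $ i $ j)"
  shows "continuous_on S (\<lambda>x. det (A x :: real^'n::finite^'n))"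
  unfolding det_def by (intro continuous_intros assms)

lemma C1_on_det:
  assumes "\<And>i j. C1_on S (\<lambda>x. A x $ i $ j)"
  shows "C1_on S (\<lambda>x. det (A x :: real^'n::finite^'n))"
  unfolding det_def by (intro C1_on_sum C1_on_mult C1_on_const C1_on_prod assms)

lemma pos_def_det_nonzero:
  fixes A :: "real^'n::finite^'n"
  assumes pos: "\<And>v. v \<noteq> 0 \<Longrightarrow> v \<bullet> (A *v v) > 0"
  shows "det A \<noteq> 0" "invertible A"
proof -
  have "\<exists>B. B ** A = mat 1"
    unfolding matrix_left_invertible_ker using pos by (metis inner_zero_right less_irrefl)
  then show "invertible A" by (simp add: invertible_left_inverse)
  then show "det A \<noteq> 0" by (simp add: invertible_det_nz)
qed

text \<open>The determinant has no zero on the segment from \<open>A\<close> to the identity matrix.\<close>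

lemma pos_def_det_pos:
  fixes A :: "real^'n::finite^'n"
  assumes pos: "\<And>v. v \<noteq> 0 \<Longrightarrow> v \<bullet> (A *v v) > 0"
  shows "det A > 0"
proof (rule ccontr)
  assume "\<not> det A > 0"
  let ?B = "\<lambda>s::real. (1 - s) *\<^sub>R mat 1 + s *\<^sub>R A"
  have c: "continuous_on {0..1} (\<lambda>s. det (?B s))"
    by (intro continuous_on_det) (auto intro!: continuous_intros)
  have "\<exists>s. 0 \<le> s \<and> s \<le> 1 \<and> det (?B s) = 0"
    using IVT2'[of "\<lambda>s. det (?B s)" 1 0 0] c \<open>\<not> det A > 0\<close> by auto
  then obtain s where s: "0 \<le> s" "s \<le> 1" "det (?B s) = 0" by auto
  have "v \<bullet> (?B s *v v) > 0" if "v \<noteq> 0" for v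
  proof -
    have "v \<bullet> (?B s *v v) = (1 - s) * (v \<bullet> v) + s * (v \<bullet> (A *v v))"
      by (simp add: matrix_vector_mult_add_rdistrib scaleR_matrix_vector_assoc[symmetric] inner_add_right)
    moreover have "v \<bullet> v > 0" using that by simp
    ultimately show ?thesis using pos[OF that] s
      by (cases "s = 0") (auto intro!: add_nonneg_pos)
  qed
  from pos_def_det_nonzero(1)[OF this] s show False by simp
qed

lemma matrix_inv_mult:
  fixes A :: "real^'n::finite^'n"
  assumes "invertible A"
  shows "A ** matrix_inv A = mat 1" "matrix_inv A ** A = mat 1"
proof -
  have "A ** matrix_inv A = mat 1 \<and> matrix_inv A ** A = mat 1"
    unfolding matrix_inv_def by (rule someI_ex) (use assms in \<open>auto simp: invertible_def\<close>)
  then show "A ** matrix_inv A = mat 1" "matrix_inv A ** A = mat 1" by auto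
qed

lemma matrix_inv_vector_eqI:
  fixes A :: "real^'n::finite^'n"
  assumes "invertible A" "A *v w = \<xi>"
  shows "matrix_inv A *v \<xi> = w"
  using assms by (simp add: matrix_vector_mul_assoc matrix_inv_mult flip: assms(2))

lemma matrix_mult_inv_vector:
  fixes A :: "real^'n::finite^'n"
  assumes "invertible A"
  shows "A *v (matrix_inv A *v \<xi>) = \<xi>"
  using assms by (simp add: matrix_vector_mul_assoc matrix_inv_mult)

text \<open>By Cramer's rule.\<close>

lemma C1_on_matrix_inv_vector:
  fixes A :: "'b::euclidean_space \<Rightarrow> real^'n::finite^'n"
  assumes S: "open S" and A: "\<And>i j. C1_on S (\<lambda>x. A x $ i $ j)" and b: "\<And>i. C1_on S (\<lambda>x. b x $ i)"
    and inv: "\<And>x. x \<in> S \<Longrightarrow> invertible (A x)"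
  shows "C1_on S (\<lambda>x. (matrix_inv (A x) *v b x) $ k)"
proof (rule C1_on_cong[OF _ S])
  show "C1_on S (\<lambda>x. det (\<chi> i j. if j = k then b x $ i else A x $ i $ j) * inverse (det (A x)))"
  proof (intro C1_on_mult C1_on_det C1_on_inverse A)
    fix i j
    show "C1_on S (\<lambda>x. (\<chi> i j. if j = k then b x $ i else A x $ i $ j) $ i $ j)"
      by (cases "j = k") (simp_all add: A b)
    fix x assume "x \<in> S" then show "det (A x) \<noteq> 0" using inv by (simp add: invertible_det_nz)
  qed
  fix x assume x: "x \<in> S"
  have "det (A x) \<noteq> 0" using inv[OF x] by (simp add: invertible_det_nz)
  from cramer[OF this, of "matrix_inv (A x) *v b x" "b x"] matrix_mult_inv_vector[OF inv[OF x]]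
  have "matrix_inv (A x) *v b x = (\<chi> k. det (\<chi> i j. if j = k then b x $ i else A x $ i $ j) / det (A x))"
    by simp
  then show "det (\<chi> i j. if j = k then b x $ i else A x $ i $ j) * inverse (det (A x)) = (matrix_inv (A x) *v b x) $ k"
    by (simp add: divide_inverse)
qed

lemma bounded_bilinear_matrix_vector: "bounded_bilinear (\<lambda>(A::real^'n::finite^'m::finite) x. A *v x)"
  unfolding bilinear_conv_bounded_bilinear[symmetric] bilinear_def linear_iff
  by (auto simp: matrix_vector_mult_add_rdistrib matrix_vector_right_distrib scaleR_matrix_vector_assoc
      matrix_vector_mult_scaleR)

section \<open>Charts and covectors\<close>

context compact_riemannian
begin

lemma chartD:
  assumes "c \<in> A"
  shows "open (cdom c)" "open (crange c)" "homeomorphism (cdom c) (crange c) (cmap c) (cinv c)"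
  using assms atlas unfolding maximal_smooth_atlas_def is_chart_def by blast+

lemma cinv_cmap [simp]: "c \<in> A \<Longrightarrow> q \<in> cdom c \<Longrightarrow> cinv c (cmap c q) = q"
  using chartD(3) homeomorphism_apply1 by blast

lemma cmap_cinv [simp]: "c \<in> A \<Longrightarrow> x \<in> crange c \<Longrightarrow> cmap c (cinv c x) = x"
  using chartD(3) homeomorphism_apply2 by blast

lemma cmap_in [simp, intro]: "q \<in> cdom c \<Longrightarrow> cmap c q \<in> crange c"
  by (simp add: crange_def)

lemma cinv_in [simp, intro]: "c \<in> A \<Longrightarrow> x \<in> crange c \<Longrightarrow> cinv c x \<in> cdom c"
  using chartD(3)[of c] unfolding homeomorphism_def by blast

lemma continuous_on_cmap: "c \<in> A \<Longrightarrow> continuous_on (cdom c) (cmap c)"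
  and continuous_on_cinv: "c \<in> A \<Longrightarrow> continuous_on (crange c) (cinv c)"
  using chartD(3)[of c] unfolding homeomorphism_def by blast+

lemma ex_chart: "\<exists>c\<in>A. q \<in> cdom c"
  using atlas unfolding maximal_smooth_atlas_def by blast

lemma chart_at: "chart_at q \<in> A" "q \<in> cdom (chart_at q)"
proof -
  have "chart_at q \<in> A \<and> q \<in> cdom (chart_at q)"
    unfolding chart_at_def by (rule someI_ex) (use ex_chart in blast)
  then show "chart_at q \<in> A" "q \<in> cdom (chart_at q)" by auto
qed

lemma open_chart_image:
  assumes c: "c \<in> A" and U: "open U"
  shows "open (cmap c ` (cdom c \<inter> U))"
proof -
  have "cmap c ` (cdom c \<inter> U) = crange c \<inter> cinv c -` U"
  proof (intro equalityI subsetI)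
    fix x assume "x \<in> crange c \<inter> cinv c -` U"
    then have x: "x \<in> crange c" "cinv c x \<in> U" by auto
    show "x \<in> cmap c ` (cdom c \<inter> U)"
      using image_eqI[of x "cmap c" "cinv c x" "cdom c \<inter> U"] x c by simp
  qed (use c in auto)
  then show ?thesis
    using continuous_open_preimage[OF continuous_on_cinv[OF c] chartD(2)[OF c] U] by simp
qed

text \<open>The differential of the change of coordinates from \<open>c\<close> to \<open>c'\<close> at a point of the manifold.\<close>

definition tmat :: "('a, 'n) chart \<Rightarrow> ('a, 'n) chart \<Rightarrow> 'a \<Rightarrow> real^'n^'n" where
  "tmat c c' q = jacobian (transition c c') (at (cmap c q))"

lemma smooth_on_transition:
  assumes "c \<in> A" "c' \<in> A"
  shows "smooth_on (cmap c ` (cdom c \<inter> cdom c')) (transition c c')"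
  using assms atlas unfolding maximal_smooth_atlas_def compatible_def by blast

lemma transition_has_derivative:
  assumes "c \<in> A" "c' \<in> A" "q \<in> cdom c" "q \<in> cdom c'"
  shows "(transition c c' has_derivative (\<lambda>v. tmat c c' q *v v)) (at (cmap c q))"
proof -
  have "Ck_on (Suc 0) (cmap c ` (cdom c \<inter> cdom c')) (transition c c')"
    using smooth_on_transition[OF assms(1,2)] by (simp only: smooth_on_def)
  then have "transition c c' differentiable (at (cmap c q))" using assms by auto
  then show ?thesis unfolding tmat_def by (simp add: jacobian_works)
qed

lemma transition_cmap [simp]: "c \<in> A \<Longrightarrow> q \<in> cdom c \<Longrightarrow> transition c c' (cmap c q) = cmap c' q"
  by (simp add: transition_def)

lemma tmat_cocycle:
  assumes A: "c \<in> A" "c' \<in> A" "c'' \<in> A" and q: "q \<in> cdom c" "q \<in> cdom c'" "q \<in> cdom c''"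
  shows "tmat c c'' q = tmat c' c'' q ** tmat c c' q"
proof -
  have "((transition c' c'' \<circ> transition c c') has_derivative ((*v) (tmat c' c'' q) \<circ> (*v) (tmat c c' q))) (at (cmap c q))"
    by (rule diff_chain_at[OF transition_has_derivative]) (use A q transition_has_derivative in auto)
  moreover have "open (cmap c ` (cdom c \<inter> cdom c'))" "cmap c q \<in> cmap c ` (cdom c \<inter> cdom c')"
    using A q open_chart_image chartD by auto
  ultimately have "(transition c c'' has_derivative ((*v) (tmat c' c'' q) \<circ> (*v) (tmat c c' q))) (at (cmap c q))"
    by (rule has_derivative_transform_within_open) (use A in \<open>auto simp: transition_def\<close>)
  from has_derivative_unique[OF transition_has_derivative[OF A(1,3) q(1,3)] this]
  show ?thesis by (simp add: fun_eq_iff matrix_vector_mul_assoc matrix_eq)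
qed

lemma tmat_self:
  assumes "c \<in> A" "q \<in> cdom c" shows "tmat c c q = mat 1"
proof -
  have "(transition c c has_derivative (\<lambda>v. v)) (at (cmap c q))"
    by (rule has_derivative_transform_within_open[OF has_derivative_ident chartD(2)[OF assms(1)]])
      (use assms in \<open>auto simp: transition_def\<close>)
  from has_derivative_unique[OF transition_has_derivative[OF assms(1,1,2,2)] this]
  show ?thesis by (simp add: fun_eq_iff matrix_eq)
qed

lemma tmat_inverse:
  assumes "c \<in> A" "c' \<in> A" "q \<in> cdom c" "q \<in> cdom c'"
  shows "tmat c' c q ** tmat c c' q = mat 1"
  using tmat_cocycle[of c c' c q] tmat_self[of c q] assms by simp

lemma cotangentD:
  assumes "\<alpha> \<in> cotangent" "c \<in> A" "c' \<in> A" "fst \<alpha> \<in> cdom c" "fst \<alpha> \<in> cdom c'"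
  shows "snd \<alpha> c' = transpose (tmat c' c (fst \<alpha>)) *v snd \<alpha> c"
  using assms unfolding cotangent_def tmat_def mem_Collect_eq case_prod_beta by blast

lemma cotangent_outside:
  assumes "\<alpha> \<in> cotangent" "c \<notin> A \<or> fst \<alpha> \<notin> cdom c" shows "snd \<alpha> c = 0"
  using assms unfolding cotangent_def mem_Collect_eq case_prod_beta by blast

definition over :: "('a, 'n) chart \<Rightarrow> ('a \<times> (('a, 'n) chart \<Rightarrow> real^'n)) set" where
  "over c = {\<alpha> \<in> cotangent. fst \<alpha> \<in> cdom c}"

lemma fst_of_coord [simp]: "fst (of_coord c z) = cinv c (fst z)"
  by (simp add: of_coord_def split_beta)

lemma snd_of_coord:
  assumes "c' \<in> A" "cinv c (fst z) \<in> cdom c'"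
  shows "snd (of_coord c z) c' = transpose (tmat c' c (cinv c (fst z))) *v snd z"
  using assms by (simp add: of_coord_def split_beta tmat_def)

lemma of_coord_in:
  assumes c: "c \<in> A" and z: "fst z \<in> crange c"
  shows "of_coord c z \<in> over c"
proof -
  have "snd (of_coord c z) c2 = transpose (tmat c2 c1 (cinv c (fst z))) *v snd (of_coord c z) c1"
    if "c1 \<in> A" "c2 \<in> A" "cinv c (fst z) \<in> cdom c1" "cinv c (fst z) \<in> cdom c2" for c1 c2
  proof -
    have "tmat c2 c (cinv c (fst z)) = tmat c1 c (cinv c (fst z)) ** tmat c2 c1 (cinv c (fst z))"
      using tmat_cocycle[OF that(2,1) c that(4,3) cinv_in[OF c z]] .
    then show ?thesis
      unfolding snd_of_coord[OF that(1,3)] snd_of_coord[OF that(2,4)]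
      by (simp only: matrix_vector_mul_assoc matrix_transpose_mul)
  qed
  moreover have "snd (of_coord c z) c' = 0" if "c' \<notin> A \<or> cinv c (fst z) \<notin> cdom c'" for c'
    using that unfolding of_coord_def case_prod_beta by auto
  ultimately have "of_coord c z \<in> cotangent"
    unfolding cotangent_def mem_Collect_eq case_prod_beta tmat_def[symmetric] fst_of_coord by blast
  then show ?thesis using c z by (simp add: over_def)
qed

lemma coord_of_coord [simp]:
  assumes "c \<in> A" "fst z \<in> crange c" shows "coord c (of_coord c z) = z"
  using assms by (simp add: coord_def snd_of_coord tmat_self prod_eq_iff)

lemma of_coord_coord [simp]:
  assumes c: "c \<in> A" and \<alpha>: "\<alpha> \<in> over c" shows "of_coord c (coord c \<alpha>) = \<alpha>"
proof -
  have \<alpha>': "\<alpha> \<in> cotangent" "fst \<alpha> \<in> cdom c" using \<alpha> by (auto simp: over_def)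
  have q: "cinv c (fst (coord c \<alpha>)) = fst \<alpha>" using c \<alpha>' by (simp add: coord_def)
  have "snd (of_coord c (coord c \<alpha>)) c' = snd \<alpha> c'" for c'
  proof (cases "c' \<in> A \<and> fst \<alpha> \<in> cdom c'")
    case True
    then show ?thesis using cotangentD[OF \<alpha>'(1) c _ \<alpha>'(2), of c'] q by (simp add: snd_of_coord) (simp add: coord_def)
  next
    case False
    then have "snd (of_coord c (coord c \<alpha>)) c' = 0" using q unfolding of_coord_def case_prod_beta by auto
    with False show ?thesis using cotangent_outside[OF \<alpha>'(1), of c'] by simp
  qed
  with q show ?thesis by (simp add: prod_eq_iff fun_eq_iff)
qed

lemma coord_in: "\<alpha> \<in> over c \<Longrightarrow> coord c \<alpha> \<in> crange c \<times> UNIV"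
  by (auto simp: coord_def over_def)

lemma inj_on_coord: "c \<in> A \<Longrightarrow> inj_on (coord c) (over c)"
  by (rule inj_on_inverseI[of _ "of_coord c"]) simp

lemma coord_image:
  assumes c: "c \<in> A" shows "coord c ` over c = crange c \<times> UNIV"
proof (intro equalityI subsetI)
  fix z :: "(real^'n) \<times> (real^'n)" assume z: "z \<in> crange c \<times> UNIV"
  then have z: "fst z \<in> crange c" by auto
  show "z \<in> coord c ` over c"
    using image_eqI[of z "coord c" "of_coord c z", OF _ of_coord_in[OF c z]] coord_of_coord[OF c z] by simp
qed (use coord_in in blast)

text \<open>The change of coordinates on the cotangent bundle.\<close>

definition ctrans :: "('a, 'n) chart \<Rightarrow> ('a, 'n) chart \<Rightarrow> (real^'n) \<times> (real^'n) \<Rightarrow> (real^'n) \<times> (real^'n)" where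
  "ctrans c c' z = (transition c c' (fst z), transpose (tmat c' c (cinv c (fst z))) *v snd z)"

lemma coord_of_coord_ctrans:
  assumes "c \<in> A" "c' \<in> A" "fst z \<in> crange c" "cinv c (fst z) \<in> cdom c'"
  shows "coord c' (of_coord c z) = ctrans c c' z"
  using assms by (simp add: coord_def snd_of_coord ctrans_def transition_def)

lemma ctrans_coord:
  assumes "c \<in> A" "c' \<in> A" "\<alpha> \<in> over c" "\<alpha> \<in> over c'"
  shows "ctrans c c' (coord c \<alpha>) = coord c' \<alpha>"
proof -
  have "fst (coord c \<alpha>) \<in> crange c" "cinv c (fst (coord c \<alpha>)) \<in> cdom c'"
    using assms by (auto simp: coord_def over_def)
  from coord_of_coord_ctrans[OF assms(1,2) this] show ?thesis using assms by simp
qed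

lemma matrix_transpose_vector_component:
  "(transpose M *v (\<xi>::real^'n)) $ i = (\<Sum>j\<in>UNIV. M $ j $ i * \<xi> $ j)"
  by (simp add: matrix_vector_mult_def transpose_def)

lemma differentiable_transform_open:
  assumes "f differentiable (at z)" "open U" "z \<in> U" "\<And>w. w \<in> U \<Longrightarrow> f w = h w"
  shows "h differentiable (at z)"
  using assms unfolding differentiable_def by (meson has_derivative_transform_within_open)

lemma ctrans_differentiable:
  assumes c: "c \<in> A" "c' \<in> A" and z: "fst z \<in> cmap c ` (cdom c \<inter> cdom c')"
  shows "ctrans c c' differentiable (at z)"
proof -
  let ?O = "cmap c ` (cdom c \<inter> cdom c')" and ?O' = "cmap c' ` (cdom c' \<inter> cdom c)"
  obtain q where q: "q \<in> cdom c" "q \<in> cdom c'" "fst z = cmap c q" using z by auto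
  have O: "open ?O" using c open_chart_image chartD by blast
  have \<tau>: "transition c c' differentiable (at (fst z))"
    using transition_has_derivative[OF c q(1,2)] q(3) unfolding differentiable_def by auto
  have t1: "(\<lambda>z. transition c c' (fst z)) differentiable (at z)"
    using differentiable_chain_at[of fst z "transition c c'"] \<tau> by (simp add: o_def linear_imp_differentiable linear_fst)
  have t2: "(\<lambda>z. tmat c' c (cinv c (fst z)) $ j $ i) differentiable (at z)" for i j
  proof -
    let ?h = "\<lambda>y. frechet_derivative (transition c' c) (at y) (axis i 1) $ j"
    have "C1_on ?O' ?h"
      by (rule C1_on_if_smooth_component(2)[OF smooth_on_transition]) (use c in \<open>auto intro: bounded_linear_vec_nth\<close>)
    then have "?h differentiable (at (transition c c' (fst z)))"
      using q c by (intro C1_on_differentiable) auto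
    from differentiable_chain_at[OF t1 this]
    have d: "(\<lambda>z. ?h (transition c c' (fst z))) differentiable (at z)" by (simp add: o_def)
    have e: "?h (transition c c' (fst w)) = tmat c' c (cinv c (fst w)) $ j $ i" if w: "w \<in> ?O \<times> UNIV" for w
    proof -
      obtain q where "q \<in> cdom c" "q \<in> cdom c'" "fst w = cmap c q" using w unfolding mem_Times_iff by blast
      then show ?thesis using c by (simp add: tmat_def jacobian_def matrix_def)
    qed
    have "open (?O \<times> (UNIV :: (real^'n) set))" "z \<in> ?O \<times> UNIV" using O z by (auto intro: open_Times simp: mem_Times_iff)
    from differentiable_transform_open[OF d this e] show ?thesis .
  qed
  have t3: "(\<lambda>z. snd z $ j) differentiable (at z)" for j
    by (intro linear_imp_differentiable) (auto simp: linear_iff)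
  have "(\<lambda>z. ctrans c c' z \<bullet> b) differentiable (at z)" if "b \<in> Basis" for b
  proof -
    from that obtain i where "b = (axis i 1, 0) \<or> b = (0, axis i 1)"
      by (auto simp: Basis_prod_def Basis_vec_def)
    then show ?thesis
    proof
      assume b: "b = (axis i 1, 0)"
      obtain D where "((\<lambda>z. transition c c' (fst z)) has_derivative D) (at z)"
        using t1 unfolding differentiable_def by blast
      from bounded_linear.has_derivative[OF bounded_linear_vec_nth[of i] this]
      have "(\<lambda>z. transition c c' (fst z) $ i) differentiable (at z)"
        unfolding differentiable_def by blast
      then show ?thesis using b by (simp add: ctrans_def inner_axis)
    next
      assume b: "b = (0, axis i 1)"
      have "(\<lambda>z. \<Sum>j\<in>UNIV. tmat c' c (cinv c (fst z)) $ j $ i * snd z $ j) differentiable (at z)"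
        by (intro differentiable_sum ballI differentiable_mult t2 t3) simp
      then show ?thesis using b by (simp add: ctrans_def inner_axis matrix_transpose_vector_component)
    qed
  qed
  then show ?thesis by (subst differentiable_componentwise_within) auto
qed

lemma ctrans_continuous_on:
  assumes "c \<in> A" "c' \<in> A"
  shows "continuous_on (cmap c ` (cdom c \<inter> cdom c') \<times> UNIV) (ctrans c c')"
proof (intro continuous_at_imp_continuous_on ballI)
  fix z assume "z \<in> cmap c ` (cdom c \<inter> cdom c') \<times> (UNIV :: (real^'n) set)"
  then have "fst z \<in> cmap c ` (cdom c \<inter> cdom c')" unfolding mem_Times_iff by blast
  from ctrans_differentiable[OF assms this] show "isCont (ctrans c c') z"
    by (rule differentiable_imp_continuous_within)
qed

end

section \<open>The topology of the cotangent bundle\<close>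

context compact_riemannian
begin

lemma restrict_over: "S \<subseteq> cotangent \<Longrightarrow> {\<alpha> \<in> S. fst \<alpha> \<in> cdom c} = S \<inter> over c"
  unfolding over_def by blast

text \<open>
  The family of sets in the definition of the topology is closed under intersections and unions, so it is the family of open sets.
\<close>

lemma openin_cot:
  "openin cot_topology S \<longleftrightarrow> S \<subseteq> cotangent \<and> (\<forall>c\<in>A. open (coord c ` (S \<inter> over c)))"
proof -
  let ?P = "\<lambda>S. S \<subseteq> cotangent \<and> (\<forall>c\<in>A. open (coord c ` (S \<inter> over c)))"
  have eq: "(\<lambda>S. S \<subseteq> cotangent \<and> (\<forall>c\<in>A. open (coord c ` {\<alpha> \<in> S. fst \<alpha> \<in> cdom c}))) = ?P"
    using restrict_over by (intro ext) (simp cong: conj_cong)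
  have int: "?P (S \<inter> T)" if S: "?P S" and T: "?P T" for S T
  proof -
    have "open (coord c ` (S \<inter> T \<inter> over c))" if c: "c \<in> A" for c
    proof -
      have "coord c ` (S \<inter> T \<inter> over c) = coord c ` ((S \<inter> over c) \<inter> (T \<inter> over c))"
        by (rule arg_cong[of _ _ "image (coord c)"]) blast
      also have "\<dots> = coord c ` (S \<inter> over c) \<inter> coord c ` (T \<inter> over c)"
        by (rule inj_on_image_Int[OF inj_on_coord[OF c]]) blast+
      finally show ?thesis using S T c by (simp add: open_Int)
    qed
    with S show "?P (S \<inter> T)" by blast
  qed
  have un: "?P (\<Union>K)" if K: "\<forall>S\<in>K. ?P S" for K
  proof -
    have "open (coord c ` (\<Union>K \<inter> over c))" if c: "c \<in> A" for c
    proof -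
      have "coord c ` (\<Union>K \<inter> over c) = (\<Union>S\<in>K. coord c ` (S \<inter> over c))" by blast
      then show ?thesis using K c by (simp add: open_UN)
    qed
    with K show "?P (\<Union>K)" by blast
  qed
  have "\<forall>S T. ?P S \<longrightarrow> ?P T \<longrightarrow> ?P (S \<inter> T)" using int by (intro allI impI)
  moreover have "\<forall>K. (\<forall>S\<in>K. ?P S) \<longrightarrow> ?P (\<Union>K)" using un by (intro allI impI)
  ultimately have "istopology ?P"
    unfolding istopology_def by (rule conjI)
  then show ?thesis
    unfolding cot_topology_def eq by (simp add: topology_inverse')
qed

lemma topspace_cot [simp]: "topspace cot_topology = cotangent"
proof -
  have "cotangent \<inter> over c = over c" for c unfolding over_def by blast
  then have "openin cot_topology cotangent"
    unfolding openin_cot using chartD(2) by (simp add: coord_image open_Times)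
  then show ?thesis
    using openin_cot by (auto simp: topspace_def)
qed

text \<open>
  Read in another chart, an open set of coordinates is transformed by a homeomorphism between open sets.
\<close>

lemma openin_of_coord:
  assumes c: "c \<in> A" and U: "open U" "U \<subseteq> crange c \<times> UNIV"
  shows "openin cot_topology (of_coord c ` U)"
  unfolding openin_cot
proof (intro conjI ballI)
  have sub: "of_coord c ` U \<subseteq> over c"
  proof (rule image_subsetI)
    fix z assume "z \<in> U"
    then have "fst z \<in> crange c" using U(2) by auto
    then show "of_coord c z \<in> over c" by (rule of_coord_in[OF c])
  qed
  then show "of_coord c ` U \<subseteq> cotangent" unfolding over_def by blast
  fix c' assume c': "c' \<in> A"
  let ?O = "cmap c' ` (cdom c' \<inter> cdom c) \<times> (UNIV :: (real^'n) set)"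
  have eq: "coord c' ` (of_coord c ` U \<inter> over c') = ?O \<inter> ctrans c' c -` U"
  proof (intro equalityI subsetI)
    fix z' assume "z' \<in> coord c' ` (of_coord c ` U \<inter> over c')"
    then obtain z where z: "z \<in> U" "of_coord c z \<in> over c'" "z' = coord c' (of_coord c z)" by blast
    have zc: "of_coord c z \<in> over c" using sub z by blast
    have "fst z \<in> crange c" using z(1) U(2) by auto
    then have "ctrans c' c z' = z"
      using ctrans_coord[OF c' c z(2) zc] z(3) c by simp
    moreover have "fst z' = cmap c' (fst (of_coord c z))" using z(3) by (simp add: coord_def)
    then have "fst z' \<in> cmap c' ` (cdom c' \<inter> cdom c)" using z(2) zc unfolding over_def by blast
    ultimately show "z' \<in> ?O \<inter> ctrans c' c -` U" using z(1) by (simp add: mem_Times_iff)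
  next
    fix z' assume z': "z' \<in> ?O \<inter> ctrans c' c -` U"
    then have "fst z' \<in> cmap c' ` (cdom c' \<inter> cdom c)" by (simp add: mem_Times_iff)
    then obtain q where q: "q \<in> cdom c'" "q \<in> cdom c" "fst z' = cmap c' q" by blast
    have 1: "of_coord c' z' \<in> over c'" by (rule of_coord_in[OF c']) (simp add: q)
    then have 2: "of_coord c' z' \<in> over c" using q c' by (simp add: over_def)
    have "coord c (of_coord c' z') = ctrans c' c z'"
      by (rule coord_of_coord_ctrans[OF c' c]) (simp_all add: q c')
    then have "of_coord c' z' = of_coord c (ctrans c' c z')" using of_coord_coord[OF c 2] by simp
    then have "of_coord c' z' \<in> of_coord c ` U \<inter> over c'" using z' 1 by blast
    moreover have "z' = coord c' (of_coord c' z')" using q c' by simp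
    ultimately show "z' \<in> coord c' ` (of_coord c ` U \<inter> over c')" by blast
  qed
  have "open ?O" using open_chart_image[OF c'] chartD(1)[OF c] by (simp add: open_Times)
  then show "open (coord c' ` (of_coord c ` U \<inter> over c'))"
    unfolding eq by (intro continuous_open_preimage[OF ctrans_continuous_on[OF c' c]] U)
qed

lemma openin_coord_vimage:
  assumes c: "c \<in> A" and U: "open U"
  shows "openin cot_topology {\<alpha> \<in> over c. coord c \<alpha> \<in> U}"
proof -
  have "{\<alpha> \<in> over c. coord c \<alpha> \<in> U} = of_coord c ` (U \<inter> crange c \<times> UNIV)"
  proof (intro equalityI subsetI)
    fix \<alpha> assume "\<alpha> \<in> {\<alpha> \<in> over c. coord c \<alpha> \<in> U}"
    then have "\<alpha> \<in> over c" "coord c \<alpha> \<in> U" by auto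
    then show "\<alpha> \<in> of_coord c ` (U \<inter> crange c \<times> UNIV)"
      using image_eqI[of \<alpha> "of_coord c" "coord c \<alpha>"] coord_in c by simp
  next
    fix \<alpha> assume "\<alpha> \<in> of_coord c ` (U \<inter> crange c \<times> UNIV)"
    then obtain z where z: "\<alpha> = of_coord c z" "z \<in> U" "fst z \<in> crange c" by auto
    then show "\<alpha> \<in> {\<alpha> \<in> over c. coord c \<alpha> \<in> U}" using of_coord_in[OF c] c by simp
  qed
  then show ?thesis
    using openin_of_coord[OF c, of "U \<inter> crange c \<times> UNIV"] U chartD(2)[OF c] by (simp add: open_Int open_Times)
qed

lemma openin_over: "c \<in> A \<Longrightarrow> openin cot_topology (over c)"
  using openin_coord_vimage[of c UNIV] by simp

lemma open_coord_image:
  "openin cot_topology W \<Longrightarrow> c \<in> A \<Longrightarrow> open (coord c ` (W \<inter> over c))"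
  by (simp add: openin_cot)

lemma openin_cot_locally:
  assumes "S \<subseteq> cotangent" "\<And>\<alpha>. \<alpha> \<in> S \<Longrightarrow> \<exists>W. openin cot_topology W \<and> \<alpha> \<in> W \<and> W \<subseteq> S"
  shows "openin cot_topology S"
  using assms by (subst openin_subopen) blast

lemma openin_fst_vimage:
  assumes U: "open U"
  shows "openin cot_topology {\<alpha> \<in> cotangent. fst \<alpha> \<in> U}"
proof (rule openin_cot_locally)
  fix \<alpha> assume \<alpha>: "\<alpha> \<in> {\<alpha> \<in> cotangent. fst \<alpha> \<in> U}"
  obtain c where c: "c \<in> A" "fst \<alpha> \<in> cdom c" using ex_chart by blast
  let ?V = "cmap c ` (cdom c \<inter> U) \<times> (UNIV :: (real^'n) set)"
  have "openin cot_topology {\<beta> \<in> over c. coord c \<beta> \<in> ?V}"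
    by (rule openin_coord_vimage[OF c(1)]) (simp add: open_Times open_chart_image c U)
  moreover have "\<alpha> \<in> {\<beta> \<in> over c. coord c \<beta> \<in> ?V}" using \<alpha> c by (simp add: over_def coord_def)
  moreover have "fst \<beta> \<in> U" if \<beta>: "\<beta> \<in> over c" "coord c \<beta> \<in> ?V" for \<beta>
  proof -
    from \<beta>(2) obtain q where q: "q \<in> cdom c" "q \<in> U" "cmap c (fst \<beta>) = cmap c q" unfolding coord_def mem_Times_iff by auto
    moreover have "fst \<beta> \<in> cdom c" using \<beta>(1) by (simp add: over_def)
    ultimately have "fst \<beta> = q" using cinv_cmap[OF c(1)] by metis
    with q show ?thesis by simp
  qed
  ultimately show "\<exists>W. openin cot_topology W \<and> \<alpha> \<in> W \<and> W \<subseteq> {\<alpha> \<in> cotangent. fst \<alpha> \<in> U}"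
    by (intro exI[of _ "{\<beta> \<in> over c. coord c \<beta> \<in> ?V}"]) (auto simp: over_def)
qed blast

section \<open>The metric and the Hamilton vector field in coordinates\<close>

lemma metricD:
  assumes "c \<in> A"
  shows "smooth_on (crange c) (g c)" "\<And>x. x \<in> crange c \<Longrightarrow> transpose (g c x) = g c x"
    "\<And>x v. x \<in> crange c \<Longrightarrow> v \<noteq> 0 \<Longrightarrow> v \<bullet> (g c x *v v) > 0"
  using metric assms unfolding riemannian_metric_def by blast+

lemma metric_transform:
  assumes "c \<in> A" "c' \<in> A" "q \<in> cdom c" "q \<in> cdom c'"
  shows "g c' (cmap c' q) = transpose (tmat c' c q) ** g c (cmap c q) ** tmat c' c q"
  using metric assms unfolding riemannian_metric_def tmat_def Let_def by blast

lemma invertible_metric: "c \<in> A \<Longrightarrow> x \<in> crange c \<Longrightarrow> invertible (g c x)"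
  using metricD(3) pos_def_det_nonzero(2) by blast

lemma det_metric_pos: "c \<in> A \<Longrightarrow> x \<in> crange c \<Longrightarrow> det (g c x) > 0"
  using metricD(3) pos_def_det_pos by blast

text \<open>The vector corresponding to a covector, and the square of its length.\<close>

definition sharp :: "('a, 'n) chart \<Rightarrow> (real^'n) \<times> (real^'n) \<Rightarrow> real^'n" where
  "sharp c z = matrix_inv (g c (fst z)) *v snd z"

definition sqnorm :: "('a, 'n) chart \<Rightarrow> (real^'n) \<times> (real^'n) \<Rightarrow> real" where
  "sqnorm c z = snd z \<bullet> sharp c z"

lemma p_loc_eq: "p_loc c z = sqrt (sqnorm c z)"
  by (simp add: p_loc_def sqnorm_def sharp_def split_beta)

lemma metric_sharp: "c \<in> A \<Longrightarrow> fst z \<in> crange c \<Longrightarrow> g c (fst z) *v sharp c z = snd z"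
  by (simp add: sharp_def matrix_mult_inv_vector invertible_metric)

lemma sqnorm_pos:
  assumes "c \<in> A" "fst z \<in> crange c" "snd z \<noteq> 0" shows "sqnorm c z > 0"
proof -
  have "sharp c z \<noteq> 0" using metric_sharp[OF assms(1,2)] assms(3) by (metis matrix_vector_mult_0_right)
  from metricD(3)[OF assms(1,2) this] show ?thesis
    using metric_sharp[OF assms(1,2)] by (simp add: sqnorm_def inner_commute)
qed

lemma sqnorm_zero: "snd z = 0 \<Longrightarrow> sqnorm c z = 0"
  by (simp add: sqnorm_def)

lemma C1_on_metric:
  assumes "c \<in> A"
  shows "C1_on (crange c \<times> (UNIV :: (real^'n) set)) (\<lambda>z. g c (fst z) $ i $ j)"
    "C1_on (crange c \<times> (UNIV :: (real^'n) set)) (\<lambda>z. frechet_derivative (g c) (at (fst z)) v $ i $ j)"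
proof -
  have l: "bounded_linear (\<lambda>M::real^'n^'n. M $ i $ j)"
    by (rule bounded_linear_compose[OF bounded_linear_vec_nth bounded_linear_vec_nth])
  have im: "fst ` (crange c \<times> (UNIV :: (real^'n) set)) \<subseteq> crange c" by auto
  show "C1_on (crange c \<times> (UNIV :: (real^'n) set)) (\<lambda>z. g c (fst z) $ i $ j)"
    using C1_on_compose_linear[OF C1_on_if_smooth_component(1)[OF metricD(1)[OF assms] l] bounded_linear_fst im] .
  show "C1_on (crange c \<times> (UNIV :: (real^'n) set)) (\<lambda>z. frechet_derivative (g c) (at (fst z)) v $ i $ j)"
    using C1_on_compose_linear[OF C1_on_if_smooth_component(2)[OF metricD(1)[OF assms] l] bounded_linear_fst im] .
qed

lemma bounded_linear_snd_nth: "bounded_linear (\<lambda>z::'b::real_normed_vector \<times> (real^'n). snd z $ i)"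
  by (rule bounded_linear_compose[OF bounded_linear_vec_nth bounded_linear_snd])

lemma open_crange_Times: "c \<in> A \<Longrightarrow> open (crange c \<times> (UNIV :: (real^'n) set))"
  by (simp add: open_Times chartD)

lemma C1_on_sharp:
  assumes c: "c \<in> A"
  shows "C1_on (crange c \<times> (UNIV :: (real^'n) set)) (\<lambda>z. sharp c z $ k)"
  unfolding sharp_def
proof (rule C1_on_matrix_inv_vector[OF open_crange_Times[OF c] C1_on_metric(1)[OF c]])
  show "C1_on (crange c \<times> (UNIV :: (real^'n) set)) (\<lambda>z. snd z $ i)" for i
    by (rule C1_on_linear[OF bounded_linear_snd_nth])
  show "invertible (g c (fst z))" if "z \<in> crange c \<times> UNIV" for z :: "(real^'n) \<times> (real^'n)"
    using that c by (intro invertible_metric) auto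
qed

lemma C1_on_sqnorm:
  assumes c: "c \<in> A"
  shows "C1_on (crange c \<times> UNIV) (sqnorm c)"
proof -
  have "sqnorm c = (\<lambda>z. \<Sum>i\<in>UNIV. snd z $ i * sharp c z $ i)"
    by (simp add: sqnorm_def inner_vec_def fun_eq_iff)
  then show ?thesis
    by (simp add: C1_on_sum C1_on_mult C1_on_linear[OF bounded_linear_snd_nth] C1_on_sharp[OF c])
qed

lemma vec_differentiable:
  fixes f :: "'b::euclidean_space \<Rightarrow> real^'k::finite"
  assumes "\<And>i. (\<lambda>x. f x $ i) differentiable (at z)"
  shows "f differentiable (at z)"
  using assms by (subst differentiable_componentwise_within) (auto simp: Basis_vec_def inner_axis)

text \<open>Differentiating \<open>g(x) v = \<xi>\<close> gives the derivative of the inverse metric.\<close>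

lemma sqnorm_has_derivative:
  assumes c: "c \<in> A" and z: "fst z \<in> crange c"
  shows "(sqnorm c has_derivative (\<lambda>h. 2 * (snd h \<bullet> sharp c z)
           - sharp c z \<bullet> (frechet_derivative (g c) (at (fst z)) (fst h) *v sharp c z))) (at z)"
proof -
  have zU: "z \<in> crange c \<times> UNIV" using z by (simp add: mem_Times_iff)
  have "(\<lambda>z. sharp c z) differentiable (at z)"
    by (rule vec_differentiable) (rule C1_on_differentiable[OF C1_on_sharp[OF c] zU])
  then obtain S where S: "((\<lambda>z. sharp c z) has_derivative S) (at z)" unfolding differentiable_def by blast
  have "Ck_on (Suc 0) (crange c) (g c)" using metricD(1)[OF c] by (simp only: smooth_on_def)
  then have "(g c has_derivative frechet_derivative (g c) (at (fst z))) (at (fst z))"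
    using z by (simp add: frechet_derivative_works)
  from has_derivative_compose[OF bounded_linear_imp_has_derivative[OF bounded_linear_fst] this]
  have G: "((\<lambda>z. g c (fst z)) has_derivative (\<lambda>h. frechet_derivative (g c) (at (fst z)) (fst h))) (at z)" .
  have "((\<lambda>z. g c (fst z) *v sharp c z) has_derivative
      (\<lambda>h. g c (fst z) *v S h + frechet_derivative (g c) (at (fst z)) (fst h) *v sharp c z)) (at z)"
    by (rule bounded_bilinear.FDERIV[OF bounded_bilinear_matrix_vector G S])
  then have "(snd has_derivative (\<lambda>h. g c (fst z) *v S h + frechet_derivative (g c) (at (fst z)) (fst h) *v sharp c z)) (at z)"
    by (rule has_derivative_transform_within_open[OF _ open_crange_Times[OF c] zU])
      (use metric_sharp[OF c] in auto)
  from fun_cong[OF has_derivative_unique[OF this bounded_linear_imp_has_derivative[OF bounded_linear_snd]]]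
  have eq: "g c (fst z) *v S h = snd h - frechet_derivative (g c) (at (fst z)) (fst h) *v sharp c z" for h
    by (simp add: eq_diff_eq)
  have sym: "snd z \<bullet> w = sharp c z \<bullet> (g c (fst z) *v w)" for w
  proof -
    have "snd z \<bullet> w = (g c (fst z) *v sharp c z) \<bullet> w" using metric_sharp[OF c z] by simp
    also have "\<dots> = sharp c z \<bullet> (transpose (g c (fst z)) *v w)"
      by (metis dot_lmul_matrix transpose_matrix_vector transpose_transpose)
    finally show ?thesis using metricD(2)[OF c z] by simp
  qed
  have "((\<lambda>z. snd z \<bullet> sharp c z) has_derivative (\<lambda>h. snd z \<bullet> S h + snd h \<bullet> sharp c z)) (at z)"
    by (rule has_derivative_inner[OF bounded_linear_imp_has_derivative[OF bounded_linear_snd] S])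
  moreover have "snd z \<bullet> S h + snd h \<bullet> sharp c z = 2 * (snd h \<bullet> sharp c z)
           - sharp c z \<bullet> (frechet_derivative (g c) (at (fst z)) (fst h) *v sharp c z)" for h
    unfolding sym eq by (simp add: inner_diff_right inner_commute)
  ultimately show ?thesis unfolding sqnorm_def[abs_def] by simp
qed

definition Hforce :: "('a, 'n) chart \<Rightarrow> (real^'n) \<times> (real^'n) \<Rightarrow> real^'n" where
  "Hforce c z = (\<chi> j. sharp c z \<bullet> (frechet_derivative (g c) (at (fst z)) (axis j 1) *v sharp c z))"

lemma p_loc_has_derivative:
  assumes c: "c \<in> A" and z: "fst z \<in> crange c" "snd z \<noteq> 0"
  shows "(p_loc c has_derivative (\<lambda>h. inverse (p_loc c z) / 2 * (2 * (snd h \<bullet> sharp c z)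
           - sharp c z \<bullet> (frechet_derivative (g c) (at (fst z)) (fst h) *v sharp c z)))) (at z)"
  using has_derivative_compose[OF sqnorm_has_derivative[OF c z(1)]
      DERIV_real_sqrt[OF sqnorm_pos[OF c z], unfolded has_field_derivative_def]]
  by (simp add: p_loc_eq[abs_def])

lemma H_p_eq:
  assumes c: "c \<in> A" and z: "fst z \<in> crange c" "snd z \<noteq> 0"
  shows "H_p c z = (inverse (p_loc c z) *\<^sub>R sharp c z, (inverse (p_loc c z) / 2) *\<^sub>R Hforce c z)"
proof -
  have l: "linear (frechet_derivative (g c) (at (fst z)))"
  proof -
    have "Ck_on (Suc 0) (crange c) (g c)" using metricD(1)[OF c] by (simp only: smooth_on_def)
    then show ?thesis using z by (simp add: linear_frechet_derivative)
  qed
  have fd: "frechet_derivative (p_loc c) (at z) = (\<lambda>h. inverse (p_loc c z) / 2 * (2 * (snd h \<bullet> sharp c z)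
           - sharp c z \<bullet> (frechet_derivative (g c) (at (fst z)) (fst h) *v sharp c z)))"
    using frechet_derivative_at[OF p_loc_has_derivative[OF assms]] by simp
  show ?thesis
    unfolding H_p_def fd Hforce_def
    by (simp add: vec_eq_iff inner_axis' linear_0[OF l] inner_axis)
qed

lemma C1_on_H_p:
  assumes c: "c \<in> A"
  shows "C1_on (crange c \<times> (UNIV - {0})) (\<lambda>z. fst (H_p c z) $ k)"
    "C1_on (crange c \<times> (UNIV - {0})) (\<lambda>z. snd (H_p c z) $ k)"
proof -
  let ?S = "crange c \<times> (UNIV - {0 :: real^'n})"
  have S: "open ?S" using chartD(2)[OF c] by (intro open_Times) auto
  have sub: "C1_on ?S f" if "C1_on (crange c \<times> UNIV) f" for f :: "(real^'n) \<times> (real^'n) \<Rightarrow> real"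
    using that unfolding C1_on_def by (meson UNIV_I continuous_on_subset Sigma_mono Diff_subset order_refl subsetD)
  have p: "C1_on ?S (\<lambda>z. inverse (p_loc c z))"
    unfolding p_loc_eq
    by (intro C1_on_inverse C1_on_sqrt sub C1_on_sqnorm c) (use sqnorm_pos[OF c] in \<open>auto simp: less_le\<close>)
  have F: "C1_on ?S (\<lambda>z. Hforce c z $ k)"
  proof -
    have "Hforce c z $ k = (\<Sum>i\<in>UNIV. sharp c z $ i * (\<Sum>j\<in>UNIV. frechet_derivative (g c) (at (fst z)) (axis k 1) $ i $ j * sharp c z $ j))" for z
      by (simp add: Hforce_def inner_vec_def matrix_vector_mult_def)
    then show ?thesis
      by (simp add: C1_on_sum C1_on_mult sub[OF C1_on_sharp[OF c]] sub[OF C1_on_metric(2)[OF c]])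
  qed
  have eq: "fst (H_p c z) $ k = inverse (p_loc c z) * sharp c z $ k"
    "snd (H_p c z) $ k = inverse (p_loc c z) * (1 / 2) * Hforce c z $ k" if "z \<in> ?S" for z
    using H_p_eq[OF c, of z] that by (simp_all add: mem_Times_iff)
  show "C1_on ?S (\<lambda>z. fst (H_p c z) $ k)"
    by (rule C1_on_cong[OF C1_on_mult[OF p sub[OF C1_on_sharp[OF c, of k]]] S]) (simp add: eq)
  show "C1_on ?S (\<lambda>z. snd (H_p c z) $ k)"
    by (rule C1_on_cong[OF C1_on_mult[OF C1_on_mult[OF p C1_on_const[of _ "1 / 2"]] F] S]) (simp add: eq)
qed

lemma norm_pair_vec_le: "norm (z :: (real^'n) \<times> (real^'n)) \<le> (\<Sum>k\<in>UNIV. \<bar>fst z $ k\<bar> + \<bar>snd z $ k\<bar>)"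
proof -
  have "norm z \<le> norm (fst z) + norm (snd z)"
    by (metis norm_Pair_le prod.collapse)
  also have "\<dots> \<le> (\<Sum>k\<in>UNIV. \<bar>fst z $ k\<bar>) + (\<Sum>k\<in>UNIV. \<bar>snd z $ k\<bar>)"
    by (intro add_mono norm_le_l1_cart)
  finally show ?thesis by (simp add: sum.distrib)
qed

lemma H_p_lipschitz:
  assumes c: "c \<in> A" and K: "K \<subseteq> crange c \<times> (UNIV - {0})" "compact K" "convex K"
  shows "\<exists>L\<ge>0. \<forall>x\<in>K. \<forall>y\<in>K. norm (H_p c x - H_p c y) \<le> L * norm (x - y)"
proof -
  have "\<exists>L\<ge>0. \<forall>x\<in>K. \<forall>y\<in>K. \<bar>fst (H_p c x) $ k - fst (H_p c y) $ k\<bar> \<le> L * norm (x - y)" for k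
    by (rule C1_on_lipschitz[OF C1_on_H_p(1)[OF c] K])
  then obtain L1 where L1: "\<And>k. L1 k \<ge> 0" "\<And>k x y. x \<in> K \<Longrightarrow> y \<in> K \<Longrightarrow> \<bar>fst (H_p c x) $ k - fst (H_p c y) $ k\<bar> \<le> L1 k * norm (x - y)"
    by metis
  have "\<exists>L\<ge>0. \<forall>x\<in>K. \<forall>y\<in>K. \<bar>snd (H_p c x) $ k - snd (H_p c y) $ k\<bar> \<le> L * norm (x - y)" for k
    by (rule C1_on_lipschitz[OF C1_on_H_p(2)[OF c] K])
  then obtain L2 where L2: "\<And>k. L2 k \<ge> 0" "\<And>k x y. x \<in> K \<Longrightarrow> y \<in> K \<Longrightarrow> \<bar>snd (H_p c x) $ k - snd (H_p c y) $ k\<bar> \<le> L2 k * norm (x - y)"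
    by metis
  have "norm (H_p c x - H_p c y) \<le> (\<Sum>k\<in>UNIV. L1 k + L2 k) * norm (x - y)" if "x \<in> K" "y \<in> K" for x y
  proof -
    have "norm (H_p c x - H_p c y) \<le> (\<Sum>k\<in>UNIV. \<bar>fst (H_p c x - H_p c y) $ k\<bar> + \<bar>snd (H_p c x - H_p c y) $ k\<bar>)"
      by (rule norm_pair_vec_le)
    also have "\<dots> \<le> (\<Sum>k\<in>UNIV. (L1 k + L2 k) * norm (x - y))"
      using L1(2)[OF that] L2(2)[OF that] by (intro sum_mono) (simp add: distrib_right add_mono)
    finally show ?thesis by (simp add: sum_distrib_right)
  qed
  moreover have "(\<Sum>k\<in>UNIV. L1 k + L2 k) \<ge> 0" using L1(1) L2(1) by (intro sum_nonneg) simp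
  ultimately show ?thesis by blast
qed

lemma continuous_on_H_p:
  assumes c: "c \<in> A" shows "continuous_on (crange c \<times> (UNIV - {0})) (H_p c)"
proof -
  have "continuous_on (crange c \<times> (UNIV - {0})) (\<lambda>z. (\<chi> k. fst (H_p c z) $ k, \<chi> k. snd (H_p c z) $ k))"
    by (intro continuous_on_Pair continuous_on_vec_lambda C1_on_continuous C1_on_H_p c)
  then show ?thesis by simp
qed

lemma continuous_on_p_loc:
  assumes c: "c \<in> A" shows "continuous_on (crange c \<times> UNIV) (p_loc c)"
  unfolding p_loc_eq[abs_def]
  by (intro continuous_on_real_sqrt C1_on_continuous C1_on_sqnorm c)

lemma p_loc_pos: "c \<in> A \<Longrightarrow> fst z \<in> crange c \<Longrightarrow> snd z \<noteq> 0 \<Longrightarrow> p_loc c z > 0"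
  by (simp add: p_loc_eq sqnorm_pos)

lemma p_loc_zero: "snd z = 0 \<Longrightarrow> p_loc c z = 0"
  by (simp add: p_loc_eq sqnorm_zero)

lemma p_loc_scale: "r \<ge> 0 \<Longrightarrow> p_loc c (x, r *\<^sub>R \<xi>) = r * p_loc c (x, \<xi>)"
  by (simp add: p_loc_eq sqnorm_def sharp_def matrix_vector_mult_scaleR real_sqrt_mult)

lemma H_p_scale:
  assumes c: "c \<in> A" and x: "x \<in> crange c" and \<xi>: "\<xi> \<noteq> 0" and r: "r > 0"
  shows "H_p c (x, r *\<^sub>R \<xi>) = (fst (H_p c (x, \<xi>)), r *\<^sub>R snd (H_p c (x, \<xi>)))"
proof -
  have sh: "sharp c (x, r *\<^sub>R \<xi>) = r *\<^sub>R sharp c (x, \<xi>)"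
    by (simp add: sharp_def matrix_vector_mult_scaleR)
  then have "Hforce c (x, r *\<^sub>R \<xi>) = (r * r) *\<^sub>R Hforce c (x, \<xi>)"
    unfolding Hforce_def fst_conv sh by (simp add: vec_eq_iff matrix_vector_mult_scaleR)
  moreover have "p_loc c (x, \<xi>) \<noteq> 0" using p_loc_pos[OF c, of "(x, \<xi>)"] x \<xi> by simp
  ultimately show ?thesis
    using H_p_eq[OF c, of "(x, \<xi>)"] H_p_eq[OF c, of "(x, r *\<^sub>R \<xi>)"] x \<xi> r sh
    by (simp add: p_loc_scale)
qed

text \<open>
  Euler's relation for the homogeneous function \<open>p\<close>: the velocity of a geodesic pairs with its covector to \<open>p\<close>.
\<close>

lemma H_p_pairing:
  assumes c: "c \<in> A" and z: "fst z \<in> crange c" "snd z \<noteq> 0"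
  shows "fst (H_p c z) \<bullet> snd z = p_loc c z"
proof -
  have "fst (H_p c z) \<bullet> snd z = sqnorm c z / p_loc c z"
    unfolding H_p_eq[OF assms] sqnorm_def fst_conv inner_scaleR_left inner_commute[of "snd z"] divide_inverse
    by (rule mult.commute)
  also have "\<dots> = p_loc c z"
    unfolding p_loc_eq by (rule real_div_sqrt[OF less_imp_le[OF sqnorm_pos[OF assms]]])
  finally show ?thesis .
qed

text \<open>A Hamiltonian is constant along its own vector field.\<close>

lemma p_loc_derivative_along_H_p:
  assumes c: "c \<in> A" and z: "fst z \<in> crange c" "snd z \<noteq> 0"
  shows "frechet_derivative (p_loc c) (at z) (H_p c z) = 0"
proof -
  let ?D = "frechet_derivative (p_loc c) (at z)"
  have l: "linear ?D"
    using p_loc_has_derivative[OF assms] by (intro linear_frechet_derivative) (auto simp: differentiable_def)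
  have ex: "?D (a, b) = (\<Sum>j\<in>UNIV. a $ j * ?D (axis j 1, 0) + b $ j * ?D (0, axis j 1))" for a b
  proof -
    have "(a, b) = (\<Sum>j\<in>UNIV. a $ j *\<^sub>R (axis j 1, 0) + b $ j *\<^sub>R (0, axis j 1))"
      using basis_expansion[of a] basis_expansion[of b]
      by (simp add: prod_eq_iff fst_sum snd_sum scalar_mult_eq_scaleR)
    then have "?D (a, b) = ?D (\<Sum>j\<in>UNIV. a $ j *\<^sub>R (axis j 1, 0) + b $ j *\<^sub>R (0, axis j 1))" by simp
    also have "\<dots> = (\<Sum>j\<in>UNIV. ?D (a $ j *\<^sub>R (axis j 1, 0) + b $ j *\<^sub>R (0, axis j 1)))"
      by (rule linear_sum[OF l])
    also have "\<dots> = (\<Sum>j\<in>UNIV. a $ j * ?D (axis j 1, 0) + b $ j * ?D (0, axis j 1))"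
      by (simp only: linear_add[OF l] linear_cmul[OF l] real_scaleR_def)
    finally show ?thesis .
  qed
  have "?D (H_p c z) = (\<Sum>j\<in>UNIV. fst (H_p c z) $ j * ?D (axis j 1, 0) + snd (H_p c z) $ j * ?D (0, axis j 1))"
    using ex[of "fst (H_p c z)" "snd (H_p c z)"] by (simp only: prod.collapse)
  also have "\<dots> = 0"
    by (rule sum.neutral) (simp add: H_p_def mult.commute)
  finally show ?thesis .
qed

lemma p_loc_invariant:
  assumes \<alpha>: "\<alpha> \<in> cotangent" and c: "c \<in> A" "c' \<in> A" and q: "fst \<alpha> \<in> cdom c" "fst \<alpha> \<in> cdom c'"
  shows "p_loc c' (coord c' \<alpha>) = p_loc c (coord c \<alpha>)"
proof -
  let ?q = "fst \<alpha>" and ?T = "tmat c' c (fst \<alpha>)" and ?S = "tmat c c' (fst \<alpha>)"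
  let ?v = "sharp c (coord c \<alpha>)"
  have \<xi>: "snd \<alpha> c' = transpose ?T *v snd \<alpha> c" by (rule cotangentD[OF \<alpha> c q])
  have TS: "?T *v (?S *v w) = w" for w
    using tmat_inverse[OF c q] by (simp add: matrix_vector_mul_assoc)
  have gv: "g c (cmap c ?q) *v ?v = snd \<alpha> c"
    using metric_sharp[OF c(1), of "coord c \<alpha>"] q by (simp add: coord_def)
  have "g c' (cmap c' ?q) *v (?S *v ?v) = transpose ?T *v (g c (cmap c ?q) *v (?T *v (?S *v ?v)))"
    by (simp add: metric_transform[OF c q] matrix_vector_mul_assoc matrix_mul_assoc)
  also have "\<dots> = snd \<alpha> c'" using TS gv \<xi> by simp
  finally have "sharp c' (coord c' \<alpha>) = ?S *v ?v"
    unfolding sharp_def[of c'] using c q by (intro matrix_inv_vector_eqI invertible_metric) (auto simp: coord_def)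
  then have "sqnorm c' (coord c' \<alpha>) = (transpose ?T *v snd \<alpha> c) \<bullet> (?S *v ?v)"
    by (simp add: sqnorm_def coord_def \<xi>)
  also have "\<dots> = snd \<alpha> c \<bullet> (?T *v (?S *v ?v))"
    by (simp add: transpose_matrix_vector dot_lmul_matrix)
  also have "\<dots> = sqnorm c (coord c \<alpha>)" using TS by (simp add: sqnorm_def coord_def)
  finally show ?thesis by (simp add: p_loc_eq)
qed

lemma p_eq: "\<alpha> \<in> over c \<Longrightarrow> c \<in> A \<Longrightarrow> p \<alpha> = p_loc c (coord c \<alpha>)"
  unfolding p_def over_def using p_loc_invariant[of \<alpha> c "chart_at (fst \<alpha>)"] chart_at[of "fst \<alpha>"] by simp

lemma openin_p_vimage:
  assumes U: "open U" shows "openin cot_topology {\<alpha> \<in> cotangent. p \<alpha> \<in> U}"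
proof (rule openin_cot_locally)
  fix \<alpha> assume \<alpha>: "\<alpha> \<in> {\<alpha> \<in> cotangent. p \<alpha> \<in> U}"
  obtain c where c: "c \<in> A" "fst \<alpha> \<in> cdom c" using ex_chart by blast
  then have \<alpha>c: "\<alpha> \<in> over c" using \<alpha> by (simp add: over_def)
  let ?V = "(crange c \<times> UNIV) \<inter> p_loc c -` U"
  have "openin cot_topology {\<beta> \<in> over c. coord c \<beta> \<in> ?V}"
    by (intro openin_coord_vimage[OF c(1)] continuous_open_preimage[OF continuous_on_p_loc] open_crange_Times c U)
  moreover have "\<alpha> \<in> {\<beta> \<in> over c. coord c \<beta> \<in> ?V}"
    using \<alpha> \<alpha>c p_eq[OF \<alpha>c c(1)] coord_in[OF \<alpha>c] by simp
  moreover have "{\<beta> \<in> over c. coord c \<beta> \<in> ?V} \<subseteq> {\<alpha> \<in> cotangent. p \<alpha> \<in> U}"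
    using p_eq[OF _ c(1)] unfolding over_def by auto
  ultimately show "\<exists>W. openin cot_topology W \<and> \<alpha> \<in> W \<and> W \<subseteq> {\<alpha> \<in> cotangent. p \<alpha> \<in> U}"
    by (intro exI[of _ "{\<beta> \<in> over c. coord c \<beta> \<in> ?V}"] conjI)
qed blast

lemma dot_cotangent_iff:
  assumes \<alpha>: "\<alpha> \<in> over c" and c: "c \<in> A"
  shows "\<alpha> \<in> dot_cotangent \<longleftrightarrow> snd (coord c \<alpha>) \<noteq> 0"
proof -
  have \<alpha>': "\<alpha> \<in> cotangent" "fst \<alpha> \<in> cdom c" using \<alpha> by (auto simp: over_def)
  have "snd \<alpha> = (\<lambda>_. 0)" if z: "snd \<alpha> c = 0"
  proof
    fix c' show "snd \<alpha> c' = 0"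
    proof (cases "c' \<in> A \<and> fst \<alpha> \<in> cdom c'")
      case True
      then show ?thesis using cotangentD[OF \<alpha>'(1) c _ \<alpha>'(2), of c'] z by simp
    next
      case False
      then show ?thesis using cotangent_outside[OF \<alpha>'(1)] by blast
    qed
  qed
  then show ?thesis using \<alpha>' by (auto simp: dot_cotangent_def coord_def)
qed

lemma p_pos_iff:
  assumes \<alpha>: "\<alpha> \<in> cotangent" shows "p \<alpha> > 0 \<longleftrightarrow> \<alpha> \<in> dot_cotangent"
proof -
  obtain c where c: "c \<in> A" "fst \<alpha> \<in> cdom c" using ex_chart by blast
  then have \<alpha>c: "\<alpha> \<in> over c" using \<alpha> by (simp add: over_def)
  have "fst (coord c \<alpha>) \<in> crange c" using c by (simp add: coord_def)
  then show ?thesis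
    using p_loc_pos[OF c(1), of "coord c \<alpha>"] p_loc_zero[of "coord c \<alpha>" c] p_eq[OF \<alpha>c c(1)] dot_cotangent_iff[OF \<alpha>c c(1)]
    by auto
qed

lemma openin_dot_cotangent: "openin cot_topology dot_cotangent"
proof -
  have "{\<alpha> \<in> cotangent. p \<alpha> \<in> {0<..}} = dot_cotangent"
    using p_pos_iff unfolding dot_cotangent_def by auto
  then show ?thesis using openin_p_vimage[of "{0<..}"] by simp
qed

end

section \<open>Symmetry of second derivatives\<close>

text \<open>
  Both mixed derivatives are limits of the second difference of \<open>f\<close> over a small parallelogram.
\<close>

lemma C2_symmetric:
  fixes f :: "'b::euclidean_space \<Rightarrow> real"
  assumes S: "open S" "x \<in> S" and f: "\<And>y. y \<in> S \<Longrightarrow> (f has_derivative f' y) (at y)"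
    and u: "\<And>y. y \<in> S \<Longrightarrow> ((\<lambda>y. f' y u) has_derivative fu y) (at y)" "continuous_on S (\<lambda>y. fu y v)"
    and v: "\<And>y. y \<in> S \<Longrightarrow> ((\<lambda>y. f' y v) has_derivative fv y) (at y)" "continuous_on S (\<lambda>y. fv y u)"
  shows "fu x v = fv x u"
proof -
  \<comment> \<open>Two applications of the mean value theorem express the second difference by either mixed derivative.\<close>
  have line: "((\<lambda>s. F (a + s *\<^sub>R w)) has_field_derivative F' (a + s *\<^sub>R w) w) (at s)"
    if "(F has_derivative F' (a + s *\<^sub>R w)) (at (a + s *\<^sub>R w))" for F :: "'b \<Rightarrow> real" and F' a s w
  proof -
    have "((\<lambda>s. a + s *\<^sub>R w) has_derivative (\<lambda>h. h *\<^sub>R w)) (at s)"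
      by (auto intro!: derivative_eq_intros)
    from has_derivative_compose[OF this that]
    have "((\<lambda>s. F (a + s *\<^sub>R w)) has_derivative (\<lambda>h. F' (a + s *\<^sub>R w) (h *\<^sub>R w))) (at s)" .
    moreover have "F' (a + s *\<^sub>R w) (h *\<^sub>R w) = F' (a + s *\<^sub>R w) w * h" for h
      using linear_cmul[OF has_derivative_linear[OF that]] by simp
    ultimately show ?thesis by (simp add: has_field_derivative_def)
  qed
  define \<Delta> where "\<Delta> h = f (x + h *\<^sub>R u + h *\<^sub>R v) - f (x + h *\<^sub>R u) - f (x + h *\<^sub>R v) + f x" for h
  have step: "\<exists>\<xi> \<eta>. 0 < \<xi> \<and> \<xi> < h \<and> 0 < \<eta> \<and> \<eta> < h \<and> \<Delta> h = h * h * gu (x + \<xi> *\<^sub>R a + \<eta> *\<^sub>R b) b"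
    if h: "h > 0" and sub: "\<And>s t. 0 \<le> s \<Longrightarrow> s \<le> h \<Longrightarrow> 0 \<le> t \<Longrightarrow> t \<le> h \<Longrightarrow> x + s *\<^sub>R a + t *\<^sub>R b \<in> S"
      and ab: "a = u \<and> b = v \<or> a = v \<and> b = u"
      and gu: "\<And>y. y \<in> S \<Longrightarrow> ((\<lambda>y. f' y a) has_derivative gu y) (at y)" for h a b gu
  proof -
    have sub0: "x + s *\<^sub>R a \<in> S" if "0 \<le> s" "s \<le> h" for s using sub[of s 0] that h by simp
    have "((\<lambda>s. f ((x + h *\<^sub>R b) + s *\<^sub>R a) - f (x + s *\<^sub>R a)) has_field_derivative
        (f' ((x + h *\<^sub>R b) + s *\<^sub>R a) a - f' (x + s *\<^sub>R a) a)) (at s)" if "0 \<le> s" "s \<le> h" for s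
      using sub[of s h] sub0[of s] that h by (intro DERIV_diff line f) (auto simp: algebra_simps)
    from MVT2[OF h this] obtain \<xi> where \<xi>: "0 < \<xi>" "\<xi> < h"
      "f ((x + h *\<^sub>R b) + h *\<^sub>R a) - f (x + h *\<^sub>R a) - (f ((x + h *\<^sub>R b) + 0 *\<^sub>R a) - f (x + 0 *\<^sub>R a))
        = (h - 0) * (f' ((x + h *\<^sub>R b) + \<xi> *\<^sub>R a) a - f' (x + \<xi> *\<^sub>R a) a)" by blast
    have "((\<lambda>t. f' ((x + \<xi> *\<^sub>R a) + t *\<^sub>R b) a) has_field_derivative gu ((x + \<xi> *\<^sub>R a) + t *\<^sub>R b) b) (at t)"
      if "0 \<le> t" "t \<le> h" for t
      using sub[of \<xi> t] that \<xi> by (intro line gu) auto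
    from MVT2[OF h this] obtain \<eta> where \<eta>: "0 < \<eta>" "\<eta> < h"
      "f' ((x + \<xi> *\<^sub>R a) + h *\<^sub>R b) a - f' ((x + \<xi> *\<^sub>R a) + 0 *\<^sub>R b) a = (h - 0) * gu ((x + \<xi> *\<^sub>R a) + \<eta> *\<^sub>R b) b" by blast
    have comm: "(x + h *\<^sub>R b) + \<xi> *\<^sub>R a = (x + \<xi> *\<^sub>R a) + h *\<^sub>R b" by simp
    have "f ((x + h *\<^sub>R b) + h *\<^sub>R a) - f (x + h *\<^sub>R a) - (f (x + h *\<^sub>R b) - f x) = h * (h * gu (x + \<xi> *\<^sub>R a + \<eta> *\<^sub>R b) b)"
      using \<xi>(3) \<eta>(3) unfolding comm by simp
    moreover have "f ((x + h *\<^sub>R b) + h *\<^sub>R a) - f (x + h *\<^sub>R a) - (f (x + h *\<^sub>R b) - f x) = \<Delta> h"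
      using ab by (auto simp: \<Delta>_def algebra_simps)
    ultimately show ?thesis using \<xi> \<eta> by (intro exI[of _ \<xi>] exI[of _ \<eta>]) (simp add: mult.assoc)
  qed
  have "\<bar>fu x v - fv x u\<bar> \<le> e" if e: "e > 0" for e
  proof -
    have "isCont (\<lambda>y. fu y v) x" "isCont (\<lambda>y. fv y u) x"
      using u(2) v(2) S by (auto simp: continuous_on_eq_continuous_at)
    then obtain d1 d2 where d: "d1 > 0" "d2 > 0" "\<And>y. dist y x < d1 \<Longrightarrow> dist (fu y v) (fu x v) < e / 2"
      "\<And>y. dist y x < d2 \<Longrightarrow> dist (fv y u) (fv x u) < e / 2"
      using e by (metis (no_types, lifting) continuous_at_eps_delta half_gt_zero)
    obtain d3 where d3: "d3 > 0" "ball x d3 \<subseteq> S" using S openE by blast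
    define d where "d = min (min d1 d2) d3"
    define h where "h = d / (2 * (norm u + norm v + 1))"
    have np: "norm u + norm v + 1 > 0" by (simp add: add_nonneg_pos)
    have h: "h > 0" using d d3 np by (simp add: h_def d_def)
    have near: "dist (x + s *\<^sub>R a + t *\<^sub>R b) x < d"
      if "0 \<le> s" "s \<le> h" "0 \<le> t" "t \<le> h" "a = u \<and> b = v \<or> a = v \<and> b = u" for s t a b
    proof -
      have "dist (x + s *\<^sub>R a + t *\<^sub>R b) x = norm (s *\<^sub>R a + t *\<^sub>R b)" by (simp add: dist_norm add.assoc)
      also have "\<dots> \<le> s * norm a + t * norm b" using that by (intro norm_triangle_le) auto
      also have "\<dots> \<le> h * norm a + h * norm b" using that by (intro add_mono mult_right_mono) auto
      also have "\<dots> = h * (norm u + norm v)" using that by (auto simp: algebra_simps)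
      also have "\<dots> < h * (2 * (norm u + norm v + 1))" using h by (intro mult_strict_left_mono) (auto simp: add_nonneg_pos)
      also have "\<dots> = d" using np unfolding h_def by (metis less_numeral_extra(3) mult_eq_0_iff nonzero_eq_divide_eq zero_neq_numeral)
      finally show ?thesis .
    qed
    have sub: "x + s *\<^sub>R a + t *\<^sub>R b \<in> S"
      if "0 \<le> s" "s \<le> h" "0 \<le> t" "t \<le> h" "a = u \<and> b = v \<or> a = v \<and> b = u" for s t a b
      using near[OF that] d3 by (auto simp: d_def dist_commute mem_ball subset_iff)
    obtain \<xi> \<eta> where 1: "0 < \<xi>" "\<xi> < h" "0 < \<eta>" "\<eta> < h" "\<Delta> h = h * h * fu (x + \<xi> *\<^sub>R u + \<eta> *\<^sub>R v) v"
      using step[of h u v fu] h sub u(1) by auto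
    obtain \<xi>' \<eta>' where 2: "0 < \<xi>'" "\<xi>' < h" "0 < \<eta>'" "\<eta>' < h" "\<Delta> h = h * h * fv (x + \<xi>' *\<^sub>R v + \<eta>' *\<^sub>R u) u"
      using step[of h v u fv] h sub v(1) by auto
    have "fu (x + \<xi> *\<^sub>R u + \<eta> *\<^sub>R v) v = fv (x + \<xi>' *\<^sub>R v + \<eta>' *\<^sub>R u) u" using 1(5) 2(5) h by simp
    moreover have "dist (fu (x + \<xi> *\<^sub>R u + \<eta> *\<^sub>R v) v) (fu x v) < e / 2"
      using near[of \<xi> \<eta> u v] 1 by (intro d(3)) (auto simp: d_def)
    moreover have "dist (fv (x + \<xi>' *\<^sub>R v + \<eta>' *\<^sub>R u) u) (fv x u) < e / 2"
      using near[of \<xi>' \<eta>' v u] 2 by (intro d(4)) (auto simp: d_def)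
    ultimately show ?thesis unfolding dist_real_def by linarith
  qed
  then have "\<bar>fu x v - fv x u\<bar> \<le> 0" using field_le_epsilon[of "\<bar>fu x v - fv x u\<bar>" 0] by simp
  then show ?thesis by simp
qed

section \<open>Invariance of the Hamilton vector field\<close>

text \<open>
  The form for which \<open>H_p\<close> is the Hamilton vector field of \<open>p\<close>, that is, \<open>dp = symplectic_form H_p\<close>.
\<close>

definition symplectic_form :: "(real^'n::finite) \<times> (real^'n) \<Rightarrow> (real^'n) \<times> (real^'n) \<Rightarrow> real" where
  "symplectic_form w w' = fst w \<bullet> snd w' - snd w \<bullet> fst w'"

lemma symplectic_form_nondegenerate:
  assumes "\<And>w'. symplectic_form w w' = symplectic_form v w'" shows "w = v"
proof -
  have eq: "fst w \<bullet> b = fst v \<bullet> b" "snd w \<bullet> b = snd v \<bullet> b" for b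
    using assms[of "(0, b)"] assms[of "(b, 0)"] by (auto simp: symplectic_form_def)
  have "(fst w - fst v) \<bullet> (fst w - fst v) = 0" "(snd w - snd v) \<bullet> (snd w - snd v) = 0"
    by (subst inner_diff_left, simp add: eq)+
  then show ?thesis by (simp add: prod_eq_iff)
qed

context compact_riemannian
begin

lemma p_loc_derivative_eq_symplectic_form:
  assumes c: "c \<in> A" and z: "fst z \<in> crange c" "snd z \<noteq> 0"
  shows "(p_loc c has_derivative symplectic_form (H_p c z)) (at z)"
proof -
  have d: "p_loc c differentiable (at z)"
    using p_loc_has_derivative[OF assms] by (auto simp: differentiable_def)
  let ?D = "frechet_derivative (p_loc c) (at z)"
  have l: "linear ?D" using d by (rule linear_frechet_derivative)
  have "?D (a, b) = symplectic_form (H_p c z) (a, b)" for a b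
  proof -
    have "(a, b) = (\<Sum>j\<in>UNIV. a $ j *\<^sub>R (axis j 1, 0) + b $ j *\<^sub>R (0, axis j 1))"
      using basis_expansion[of a] basis_expansion[of b]
      by (simp add: prod_eq_iff fst_sum snd_sum scalar_mult_eq_scaleR)
    then have "?D (a, b) = ?D (\<Sum>j\<in>UNIV. a $ j *\<^sub>R (axis j 1, 0) + b $ j *\<^sub>R (0, axis j 1))" by (rule arg_cong)
    also have "\<dots> = (\<Sum>j\<in>UNIV. ?D (a $ j *\<^sub>R (axis j 1, 0) + b $ j *\<^sub>R (0, axis j 1)))"
      by (rule linear_sum[OF l])
    also have "\<dots> = (\<Sum>j\<in>UNIV. a $ j * ?D (axis j 1, 0) + b $ j * ?D (0, axis j 1))"
      by (simp only: linear_add[OF l] linear_cmul[OF l] real_scaleR_def)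
    also have "\<dots> = (\<Sum>j\<in>UNIV. ?D (0, axis j 1) * b $ j) - (\<Sum>j\<in>UNIV. - ?D (axis j 1, 0) * a $ j)"
      unfolding sum_subtractf[symmetric] by (intro sum.cong) (auto simp: mult.commute)
    also have "\<dots> = symplectic_form (H_p c z) (a, b)"
      by (simp add: symplectic_form_def H_p_def inner_vec_def)
    finally show ?thesis .
  qed
  then have "?D = symplectic_form (H_p c z)" by (intro ext) (metis prod.collapse)
  then show ?thesis using d by (metis frechet_derivative_works)
qed

lemma transition_second_derivative_symmetric:
  assumes c: "c \<in> A" "c' \<in> A" and q: "q \<in> cdom c" "q \<in> cdom c'"
  shows "frechet_derivative (\<lambda>y. frechet_derivative (transition c c') (at y) u) (at (cmap c q)) v
       = frechet_derivative (\<lambda>y. frechet_derivative (transition c c') (at y) v) (at (cmap c q)) u"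
proof (rule vec_eq_iff[THEN iffD2, rule_format])
  fix k
  let ?O = "cmap c ` (cdom c \<inter> cdom c')" and ?X = "transition c c'"
  let ?D = "\<lambda>u y. frechet_derivative ?X (at y) u"
  have O: "open ?O" "cmap c q \<in> ?O" using c q open_chart_image chartD by auto
  have C: "Ck_on 2 ?O ?X" using smooth_on_transition[OF c] unfolding smooth_on_def by blast
  have C1: "(?X has_derivative frechet_derivative ?X (at y)) (at y)" if "y \<in> ?O" for y
    using C that unfolding numeral_2_eq_2 Ck_on.simps frechet_derivative_works by blast
  have C2: "(?D u has_derivative frechet_derivative (?D u) (at y)) (at y)"
    "continuous_on ?O (\<lambda>y. frechet_derivative (?D u) (at y) v)" if "y \<in> ?O" for u v y
    using C that unfolding numeral_2_eq_2 Ck_on.simps frechet_derivative_works by blast+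
  have nth: "bounded_linear (\<lambda>w::real^'n. w $ k)" by (rule bounded_linear_vec_nth)
  show "frechet_derivative (?D u) (at (cmap c q)) v $ k = frechet_derivative (?D v) (at (cmap c q)) u $ k"
  proof (rule C2_symmetric[OF O, where f = "\<lambda>y. ?X y $ k" and f' = "\<lambda>y u. ?D u y $ k"
        and fu = "\<lambda>y w. frechet_derivative (?D u) (at y) w $ k" and fv = "\<lambda>y w. frechet_derivative (?D v) (at y) w $ k"])
    show "continuous_on ?O (\<lambda>y. frechet_derivative (?D u) (at y) v $ k)"
      by (rule bounded_linear.continuous_on[OF nth C2(2)[OF O(2)]])
    show "continuous_on ?O (\<lambda>y. frechet_derivative (?D v) (at y) u $ k)"
      by (rule bounded_linear.continuous_on[OF nth C2(2)[OF O(2)]])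
  qed (rule bounded_linear.has_derivative[OF nth C1] bounded_linear.has_derivative[OF nth C2(1)]; assumption)+
qed

text \<open>
  The differential of \<open>(x, \<xi>) \<mapsto> (y(x), (\<partial>x/\<partial>y)\<^sup>T \<xi>)\<close> differs from a product of inverse transposed maps only
  by a term with the second derivatives of \<open>x(y)\<close>, which cancels because these are symmetric.
\<close>

lemma ctrans_symplectic:
  assumes c: "c \<in> A" "c' \<in> A" and q: "q \<in> cdom c" "q \<in> cdom c'" and z: "fst z = cmap c q"
    and D: "(ctrans c c' has_derivative D) (at z)"
  shows "symplectic_form (D w) (D w') = symplectic_form w w'"
proof -
  let ?X = "transition c' c" and ?y = "cmap c' q" and ?S = "tmat c c' q" and ?T = "tmat c' c q"
  let ?O = "cmap c ` (cdom c \<inter> cdom c')" and ?O' = "cmap c' ` (cdom c' \<inter> cdom c)"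
  define E where "E e y = frechet_derivative ?X (at y) e" for e y
  define F where "F e v = frechet_derivative (E e) (at ?y) v" for e v
  have O: "open ?O" "fst z \<in> ?O" using c q z open_chart_image chartD by auto
  have O': "?y \<in> ?O'" using q by blast
  have C: "Ck_on 2 ?O' ?X" using smooth_on_transition[OF c(2,1)] unfolding smooth_on_def by blast
  have EF: "(E e has_derivative F e) (at ?y)" for e
    using C O' unfolding E_def F_def numeral_2_eq_2 Ck_on.simps frechet_derivative_works by blast
  have lF: "linear (F e)" for e using EF has_derivative_linear by blast
  have sym: "F e e' = F e' e" for e e'
    using transition_second_derivative_symmetric[OF c(2,1) q(2,1), of e e'] by (simp add: F_def E_def[abs_def])
  have ET: "E e (cmap c' r) = tmat c' c r *v e" if "r \<in> cdom c" "r \<in> cdom c'" for e r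
    using frechet_derivative_at[OF transition_has_derivative[OF c(2,1) that(2,1)]] by (simp add: E_def fun_eq_iff)
  have \<tau>: "((\<lambda>z. transition c c' (fst z)) has_derivative (\<lambda>h. ?S *v fst h)) (at z)"
    by (rule has_derivative_compose[OF bounded_linear_imp_has_derivative[OF bounded_linear_fst]])
      (use transition_has_derivative[OF c q] z in simp)
  have fstD: "fst (D h) = ?S *v fst h" for h
  proof -
    have "((\<lambda>z. fst (ctrans c c' z)) has_derivative (\<lambda>h. fst (D h))) (at z)"
      by (rule has_derivative_fst[OF D])
    moreover have "(\<lambda>z. fst (ctrans c c' z)) = (\<lambda>z. transition c c' (fst z))" by (simp add: ctrans_def)
    ultimately have "((\<lambda>z. transition c c' (fst z)) has_derivative (\<lambda>h. fst (D h))) (at z)" by simp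
    from fun_cong[OF has_derivative_unique[OF this \<tau>], of h] show ?thesis .
  qed
  have sndD: "snd (D h) $ i = snd h \<bullet> (?T *v axis i 1) + snd z \<bullet> F (axis i 1) (?S *v fst h)" for h i
  proof -
    have "((\<lambda>z. E (axis i 1) (transition c c' (fst z))) has_derivative (\<lambda>h. F (axis i 1) (?S *v fst h))) (at z)"
      by (rule has_derivative_compose[OF \<tau>]) (use EF z c q in simp)
    from has_derivative_inner[OF bounded_linear_imp_has_derivative[OF bounded_linear_snd] this]
    have 1: "((\<lambda>z. snd z \<bullet> E (axis i 1) (transition c c' (fst z))) has_derivative
      (\<lambda>h. snd z \<bullet> F (axis i 1) (?S *v fst h) + snd h \<bullet> E (axis i 1) (transition c c' (fst z)))) (at z)" .
    have 2: "snd w \<bullet> E (axis i 1) (transition c c' (fst w)) = snd (ctrans c c' w) $ i" if w: "w \<in> ?O \<times> UNIV" for w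
    proof -
      obtain r where r: "r \<in> cdom c" "r \<in> cdom c'" "fst w = cmap c r" using w by (force simp: mem_Times_iff)
      have "snd (ctrans c c' w) $ i = (transpose (tmat c' c r) *v snd w) \<bullet> axis i 1"
        using r c by (simp add: ctrans_def inner_axis)
      also have "\<dots> = snd w \<bullet> (tmat c' c r *v axis i 1)"
        by (simp add: transpose_matrix_vector dot_lmul_matrix)
      finally show ?thesis using r c ET[OF r(1,2)] by simp
    qed
    have zO: "z \<in> ?O \<times> UNIV" using O(2) by (simp only: mem_Times_iff) simp
    have 3: "((\<lambda>z. snd (ctrans c c' z) $ i) has_derivative
      (\<lambda>h. snd z \<bullet> F (axis i 1) (?S *v fst h) + snd h \<bullet> E (axis i 1) (transition c c' (fst z)))) (at z)"
      by (rule has_derivative_transform_within_open[OF 1 open_Times[OF O(1) open_UNIV] zO 2])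
    have 4: "((\<lambda>z. snd (ctrans c c' z) $ i) has_derivative (\<lambda>h. snd (D h) $ i)) (at z)"
      by (rule bounded_linear.has_derivative[OF bounded_linear_vec_nth has_derivative_snd[OF D]])
    from fun_cong[OF has_derivative_unique[OF 4 3], of h] show ?thesis using ET[OF q] z c q by simp
  qed
  have TS: "?T *v (?S *v a) = a" for a
    using tmat_inverse[OF c q] by (simp add: matrix_vector_mul_assoc)
  define B where "B a a' = (\<Sum>i\<in>UNIV. \<Sum>j\<in>UNIV. a $ i * a' $ j * (snd z \<bullet> F (axis i 1) (axis j 1)))" for a a' :: "real^'n"
  have Bsym: "B a a' = B a' a" for a a'
    unfolding B_def by (subst sum.swap) (simp add: sym mult.commute mult.left_commute)
  have Fexp: "F e v = (\<Sum>j\<in>UNIV. v $ j *\<^sub>R F e (axis j 1))" for e v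
  proof -
    have "v = (\<Sum>j\<in>UNIV. v $ j *\<^sub>R axis j 1)" using basis_expansion[of v] by (simp add: scalar_mult_eq_scaleR)
    then have "F e v = F e (\<Sum>j\<in>UNIV. v $ j *\<^sub>R axis j 1)" by (rule arg_cong)
    also have "\<dots> = (\<Sum>j\<in>UNIV. v $ j *\<^sub>R F e (axis j 1))" by (simp add: linear_sum[OF lF] linear_cmul[OF lF])
    finally show ?thesis .
  qed
  have key: "(?S *v a) \<bullet> snd (D h) = a \<bullet> snd h + B (?S *v a) (?S *v fst h)" for a h
  proof -
    let ?u = "?S *v a"
    have "?u \<bullet> snd (D h) = (\<Sum>i\<in>UNIV. ?u $ i * (snd h \<bullet> (?T *v axis i 1))) + (\<Sum>i\<in>UNIV. ?u $ i * (snd z \<bullet> F (axis i 1) (?S *v fst h)))"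
      by (simp add: inner_vec_def[of ?u] sndD distrib_left sum.distrib)
    also have "(\<Sum>i\<in>UNIV. ?u $ i * (snd h \<bullet> (?T *v axis i 1))) = snd h \<bullet> (?T *v ?u)"
    proof -
      have "?T *v ?u = ?T *v (\<Sum>i\<in>UNIV. ?u $ i *\<^sub>R axis i 1)" using basis_expansion[of ?u] by (simp add: scalar_mult_eq_scaleR)
      also have "\<dots> = (\<Sum>i\<in>UNIV. ?u $ i *\<^sub>R (?T *v axis i 1))"
        by (simp add: linear_sum[OF matrix_vector_mul_linear] matrix_vector_mult_scaleR)
      finally show ?thesis by (simp add: inner_sum_right)
    qed
    also have "\<dots> = a \<bullet> snd h" by (simp add: TS inner_commute)
    also have "(\<Sum>i\<in>UNIV. ?u $ i * (snd z \<bullet> F (axis i 1) (?S *v fst h))) = B ?u (?S *v fst h)"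
      unfolding B_def by (subst Fexp) (simp add: inner_sum_right sum_distrib_left mult.assoc)
    finally show ?thesis .
  qed
  show ?thesis
    unfolding symplectic_form_def fstD key inner_commute[of "snd (D w)"] by (simp add: Bsym inner_commute)
qed

text \<open>
  Coordinate changes preserve \<open>p\<close> and the symplectic form, and the nondegenerate form determines the
  vector field.
\<close>

lemma H_p_transform:
  assumes c: "c \<in> A" "c' \<in> A" and \<alpha>: "\<alpha> \<in> over c" "\<alpha> \<in> over c'" "\<alpha> \<in> dot_cotangent"
    and D: "(ctrans c c' has_derivative D) (at (coord c \<alpha>))"
  shows "D (H_p c (coord c \<alpha>)) = H_p c' (coord c' \<alpha>)"
proof (rule symplectic_form_nondegenerate)
  fix w'
  let ?z = "coord c \<alpha>" and ?z' = "coord c' \<alpha>"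
  have q: "fst \<alpha> \<in> cdom c" "fst \<alpha> \<in> cdom c'" using \<alpha> by (auto simp: over_def)
  have z: "fst ?z = cmap c (fst \<alpha>)" and z': "fst ?z' = cmap c' (fst \<alpha>)" by (auto simp: coord_def)
  have tr: "ctrans c c' ?z = ?z'" by (rule ctrans_coord[OF c \<alpha>(1,2)])
  have nz: "snd ?z \<noteq> 0" "snd ?z' \<noteq> 0" using dot_cotangent_iff[OF \<alpha>(1) c(1)] dot_cotangent_iff[OF \<alpha>(2) c(2)] \<alpha>(3) by simp_all
  have 1: "fst ?z \<in> crange c" "fst ?z' \<in> crange c'" using q by (auto simp: z z')
  \<comment> \<open>The inverse change of coordinates shows that \<open>D\<close> is onto.\<close>
  have "ctrans c' c differentiable (at ?z')"
    by (rule ctrans_differentiable[OF c(2,1)]) (use q z' in simp)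
  then obtain D' where D': "(ctrans c' c has_derivative D') (at ?z')" unfolding differentiable_def by blast
  let ?O = "cmap c' ` (cdom c' \<inter> cdom c)"
  have O: "open ?O" "fst ?z' \<in> ?O" using c q z' open_chart_image chartD by auto
  have d1: "((\<lambda>w. ctrans c c' (ctrans c' c w)) has_derivative (\<lambda>h. D (D' h))) (at ?z')"
    by (rule has_derivative_compose[OF D']) (use D ctrans_coord[OF c(2,1) \<alpha>(2,1)] in simp)
  have d2: "ctrans c c' (ctrans c' c w) = w" if w: "w \<in> ?O \<times> UNIV" for w
  proof -
    have "fst w \<in> ?O" using w by (simp add: mem_Times_iff)
    then obtain r where r: "r \<in> cdom c'" "r \<in> cdom c" "fst w = cmap c' r" by blast
    have 1: "of_coord c' w \<in> over c'" by (rule of_coord_in[OF c(2)]) (simp add: r)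
    then have 2: "of_coord c' w \<in> over c" using r c by (simp add: over_def)
    have "ctrans c' c w = coord c (of_coord c' w)" using coord_of_coord_ctrans[OF c(2,1)] r c by simp
    then show ?thesis using ctrans_coord[OF c 2 1] r c by simp
  qed
  have "?z' \<in> ?O \<times> UNIV" using O(2) by (simp only: mem_Times_iff) simp
  from has_derivative_transform_within_open[OF d1 open_Times[OF O(1) open_UNIV] this d2]
  have "((\<lambda>w. w) has_derivative (\<lambda>h. D (D' h))) (at ?z')" .
  from fun_cong[OF has_derivative_unique[OF this has_derivative_ident], of w'] have DD: "D (D' w') = w'" .
  have e1: "((\<lambda>w. p_loc c' (ctrans c c' w)) has_derivative (\<lambda>h. symplectic_form (H_p c' ?z') (D h))) (at ?z)"
    by (rule has_derivative_compose[OF D]) (use p_loc_derivative_eq_symplectic_form[OF c(2) 1(2) nz(2)] tr in simp)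
  have e2: "p_loc c' (ctrans c c' w) = p_loc c w" if w: "w \<in> cmap c ` (cdom c \<inter> cdom c') \<times> UNIV" for w
  proof -
    have "fst w \<in> cmap c ` (cdom c \<inter> cdom c')" using w by (simp add: mem_Times_iff)
    then obtain r where r: "r \<in> cdom c" "r \<in> cdom c'" "fst w = cmap c r" by blast
    have 1: "of_coord c w \<in> over c" by (rule of_coord_in[OF c(1)]) (simp add: r)
    then have 2: "of_coord c w \<in> over c'" using r c by (simp add: over_def)
    have "ctrans c c' w = coord c' (of_coord c w)" using coord_of_coord_ctrans[OF c] r c by simp
    then show ?thesis using p_eq[OF 1 c(1)] p_eq[OF 2 c(2)] r c by simp
  qed
  have e3: "?z \<in> cmap c ` (cdom c \<inter> cdom c') \<times> UNIV" unfolding mem_Times_iff z using q by blast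
  have e4: "open (cmap c ` (cdom c \<inter> cdom c') \<times> (UNIV :: (real^'n) set))"
    by (intro open_Times open_chart_image chartD c) simp
  from has_derivative_transform_within_open[OF e1 e4 e3 e2]
  have "(p_loc c has_derivative (\<lambda>h. symplectic_form (H_p c' ?z') (D h))) (at ?z)" .
  from has_derivative_unique[OF this p_loc_derivative_eq_symplectic_form[OF c(1) 1(1) nz(1)]]
  have "symplectic_form (H_p c' ?z') (D (D' w')) = symplectic_form (H_p c ?z) (D' w')" by (rule fun_cong)
  also have "\<dots> = symplectic_form (D (H_p c ?z)) (D (D' w'))"
    by (rule ctrans_symplectic[OF c q z D, symmetric])
  finally show "symplectic_form (D (H_p c ?z)) w' = symplectic_form (H_p c' ?z') w'" by (simp add: DD)
qed

end

section \<open>The geodesic flow\<close>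

context compact_riemannian
begin

lemma fst_coord: "fst (coord c \<alpha>) = cmap c (fst \<alpha>)"
  by (simp add: coord_def)

lemma dot_in_cotangent: "\<alpha> \<in> dot_cotangent \<Longrightarrow> \<alpha> \<in> cotangent"
  unfolding dot_cotangent_def by blast

lemma overI: "\<alpha> \<in> cotangent \<Longrightarrow> fst \<alpha> \<in> cdom c \<Longrightarrow> \<alpha> \<in> over c"
  unfolding over_def by blast

lemma over_fst: "\<alpha> \<in> over c \<Longrightarrow> fst \<alpha> \<in> cdom c"
  unfolding over_def by blast

lemma over_cotangent: "\<alpha> \<in> over c \<Longrightarrow> \<alpha> \<in> cotangent"
  unfolding over_def by blast

lemma in_if_coord_in_image:
  assumes "c \<in> A" "\<alpha> \<in> over c" "coord c \<alpha> \<in> coord c ` (W \<inter> over c)" shows "\<alpha> \<in> W"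
proof -
  obtain \<beta> where "\<beta> \<in> W" "\<beta> \<in> over c" "coord c \<alpha> = coord c \<beta>" using assms(3) by blast
  with inj_onD[OF inj_on_coord[OF assms(1)]] assms(2) show ?thesis by metis
qed

text \<open>Integral curves on an open set of times, characterised by local conditions.\<close>

definition icurve :: "real set \<Rightarrow> (real \<Rightarrow> 'a \<times> (('a, 'n) chart \<Rightarrow> real^'n)) \<Rightarrow> bool" where
  "icurve I \<gamma> \<longleftrightarrow> (\<forall>t\<in>I. \<gamma> t \<in> dot_cotangent) \<and> continuous_on I (\<lambda>t. fst (\<gamma> t)) \<and>
     (\<forall>c\<in>A. \<forall>t\<in>I. fst (\<gamma> t) \<in> cdom c \<longrightarrow>
        ((\<lambda>s. coord c (\<gamma> s)) has_vector_derivative H_p c (coord c (\<gamma> t))) (at t))"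

lemma integral_curve_iff: "integral_curve \<gamma> \<longleftrightarrow> icurve UNIV \<gamma>"
  unfolding integral_curve_def icurve_def comp_def by simp

lemma icurveD:
  assumes "icurve I \<gamma>" "t \<in> I"
  shows "\<gamma> t \<in> dot_cotangent" "c \<in> A \<Longrightarrow> fst (\<gamma> t) \<in> cdom c \<Longrightarrow>
    ((\<lambda>s. coord c (\<gamma> s)) has_vector_derivative H_p c (coord c (\<gamma> t))) (at t)"
  using assms unfolding icurve_def by blast+

lemma icurve_continuous: "icurve I \<gamma> \<Longrightarrow> continuous_on I (\<lambda>t. fst (\<gamma> t))"
  unfolding icurve_def by blast

lemma icurve_subset:
  assumes "icurve I \<gamma>" "J \<subseteq> I" shows "icurve J \<gamma>"
  unfolding icurve_def
proof (intro conjI ballI impI)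
  show "continuous_on J (\<lambda>t. fst (\<gamma> t))" by (rule continuous_on_subset[OF icurve_continuous[OF assms(1)] assms(2)])
qed (use icurveD[OF assms(1)] assms(2) in blast)+

text \<open>By the invariance of the Hamilton vector field one chart suffices.\<close>

lemma icurve_chartI:
  assumes c: "c \<in> A" and I: "open I" and \<gamma>: "\<And>t. t \<in> I \<Longrightarrow> \<gamma> t \<in> over c" "\<And>t. t \<in> I \<Longrightarrow> \<gamma> t \<in> dot_cotangent"
    and der: "\<And>t. t \<in> I \<Longrightarrow> ((\<lambda>s. coord c (\<gamma> s)) has_vector_derivative H_p c (coord c (\<gamma> t))) (at t)"
  shows "icurve I \<gamma>"
proof -
  have cc: "continuous_on I (\<lambda>t. coord c (\<gamma> t))"
    by (intro continuous_at_imp_continuous_on ballI has_vector_derivative_continuous[OF der])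
  have "continuous_on I (\<lambda>t. cinv c (fst (coord c (\<gamma> t))))"
    by (rule continuous_on_compose2[OF continuous_on_cinv[OF c] continuous_on_fst[OF cc]])
      (simp add: image_subset_iff fst_coord cmap_in over_fst \<gamma>(1))
  moreover have "cinv c (fst (coord c (\<gamma> t))) = fst (\<gamma> t)" if "t \<in> I" for t
    using c over_fst[OF \<gamma>(1)[OF that]] by (simp add: fst_coord)
  ultimately have cont: "continuous_on I (\<lambda>t. fst (\<gamma> t))"
    by (simp cong: continuous_on_cong)
  have "((\<lambda>s. coord c' (\<gamma> s)) has_vector_derivative H_p c' (coord c' (\<gamma> t))) (at t)"
    if c': "c' \<in> A" and t: "t \<in> I" and q: "fst (\<gamma> t) \<in> cdom c'" for c' t
  proof -
    have "fst (coord c (\<gamma> t)) \<in> cmap c ` (cdom c \<inter> cdom c')"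
      using q over_fst[OF \<gamma>(1)[OF t]] by (simp add: fst_coord)
    from ctrans_differentiable[OF c c' this] obtain D where D: "(ctrans c c' has_derivative D) (at (coord c (\<gamma> t)))"
      unfolding differentiable_def by blast
    have "((\<lambda>s. ctrans c c' (coord c (\<gamma> s))) has_derivative (\<lambda>h. D (h *\<^sub>R H_p c (coord c (\<gamma> t))))) (at t)"
      by (rule has_derivative_compose[OF der[OF t, unfolded has_vector_derivative_def] D])
    then have 1: "((\<lambda>s. ctrans c c' (coord c (\<gamma> s))) has_vector_derivative D (H_p c (coord c (\<gamma> t)))) (at t)"
      unfolding has_vector_derivative_def linear_cmul[OF has_derivative_linear[OF D]] .
    have o: "open (I \<inter> (\<lambda>t. fst (\<gamma> t)) -` cdom c')"
      by (rule continuous_open_preimage[OF cont I chartD(1)[OF c']])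
    have "((\<lambda>s. coord c' (\<gamma> s)) has_vector_derivative D (H_p c (coord c (\<gamma> t)))) (at t)"
    proof (rule has_vector_derivative_transform_within_open[OF 1 o])
      fix s assume s: "s \<in> I \<inter> (\<lambda>t. fst (\<gamma> t)) -` cdom c'"
      then have "\<gamma> s \<in> over c" "\<gamma> s \<in> over c'" using \<gamma>(1) overI over_cotangent by blast+
      then show "ctrans c c' (coord c (\<gamma> s)) = coord c' (\<gamma> s)" by (rule ctrans_coord[OF c c'])
    qed (use t q in blast)
    also have "D (H_p c (coord c (\<gamma> t))) = H_p c' (coord c' (\<gamma> t))"
      using \<gamma>[OF t] overI[OF over_cotangent q] by (intro H_p_transform[OF c c' _ _ _ D])
    finally show ?thesis .
  qed
  with \<gamma>(2) cont show ?thesis unfolding icurve_def by blast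
qed

lemma icurve_local:
  assumes loc: "\<And>t. t \<in> I \<Longrightarrow> \<exists>J \<gamma>'. open J \<and> t \<in> J \<and> icurve J \<gamma>' \<and> (\<forall>s\<in>J. \<gamma> s = \<gamma>' s)"
  shows "icurve I \<gamma>"
  unfolding icurve_def
proof (intro conjI ballI impI continuous_at_imp_continuous_on)
  fix t assume "t \<in> I"
  from loc[OF this] obtain J \<gamma>' where J: "open J" "t \<in> J" "icurve J \<gamma>'" "\<And>s. s \<in> J \<Longrightarrow> \<gamma> s = \<gamma>' s" by blast
  show "\<gamma> t \<in> dot_cotangent" using icurveD(1)[OF J(3,2)] J(2,4) by simp
  have "continuous_on J (\<lambda>t. fst (\<gamma> t))"
    using icurve_continuous[OF J(3)] J(4) by (simp cong: continuous_on_cong)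
  then show "isCont (\<lambda>t. fst (\<gamma> t)) t" using J(1,2) by (simp add: continuous_on_eq_continuous_at)
  fix c assume c: "c \<in> A" and q: "fst (\<gamma> t) \<in> cdom c"
  have "((\<lambda>s. coord c (\<gamma>' s)) has_vector_derivative H_p c (coord c (\<gamma>' t))) (at t)"
    using icurveD(2)[OF J(3,2) c] q J(4)[OF J(2)] by simp
  then show "((\<lambda>s. coord c (\<gamma> s)) has_vector_derivative H_p c (coord c (\<gamma> t))) (at t)"
    unfolding J(4)[OF J(2)]
    by (rule has_vector_derivative_transform_within_open[OF _ J(1,2)]) (simp add: J(4))
qed

lemma icurve_shift:
  assumes "icurve I \<gamma>" shows "icurve {t. t + a \<in> I} (\<lambda>t. \<gamma> (t + a))"
  unfolding icurve_def
proof (intro conjI ballI impI)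
  show "continuous_on {t. t + a \<in> I} (\<lambda>t. fst (\<gamma> (t + a)))"
    by (rule continuous_on_compose2[OF icurve_continuous[OF assms]]) (auto intro!: continuous_intros)
  fix t assume t: "t \<in> {t. t + a \<in> I}"
  then show "\<gamma> (t + a) \<in> dot_cotangent" using icurveD(1)[OF assms] by simp
  fix c assume c: "c \<in> A" and q: "fst (\<gamma> (t + a)) \<in> cdom c"
  have "((\<lambda>s. coord c (\<gamma> s)) has_derivative (\<lambda>h. h *\<^sub>R H_p c (coord c (\<gamma> (t + a))))) (at (t + a))"
    using icurveD(2)[OF assms _ c q] t by (simp add: has_vector_derivative_def)
  moreover have "((\<lambda>s. s + a) has_derivative (\<lambda>h. h)) (at t)" by (auto intro!: derivative_eq_intros)
  ultimately show "((\<lambda>s. coord c (\<gamma> (s + a))) has_vector_derivative H_p c (coord c (\<gamma> (t + a)))) (at t)"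
    unfolding has_vector_derivative_def by (rule has_derivative_compose[rotated])
qed

lemma icurve_near:
  assumes \<gamma>: "icurve I \<gamma>" and I: "open I" "t \<in> I" and W: "openin cot_topology W" "\<gamma> t \<in> W"
  shows "\<exists>\<epsilon>>0. \<forall>s. \<bar>s - t\<bar> < \<epsilon> \<longrightarrow> s \<in> I \<and> \<gamma> s \<in> W"
proof -
  obtain c where c: "c \<in> A" "fst (\<gamma> t) \<in> cdom c" using ex_chart by blast
  have ov: "\<gamma> t \<in> over c" using overI dot_in_cotangent icurveD(1)[OF \<gamma> I(2)] c by blast
  have "isCont (\<lambda>s. coord c (\<gamma> s)) t"
    by (rule has_vector_derivative_continuous[OF icurveD(2)[OF \<gamma> I(2) c]])
  moreover have "open (coord c ` (W \<inter> over c))" "coord c (\<gamma> t) \<in> coord c ` (W \<inter> over c)"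
    using open_coord_image[OF W(1) c(1)] W(2) ov by blast+
  ultimately have 1: "\<forall>\<^sub>F s in at t. coord c (\<gamma> s) \<in> coord c ` (W \<inter> over c)"
    unfolding isCont_def by (rule topological_tendstoD)
  have o: "open (I \<inter> (\<lambda>t. fst (\<gamma> t)) -` cdom c)"
    by (rule continuous_open_preimage[OF icurve_continuous[OF \<gamma>] I(1) chartD(1)[OF c(1)]])
  have "t \<in> I \<inter> (\<lambda>t. fst (\<gamma> t)) -` cdom c" using I c by blast
  from eventually_conj[OF eventually_at_in_open'[OF o this] 1]
  obtain \<epsilon> where \<epsilon>: "\<epsilon> > 0" "\<And>s. s \<noteq> t \<Longrightarrow> dist s t < \<epsilon> \<Longrightarrow> s \<in> I \<inter> (\<lambda>t. fst (\<gamma> t)) -` cdom c \<and> coord c (\<gamma> s) \<in> coord c ` (W \<inter> over c)"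
    unfolding eventually_at by blast
  have "s \<in> I \<and> \<gamma> s \<in> W" if s: "\<bar>s - t\<bar> < \<epsilon>" for s
  proof (cases "s = t")
    case True then show ?thesis using I W by blast
  next
    case False
    then have 1: "s \<in> I" "fst (\<gamma> s) \<in> cdom c" "coord c (\<gamma> s) \<in> coord c ` (W \<inter> over c)"
      using \<epsilon>(2)[OF False] s by (auto simp: dist_real_def)
    have "\<gamma> s \<in> over c" using overI[OF dot_in_cotangent[OF icurveD(1)[OF \<gamma> 1(1)]] 1(2)] .
    from in_if_coord_in_image[OF c(1) this 1(3)] 1(1) show ?thesis by blast
  qed
  with \<epsilon>(1) show ?thesis by blast
qed

lemma ex_cball_dot:
  assumes c: "c \<in> A" and \<alpha>: "\<alpha> \<in> over c" "\<alpha> \<in> dot_cotangent"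
  shows "\<exists>r>0. cball (coord c \<alpha>) r \<subseteq> crange c \<times> (UNIV - {0})"
proof -
  have "open (crange c \<times> (UNIV - {0 :: real^'n}))" using chartD(2)[OF c] by (intro open_Times) auto
  moreover have "coord c \<alpha> \<in> crange c \<times> (UNIV - {0})"
    using dot_cotangent_iff[OF \<alpha>(1) c] \<alpha>(2) over_fst[OF \<alpha>(1)] by (simp add: mem_Times_iff fst_coord)
  ultimately show ?thesis by (meson open_contains_cball)
qed

text \<open>
  The times at which two curves agree form an open set by Lipschitz dependence on the initial value, and
  a closed one because distinct covectors have disjoint neighbourhoods.
\<close>

lemma icurve_unique:
  assumes \<gamma>: "icurve I \<gamma>1" "icurve I \<gamma>2" and I: "open I" "connected I" and t0: "t0 \<in> I" "\<gamma>1 t0 = \<gamma>2 t0" and t: "t \<in> I"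
  shows "\<gamma>1 t = \<gamma>2 t"
proof -
  define E where "E = {t \<in> I. \<gamma>1 t = \<gamma>2 t}"
  have eq_open: "\<exists>\<epsilon>>0. \<forall>s. \<bar>s - t\<bar> < \<epsilon> \<longrightarrow> s \<in> E" if t: "t \<in> E" for t
  proof -
    have tI: "t \<in> I" and teq: "\<gamma>1 t = \<gamma>2 t" using t by (auto simp: E_def)
    obtain c where c: "c \<in> A" "fst (\<gamma>1 t) \<in> cdom c" using ex_chart by blast
    have dot: "\<gamma>1 t \<in> dot_cotangent" by (rule icurveD(1)[OF \<gamma>(1) tI])
    have ov: "\<gamma>1 t \<in> over c" by (rule overI[OF dot_in_cotangent[OF dot] c(2)])
    let ?z = "coord c (\<gamma>1 t)"
    obtain r where r: "r > 0" "cball ?z r \<subseteq> crange c \<times> (UNIV - {0})" using ex_cball_dot[OF c(1) ov dot] by blast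
    obtain L where L: "L \<ge> 0" "\<And>x y. x \<in> cball ?z r \<Longrightarrow> y \<in> cball ?z r \<Longrightarrow> norm (H_p c x - H_p c y) \<le> L * norm (x - y)"
      using H_p_lipschitz[OF c(1) r(2) compact_cball convex_cball] by blast
    let ?W = "{\<beta> \<in> over c. coord c \<beta> \<in> ball ?z r}"
    have W: "openin cot_topology ?W" by (rule openin_coord_vimage[OF c(1) open_ball])
    have tW: "\<gamma>1 t \<in> ?W" "\<gamma>2 t \<in> ?W" using ov r teq by auto
    obtain e1 where e1: "e1 > 0" "\<And>s. \<bar>s - t\<bar> < e1 \<Longrightarrow> s \<in> I \<and> \<gamma>1 s \<in> ?W"
      using icurve_near[OF \<gamma>(1) I(1) tI W tW(1)] by blast
    obtain e2 where e2: "e2 > 0" "\<And>s. \<bar>s - t\<bar> < e2 \<Longrightarrow> s \<in> I \<and> \<gamma>2 s \<in> ?W"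
      using icurve_near[OF \<gamma>(2) I(1) tI W tW(2)] by blast
    note e = e1 e2
    define \<epsilon> where "\<epsilon> = min (min e1 e2 / 2) (1 / (2 * (L + 1)))"
    have \<epsilon>: "\<epsilon> > 0" "\<epsilon> < e1" "\<epsilon> < e2" "\<epsilon> * L \<le> 1 / 2"
    proof -
      show "\<epsilon> > 0" "\<epsilon> < e1" "\<epsilon> < e2" using e(1,3) L(1) by (auto simp: \<epsilon>_def min_def)
      have "\<epsilon> * L \<le> 1 / (2 * (L + 1)) * L" using L(1) by (intro mult_right_mono) (auto simp: \<epsilon>_def)
      also have "\<dots> \<le> 1 / 2" using L(1) by (simp add: field_simps)
      finally show "\<epsilon> * L \<le> 1 / 2" .
    qed
    have der: "((\<lambda>h. coord c (\<gamma> (h + t))) has_vector_derivative H_p c (coord c (\<gamma> (s + t)))) (at s within {-\<epsilon>..\<epsilon>})"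
      if \<gamma>: "icurve I \<gamma>" "s + t \<in> I" "\<gamma> (s + t) \<in> ?W" for \<gamma> s
    proof -
      have q: "fst (\<gamma> (s + t)) \<in> cdom c" using \<gamma>(3) over_fst by blast
      have "s \<in> {s. s + t \<in> I}" using \<gamma>(2) by simp
      from icurveD(2)[OF icurve_shift[OF \<gamma>(1), of t] this c(1) q] show ?thesis
        by (rule has_vector_derivative_at_within)
    qed
    have "\<gamma>1 s = \<gamma>2 s" if s: "\<bar>s - t\<bar> < \<epsilon>" for s
    proof -
      have n: "\<bar>(h + t) - t\<bar> < e1" "\<bar>(h + t) - t\<bar> < e2" if "h \<in> {-\<epsilon>..\<epsilon>}" for h
        using that \<epsilon> by auto
      have "norm (coord c (\<gamma>1 ((s - t) + t)) - coord c (\<gamma>2 ((s - t) + t))) \<le> 2 * norm (coord c (\<gamma>1 (0 + t)) - coord c (\<gamma>2 (0 + t)))"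
      proof (rule ode_dependence[where S = "cball ?z r" and X = "H_p c" and L = L and \<delta> = \<epsilon>
            and u = "\<lambda>h. coord c (\<gamma>1 (h + t))" and v = "\<lambda>h. coord c (\<gamma>2 (h + t))" and t = "s - t"])
        fix h assume h: "h \<in> {-\<epsilon>..\<epsilon>}"
        show "coord c (\<gamma>1 (h + t)) \<in> cball ?z r" using e(2)[OF n(1)[OF h]] by simp
        show "coord c (\<gamma>2 (h + t)) \<in> cball ?z r" using e(4)[OF n(2)[OF h]] by simp
        show "((\<lambda>h. coord c (\<gamma>1 (h + t))) has_vector_derivative H_p c (coord c (\<gamma>1 (h + t)))) (at h within {-\<epsilon>..\<epsilon>})"
          by (rule der[OF \<gamma>(1)]) (use e(2)[OF n(1)[OF h]] in blast)+
        show "((\<lambda>h. coord c (\<gamma>2 (h + t))) has_vector_derivative H_p c (coord c (\<gamma>2 (h + t)))) (at h within {-\<epsilon>..\<epsilon>})"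
          by (rule der[OF \<gamma>(2)]) (use e(4)[OF n(2)[OF h]] in blast)+
      qed (use \<epsilon> L s in auto)
      then have "coord c (\<gamma>1 s) = coord c (\<gamma>2 s)" by (simp add: teq)
      moreover have "\<gamma>1 s \<in> over c" "\<gamma>2 s \<in> over c" using e(2)[of s] e(4)[of s] s \<epsilon> by auto
      ultimately show ?thesis using inj_onD[OF inj_on_coord[OF c(1)]] by blast
    qed
    moreover have "s \<in> I" if "\<bar>s - t\<bar> < \<epsilon>" for s using e(2)[of s] that \<epsilon> by auto
    ultimately show ?thesis using \<epsilon>(1) unfolding E_def by blast
  qed
  have neq_open: "\<exists>\<epsilon>>0. \<forall>s. \<bar>s - t\<bar> < \<epsilon> \<longrightarrow> s \<in> I - E" if t: "t \<in> I - E" for t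
  proof -
    have tI: "t \<in> I" and tne: "\<gamma>1 t \<noteq> \<gamma>2 t" using t by (auto simp: E_def)
    have cot: "\<gamma>1 t \<in> cotangent" "\<gamma>2 t \<in> cotangent" using icurveD(1)[OF \<gamma>(1) tI] icurveD(1)[OF \<gamma>(2) tI] dot_in_cotangent by blast+
    have "\<exists>W1 W2. openin cot_topology W1 \<and> openin cot_topology W2 \<and> \<gamma>1 t \<in> W1 \<and> \<gamma>2 t \<in> W2 \<and> W1 \<inter> W2 = {}"
    proof (cases "fst (\<gamma>1 t) = fst (\<gamma>2 t)")
      case False
      then obtain U V where UV: "open U" "open V" "fst (\<gamma>1 t) \<in> U" "fst (\<gamma>2 t) \<in> V" "U \<inter> V = {}"
        by (meson hausdorff)
      have "{\<alpha> \<in> cotangent. fst \<alpha> \<in> U} \<inter> {\<alpha> \<in> cotangent. fst \<alpha> \<in> V} = {}" using UV(5) by blast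
      with openin_fst_vimage[OF UV(1)] openin_fst_vimage[OF UV(2)] cot UV(3,4) show ?thesis by blast
    next
      case True
      obtain c where c: "c \<in> A" "fst (\<gamma>1 t) \<in> cdom c" using ex_chart by blast
      have ov: "\<gamma>1 t \<in> over c" "\<gamma>2 t \<in> over c" using overI cot c True by metis+
      have "coord c (\<gamma>1 t) \<noteq> coord c (\<gamma>2 t)" using inj_onD[OF inj_on_coord[OF c(1)]] ov tne by blast
      then obtain U V where UV: "open U" "open V" "coord c (\<gamma>1 t) \<in> U" "coord c (\<gamma>2 t) \<in> V" "U \<inter> V = {}"
        by (meson hausdorff)
      have "{\<beta> \<in> over c. coord c \<beta> \<in> U} \<inter> {\<beta> \<in> over c. coord c \<beta> \<in> V} = {}" using UV(5) by blast
      with openin_coord_vimage[OF c(1) UV(1)] openin_coord_vimage[OF c(1) UV(2)] ov UV(3,4) show ?thesis by blast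
    qed
    then obtain W1 W2 where W: "openin cot_topology W1" "openin cot_topology W2" "\<gamma>1 t \<in> W1" "\<gamma>2 t \<in> W2" "W1 \<inter> W2 = {}" by blast
    obtain e1 where e1: "e1 > 0" "\<And>s. \<bar>s - t\<bar> < e1 \<Longrightarrow> s \<in> I \<and> \<gamma>1 s \<in> W1"
      using icurve_near[OF \<gamma>(1) I(1) tI W(1,3)] by blast
    obtain e2 where e2: "e2 > 0" "\<And>s. \<bar>s - t\<bar> < e2 \<Longrightarrow> s \<in> I \<and> \<gamma>2 s \<in> W2"
      using icurve_near[OF \<gamma>(2) I(1) tI W(2,4)] by blast
    have "s \<in> I - E" if "\<bar>s - t\<bar> < min e1 e2" for s
    proof -
      have "s \<in> I" "\<gamma>1 s \<in> W1" "\<gamma>2 s \<in> W2" using e1(2)[of s] e2(2)[of s] that by auto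
      then show ?thesis using W(5) unfolding E_def by auto
    qed
    then show ?thesis using e1(1) e2(1) by (intro exI[of _ "min e1 e2"]) auto
  qed
  have "open E" "open (I - E)"
    using eq_open neq_open unfolding open_dist dist_real_def by blast+
  moreover have "E \<inter> (I - E) \<inter> I = {}" "I \<subseteq> E \<union> (I - E)" by blast+
  ultimately have "E \<inter> I = {} \<or> (I - E) \<inter> I = {}" using connectedD[OF I(2)] by blast
  moreover have "t0 \<in> E" using t0 by (simp add: E_def)
  ultimately have "t \<in> E" using t t0 by blast
  then show ?thesis by (simp add: E_def)
qed

text \<open>
  The Hamilton vector field of a chart is Lipschitz on balls that stay away from the zero section.
\<close>

lemma local_curves:
  assumes c: "c \<in> A" and r: "r > 0" "cball z0 r \<subseteq> crange c \<times> (UNIV - {0})"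
  shows "\<exists>\<delta>>0. \<exists>u. (\<forall>z\<in>cball z0 (r / 2). u z 0 = z \<and> (\<forall>t\<in>{-\<delta><..<\<delta>}. u z t \<in> cball z0 r) \<and>
        icurve {-\<delta><..<\<delta>} (\<lambda>t. of_coord c (u z t))) \<and>
     (\<forall>z\<in>cball z0 (r / 2). \<forall>z'\<in>cball z0 (r / 2). \<forall>t\<in>{-\<delta><..<\<delta>}. norm (u z t - u z' t) \<le> 2 * norm (z - z'))"
proof -
  obtain L where L: "L \<ge> 0" "\<And>x y. x \<in> cball z0 r \<Longrightarrow> y \<in> cball z0 r \<Longrightarrow> norm (H_p c x - H_p c y) \<le> L * norm (x - y)"
    using H_p_lipschitz[OF c r(2) compact_cball convex_cball] by blast
  from local_flow[where X = "H_p c", OF L(2,1) r(1)] obtain \<delta> u where \<delta>: "\<delta> > 0" and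
    u1: "\<forall>z\<in>cball z0 (r / 2). u z 0 = z \<and> (\<forall>t\<in>{-\<delta>..\<delta>}. u z t \<in> cball z0 r \<and>
          (u z has_vector_derivative H_p c (u z t)) (at t within {-\<delta>..\<delta>}))" and
    u2: "\<forall>z\<in>cball z0 (r / 2). \<forall>z'\<in>cball z0 (r / 2). \<forall>t\<in>{-\<delta>..\<delta>}. norm (u z t - u z' t) \<le> 2 * norm (z - z')"
    by blast
  have u: "\<And>z. z \<in> cball z0 (r / 2) \<Longrightarrow> u z 0 = z"
      "\<And>z t. z \<in> cball z0 (r / 2) \<Longrightarrow> t \<in> {-\<delta>..\<delta>} \<Longrightarrow> u z t \<in> cball z0 r"
      "\<And>z t. z \<in> cball z0 (r / 2) \<Longrightarrow> t \<in> {-\<delta>..\<delta>} \<Longrightarrow> (u z has_vector_derivative H_p c (u z t)) (at t within {-\<delta>..\<delta>})"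
      "\<And>z z' t. z \<in> cball z0 (r / 2) \<Longrightarrow> z' \<in> cball z0 (r / 2) \<Longrightarrow> t \<in> {-\<delta>..\<delta>} \<Longrightarrow> norm (u z t - u z' t) \<le> 2 * norm (z - z')"
    using u1 u2 by blast+
  have "icurve {-\<delta><..<\<delta>} (\<lambda>t. of_coord c (u z t))" if z: "z \<in> cball z0 (r / 2)" for z
  proof (rule icurve_chartI[OF c])
    have m: "fst (u z t) \<in> crange c" "snd (u z t) \<noteq> 0" if "t \<in> {-\<delta><..<\<delta>}" for t
    proof -
      have "u z t \<in> crange c \<times> (UNIV - {0})" using u(2)[OF z] that r(2) by (meson atLeastAtMost_iff greaterThanLessThan_iff less_imp_le subsetD)
      then show "fst (u z t) \<in> crange c" "snd (u z t) \<noteq> 0" by (simp_all add: mem_Times_iff)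
    qed
    fix t assume t: "t \<in> {-\<delta><..<\<delta>}"
    show ov: "of_coord c (u z t) \<in> over c" by (rule of_coord_in[OF c m(1)[OF t]])
    show "of_coord c (u z t) \<in> dot_cotangent"
      using dot_cotangent_iff[OF ov c] m[OF t] c by simp
    have "(u z has_vector_derivative H_p c (u z t)) (at t)"
      using u(3)[OF z, of t] t by (simp add: at_within_Icc_at)
    from has_vector_derivative_transform_within_open[OF this open_greaterThanLessThan t, of "\<lambda>s. coord c (of_coord c (u z s))"]
    show "((\<lambda>s. coord c (of_coord c (u z s))) has_vector_derivative H_p c (coord c (of_coord c (u z t)))) (at t)"
      using m t c by simp
  qed simp
  moreover have "t \<in> {-\<delta>..\<delta>}" if "t \<in> {-\<delta><..<\<delta>}" for t using that by auto
  ultimately show ?thesis using \<delta> u(1,2,4) by (intro exI[of _ \<delta>] conjI exI[of _ u] ballI) blast+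
qed

section \<open>Compactness of the energy surfaces\<close>

text \<open>
  By homogeneity, \<open>p\<close> is at least a positive multiple of the norm over the compact set of base points.
\<close>

lemma compact_level:
  assumes c: "c \<in> A" and e: "cball x0 e \<subseteq> crange c" "e \<ge> 0"
  shows "compact {z. fst z \<in> cball x0 e \<and> p_loc c z = \<rho>}"
proof -
  let ?S = "cball x0 e \<times> sphere (0::real^'n) 1"
  have cont: "continuous_on (cball x0 e \<times> UNIV) (p_loc c)"
    by (rule continuous_on_subset[OF continuous_on_p_loc[OF c]]) (use e in auto)
  have S: "compact ?S" "?S \<noteq> {}"
    using e(2) by (auto intro!: compact_Times)
  have "continuous_on ?S (p_loc c)" by (rule continuous_on_subset[OF cont]) auto
  from continuous_attains_inf[OF S this] obtain w where w: "w \<in> ?S" "\<And>z. z \<in> ?S \<Longrightarrow> p_loc c w \<le> p_loc c z" by blast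
  have m: "p_loc c w > 0"
    using w(1) e(1) by (intro p_loc_pos[OF c]) (auto simp: mem_Times_iff)
  have bound: "norm (snd z) \<le> \<rho> / p_loc c w" if z: "fst z \<in> cball x0 e" "p_loc c z = \<rho>" for z
  proof (cases "snd z = 0")
    case True
    then show ?thesis using p_loc_zero[OF True] z(2) by simp
  next
    case False
    have "p_loc c z = norm (snd z) * p_loc c (fst z, inverse (norm (snd z)) *\<^sub>R snd z)"
      using p_loc_scale[of "norm (snd z)" c "fst z" "inverse (norm (snd z)) *\<^sub>R snd z"] False by simp
    also have "\<dots> \<ge> norm (snd z) * p_loc c w"
      using False z(1) by (intro mult_left_mono w(2)) auto
    finally show ?thesis using z(2) m by (simp add: field_simps)
  qed
  let ?B = "cball x0 e \<times> cball (0::real^'n) (\<rho> / p_loc c w)"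
  have eq: "{z. fst z \<in> cball x0 e \<and> p_loc c z = \<rho>} = ?B \<inter> p_loc c -` {\<rho>}"
    using bound by (auto simp: mem_Times_iff)
  have "closed (?B \<inter> p_loc c -` {\<rho>})"
    by (intro continuous_closed_preimage continuous_on_subset[OF cont] closed_Times) auto
  moreover have "bounded (?B \<inter> p_loc c -` {\<rho>})"
    by (rule bounded_subset[of ?B]) (auto intro: bounded_Times)
  ultimately show ?thesis unfolding eq by (simp add: compact_eq_bounded_closed)
qed

text \<open>
  A property that holds with some \<open>\<delta>\<close> near each covector of length \<open>\<rho>\<close> holds with one \<open>\<delta>\<close> for all of them:
  first over a ball in a chart, by compactness of its level set, and then over the compact manifold.
\<close>

lemma uniform_on_level:
  fixes P :: "real \<Rightarrow> 'a \<times> (('a, 'n) chart \<Rightarrow> real^'n) \<Rightarrow> bool"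
  assumes loc: "\<And>\<alpha>0. \<alpha>0 \<in> cotangent \<Longrightarrow> p \<alpha>0 = \<rho> \<Longrightarrow>
      \<exists>W \<delta>. openin cot_topology W \<and> \<alpha>0 \<in> W \<and> \<delta> > 0 \<and> (\<forall>\<alpha>\<in>W. p \<alpha> = \<rho> \<longrightarrow> P \<delta> \<alpha>)"
    and mono: "\<And>\<delta> \<delta>' \<alpha>. P \<delta> \<alpha> \<Longrightarrow> 0 < \<delta>' \<Longrightarrow> \<delta>' \<le> \<delta> \<Longrightarrow> P \<delta>' \<alpha>"
  shows "\<exists>\<delta>>0. \<forall>\<alpha>\<in>cotangent. p \<alpha> = \<rho> \<longrightarrow> P \<delta> \<alpha>"
proof -
  have "\<exists>U \<delta>. open U \<and> q \<in> U \<and> \<delta> > 0 \<and> (\<forall>\<alpha>\<in>cotangent. fst \<alpha> \<in> U \<longrightarrow> p \<alpha> = \<rho> \<longrightarrow> P \<delta> \<alpha>)" for q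
  proof -
    obtain c where c: "c \<in> A" "q \<in> cdom c" using ex_chart by blast
    obtain e where e: "e > 0" "cball (cmap c q) e \<subseteq> crange c"
      using chartD(2)[OF c(1)] cmap_in[OF c(2)] by (meson open_contains_cball)
    let ?K = "{z. fst z \<in> cball (cmap c q) e \<and> p_loc c z = \<rho>}"
    have K: "compact ?K" by (rule compact_level[OF c(1) e(2)]) (use e in simp)
    have ocK: "of_coord c z \<in> over c" "coord c (of_coord c z) = z" "p (of_coord c z) = \<rho>" if z: "z \<in> ?K" for z
    proof -
      have f: "fst z \<in> crange c" using z e(2) by blast
      show 1: "of_coord c z \<in> over c" by (rule of_coord_in[OF c(1) f])
      show 2: "coord c (of_coord c z) = z" by (rule coord_of_coord[OF c(1) f])
      show "p (of_coord c z) = \<rho>" using p_eq[OF 1 c(1)] 2 z by simp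
    qed
    have "\<exists>W \<delta>. openin cot_topology W \<and> of_coord c z \<in> W \<and> \<delta> > 0 \<and> (\<forall>\<alpha>\<in>W. p \<alpha> = \<rho> \<longrightarrow> P \<delta> \<alpha>)" if "z \<in> ?K" for z
      using ocK[OF that] by (intro loc over_cotangent)
    then have "\<forall>z\<in>?K. \<exists>w. openin cot_topology (fst w) \<and> of_coord c z \<in> fst w \<and> snd w > 0 \<and> (\<forall>\<alpha>\<in>fst w. p \<alpha> = \<rho> \<longrightarrow> P (snd w) \<alpha>)"
      by (simp only: split_paired_Ex fst_conv snd_conv) blast
    from bchoice[OF this] obtain w where w: "\<forall>z\<in>?K. openin cot_topology (fst (w z)) \<and> of_coord c z \<in> fst (w z) \<and> snd (w z) > 0 \<and>
        (\<forall>\<alpha>\<in>fst (w z). p \<alpha> = \<rho> \<longrightarrow> P (snd (w z)) \<alpha>)" by blast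
    define W where "W z = fst (w z)" for z
    define \<delta> where "\<delta> z = snd (w z)" for z
    have W: "openin cot_topology (W z)" "of_coord c z \<in> W z" "\<delta> z > 0"
      "\<And>\<alpha>. \<alpha> \<in> W z \<Longrightarrow> p \<alpha> = \<rho> \<Longrightarrow> P (\<delta> z) \<alpha>" if z: "z \<in> ?K" for z
      using bspec[OF w z] unfolding W_def \<delta>_def by blast+
    have "?K \<subseteq> (\<Union>z\<in>?K. coord c ` (W z \<inter> over c))"
    proof
      fix z assume z: "z \<in> ?K"
      have "of_coord c z \<in> W z \<inter> over c" using W(2)[OF z] ocK(1)[OF z] by blast
      then have "coord c (of_coord c z) \<in> coord c ` (W z \<inter> over c)" by (rule imageI)
      then show "z \<in> (\<Union>z\<in>?K. coord c ` (W z \<inter> over c))" unfolding ocK(2)[OF z] using z by blast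
    qed
    from compactE_image[OF K _ this] open_coord_image[OF W(1) c(1)]
    obtain Z where Z: "Z \<subseteq> ?K" "finite Z" "?K \<subseteq> (\<Union>z\<in>Z. coord c ` (W z \<inter> over c))" by blast
    define d where "d = Min (insert 1 (\<delta> ` Z))"
    have d: "d > 0" "\<And>z. z \<in> Z \<Longrightarrow> d \<le> \<delta> z"
      using Z(1,2) W(3) by (auto simp: d_def)
    let ?U = "cdom c \<inter> cmap c -` ball (cmap c q) e"
    have "open ?U" by (rule continuous_open_preimage[OF continuous_on_cmap[OF c(1)] chartD(1)[OF c(1)] open_ball])
    moreover have "q \<in> ?U" using c e by simp
    moreover have "P d \<alpha>" if \<alpha>: "\<alpha> \<in> cotangent" "fst \<alpha> \<in> ?U" "p \<alpha> = \<rho>" for \<alpha>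
    proof -
      have ov: "\<alpha> \<in> over c" using \<alpha> by (intro overI) blast+
      have "coord c \<alpha> \<in> ?K" using \<alpha>(2,3) p_eq[OF ov c(1)] by (simp add: fst_coord)
      then obtain z where z: "z \<in> Z" "coord c \<alpha> \<in> coord c ` (W z \<inter> over c)" using Z(3) by blast
      have "\<alpha> \<in> W z" by (rule in_if_coord_in_image[OF c(1) ov z(2)])
      then have "P (\<delta> z) \<alpha>" using W(4) z(1) Z(1) \<alpha>(3) by blast
      then show ?thesis by (rule mono[OF _ d(1) d(2)[OF z(1)]])
    qed
    ultimately show ?thesis using d(1) by blast
  qed
  then have "\<forall>q. \<exists>u. open (fst u) \<and> q \<in> fst u \<and> snd u > 0 \<and> (\<forall>\<alpha>\<in>cotangent. fst \<alpha> \<in> fst u \<longrightarrow> p \<alpha> = \<rho> \<longrightarrow> P (snd u) \<alpha>)"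
    by (simp only: split_paired_Ex fst_conv snd_conv) blast
  from choice[OF this] obtain u where u: "\<forall>q. open (fst (u q)) \<and> q \<in> fst (u q) \<and> snd (u q) > 0 \<and>
      (\<forall>\<alpha>\<in>cotangent. fst \<alpha> \<in> fst (u q) \<longrightarrow> p \<alpha> = \<rho> \<longrightarrow> P (snd (u q)) \<alpha>)" by blast
  define U where "U q = fst (u q)" for q
  define \<delta> where "\<delta> q = snd (u q)" for q
  have U: "open (U q)" "q \<in> U q" "\<delta> q > 0"
    "\<And>\<alpha>. \<alpha> \<in> cotangent \<Longrightarrow> fst \<alpha> \<in> U q \<Longrightarrow> p \<alpha> = \<rho> \<Longrightarrow> P (\<delta> q) \<alpha>" for q
    using spec[OF u, of q] unfolding U_def \<delta>_def by blast+
  have "UNIV \<subseteq> (\<Union>q\<in>UNIV. U q)" using U(2) by blast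
  then obtain Q where Q: "finite Q" "UNIV \<subseteq> (\<Union>q\<in>Q. U q)"
    by (rule compactE_image[OF compact_M U(1)])
  define d where "d = Min (insert 1 (\<delta> ` Q))"
  have d: "d > 0" "\<And>q. q \<in> Q \<Longrightarrow> d \<le> \<delta> q" using Q(1) U(3) by (auto simp: d_def)
  have "P d \<alpha>" if \<alpha>: "\<alpha> \<in> cotangent" "p \<alpha> = \<rho>" for \<alpha>
  proof -
    obtain q where q: "q \<in> Q" "fst \<alpha> \<in> U q" using Q(2) by blast
    from mono[OF U(4)[OF \<alpha>(1) q(2) \<alpha>(2)] d(1) d(2)[OF q(1)]] show ?thesis .
  qed
  with d(1) show ?thesis by blast
qed

end

context compact_riemannian
begin

section \<open>Existence and continuity of the flow\<close>

lemma fst_scale [simp]: "fst (scale r \<alpha>) = fst \<alpha>"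
  by (simp add: scale_def)

lemma coord_scale: "coord c (scale r \<alpha>) = (fst (coord c \<alpha>), r *\<^sub>R snd (coord c \<alpha>))"
  by (simp add: coord_def scale_def)

lemma scale_scale: "scale r (scale s \<alpha>) = scale (r * s) \<alpha>"
  by (simp add: scale_def)

lemma scale_one [simp]: "scale 1 \<alpha> = \<alpha>"
  by (simp add: scale_def)

lemma scale_in_cotangent:
  assumes \<alpha>: "\<alpha> \<in> cotangent" shows "scale r \<alpha> \<in> cotangent"
proof -
  have "r *\<^sub>R snd \<alpha> c' = transpose (tmat c' c (fst \<alpha>)) *v (r *\<^sub>R snd \<alpha> c)"
    if "c \<in> A" "c' \<in> A" "fst \<alpha> \<in> cdom c \<inter> cdom c'" for c c'
  proof -
    have "fst \<alpha> \<in> cdom c" "fst \<alpha> \<in> cdom c'" using that(3) by blast+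
    from cotangentD[OF \<alpha> that(1,2) this] show ?thesis by (simp add: matrix_vector_mult_scaleR)
  qed
  moreover have "r *\<^sub>R snd \<alpha> c = 0" if "c \<notin> A \<or> fst \<alpha> \<notin> cdom c" for c
    using cotangent_outside[OF \<alpha> that] by simp
  ultimately show ?thesis
    unfolding cotangent_def scale_def mem_Collect_eq case_prod_beta fst_conv snd_conv tmat_def[symmetric] by blast
qed

lemma scale_over: "\<alpha> \<in> over c \<Longrightarrow> scale r \<alpha> \<in> over c"
  unfolding over_def using scale_in_cotangent by simp

lemma ex_over: "\<alpha> \<in> cotangent \<Longrightarrow> \<exists>c\<in>A. \<alpha> \<in> over c"
  using ex_chart overI by blast

lemma p_scale:
  assumes "\<alpha> \<in> cotangent" "r \<ge> 0" shows "p (scale r \<alpha>) = r * p \<alpha>"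
proof -
  obtain c where c: "c \<in> A" "\<alpha> \<in> over c" using ex_over[OF assms(1)] by blast
  show ?thesis
    using p_eq[OF scale_over[OF c(2)] c(1)] p_eq[OF c(2,1)] p_loc_scale[OF assms(2), of c "fst (coord c \<alpha>)" "snd (coord c \<alpha>)"]
    by (simp add: coord_scale)
qed

lemma scale_in_dot: "\<alpha> \<in> dot_cotangent \<Longrightarrow> r > 0 \<Longrightarrow> scale r \<alpha> \<in> dot_cotangent"
  using p_pos_iff[of \<alpha>] p_pos_iff[of "scale r \<alpha>"] p_scale[of \<alpha> r] scale_in_cotangent[of \<alpha> r] dot_in_cotangent[of \<alpha>]
  by simp

text \<open>\<open>H_p\<close> is homogeneous of degree 0 in the base and of degree 1 in the fiber.\<close>

lemma icurve_scale:
  assumes \<gamma>: "icurve I \<gamma>" and r: "r > 0" shows "icurve I (\<lambda>t. scale r (\<gamma> t))"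
  unfolding icurve_def
proof (intro conjI ballI impI)
  show "continuous_on I (\<lambda>t. fst (scale r (\<gamma> t)))" using icurve_continuous[OF \<gamma>] by simp
  fix t assume t: "t \<in> I"
  note dot = icurveD(1)[OF \<gamma> t]
  show "scale r (\<gamma> t) \<in> dot_cotangent" by (rule scale_in_dot[OF dot r])
  fix c assume c: "c \<in> A" and "fst (scale r (\<gamma> t)) \<in> cdom c"
  then have q: "fst (\<gamma> t) \<in> cdom c" by simp
  have ov: "\<gamma> t \<in> over c" by (rule overI[OF dot_in_cotangent[OF dot] q])
  let ?S = "\<lambda>z. (fst z, r *\<^sub>R snd z) :: (real^'n) \<times> (real^'n)"
  have S: "bounded_linear ?S"
    by (intro bounded_linear_Pair bounded_linear_fst bounded_linear_compose[OF bounded_linear_scaleR_right bounded_linear_snd])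
  have "((\<lambda>s. ?S (coord c (\<gamma> s))) has_vector_derivative ?S (H_p c (coord c (\<gamma> t)))) (at t)"
    by (rule bounded_linear.has_vector_derivative[OF S icurveD(2)[OF \<gamma> t c q]])
  moreover have "H_p c (coord c (scale r (\<gamma> t))) = ?S (H_p c (coord c (\<gamma> t)))"
    using H_p_scale[OF c, of "fst (coord c (\<gamma> t))" "snd (coord c (\<gamma> t))" r] r q dot_cotangent_iff[OF ov c] dot
    by (simp add: coord_scale) (simp add: fst_coord)
  ultimately show "((\<lambda>s. coord c (scale r (\<gamma> s))) has_vector_derivative H_p c (coord c (scale r (\<gamma> t)))) (at t)"
    by (simp add: coord_scale)
qed

lemma icurve_glue:
  assumes \<gamma>: "icurve {a<..<b} \<gamma>" "icurve {a'<..<b'} \<gamma>'" and t: "t \<in> {a<..<b}" "t \<in> {a'<..<b'}" "\<gamma> t = \<gamma>' t"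
  shows "\<exists>\<gamma>''. icurve {min a a'<..<max b b'} \<gamma>'' \<and> (\<forall>s\<in>{a<..<b}. \<gamma>'' s = \<gamma> s)"
proof -
  have I: "{a<..<b} \<inter> {a'<..<b'} = {max a a'<..<min b b'}" by auto
  have eq: "\<gamma> s = \<gamma>' s" if s: "s \<in> {a<..<b}" "s \<in> {a'<..<b'}" for s
  proof (rule icurve_unique)
    show "icurve {max a a'<..<min b b'} \<gamma>" by (rule icurve_subset[OF \<gamma>(1)]) auto
    show "icurve {max a a'<..<min b b'} \<gamma>'" by (rule icurve_subset[OF \<gamma>(2)]) auto
    show "open {max a a'<..<min b b'}" "connected {max a a'<..<min b b'}" by auto
    show "t \<in> {max a a'<..<min b b'}" "\<gamma> t = \<gamma>' t" "s \<in> {max a a'<..<min b b'}" using t s I by auto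
  qed
  let ?\<gamma> = "\<lambda>s. if s \<in> {a<..<b} then \<gamma> s else \<gamma>' s"
  have "icurve {min a a'<..<max b b'} ?\<gamma>"
  proof (rule icurve_local)
    fix s assume "s \<in> {min a a'<..<max b b'}"
    then have "s \<in> {a<..<b} \<or> s \<in> {a'<..<b'}" using t by auto
    then show "\<exists>J \<gamma>'. open J \<and> s \<in> J \<and> icurve J \<gamma>' \<and> (\<forall>s\<in>J. ?\<gamma> s = \<gamma>' s)"
    proof
      assume "s \<in> {a<..<b}"
      then show ?thesis using \<gamma>(1) by (intro exI[of _ "{a<..<b}"] exI[of _ \<gamma>]) auto
    next
      assume "s \<in> {a'<..<b'}"
      then show ?thesis using \<gamma>(2) eq by (intro exI[of _ "{a'<..<b'}"] exI[of _ \<gamma>']) auto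
    qed
  qed
  then show ?thesis by (intro exI[of _ ?\<gamma>]) auto
qed

lemma p_along_curve:
  assumes \<gamma>: "icurve I \<gamma>" and I: "open I" "t \<in> I"
  shows "((\<lambda>s. p (\<gamma> s)) has_field_derivative 0) (at t)"
proof -
  note dot = icurveD(1)[OF \<gamma> I(2)]
  obtain c where c: "c \<in> A" "\<gamma> t \<in> over c" using ex_over[OF dot_in_cotangent[OF dot]] by blast
  note q = over_fst[OF c(2)]
  have z: "fst (coord c (\<gamma> t)) \<in> crange c" "snd (coord c (\<gamma> t)) \<noteq> 0"
    using q dot_cotangent_iff[OF c(2,1)] dot by (auto simp: fst_coord)
  have d: "(p_loc c has_derivative frechet_derivative (p_loc c) (at (coord c (\<gamma> t)))) (at (coord c (\<gamma> t)))"
    using p_loc_has_derivative[OF c(1) z] frechet_derivative_works differentiable_def by blast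
  have "((\<lambda>s. p_loc c (coord c (\<gamma> s))) has_derivative (\<lambda>h. frechet_derivative (p_loc c) (at (coord c (\<gamma> t))) (h *\<^sub>R H_p c (coord c (\<gamma> t))))) (at t)"
    by (rule has_derivative_compose[OF icurveD(2)[OF \<gamma> I(2) c(1) q, unfolded has_vector_derivative_def] d])
  then have 1: "((\<lambda>s. p_loc c (coord c (\<gamma> s))) has_derivative (\<lambda>h. 0)) (at t)"
    unfolding linear_cmul[OF has_derivative_linear[OF d]] p_loc_derivative_along_H_p[OF c(1) z] by simp
  have o: "open (I \<inter> (\<lambda>t. fst (\<gamma> t)) -` cdom c)"
    by (rule continuous_open_preimage[OF icurve_continuous[OF \<gamma>] I(1) chartD(1)[OF c(1)]])
  have "((\<lambda>s. p (\<gamma> s)) has_derivative (\<lambda>h. 0)) (at t)"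
  proof (rule has_derivative_transform_within_open[OF 1 o])
    fix s assume s: "s \<in> I \<inter> (\<lambda>t. fst (\<gamma> t)) -` cdom c"
    then have "\<gamma> s \<in> over c" using icurveD(1)[OF \<gamma>] overI[OF dot_in_cotangent] by blast
    then show "p_loc c (coord c (\<gamma> s)) = p (\<gamma> s)" using p_eq c(1) by simp
  qed (use I q in blast)
  then show ?thesis by (simp add: has_field_derivative_def lambda_zero)
qed

lemma p_curve_constant: "icurve UNIV \<gamma> \<Longrightarrow> p (\<gamma> s) = p (\<gamma> t)"
  using p_along_curve[of UNIV \<gamma>] by (intro DERIV_isconst_all) auto

lemma p_curve_constant_on:
  assumes "icurve {a<..<b} \<gamma>" "s \<in> {a<..<b}" "t \<in> {a<..<b}" shows "p (\<gamma> s) = p (\<gamma> t)"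
proof -
  have der: "((\<lambda>s. p (\<gamma> s)) has_derivative (\<lambda>h. 0)) (at x within {a<..<b})" if x: "x \<in> {a<..<b}" for x
  proof (rule has_derivative_at_withinI)
    show "((\<lambda>s. p (\<gamma> s)) has_derivative (\<lambda>h. 0)) (at x)"
      using p_along_curve[OF assms(1) open_greaterThanLessThan x]
      unfolding has_field_derivative_def lambda_zero .
  qed
  show ?thesis
    by (rule has_derivative_zero_unique[OF _ der assms(3,2), symmetric]) simp
qed

text \<open>
  On a level set of \<open>p\<close>, which is compact, all curves exist for a common time; as \<open>p\<close> is constant along
  curves, they can be prolonged by this time over and over.
\<close>

lemma ex_global_curve:
  assumes \<alpha>: "\<alpha> \<in> dot_cotangent"
  shows "\<exists>\<gamma>. icurve UNIV \<gamma> \<and> \<gamma> 0 = \<alpha>"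
proof -
  let ?P = "\<lambda>\<delta> \<beta>. \<exists>\<gamma>. icurve {-\<delta><..<\<delta>} \<gamma> \<and> \<gamma> 0 = \<beta>"
  have p\<alpha>: "p \<alpha> > 0" using p_pos_iff[OF dot_in_cotangent[OF \<alpha>]] \<alpha> by simp
  have "\<exists>\<delta>>0. \<forall>\<beta>\<in>cotangent. p \<beta> = p \<alpha> \<longrightarrow> ?P \<delta> \<beta>"
  proof (rule uniform_on_level)
    fix \<alpha>0 assume a0: "\<alpha>0 \<in> cotangent" "p \<alpha>0 = p \<alpha>"
    then have dot: "\<alpha>0 \<in> dot_cotangent" using p_pos_iff[OF a0(1)] p\<alpha> by simp
    obtain c where c: "c \<in> A" "\<alpha>0 \<in> over c" using ex_over[OF a0(1)] by blast
    obtain r where r: "r > 0" "cball (coord c \<alpha>0) r \<subseteq> crange c \<times> (UNIV - {0})"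
      using ex_cball_dot[OF c dot] by blast
    from local_curves[OF c(1) r] obtain \<delta> u where \<delta>: "\<delta> > 0" and
      u: "\<forall>z\<in>cball (coord c \<alpha>0) (r / 2). u z 0 = z \<and> (\<forall>t\<in>{-\<delta><..<\<delta>}. u z t \<in> cball (coord c \<alpha>0) r) \<and>
        icurve {-\<delta><..<\<delta>} (\<lambda>t. of_coord c (u z t))" by blast
    let ?W = "{\<beta> \<in> over c. coord c \<beta> \<in> ball (coord c \<alpha>0) (r / 2)}"
    have "?P \<delta> \<beta>" if \<beta>: "\<beta> \<in> ?W" for \<beta>
    proof -
      have "coord c \<beta> \<in> cball (coord c \<alpha>0) (r / 2)" "\<beta> \<in> over c" using \<beta> by auto
      then have "icurve {-\<delta><..<\<delta>} (\<lambda>t. of_coord c (u (coord c \<beta>) t))" "of_coord c (u (coord c \<beta>) 0) = \<beta>"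
        using u c(1) by auto
      then show ?thesis by blast
    qed
    moreover have "openin cot_topology ?W" by (rule openin_coord_vimage[OF c(1) open_ball])
    moreover have "\<alpha>0 \<in> ?W" using c r by simp
    ultimately show "\<exists>W \<delta>. openin cot_topology W \<and> \<alpha>0 \<in> W \<and> \<delta> > 0 \<and> (\<forall>\<beta>\<in>W. p \<beta> = p \<alpha> \<longrightarrow> ?P \<delta> \<beta>)"
      using \<delta> by (intro exI[of _ ?W] exI[of _ \<delta>]) simp
  next
    fix \<delta> \<delta>' \<beta> assume P: "?P \<delta> \<beta>" and d: "0 < \<delta>'" "\<delta>' \<le> \<delta>"
    then obtain \<gamma> where "icurve {-\<delta><..<\<delta>} \<gamma>" "\<gamma> 0 = \<beta>" by blast
    moreover have "{-\<delta>'<..<\<delta>'} \<subseteq> {-\<delta><..<\<delta>}" using d by auto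
    ultimately show "?P \<delta>' \<beta>" using icurve_subset by blast
  qed
  then obtain \<delta> where \<delta>: "\<delta> > 0" "\<And>\<beta>. \<beta> \<in> cotangent \<Longrightarrow> p \<beta> = p \<alpha> \<Longrightarrow> ?P \<delta> \<beta>" by blast
  define T where "T n = real (Suc n) * (\<delta> / 2)" for n
  have T: "T n > 0" "T (Suc n) = T n + \<delta> / 2" for n
  proof -
    show "T n > 0" unfolding T_def using \<delta>(1) by (intro mult_pos_pos) auto
    have "real (Suc (Suc n)) = real (Suc n) + 1" by simp
    then show "T (Suc n) = T n + \<delta> / 2" unfolding T_def by (simp only: distrib_right mult_1_left)
  qed
  have ex: "\<exists>\<gamma>. icurve {- T n<..<T n} \<gamma> \<and> \<gamma> 0 = \<alpha>" for n
  proof (induction n)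
    case 0
    obtain \<gamma> where "icurve {-\<delta><..<\<delta>} \<gamma>" "\<gamma> 0 = \<alpha>" using \<delta>(2)[OF dot_in_cotangent[OF \<alpha>] refl] by blast
    moreover have "{- T 0<..<T 0} \<subseteq> {-\<delta><..<\<delta>}" using \<delta>(1) by (auto simp: T_def)
    ultimately show ?case using icurve_subset by blast
  next
    case (Suc n)
    then obtain \<gamma> where \<gamma>: "icurve {- T n<..<T n} \<gamma>" "\<gamma> 0 = \<alpha>" by blast
    define s where "s = T n - \<delta> / 4"
    have s: "s \<in> {- T n<..<T n}" "- s \<in> {- T n<..<T n}" "s + \<delta> > T (Suc n)" "s > 0"
    proof -
      have "\<delta> / 2 \<le> T n" unfolding T_def using \<delta>(1) by simp
      then show "s \<in> {- T n<..<T n}" "- s \<in> {- T n<..<T n}" "s + \<delta> > T (Suc n)" "s > 0"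
        using \<delta>(1) T(2)[of n] unfolding s_def by (simp_all add: field_simps)
    qed
    have step: "\<exists>\<gamma>2. icurve {s' - \<delta><..<s' + \<delta>} \<gamma>2 \<and> \<gamma>2 s' = \<gamma> s'" if s': "s' \<in> {- T n<..<T n}" for s'
    proof -
      have "p (\<gamma> s') = p \<alpha>" using p_curve_constant_on[OF \<gamma>(1) s', of 0] \<gamma>(2) T(1)[of n] by simp
      from \<delta>(2)[OF dot_in_cotangent[OF icurveD(1)[OF \<gamma>(1) s']] this]
      obtain \<gamma>2 where g2: "icurve {-\<delta><..<\<delta>} \<gamma>2" "\<gamma>2 0 = \<gamma> s'" by blast
      have "{t. t + - s' \<in> {-\<delta><..<\<delta>}} = {s' - \<delta><..<s' + \<delta>}" by auto
      with icurve_shift[OF g2(1), of "- s'"] g2(2) show ?thesis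
        by (intro exI[of _ "\<lambda>t. \<gamma>2 (t + - s')"]) simp
    qed
    obtain \<gamma>2 where g2: "icurve {s - \<delta><..<s + \<delta>} \<gamma>2" "\<gamma>2 s = \<gamma> s" using step[OF s(1)] by blast
    have "s \<in> {s - \<delta><..<s + \<delta>}" using \<delta>(1) by simp
    from icurve_glue[OF \<gamma>(1) g2(1) s(1) this g2(2)[symmetric]] obtain \<gamma>3 where
      g3: "icurve {min (- T n) (s - \<delta>)<..<max (T n) (s + \<delta>)} \<gamma>3" "\<And>t. t \<in> {- T n<..<T n} \<Longrightarrow> \<gamma>3 t = \<gamma> t" by blast
    obtain \<gamma>4 where g4: "icurve {- s - \<delta><..<- s + \<delta>} \<gamma>4" "\<gamma>4 (- s) = \<gamma> (- s)" using step[OF s(2)] by blast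
    have m: "- s \<in> {min (- T n) (s - \<delta>)<..<max (T n) (s + \<delta>)}" "- s \<in> {- s - \<delta><..<- s + \<delta>}" using s(2) \<delta>(1) by auto
    have "\<gamma>3 (- s) = \<gamma>4 (- s)" using g3(2)[OF s(2)] g4(2) by simp
    from icurve_glue[OF g3(1) g4(1) m this] obtain \<gamma>5 where
      g5: "icurve {min (min (- T n) (s - \<delta>)) (- s - \<delta>)<..<max (max (T n) (s + \<delta>)) (- s + \<delta>)} \<gamma>5"
        "\<And>t. t \<in> {min (- T n) (s - \<delta>)<..<max (T n) (s + \<delta>)} \<Longrightarrow> \<gamma>5 t = \<gamma>3 t" by blast
    have "icurve {- T (Suc n)<..<T (Suc n)} \<gamma>5"
      by (rule icurve_subset[OF g5(1)]) (use s in auto)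
    moreover have "0 \<in> {min (- T n) (s - \<delta>)<..<max (T n) (s + \<delta>)}"
      using T(1)[of n] by (simp add: min_less_iff_disj less_max_iff_disj)
    then have "\<gamma>5 0 = \<alpha>" using g5(2)[of 0] g3(2)[of 0] \<gamma>(2) T(1)[of n] by simp
    ultimately show ?case by blast
  qed
  then obtain \<Gamma> where \<Gamma>: "\<And>n. icurve {- T n<..<T n} (\<Gamma> n)" "\<And>n. \<Gamma> n 0 = \<alpha>" by metis
  have agree: "\<Gamma> m t = \<Gamma> n t" if t: "\<bar>t\<bar> < T m" "m \<le> n" for m n t
  proof (rule icurve_unique)
    have le: "T m \<le> T n" using t(2) \<delta>(1) unfolding T_def by (intro mult_right_mono) auto
    show "icurve {- T m<..<T m} (\<Gamma> n)" by (rule icurve_subset[OF \<Gamma>(1)[of n]]) (use le in auto)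
    show "0 \<in> {- T m<..<T m}" "\<Gamma> m 0 = \<Gamma> n 0" "t \<in> {- T m<..<T m}" using T(1)[of m] \<Gamma>(2) t by auto
  qed (use \<Gamma> in auto)
  define N where "N t = (LEAST n. \<bar>t\<bar> < T n)" for t
  have N: "\<bar>t\<bar> < T (N t)" "\<bar>t\<bar> < T n \<Longrightarrow> N t \<le> n" for t n
  proof -
    obtain n where "\<bar>t\<bar> / (\<delta> / 2) < real n" using reals_Archimedean2 by blast
    then have "\<bar>t\<bar> < real n * (\<delta> / 2)" using \<delta>(1) by (simp add: field_simps)
    also have "\<dots> \<le> T n" using \<delta>(1) unfolding T_def by (intro mult_right_mono) auto
    finally show "\<bar>t\<bar> < T (N t)" unfolding N_def by (rule LeastI)
    show "\<bar>t\<bar> < T n \<Longrightarrow> N t \<le> n" for n unfolding N_def by (rule Least_le)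
  qed
  have "icurve UNIV (\<lambda>t. \<Gamma> (N t) t)"
  proof (rule icurve_local)
    fix t
    show "\<exists>J \<gamma>'. open J \<and> t \<in> J \<and> icurve J \<gamma>' \<and> (\<forall>s\<in>J. \<Gamma> (N s) s = \<gamma>' s)"
      using \<Gamma>(1)[of "N t"] N(1)[of t] agree[OF N(1) N(2)]
      by (intro exI[of _ "{- T (N t)<..<T (N t)}"] exI[of _ "\<Gamma> (N t)"]) auto
  qed
  then show ?thesis using \<Gamma>(2) by blast
qed

lemma G_eq:
  assumes "icurve UNIV \<gamma>" "\<gamma> 0 = \<alpha>" shows "G t \<alpha> = \<gamma> t"
  unfolding G_def integral_curve_iff
proof (rule the_equality)
  show "\<exists>\<gamma>'. icurve UNIV \<gamma>' \<and> \<gamma>' 0 = \<alpha> \<and> \<gamma>' t = \<gamma> t" using assms by blast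
next
  fix \<beta> assume "\<exists>\<gamma>'. icurve UNIV \<gamma>' \<and> \<gamma>' 0 = \<alpha> \<and> \<gamma>' t = \<beta>"
  then obtain \<gamma>' where g: "icurve UNIV \<gamma>'" "\<gamma>' 0 = \<alpha>" "\<gamma>' t = \<beta>" by blast
  have "\<gamma>' t = \<gamma> t"
  proof -
    have "\<gamma>' 0 = \<gamma> 0" using g assms by simp
    from icurve_unique[OF g(1) assms(1) open_UNIV connected_UNIV UNIV_I this UNIV_I] show ?thesis .
  qed
  then show "\<beta> = \<gamma> t" using g by simp
qed

lemma G_curve:
  assumes "\<alpha> \<in> dot_cotangent" shows "icurve UNIV (\<lambda>t. G t \<alpha>)" "G 0 \<alpha> = \<alpha>"
proof -
  obtain \<gamma> where g: "icurve UNIV \<gamma>" "\<gamma> 0 = \<alpha>" using ex_global_curve[OF assms] by blast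
  have "(\<lambda>t. G t \<alpha>) = \<gamma>" using G_eq[OF g] by blast
  with g show "icurve UNIV (\<lambda>t. G t \<alpha>)" "G 0 \<alpha> = \<alpha>" by (auto simp: fun_eq_iff)
qed

lemma G_dot: "\<alpha> \<in> dot_cotangent \<Longrightarrow> G t \<alpha> \<in> dot_cotangent"
  using icurveD(1)[OF G_curve(1)] by blast

lemma G_add:
  assumes "\<alpha> \<in> dot_cotangent" shows "G s (G t \<alpha>) = G (s + t) \<alpha>"
proof -
  have "icurve UNIV (\<lambda>s. G (s + t) \<alpha>)" using icurve_shift[OF G_curve(1)[OF assms], of t] by simp
  from G_eq[OF this] show ?thesis by simp
qed

lemma G_inverse: "\<alpha> \<in> dot_cotangent \<Longrightarrow> G (- t) (G t \<alpha>) = \<alpha>" "\<alpha> \<in> dot_cotangent \<Longrightarrow> G t (G (- t) \<alpha>) = \<alpha>"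
  by (simp_all add: G_add G_curve)

lemma p_G: "\<alpha> \<in> dot_cotangent \<Longrightarrow> p (G t \<alpha>) = p \<alpha>"
  using p_curve_constant[OF G_curve(1), of \<alpha> t 0] G_curve(2) by simp

lemma G_scale:
  assumes "\<alpha> \<in> dot_cotangent" "r > 0" shows "G t (scale r \<alpha>) = scale r (G t \<alpha>)"
  by (rule G_eq[OF icurve_scale[OF G_curve(1)[OF assms(1)] assms(2)]]) (simp add: G_curve(2)[OF assms(1)])

text \<open>Continuity of the flow spreads from short times along a whole curve by the group law.\<close>

definition cont_at :: "real \<Rightarrow> 'a \<times> (('a, 'n) chart \<Rightarrow> real^'n) \<Rightarrow> bool" where
  "cont_at t \<alpha> \<longleftrightarrow> (\<forall>V. openin cot_topology V \<and> G t \<alpha> \<in> V \<longrightarrow>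
     (\<exists>W. openin cot_topology W \<and> \<alpha> \<in> W \<and> W \<subseteq> dot_cotangent \<and> (\<forall>\<beta>\<in>W. G t \<beta> \<in> V)))"

lemma cont_atD:
  assumes "cont_at t \<alpha>" "openin cot_topology V" "G t \<alpha> \<in> V"
  shows "\<exists>W. openin cot_topology W \<and> \<alpha> \<in> W \<and> W \<subseteq> dot_cotangent \<and> (\<forall>\<beta>\<in>W. G t \<beta> \<in> V)"
  using assms(1)[unfolded cont_at_def, rule_format, OF conjI[OF assms(2,3)]] .

lemma cont_at_compose:
  assumes \<alpha>: "\<alpha> \<in> dot_cotangent" and t: "cont_at t \<alpha>" and s: "cont_at s (G t \<alpha>)"
  shows "cont_at (s + t) \<alpha>"
  unfolding cont_at_def
proof (intro allI impI, elim conjE)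
  fix V assume V: "openin cot_topology V" "G (s + t) \<alpha> \<in> V"
  then have "G s (G t \<alpha>) \<in> V" using G_add[OF \<alpha>] by simp
  from cont_atD[OF s V(1) this]
  obtain W where W: "openin cot_topology W" "G t \<alpha> \<in> W" "\<forall>\<beta>\<in>W. G s \<beta> \<in> V" by blast
  from cont_atD[OF t W(1,2)]
  obtain W' where W': "openin cot_topology W'" "\<alpha> \<in> W'" "W' \<subseteq> dot_cotangent" "\<forall>\<beta>\<in>W'. G t \<beta> \<in> W" by blast
  have "\<forall>\<beta>\<in>W'. G (s + t) \<beta> \<in> V"
  proof
    fix \<beta> assume b: "\<beta> \<in> W'"
    then have "G s (G t \<beta>) \<in> V" using W(3) W'(4) by blast
    then show "G (s + t) \<beta> \<in> V" using G_add[OF subsetD[OF W'(3) b], of s t] by simp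
  qed
  with W' show "\<exists>W. openin cot_topology W \<and> \<alpha> \<in> W \<and> W \<subseteq> dot_cotangent \<and> (\<forall>\<beta>\<in>W. G (s + t) \<beta> \<in> V)" by blast
qed

lemma local_flow_G:
  assumes c: "c \<in> A" and r: "r > 0" "cball z0 r \<subseteq> crange c \<times> (UNIV - {0})"
  shows "\<exists>\<delta>>0. \<exists>u. (\<forall>\<beta>. \<beta> \<in> over c \<and> coord c \<beta> \<in> cball z0 (r / 2) \<longrightarrow> \<beta> \<in> dot_cotangent \<and>
         (\<forall>t\<in>{-\<delta><..<\<delta>}. G t \<beta> = of_coord c (u (coord c \<beta>) t) \<and> u (coord c \<beta>) t \<in> cball z0 r)) \<and>
      (\<forall>z\<in>cball z0 (r / 2). \<forall>z'\<in>cball z0 (r / 2). \<forall>t\<in>{-\<delta><..<\<delta>}. norm (u z t - u z' t) \<le> 2 * norm (z - z'))"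
proof -
  from local_curves[OF c r] obtain \<delta> u where \<delta>: "\<delta> > 0" and
    u: "\<forall>z\<in>cball z0 (r / 2). u z 0 = z \<and> (\<forall>t\<in>{-\<delta><..<\<delta>}. u z t \<in> cball z0 r) \<and>
        icurve {-\<delta><..<\<delta>} (\<lambda>t. of_coord c (u z t))" and
    u2: "\<forall>z\<in>cball z0 (r / 2). \<forall>z'\<in>cball z0 (r / 2). \<forall>t\<in>{-\<delta><..<\<delta>}. norm (u z t - u z' t) \<le> 2 * norm (z - z')" by blast
  have "\<beta> \<in> dot_cotangent \<and> (\<forall>t\<in>{-\<delta><..<\<delta>}. G t \<beta> = of_coord c (u (coord c \<beta>) t) \<and> u (coord c \<beta>) t \<in> cball z0 r)"
    if b: "\<beta> \<in> over c" "coord c \<beta> \<in> cball z0 (r / 2)" for \<beta>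
  proof -
    note u' = bspec[OF u b(2)]
    have ic: "icurve {-\<delta><..<\<delta>} (\<lambda>t. of_coord c (u (coord c \<beta>) t))" using u' by blast
    have z: "of_coord c (u (coord c \<beta>) 0) = \<beta>" using u' c b(1) by simp
    have 0: "0 \<in> {-\<delta><..<\<delta>}" using \<delta> by simp
    have dot: "\<beta> \<in> dot_cotangent" using icurveD(1)[OF ic 0] z by simp
    have "G t \<beta> = of_coord c (u (coord c \<beta>) t)" if t: "t \<in> {-\<delta><..<\<delta>}" for t
      by (rule icurve_unique[OF icurve_subset[OF G_curve(1)[OF dot] subset_UNIV] ic _ _ 0 _ t]) (use z G_curve(2)[OF dot] in auto)
    with u' dot show ?thesis by blast
  qed
  with \<delta> u2 show ?thesis by (intro exI[of _ \<delta>] conjI exI[of _ u] allI impI) blast+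
qed

lemma cont_at_local:
  assumes \<alpha>: "\<alpha> \<in> dot_cotangent"
  shows "\<exists>W \<delta>. openin cot_topology W \<and> \<alpha> \<in> W \<and> \<delta> > 0 \<and> (\<forall>\<beta>\<in>W. \<forall>t. \<bar>t\<bar> < \<delta> \<longrightarrow> cont_at t \<beta>)"
proof -
  obtain c where c: "c \<in> A" "\<alpha> \<in> over c" using ex_over[OF dot_in_cotangent[OF \<alpha>]] by blast
  let ?z = "coord c \<alpha>"
  obtain r where r: "r > 0" "cball ?z r \<subseteq> crange c \<times> (UNIV - {0})" using ex_cball_dot[OF c \<alpha>] by blast
  from local_flow_G[OF c(1) r] obtain \<delta> u where \<delta>: "\<delta> > 0" and
    u1: "\<And>\<beta>. \<beta> \<in> over c \<and> coord c \<beta> \<in> cball ?z (r / 2) \<Longrightarrow> \<beta> \<in> dot_cotangent \<and>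
         (\<forall>t\<in>{-\<delta><..<\<delta>}. G t \<beta> = of_coord c (u (coord c \<beta>) t) \<and> u (coord c \<beta>) t \<in> cball ?z r)" and
    u2: "\<forall>z\<in>cball ?z (r / 2). \<forall>z'\<in>cball ?z (r / 2). \<forall>t\<in>{-\<delta><..<\<delta>}. norm (u z t - u z' t) \<le> 2 * norm (z - z')" by blast
  let ?W = "{\<beta> \<in> over c. coord c \<beta> \<in> ball ?z (r / 2)}"
  have "cont_at t \<beta>" if b: "\<beta> \<in> ?W" and t: "\<bar>t\<bar> < \<delta>" for \<beta> t
    unfolding cont_at_def
  proof (intro allI impI, elim conjE)
    fix V assume V: "openin cot_topology V" "G t \<beta> \<in> V"
    have tI: "t \<in> {-\<delta><..<\<delta>}" using t by auto
    have in_cr: "fst w \<in> crange c" if "w \<in> cball ?z r" for w using subsetD[OF r(2) that] by (simp add: mem_Times_iff)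
    have b': "\<beta> \<in> over c \<and> coord c \<beta> \<in> cball ?z (r / 2)" using b by auto
    have w: "G t \<beta> = of_coord c (u (coord c \<beta>) t)" "u (coord c \<beta>) t \<in> cball ?z r" using u1[OF b'] tI by blast+
    have "of_coord c (u (coord c \<beta>) t) \<in> V \<inter> over c" using V(2) w of_coord_in[OF c(1) in_cr[OF w(2)]] by simp
    then have "coord c (of_coord c (u (coord c \<beta>) t)) \<in> coord c ` (V \<inter> over c)" by (rule imageI)
    then have "u (coord c \<beta>) t \<in> coord c ` (V \<inter> over c)" using c(1) in_cr[OF w(2)] by simp
    then obtain e where e: "e > 0" "ball (u (coord c \<beta>) t) e \<subseteq> coord c ` (V \<inter> over c)"
      using open_coord_image[OF V(1) c(1)] openE by blast
    let ?W' = "{\<beta>' \<in> over c. coord c \<beta>' \<in> ball ?z (r / 2) \<inter> ball (coord c \<beta>) (e / 2)}"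
    have "openin cot_topology ?W'" by (rule openin_coord_vimage[OF c(1) open_Int[OF open_ball open_ball]])
    moreover have "\<beta> \<in> ?W'" using b e(1) by auto
    moreover have "\<beta>' \<in> dot_cotangent \<and> G t \<beta>' \<in> V" if b2: "\<beta>' \<in> ?W'" for \<beta>'
    proof -
      have b3: "\<beta>' \<in> over c \<and> coord c \<beta>' \<in> cball ?z (r / 2)" using b2 by auto
      have w': "G t \<beta>' = of_coord c (u (coord c \<beta>') t)" "u (coord c \<beta>') t \<in> cball ?z r" "\<beta>' \<in> dot_cotangent"
        using u1[OF b3] tI by blast+
      have "norm (u (coord c \<beta>) t - u (coord c \<beta>') t) \<le> 2 * norm (coord c \<beta> - coord c \<beta>')"
        using u2 b' b3 tI by blast
      also have "\<dots> < e" using b2 by (auto simp: dist_norm)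
      finally have "u (coord c \<beta>') t \<in> coord c ` (V \<inter> over c)" using e(2) by (auto simp: dist_norm)
      moreover have "coord c (G t \<beta>') = u (coord c \<beta>') t" "G t \<beta>' \<in> over c"
        using w' c(1) in_cr[OF w'(2)] of_coord_in[OF c(1) in_cr[OF w'(2)]] by simp_all
      ultimately have "G t \<beta>' \<in> V" using in_if_coord_in_image[OF c(1)] by metis
      with w'(3) show ?thesis by blast
    qed
    ultimately show "\<exists>W. openin cot_topology W \<and> \<beta> \<in> W \<and> W \<subseteq> dot_cotangent \<and> (\<forall>\<beta>\<in>W. G t \<beta> \<in> V)"
      by (intro exI[of _ ?W']) blast
  qed
  moreover have "openin cot_topology ?W" by (rule openin_coord_vimage[OF c(1) open_ball])
  moreover have "\<alpha> \<in> ?W" using c r by simp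
  ultimately show ?thesis using \<delta> by (intro exI[of _ ?W] exI[of _ \<delta>]) simp
qed

lemma G_cont_at:
  assumes \<alpha>: "\<alpha> \<in> dot_cotangent" shows "cont_at t \<alpha>"
proof -
  define Q where "Q = {t. cont_at t \<alpha>}"
  have loc: "\<exists>\<eta>>0. \<forall>t t'. \<bar>t - t0\<bar> < \<eta> \<longrightarrow> \<bar>t' - t0\<bar> < \<eta> \<longrightarrow> t' \<in> Q \<longrightarrow> t \<in> Q" for t0
  proof -
    obtain W \<delta> where W: "openin cot_topology W" "G t0 \<alpha> \<in> W" "\<delta> > 0" "\<And>\<beta> t. \<beta> \<in> W \<Longrightarrow> \<bar>t\<bar> < \<delta> \<Longrightarrow> cont_at t \<beta>"
      using cont_at_local[OF G_dot[OF \<alpha>, of t0]] by blast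
    obtain \<epsilon> where e: "\<epsilon> > 0" "\<And>s. \<bar>s - t0\<bar> < \<epsilon> \<Longrightarrow> G s \<alpha> \<in> W"
      using icurve_near[OF G_curve(1)[OF \<alpha>] open_UNIV UNIV_I W(1,2)] by blast
    have "t \<in> Q" if t: "\<bar>t - t0\<bar> < min \<epsilon> (\<delta> / 2)" "\<bar>t' - t0\<bar> < min \<epsilon> (\<delta> / 2)" "t' \<in> Q" for t t'
    proof -
      have "\<bar>t - t'\<bar> < \<delta>" using t(1,2) by linarith
      then have "cont_at (t - t') (G t' \<alpha>)" using W(4) e(2)[of t'] t(2) by simp
      from cont_at_compose[OF \<alpha> _ this] t(3) show ?thesis by (simp add: Q_def)
    qed
    then have "\<forall>t t'. \<bar>t - t0\<bar> < min \<epsilon> (\<delta> / 2) \<longrightarrow> \<bar>t' - t0\<bar> < min \<epsilon> (\<delta> / 2) \<longrightarrow> t' \<in> Q \<longrightarrow> t \<in> Q"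
      by blast
    moreover have "min \<epsilon> (\<delta> / 2) > 0" using e(1) W(3) by simp
    ultimately show ?thesis by (intro exI[of _ "min \<epsilon> (\<delta> / 2)"] conjI)
  qed
  have "open Q"
    unfolding open_dist
  proof
    fix t0 assume "t0 \<in> Q"
    moreover obtain \<eta> where "\<eta> > 0" "\<forall>t t'. \<bar>t - t0\<bar> < \<eta> \<longrightarrow> \<bar>t' - t0\<bar> < \<eta> \<longrightarrow> t' \<in> Q \<longrightarrow> t \<in> Q" using loc[of t0] by blast
    moreover have "\<bar>t0 - t0\<bar> < \<eta>" using \<open>\<eta> > 0\<close> by simp
    ultimately show "\<exists>e>0. \<forall>y. dist y t0 < e \<longrightarrow> y \<in> Q" unfolding dist_real_def by blast
  qed
  moreover have "open (- Q)"
    unfolding open_dist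
  proof
    fix t0 assume "t0 \<in> - Q"
    moreover obtain \<eta> where "\<eta> > 0" "\<forall>t t'. \<bar>t - t0\<bar> < \<eta> \<longrightarrow> \<bar>t' - t0\<bar> < \<eta> \<longrightarrow> t' \<in> Q \<longrightarrow> t \<in> Q" using loc[of t0] by blast
    moreover have "\<bar>t0 - t0\<bar> < \<eta>" using \<open>\<eta> > 0\<close> by simp
    ultimately show "\<exists>e>0. \<forall>y. dist y t0 < e \<longrightarrow> y \<in> - Q" unfolding dist_real_def by blast
  qed
  ultimately have "Q = {} \<or> - Q = {}" using connectedD[OF connected_UNIV, of Q "- Q"] by simp
  moreover have "0 \<in> Q"
  proof -
    obtain W \<delta> where "\<alpha> \<in> W" "\<delta> > 0" "\<forall>\<beta>\<in>W. \<forall>t. \<bar>t\<bar> < \<delta> \<longrightarrow> cont_at t \<beta>"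
      using cont_at_local[OF \<alpha>] by blast
    then show ?thesis unfolding Q_def by simp
  qed
  ultimately have "t \<in> Q" by blast
  then show ?thesis by (simp add: Q_def)
qed

lemma openin_G_vimage:
  assumes V: "openin cot_topology V"
  shows "openin cot_topology {\<alpha> \<in> dot_cotangent. G t \<alpha> \<in> V}"
proof (rule openin_cot_locally)
  show "{\<alpha> \<in> dot_cotangent. G t \<alpha> \<in> V} \<subseteq> cotangent" using dot_in_cotangent by blast
  fix \<alpha> assume "\<alpha> \<in> {\<alpha> \<in> dot_cotangent. G t \<alpha> \<in> V}"
  then have "\<alpha> \<in> dot_cotangent" "G t \<alpha> \<in> V" by blast+
  from cont_atD[OF G_cont_at[OF this(1)] V this(2)]
  obtain W where "openin cot_topology W" "\<alpha> \<in> W" "W \<subseteq> dot_cotangent" "\<forall>\<beta>\<in>W. G t \<beta> \<in> V" by blast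
  then show "\<exists>W. openin cot_topology W \<and> \<alpha> \<in> W \<and> W \<subseteq> {\<alpha> \<in> dot_cotangent. G t \<alpha> \<in> V}"
    by (intro exI[of _ W]) blast
qed

end

section \<open>The time between two returns\<close>

context compact_riemannian_submanifold
begin

lemma adaptedD:
  assumes "adapted H d c D"
  shows "c \<in> A" "card D = d" "y \<in> cdom c \<Longrightarrow> y \<in> H \<longleftrightarrow> (\<forall>i. i \<notin> D \<longrightarrow> cmap c y $ i = 0)"
proof -
  show c: "c \<in> A" "card D = d" using assms unfolding adapted_def by blast+
  assume y: "y \<in> cdom c"
  have eq: "cmap c ` (H \<inter> cdom c) = {x \<in> crange c. \<forall>i. i \<notin> D \<longrightarrow> x $ i = 0}" using assms unfolding adapted_def by blast
  have "y \<in> H \<longleftrightarrow> cmap c y \<in> cmap c ` (H \<inter> cdom c)"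
  proof
    assume "cmap c y \<in> cmap c ` (H \<inter> cdom c)"
    then obtain y' where y': "y' \<in> H" "y' \<in> cdom c" "cmap c y = cmap c y'" by blast
    then have "y = y'" using cinv_cmap[OF c(1)] y by metis
    then show "y \<in> H" using y' by simp
  qed (use y in blast)
  also have "\<dots> \<longleftrightarrow> (\<forall>i. i \<notin> D \<longrightarrow> cmap c y $ i = 0)" unfolding eq using y by blast
  finally show "y \<in> H \<longleftrightarrow> (\<forall>i. i \<notin> D \<longrightarrow> cmap c y $ i = 0)" .
qed

lemma dot_conormalD:
  assumes "\<alpha> \<in> dot_conormal"
  shows "\<alpha> \<in> dot_cotangent" "\<alpha> \<in> cotangent" "fst \<alpha> \<in> H"
    "adapted H d c D \<Longrightarrow> fst \<alpha> \<in> cdom c \<Longrightarrow> i \<in> D \<Longrightarrow> snd (coord c \<alpha>) $ i = 0"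
    "adapted H d c D \<Longrightarrow> fst \<alpha> \<in> cdom c \<Longrightarrow> i \<notin> D \<Longrightarrow> fst (coord c \<alpha>) $ i = 0"
proof -
  show "\<alpha> \<in> dot_cotangent" and H: "fst \<alpha> \<in> H" using assms unfolding dot_conormal_def by blast+
  then show "\<alpha> \<in> cotangent" using dot_in_cotangent by blast
  show "adapted H d c D \<Longrightarrow> fst \<alpha> \<in> cdom c \<Longrightarrow> i \<in> D \<Longrightarrow> snd (coord c \<alpha>) $ i = 0"
    using assms unfolding dot_conormal_def coord_def snd_conv by blast
  show "adapted H d c D \<Longrightarrow> fst \<alpha> \<in> cdom c \<Longrightarrow> i \<notin> D \<Longrightarrow> fst (coord c \<alpha>) $ i = 0"
    using adaptedD(3)[of c D "fst \<alpha>"] H by (simp add: fst_coord)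
qed

lemma SN_D: "\<alpha> \<in> SN \<Longrightarrow> \<alpha> \<in> dot_conormal" "\<alpha> \<in> SN \<Longrightarrow> p \<alpha> = 1"
  unfolding SN_def by blast+

text \<open>
  A curve starts orthogonally to \<open>H\<close>: in an adapted chart \<open>f(t) = \<langle>x(t), \<xi>(0)\<rangle>\<close> vanishes whenever the
  curve is on the conormal bundle, while \<open>f' = p - \<langle>x', \<xi>(t) - \<xi>(0)\<rangle>\<close> is positive for small times.
\<close>

lemma return_gap: "\<exists>\<delta>>0. \<forall>\<alpha>\<in>SN. \<forall>t. t \<noteq> 0 \<and> \<bar>t\<bar> < \<delta> \<longrightarrow> G t \<alpha> \<notin> dot_conormal"
proof -
  let ?P = "\<lambda>\<delta> \<alpha>. \<alpha> \<in> SN \<longrightarrow> (\<forall>t. t \<noteq> 0 \<and> \<bar>t\<bar> < \<delta> \<longrightarrow> G t \<alpha> \<notin> dot_conormal)"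
  have "\<exists>\<delta>>0. \<forall>\<alpha>\<in>cotangent. p \<alpha> = 1 \<longrightarrow> ?P \<delta> \<alpha>"
  proof (rule uniform_on_level)
    fix \<alpha>0 assume a0: "\<alpha>0 \<in> cotangent" "p \<alpha>0 = 1"
    show "\<exists>W \<delta>. openin cot_topology W \<and> \<alpha>0 \<in> W \<and> \<delta> > 0 \<and> (\<forall>\<alpha>\<in>W. p \<alpha> = 1 \<longrightarrow> ?P \<delta> \<alpha>)"
    proof (cases "fst \<alpha>0 \<in> H")
      case False
      have "open (- H)" by (rule open_Compl[OF compact_imp_closed[OF compact_H]])
      from openin_fst_vimage[OF this] have o: "openin cot_topology {\<alpha> \<in> cotangent. fst \<alpha> \<in> - H}" .
      have "?P 1 \<alpha>" if "\<alpha> \<in> {\<alpha> \<in> cotangent. fst \<alpha> \<in> - H}" for \<alpha>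
        using that dot_conormalD(3)[OF SN_D(1)] by blast
      with o a0 False show ?thesis by (intro exI[of _ "{\<alpha> \<in> cotangent. fst \<alpha> \<in> - H}"] exI[of _ 1]) simp
    next
      case True
      then obtain c D where cD: "adapted H d c D" "fst \<alpha>0 \<in> cdom c" using submanifold by blast
      note c = adaptedD(1)[OF cD(1)]
      have ov: "\<alpha>0 \<in> over c" by (rule overI[OF a0(1) cD(2)])
      have dot: "\<alpha>0 \<in> dot_cotangent" using p_pos_iff[OF a0(1)] a0(2) by simp
      let ?z = "coord c \<alpha>0"
      obtain r where r: "r > 0" "cball ?z r \<subseteq> crange c \<times> (UNIV - {0})" using ex_cball_dot[OF c ov dot] by blast
      have "bounded (H_p c ` cball ?z r)"
        by (intro compact_imp_bounded compact_continuous_image continuous_on_subset[OF continuous_on_H_p[OF c] r(2)] compact_cball)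
      then obtain B where B: "B > 0" "\<And>w. w \<in> cball ?z r \<Longrightarrow> norm (H_p c w) \<le> B"
        unfolding bounded_pos by blast
      from local_flow_G[OF c r] obtain \<delta> u where \<delta>: "\<delta> > 0" and
        u1: "\<And>\<beta>. \<beta> \<in> over c \<and> coord c \<beta> \<in> cball ?z (r / 2) \<Longrightarrow> \<beta> \<in> dot_cotangent \<and>
         (\<forall>t\<in>{-\<delta><..<\<delta>}. G t \<beta> = of_coord c (u (coord c \<beta>) t) \<and> u (coord c \<beta>) t \<in> cball ?z r)" by blast
      \<comment> \<open>The velocity and the derivative of the covector are at most \<open>B\<close>, so with the initial covector in place of the current one their pairing \<open>p = 1\<close> changes by less than \<open>1\<close>.\<close>
      define \<delta>' where "\<delta>' = min \<delta> (1 / (B * B))"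
      have \<delta>': "\<delta>' > 0" "\<delta>' \<le> \<delta>" "\<delta>' * (B * B) \<le> 1"
      proof -
        show "\<delta>' > 0" "\<delta>' \<le> \<delta>" using \<delta> B(1) by (auto simp: \<delta>'_def)
        have "\<delta>' * (B * B) \<le> 1 / (B * B) * (B * B)" by (intro mult_right_mono) (auto simp: \<delta>'_def)
        then show "\<delta>' * (B * B) \<le> 1" using B(1) by simp
      qed
      let ?W = "{\<beta> \<in> over c. coord c \<beta> \<in> ball ?z (r / 2)}"
      have "?P \<delta>' \<alpha>" if \<alpha>: "\<alpha> \<in> ?W" for \<alpha>
      proof (intro impI allI notI, elim conjE)
        fix t assume SN: "\<alpha> \<in> SN" and t: "t \<noteq> 0" "\<bar>t\<bar> < \<delta>'" and ret: "G t \<alpha> \<in> dot_conormal"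
        have \<alpha>': "\<alpha> \<in> over c \<and> coord c \<alpha> \<in> cball ?z (r / 2)" using \<alpha> by auto
        let ?w = "\<lambda>s. coord c (G s \<alpha>)"
        have dot\<alpha>: "\<alpha> \<in> dot_cotangent" using u1[OF \<alpha>'] by blast
        have w: "G s \<alpha> \<in> over c" "?w s \<in> cball ?z r" "fst (?w s) \<in> crange c" "snd (?w s) \<noteq> 0"
          if s: "\<bar>s\<bar> < \<delta>'" for s
        proof -
          have "s \<in> {-\<delta><..<\<delta>}" using s \<delta>'(2) by auto
          then have eq: "G s \<alpha> = of_coord c (u (coord c \<alpha>) s)" and wb: "u (coord c \<alpha>) s \<in> cball ?z r" using u1[OF \<alpha>'] by blast+
          have m: "fst (u (coord c \<alpha>) s) \<in> crange c" "snd (u (coord c \<alpha>) s) \<noteq> 0" using subsetD[OF r(2) wb] by (simp_all add: mem_Times_iff)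
          show "G s \<alpha> \<in> over c" unfolding eq by (rule of_coord_in[OF c m(1)])
          show "?w s \<in> cball ?z r" "fst (?w s) \<in> crange c" "snd (?w s) \<noteq> 0" using eq wb m c by simp_all
        qed
        have der: "(?w has_vector_derivative H_p c (?w s)) (at s)" if "\<bar>s\<bar> < \<delta>'" for s
          by (rule icurveD(2)[OF G_curve(1)[OF dot\<alpha>] UNIV_I c over_fst[OF w(1)[OF that]]])
        have diff: "norm (?w s - ?w 0) \<le> B * \<bar>s\<bar>" if s: "\<bar>s\<bar> < \<delta>'" for s
        proof -
          have "norm (?w s - ?w 0) \<le> B * \<bar>s - 0\<bar>"
          proof (rule norm_diff_le_vector_derivative_bound[where S = "{-\<delta>'<..<\<delta>'}" and w' = "\<lambda>s. H_p c (?w s)"])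
            fix t' assume "t' \<in> {-\<delta>'<..<\<delta>'}"
            then have t': "\<bar>t'\<bar> < \<delta>'" by auto
            show "(?w has_vector_derivative H_p c (?w t')) (at t' within {-\<delta>'<..<\<delta>'})"
              by (rule has_vector_derivative_at_within[OF der[OF t']])
            show "norm (H_p c (?w t')) \<le> B" by (rule B(2)[OF w(2)[OF t']])
          qed (use s \<delta>'(1) in auto)
          then show ?thesis by simp
        qed
        let ?\<xi> = "snd (?w 0)"
        define f where "f s = fst (?w s) \<bullet> ?\<xi>" for s
        have f': "(f has_field_derivative fst (H_p c (?w s)) \<bullet> ?\<xi>) (at s)" if "\<bar>s\<bar> < \<delta>'" for s
        proof -
          have "bounded_linear (\<lambda>z::(real^'n) \<times> (real^'n). fst z \<bullet> ?\<xi>)"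
            by (rule bounded_linear_compose[OF bounded_linear_inner_left bounded_linear_fst])
          from bounded_linear.has_vector_derivative[OF this der[OF that]]
          show ?thesis unfolding f_def[abs_def] has_real_derivative_iff_has_vector_derivative .
        qed
        have pos: "fst (H_p c (?w s)) \<bullet> ?\<xi> > 0" if s: "\<bar>s\<bar> < \<delta>'" for s
        proof -
          have "p_loc c (?w s) = 1"
            using p_eq[OF w(1)[OF s] c] p_G[OF dot\<alpha>] SN_D(2)[OF SN] by simp
          then have 1: "fst (H_p c (?w s)) \<bullet> snd (?w s) = 1" using H_p_pairing[OF c w(3,4)[OF s]] by simp
          have "fst (H_p c (?w s)) \<bullet> (snd (?w s) - ?\<xi>) \<le> norm (fst (H_p c (?w s))) * norm (snd (?w s) - ?\<xi>)"
            by (rule norm_cauchy_schwarz)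
          also have "\<dots> \<le> B * (B * \<bar>s\<bar>)"
          proof (rule mult_mono)
            show "norm (fst (H_p c (?w s))) \<le> B"
              using norm_fst_le[of "fst (H_p c (?w s))" "snd (H_p c (?w s))"] B(2)[OF w(2)[OF s]] by simp
            have "norm (snd (?w s - ?w 0)) \<le> norm (?w s - ?w 0)"
              using norm_snd_le[of "snd (?w s - ?w 0)" "fst (?w s - ?w 0)"] by (simp only: prod.collapse)
            then have "norm (snd (?w s) - ?\<xi>) \<le> norm (?w s - ?w 0)" by (simp only: snd_diff)
            then show "norm (snd (?w s) - ?\<xi>) \<le> B * \<bar>s\<bar>" using diff[OF s] by linarith
          qed (use B(1) in auto)
          also have "\<dots> = \<bar>s\<bar> * (B * B)" by simp
          also have "\<dots> < \<delta>' * (B * B)" using s B(1) by (intro mult_strict_right_mono) auto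
          also have "\<dots> \<le> 1" by (rule \<delta>'(3))
          finally show ?thesis using 1 by (simp add: inner_diff_right)
        qed
        have \<xi>: "?\<xi> $ i = 0" if "i \<in> D" for i
          using dot_conormalD(4)[OF SN_D(1)[OF SN] cD(1) _ that] G_curve(2)[OF dot\<alpha>] over_fst \<alpha>' by simp
        have zero: "f s = 0" if s: "G s \<alpha> \<in> dot_conormal" "\<bar>s\<bar> < \<delta>'" for s
          unfolding f_def inner_vec_def
        proof (rule sum.neutral, rule ballI)
          fix i
          show "fst (?w s) $ i \<bullet> ?\<xi> $ i = 0"
            using \<xi>[of i] dot_conormalD(5)[OF s(1) cD(1) over_fst[OF w(1)[OF s(2)]], of i] by (cases "i \<in> D") simp_all
        qed
        have f0: "f 0 = 0" using zero[of 0] SN_D(1)[OF SN] G_curve(2)[OF dot\<alpha>] \<delta>'(1) by simp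
        have ft: "f t = 0" by (rule zero[OF ret t(2)])
        show False
        proof (cases "t > 0")
          case True
          have "(f has_field_derivative fst (H_p c (?w s)) \<bullet> ?\<xi>) (at s)" if "0 \<le> s" "s \<le> t" for s using f' that t(2) by auto
          from MVT2[OF True this] obtain s where "0 < s" "s < t" "f t - f 0 = (t - 0) * (fst (H_p c (?w s)) \<bullet> ?\<xi>)" by blast
          then show False using pos[of s] f0 ft t True by auto
        next
          case False
          then have neg: "t < 0" using t(1) by simp
          have "(f has_field_derivative fst (H_p c (?w s)) \<bullet> ?\<xi>) (at s)" if "t \<le> s" "s \<le> 0" for s using f' that t(2) by auto
          from MVT2[OF neg this] obtain s where "t < s" "s < 0" "f 0 - f t = (0 - t) * (fst (H_p c (?w s)) \<bullet> ?\<xi>)" by blast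
          then show False using pos[of s] f0 ft t neg by auto
        qed
      qed
      moreover have "openin cot_topology ?W" by (rule openin_coord_vimage[OF c open_ball])
      moreover have "\<alpha>0 \<in> ?W" using ov r by simp
      ultimately show ?thesis using \<delta>'(1) by (intro exI[of _ ?W] exI[of _ \<delta>']) simp
    qed
  next
    fix \<delta> \<delta>' \<alpha> assume "?P \<delta> \<alpha>" "0 < \<delta>'" "\<delta>' \<le> \<delta>"
    then show "?P \<delta>' \<alpha>" using order_less_le_trans by blast
  qed
  then obtain \<delta> where \<delta>: "\<delta> > 0" "\<forall>\<alpha>\<in>cotangent. p \<alpha> = 1 \<longrightarrow> ?P \<delta> \<alpha>" by blast
  have "\<alpha> \<in> cotangent" "p \<alpha> = 1" if "\<alpha> \<in> SN" for \<alpha>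
    using SN_D[OF that] dot_conormalD(2) by blast+
  then have "\<forall>\<alpha>\<in>SN. \<forall>t. t \<noteq> 0 \<and> \<bar>t\<bar> < \<delta> \<longrightarrow> G t \<alpha> \<notin> dot_conormal" using \<delta>(2) by blast
  with \<delta>(1) show ?thesis by blast
qed

end

section \<open>Borel sets of the cotangent bundle\<close>

context compact_riemannian
begin

definition cot_borel :: "('a \<times> (('a, 'n) chart \<Rightarrow> real^'n)) measure" where
  "cot_borel = sigma cotangent {S. openin cot_topology S}"

lemma space_cot_borel [simp]: "space cot_borel = cotangent"
  unfolding cot_borel_def using openin_subset by (intro space_measure_of) fastforce

lemma sets_cot_borel: "sets cot_borel = sigma_sets cotangent {S. openin cot_topology S}"
  unfolding cot_borel_def using openin_subset by (intro sets_measure_of) fastforce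

lemma openin_cot_borel: "openin cot_topology S \<Longrightarrow> S \<in> sets cot_borel"
  unfolding sets_cot_borel by (rule sigma_sets.Basic) simp

lemma cot_borel_subset: "S \<in> sets cot_borel \<Longrightarrow> S \<subseteq> cotangent"
  using sets.sets_into_space by fastforce

lemma measurable_to_cot_borel:
  assumes "\<And>x. x \<in> space M \<Longrightarrow> f x \<in> cotangent" "\<And>S. openin cot_topology S \<Longrightarrow> f -` S \<inter> space M \<in> sets M"
  shows "f \<in> M \<rightarrow>\<^sub>M cot_borel"
  unfolding cot_borel_def using assms openin_subset[of cot_topology]
  by (intro measurable_measure_of) (fastforce, blast, blast)

lemma over_cot_borel: "c \<in> A \<Longrightarrow> over c \<in> sets cot_borel"
  by (rule openin_cot_borel[OF openin_over])

lemma dot_cot_borel: "dot_cotangent \<in> sets cot_borel"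
  by (rule openin_cot_borel[OF openin_dot_cotangent])

lemma in_sets_restrict:
  assumes "\<Omega> \<in> sets M" "S \<subseteq> \<Omega>" "S \<in> sets M" shows "S \<in> sets (restrict_space M \<Omega>)"
  using assms by (subst sets_restrict_space_iff) (auto dest: sets.sets_into_space)

lemma measurable_vimage_restrict:
  assumes f: "f \<in> restrict_space M \<Omega> \<rightarrow>\<^sub>M N" and \<Omega>: "\<Omega> \<in> sets M" and B: "B \<in> sets N"
  shows "{x \<in> \<Omega>. f x \<in> B} \<in> sets M"
proof -
  have sp: "space (restrict_space M \<Omega>) = \<Omega>" using sets.sets_into_space[OF \<Omega>] by (auto simp: space_restrict_space)
  have "f -` B \<inter> \<Omega> \<in> sets (restrict_space M \<Omega>)" using measurable_sets[OF f B] by (simp only: sp)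
  moreover have "f -` B \<inter> \<Omega> = {x \<in> \<Omega>. f x \<in> B}" by blast
  ultimately have "{x \<in> \<Omega>. f x \<in> B} \<in> sets (restrict_space M \<Omega>)" by simp
  then show ?thesis using \<Omega> sets.sets_into_space[OF \<Omega>] by (subst (asm) sets_restrict_space_iff) auto
qed

lemma measurable_coord:
  assumes c: "c \<in> A" shows "coord c \<in> restrict_space cot_borel (over c) \<rightarrow>\<^sub>M borel"
proof (rule borel_measurableI)
  fix U :: "((real^'n) \<times> (real^'n)) set" assume "open U"
  have sp: "space (restrict_space cot_borel (over c)) = over c"
    using cot_borel_subset[OF over_cot_borel[OF c]] by (auto simp: space_restrict_space)
  have "coord c -` U \<inter> space (restrict_space cot_borel (over c)) = {\<alpha> \<in> over c. coord c \<alpha> \<in> U}" unfolding sp by blast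
  then show "coord c -` U \<inter> space (restrict_space cot_borel (over c)) \<in> sets (restrict_space cot_borel (over c))"
    using in_sets_restrict[OF over_cot_borel[OF c] _ openin_cot_borel[OF openin_coord_vimage[OF c \<open>open U\<close>]]] by simp
qed

lemma coord_vimage_borel:
  "c \<in> A \<Longrightarrow> B \<in> sets borel \<Longrightarrow> {\<alpha> \<in> over c. coord c \<alpha> \<in> B} \<in> sets cot_borel"
  by (rule measurable_vimage_restrict[OF measurable_coord over_cot_borel])

lemma of_coord_vimage_borel:
  assumes c: "c \<in> A" and S: "S \<in> sets cot_borel"
  shows "{z \<in> crange c \<times> UNIV. of_coord c z \<in> S} \<in> sets borel"
proof (rule measurable_vimage_restrict[OF _ _ S])
  show \<Omega>: "crange c \<times> (UNIV :: (real^'n) set) \<in> sets borel" using open_crange_Times[OF c] by simp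
  have sp: "space (restrict_space borel (crange c \<times> (UNIV :: (real^'n) set))) = crange c \<times> UNIV"
    by (simp add: space_restrict_space)
  show "of_coord c \<in> restrict_space borel (crange c \<times> UNIV) \<rightarrow>\<^sub>M cot_borel"
  proof (rule measurable_to_cot_borel)
    fix z :: "(real^'n) \<times> (real^'n)" assume "z \<in> space (restrict_space borel (crange c \<times> UNIV))"
    then have "fst z \<in> crange c" unfolding sp by (simp add: mem_Times_iff)
    then show "of_coord c z \<in> cotangent" using of_coord_in[OF c] over_cotangent by blast
  next
    fix W assume W: "openin cot_topology W"
    have "of_coord c -` W \<inter> crange c \<times> UNIV = coord c ` (W \<inter> over c)"
    proof (intro equalityI subsetI)
      fix z assume z: "z \<in> of_coord c -` W \<inter> crange c \<times> UNIV"
      then have f: "fst z \<in> crange c" by (simp add: mem_Times_iff)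
      have "of_coord c z \<in> W \<inter> over c" using z of_coord_in[OF c f] by simp
      then have "coord c (of_coord c z) \<in> coord c ` (W \<inter> over c)" by (rule imageI)
      then show "z \<in> coord c ` (W \<inter> over c)" using coord_of_coord[OF c f] by simp
    next
      fix z assume "z \<in> coord c ` (W \<inter> over c)"
      then obtain \<alpha> where \<alpha>: "\<alpha> \<in> W" "\<alpha> \<in> over c" "z = coord c \<alpha>" by blast
      then show "z \<in> of_coord c -` W \<inter> crange c \<times> UNIV" using coord_in[OF \<alpha>(2)] c by simp
    qed
    then have "of_coord c -` W \<inter> crange c \<times> UNIV \<in> sets borel" using open_coord_image[OF W c] by simp
    then show "of_coord c -` W \<inter> space (restrict_space borel (crange c \<times> UNIV)) \<in> sets (restrict_space borel (crange c \<times> UNIV))"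
      unfolding sp by (intro in_sets_restrict[OF \<Omega>]) auto
  qed
qed

lemma measurable_p: "p \<in> cot_borel \<rightarrow>\<^sub>M borel"
proof (rule borel_measurableI)
  fix U :: "real set" assume "open U"
  have "p -` U \<inter> space cot_borel = {\<alpha> \<in> cotangent. p \<alpha> \<in> U}" by auto
  then show "p -` U \<inter> space cot_borel \<in> sets cot_borel"
    using openin_cot_borel[OF openin_p_vimage[OF \<open>open U\<close>]] by simp
qed

lemma G_vimage_borel:
  assumes S: "S \<in> sets cot_borel" shows "{\<alpha> \<in> dot_cotangent. G t \<alpha> \<in> S} \<in> sets cot_borel"
proof (rule measurable_vimage_restrict[OF _ dot_cot_borel S])
  have sp: "space (restrict_space cot_borel dot_cotangent) = dot_cotangent"
    using dot_in_cotangent by (auto simp: space_restrict_space)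
  show "G t \<in> restrict_space cot_borel dot_cotangent \<rightarrow>\<^sub>M cot_borel"
  proof (rule measurable_to_cot_borel; unfold sp)
    show "G t \<alpha> \<in> cotangent" if "\<alpha> \<in> dot_cotangent" for \<alpha> using G_dot[OF that] dot_in_cotangent by blast
    fix W assume W: "openin cot_topology W"
    have "G t -` W \<inter> dot_cotangent = {\<alpha> \<in> dot_cotangent. G t \<alpha> \<in> W}" by blast
    then show "G t -` W \<inter> dot_cotangent \<in> sets (restrict_space cot_borel dot_cotangent)"
      using openin_cot_borel[OF openin_G_vimage[OF W]] by (intro in_sets_restrict[OF dot_cot_borel]) auto
  qed
qed

text \<open>Rescaling a covector by a continuous positive function of it.\<close>

lemma scale_vimage_borel:
  assumes S: "S \<in> sets cot_borel" and f: "continuous_on {0<..} f"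
  shows "{\<alpha> \<in> dot_cotangent. scale (f (p \<alpha>)) \<alpha> \<in> S} \<in> sets cot_borel"
proof (rule measurable_vimage_restrict[OF _ dot_cot_borel S])
  have sp: "space (restrict_space cot_borel dot_cotangent) = dot_cotangent"
    using dot_in_cotangent by (auto simp: space_restrict_space)
  show "(\<lambda>\<alpha>. scale (f (p \<alpha>)) \<alpha>) \<in> restrict_space cot_borel dot_cotangent \<rightarrow>\<^sub>M cot_borel"
  proof (rule measurable_to_cot_borel; unfold sp)
    show "scale (f (p \<alpha>)) \<alpha> \<in> cotangent" if "\<alpha> \<in> dot_cotangent" for \<alpha> using scale_in_cotangent[OF dot_in_cotangent[OF that]] .
    fix W assume W: "openin cot_topology W"
    let ?V = "{\<alpha> \<in> dot_cotangent. scale (f (p \<alpha>)) \<alpha> \<in> W}"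
    have "openin cot_topology ?V"
    proof (rule openin_cot_locally)
      show "?V \<subseteq> cotangent" using dot_in_cotangent by blast
      fix \<alpha> assume a: "\<alpha> \<in> ?V"
      obtain c where c: "c \<in> A" "\<alpha> \<in> over c" using ex_over[OF dot_in_cotangent] a by blast
      let ?O = "crange c \<times> (UNIV - {0 :: real^'n})"
      let ?h = "\<lambda>z. (fst z, f (p_loc c z) *\<^sub>R snd z)"
      have "continuous_on ?O (\<lambda>z. f (p_loc c z))"
        by (rule continuous_on_compose2[OF f continuous_on_subset[OF continuous_on_p_loc[OF c(1)]]])
          (blast, intro image_subsetI, simp add: p_loc_pos[OF c(1)] mem_Times_iff)
      then have h: "continuous_on ?O ?h" by (intro continuous_intros)
      have O: "open ?O" using chartD(2)[OF c(1)] by (intro open_Times) auto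
      have op: "open (?O \<inter> ?h -` (coord c ` (W \<inter> over c)))"
        by (rule continuous_open_preimage[OF h O open_coord_image[OF W c(1)]])
      have key: "\<beta> \<in> dot_cotangent \<and> scale (f (p \<beta>)) \<beta> \<in> W \<longleftrightarrow> coord c \<beta> \<in> ?O \<inter> ?h -` (coord c ` (W \<inter> over c))"
        if b: "\<beta> \<in> over c" for \<beta>
      proof -
        have 1: "coord c \<beta> \<in> ?O \<longleftrightarrow> \<beta> \<in> dot_cotangent"
          using dot_cotangent_iff[OF b c(1)] coord_in[OF b] by (auto simp: mem_Times_iff)
        have 2: "?h (coord c \<beta>) = coord c (scale (f (p \<beta>)) \<beta>)" by (simp add: coord_scale p_eq[OF b c(1)])
        have 3: "coord c (scale (f (p \<beta>)) \<beta>) \<in> coord c ` (W \<inter> over c) \<longleftrightarrow> scale (f (p \<beta>)) \<beta> \<in> W"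
          using in_if_coord_in_image[OF c(1) scale_over[OF b]] scale_over[OF b] by blast
        show ?thesis using 1 2 3 by simp
      qed
      let ?U = "{\<beta> \<in> over c. coord c \<beta> \<in> ?O \<inter> ?h -` (coord c ` (W \<inter> over c))}"
      have "openin cot_topology ?U" by (rule openin_coord_vimage[OF c(1) op])
      moreover have "\<alpha> \<in> ?U"
        by (rule CollectI, rule conjI[OF c(2)], rule iffD1[OF key[OF c(2)]]) (use a in simp)
      moreover have "?U \<subseteq> ?V"
      proof (rule subsetI)
        fix \<beta> assume "\<beta> \<in> ?U"
        then show "\<beta> \<in> ?V" using key[of \<beta>] by (simp del: Int_iff)
      qed
      ultimately show "\<exists>U. openin cot_topology U \<and> \<alpha> \<in> U \<and> U \<subseteq> ?V" by (intro exI[of _ ?U] conjI)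
    qed
    moreover have "(\<lambda>\<alpha>. scale (f (p \<alpha>)) \<alpha>) -` W \<inter> dot_cotangent = ?V" by blast
    ultimately show "(\<lambda>\<alpha>. scale (f (p \<alpha>)) \<alpha>) -` W \<inter> dot_cotangent \<in> sets (restrict_space cot_borel dot_cotangent)"
      using openin_cot_borel by (intro in_sets_restrict[OF dot_cot_borel]) auto
  qed
qed

end

section \<open>Coordinates on the conormal bundle\<close>

lemma conormal_param_merge:
  assumes "\<And>i. i \<notin> D \<Longrightarrow> x $ i = 0" "\<And>i. i \<in> D \<Longrightarrow> \<xi> $ i = 0"
  shows "conormal_param D (merge D (x, \<xi>)) = (x, \<xi>)"
  using assms by (auto simp: conormal_param_def merge_def proj_def vec_eq_iff)

lemma merge_conormal_param [simp]: "merge D (conormal_param D z) = z"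
  by (auto simp: conormal_param_def merge_def proj_def vec_eq_iff)

lemma range_conormal_param:
  "range (conormal_param D) = {w :: (real^'n::finite) \<times> (real^'n). (\<forall>i. i \<notin> D \<longrightarrow> fst w $ i = 0) \<and> (\<forall>i\<in>D. snd w $ i = 0)}"
proof (intro equalityI subsetI)
  fix w :: "(real^'n) \<times> (real^'n)" assume "w \<in> {w. (\<forall>i. i \<notin> D \<longrightarrow> fst w $ i = 0) \<and> (\<forall>i\<in>D. snd w $ i = 0)}"
  then have "conormal_param D (merge D w) = w" using conormal_param_merge[of D "fst w" "snd w"] by simp
  then show "w \<in> range (conormal_param D)" by (metis rangeI)
qed (auto simp: conormal_param_def proj_def)

lemma bounded_linear_proj: "bounded_linear (proj D)"
  unfolding linear_conv_bounded_linear[symmetric] by (auto simp: linear_iff proj_def vec_eq_iff)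

lemma bounded_linear_conormal_param: "bounded_linear (conormal_param D)"
  unfolding conormal_param_def[abs_def] by (intro bounded_linear_Pair bounded_linear_proj)

lemma bounded_linear_merge: "bounded_linear (merge D)"
  unfolding linear_conv_bounded_linear[symmetric] by (auto simp: linear_iff merge_def vec_eq_iff split_beta)

context compact_riemannian_submanifold
begin

text \<open>
  The parameters \<open>(x', \<xi>'')\<close> of a conormal covector; \<open>kinv\<close> below is the inverse parametrization, defined on \<open>Zdom\<close>.
\<close>

abbreviation "kap c D \<equiv> (\<lambda>\<alpha>. merge D (coord c \<alpha>))"

definition kinv :: "('a, 'n) chart \<Rightarrow> 'n set \<Rightarrow> real^'n \<Rightarrow> 'a \<times> (('a, 'n) chart \<Rightarrow> real^'n)" where
  "kinv c D z = of_coord c (conormal_param D z)"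

definition Zdom :: "('a, 'n) chart \<Rightarrow> 'n set \<Rightarrow> (real^'n) set" where
  "Zdom c D = {z. proj D z \<in> crange c \<and> proj (- D) z \<noteq> 0}"

definition conormal_over :: "('a, 'n) chart \<Rightarrow> ('a \<times> (('a, 'n) chart \<Rightarrow> real^'n)) set" where
  "conormal_over c = dot_conormal \<inter> over c"

lemma conormal_overD:
  assumes "\<alpha> \<in> conormal_over c"
  shows "\<alpha> \<in> dot_conormal" "\<alpha> \<in> over c" "fst \<alpha> \<in> cdom c" "\<alpha> \<in> dot_cotangent" "fst \<alpha> \<in> H"
  using assms over_fst dot_conormalD(1,3) unfolding conormal_over_def by blast+

text \<open>Coordinate changes map \<open>H\<close> to itself.\<close>

lemma tmat_block:
  assumes ad: "adapted H d c D" "adapted H d c' D'" and m: "m \<in> H" "m \<in> cdom c" "m \<in> cdom c'"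
    and ij: "j \<notin> D" "i \<in> D'"
  shows "tmat c' c m $ j $ i = 0"
proof -
  note c = adaptedD(1)[OF ad(1)] and c' = adaptedD(1)[OF ad(2)]
  let ?x = "cmap c' m" and ?O = "cmap c' ` (cdom c' \<inter> cdom c)"
  have O: "open ?O" "?x \<in> ?O" using c' open_chart_image chartD(1)[OF c] m by blast+
  let ?l = "\<lambda>s. ?x + s *\<^sub>R axis i (1::real)"
  have l: "(?l has_vector_derivative axis i 1) (at 0)"
    by (auto intro!: derivative_eq_intros simp: has_vector_derivative_def)
  have "(transition c' c has_derivative (*v) (tmat c' c m)) (at (?l 0))"
    using transition_has_derivative[OF c' c m(3,2)] by simp
  from has_derivative_compose[OF l[unfolded has_vector_derivative_def] this]
  have "((\<lambda>s. transition c' c (?l s)) has_derivative (\<lambda>h. tmat c' c m *v (h *\<^sub>R axis i 1))) (at 0)" .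
  from bounded_linear.has_derivative[OF bounded_linear_vec_nth[of j] this]
  have 1: "((\<lambda>s. transition c' c (?l s) $ j) has_derivative (\<lambda>h. (tmat c' c m *v (h *\<^sub>R axis i 1)) $ j)) (at 0)" .
  have "continuous_on UNIV ?l" by (intro continuous_intros)
  then have o: "open (?l -` ?O)" using O(1) by (simp add: open_vimage)
  have "((\<lambda>s. 0) has_derivative (\<lambda>h. (tmat c' c m *v (h *\<^sub>R axis i 1)) $ j)) (at 0)"
  proof (rule has_derivative_transform_within_open[OF 1 o])
    show "0 \<in> ?l -` ?O" using O(2) by simp
    fix s assume "s \<in> ?l -` ?O"
    then obtain y where y: "y \<in> cdom c'" "y \<in> cdom c" "?l s = cmap c' y" by blast
    have "cmap c' y $ k = 0" if "k \<notin> D'" for k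
      using adaptedD(3)[OF ad(2) m(3)] m(1) that ij(2) unfolding y(3)[symmetric] by (auto simp: axis_def)
    then have "y \<in> H" using adaptedD(3)[OF ad(2) y(1)] by blast
    then have "cmap c y $ j = 0" using adaptedD(3)[OF ad(1) y(2)] ij(1) by blast
    then show "transition c' c (?l s) $ j = 0" using y c' by simp
  qed
  from fun_cong[OF has_derivative_unique[OF this has_derivative_const], of 1]
  have "(tmat c' c m *v axis i 1) $ j = 0" by simp
  then show ?thesis by (simp add: matrix_vector_mult_basis column_def)
qed

text \<open>One adapted chart suffices, by the block form of the coordinate changes.\<close>

lemma in_dot_conormalI:
  assumes ad: "adapted H d c D" and \<alpha>: "\<alpha> \<in> over c" "snd (coord c \<alpha>) \<noteq> 0"
    and fz: "\<And>i. i \<notin> D \<Longrightarrow> fst (coord c \<alpha>) $ i = 0" and sz: "\<And>i. i \<in> D \<Longrightarrow> snd (coord c \<alpha>) $ i = 0"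
  shows "\<alpha> \<in> conormal_over c"
proof -
  note c = adaptedD(1)[OF ad] and m = over_fst[OF \<alpha>(1)]
  have H: "fst \<alpha> \<in> H" using adaptedD(3)[OF ad m] fz by (simp add: fst_coord)
  have "snd \<alpha> c' $ i = 0" if c': "adapted H d c' D'" "fst \<alpha> \<in> cdom c'" and i: "i \<in> D'" for c' D' i
  proof -
    have "snd \<alpha> c' $ i = (\<Sum>j\<in>UNIV. tmat c' c (fst \<alpha>) $ j $ i * snd \<alpha> c $ j)"
      using cotangentD[OF over_cotangent[OF \<alpha>(1)] c adaptedD(1)[OF c'(1)] m c'(2)]
      by (simp add: matrix_transpose_vector_component)
    also have "\<dots> = 0"
    proof (rule sum.neutral, rule ballI)
      fix j show "tmat c' c (fst \<alpha>) $ j $ i * snd \<alpha> c $ j = 0"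
        using tmat_block[OF ad c'(1) H m c'(2) _ i, of j] sz[of j] by (cases "j \<in> D") (simp_all add: coord_def)
    qed
    finally show ?thesis .
  qed
  moreover have "\<alpha> \<in> dot_cotangent" using dot_cotangent_iff[OF \<alpha>(1) c] \<alpha>(2) by simp
  ultimately have "\<alpha> \<in> dot_conormal" using H unfolding dot_conormal_def by blast
  then show ?thesis using \<alpha>(1) unfolding conormal_over_def by blast
qed

lemma param_kap:
  assumes "adapted H d c D" "\<alpha> \<in> conormal_over c"
  shows "conormal_param D (kap c D \<alpha>) = coord c \<alpha>"
proof -
  note d = conormal_overD[OF assms(2)]
  have "conormal_param D (merge D (fst (coord c \<alpha>), snd (coord c \<alpha>))) = (fst (coord c \<alpha>), snd (coord c \<alpha>))"
    by (intro conormal_param_merge dot_conormalD(4,5)[OF d(1) assms(1) d(3)])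
  then show ?thesis by simp
qed

lemma kinv_kap: "adapted H d c D \<Longrightarrow> \<alpha> \<in> conormal_over c \<Longrightarrow> kinv c D (kap c D \<alpha>) = \<alpha>"
  unfolding kinv_def using param_kap conormal_overD(2) adaptedD(1) by simp

lemma kap_in:
  assumes "adapted H d c D" "\<alpha> \<in> conormal_over c" shows "kap c D \<alpha> \<in> Zdom c D"
proof -
  note d = conormal_overD[OF assms(2)]
  have "proj D (kap c D \<alpha>) = fst (coord c \<alpha>)" "proj (- D) (kap c D \<alpha>) = snd (coord c \<alpha>)"
    using param_kap[OF assms] unfolding conormal_param_def by (simp_all add: prod_eq_iff)
  then show ?thesis
    unfolding Zdom_def using dot_cotangent_iff[OF d(2) adaptedD(1)[OF assms(1)]] d(3,4) by (simp add: fst_coord)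
qed

lemma coord_kinv:
  assumes "adapted H d c D" "z \<in> Zdom c D"
  shows "coord c (kinv c D z) = conormal_param D z" "kinv c D z \<in> over c"
proof -
  have f: "fst (conormal_param D z) \<in> crange c" using assms(2) by (simp add: Zdom_def conormal_param_def)
  show "coord c (kinv c D z) = conormal_param D z" "kinv c D z \<in> over c"
    unfolding kinv_def using coord_of_coord[OF adaptedD(1)[OF assms(1)] f] of_coord_in[OF adaptedD(1)[OF assms(1)] f] by simp_all
qed

lemma kap_kinv: "adapted H d c D \<Longrightarrow> z \<in> Zdom c D \<Longrightarrow> kap c D (kinv c D z) = z"
  by (simp add: coord_kinv)

lemma kinv_in:
  assumes "adapted H d c D" "z \<in> Zdom c D" shows "kinv c D z \<in> conormal_over c"
proof (rule in_dot_conormalI[OF assms(1)])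
  note k = coord_kinv[OF assms]
  show "kinv c D z \<in> over c" by (rule k(2))
  show "snd (coord c (kinv c D z)) \<noteq> 0" using assms(2) unfolding k(1) by (simp add: Zdom_def conormal_param_def)
  show "fst (coord c (kinv c D z)) $ i = 0" if "i \<notin> D" for i using that unfolding k(1) by (simp add: conormal_param_def proj_def)
  show "snd (coord c (kinv c D z)) $ i = 0" if "i \<in> D" for i using that unfolding k(1) by (simp add: conormal_param_def proj_def)
qed

lemma inj_on_kap: "adapted H d c D \<Longrightarrow> S \<subseteq> conormal_over c \<Longrightarrow> inj_on (kap c D) S"
  by (rule inj_on_inverseI[of _ "kinv c D"]) (use kinv_kap in blast)

lemma kap_image:
  assumes "adapted H d c D" "S \<subseteq> conormal_over c"
  shows "kap c D ` S = {z \<in> Zdom c D. kinv c D z \<in> S}"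
proof (intro equalityI subsetI)
  fix z assume "z \<in> kap c D ` S"
  then obtain \<alpha> where a: "\<alpha> \<in> S" "z = kap c D \<alpha>" by blast
  then have "\<alpha> \<in> conormal_over c" using assms(2) by blast
  then show "z \<in> {z \<in> Zdom c D. kinv c D z \<in> S}" using kap_in[OF assms(1)] kinv_kap[OF assms(1)] a by simp
next
  fix z assume z: "z \<in> {z \<in> Zdom c D. kinv c D z \<in> S}"
  then have "kap c D (kinv c D z) = z" "kinv c D z \<in> S" using kap_kinv[OF assms(1)] by blast+
  then show "z \<in> kap c D ` S" by (metis imageI)
qed

lemma open_Zdom: "c \<in> A \<Longrightarrow> open (Zdom c D)"
proof -
  assume c: "c \<in> A"
  have p: "continuous_on UNIV (proj E :: real^'n \<Rightarrow> real^'n)" for E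
    by (rule linear_continuous_on[OF bounded_linear_proj])
  have "open (proj D -` crange c \<inter> proj (- D) -` (UNIV - {0}))"
    using chartD(2)[OF c] by (intro open_Int open_vimage p) auto
  moreover have "Zdom c D = proj D -` crange c \<inter> proj (- D) -` (UNIV - {0})" unfolding Zdom_def by blast
  ultimately show ?thesis by simp
qed

lemma kap_image_borel:
  assumes ad: "adapted H d c D" and S: "S \<in> sets cot_borel" "S \<subseteq> conormal_over c"
  shows "kap c D ` S \<in> sets borel"
proof -
  note c = adaptedD(1)[OF ad]
  have "conormal_param D \<in> borel \<rightarrow>\<^sub>M borel"
    by (intro borel_measurable_continuous_onI linear_continuous_on bounded_linear_conormal_param)
  from measurable_sets[OF this of_coord_vimage_borel[OF c S(1)]]
  have "conormal_param D -` {z \<in> crange c \<times> UNIV. of_coord c z \<in> S} \<in> sets borel" by simp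
  moreover have "Zdom c D \<in> sets borel" using open_Zdom[OF c] by simp
  ultimately have "Zdom c D \<inter> conormal_param D -` {z \<in> crange c \<times> UNIV. of_coord c z \<in> S} \<in> sets borel" by blast
  moreover have "kap c D ` S = Zdom c D \<inter> conormal_param D -` {z \<in> crange c \<times> UNIV. of_coord c z \<in> S}"
    unfolding kap_image[OF ad S(2)] kinv_def by (auto simp: Zdom_def conormal_param_def)
  ultimately show ?thesis by simp
qed

subsection \<open>The density in different coordinates\<close>

definition gH :: "('a, 'n) chart \<Rightarrow> 'n set \<Rightarrow> real^'n \<Rightarrow> real^'n^'n" where
  "gH c D x = (\<chi> i j. if i \<in> D \<and> j \<in> D then g c x $ i $ j else if i = j then 1 else 0)"

lemma det_gH_eq: "det_gH c D x = det (gH c D x)"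
  by (simp add: det_gH_def gH_def)

text \<open>
  On the padded block, the quadratic form is the metric on the \<open>x'\<close>-part plus the square of the \<open>x''\<close>-part.
\<close>

lemma det_gH_pos:
  assumes c: "c \<in> A" and x: "x \<in> crange c" shows "det_gH c D x > 0"
  unfolding det_gH_eq
proof (rule pos_def_det_pos)
  fix v :: "real^'n" assume v: "v \<noteq> 0"
  let ?u = "proj D v"
  have comp: "(gH c D x *v v) $ i = (if i \<in> D then (g c x *v ?u) $ i else v $ i)" for i
  proof -
    have "(gH c D x *v v) $ i = (\<Sum>j\<in>UNIV. (if i \<in> D \<and> j \<in> D then g c x $ i $ j else if i = j then 1 else 0) * v $ j)"
      by (simp add: gH_def matrix_vector_mult_def)
    also have "\<dots> = (\<Sum>j\<in>UNIV. if i \<in> D then g c x $ i $ j * ?u $ j else if i = j then v $ j else 0)"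
      by (rule sum.cong) (auto simp: proj_def)
    also have "\<dots> = (if i \<in> D then (g c x *v ?u) $ i else v $ i)"
      by (simp add: matrix_vector_mult_def)
    finally show ?thesis .
  qed
  have "v \<bullet> (gH c D x *v v) = (\<Sum>i\<in>UNIV. ?u $ i * (g c x *v ?u) $ i) + (\<Sum>i\<in>UNIV. proj (- D) v $ i * proj (- D) v $ i)"
    unfolding inner_vec_def sum.distrib[symmetric] by (rule sum.cong) (auto simp: comp proj_def)
  then have eq: "v \<bullet> (gH c D x *v v) = ?u \<bullet> (g c x *v ?u) + proj (- D) v \<bullet> proj (- D) v"
    by (simp add: inner_vec_def)
  show "v \<bullet> (gH c D x *v v) > 0"
  proof (cases "?u = 0")
    case True
    have "v = ?u + proj (- D) v" by (auto simp: proj_def vec_eq_iff)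
    then have "proj (- D) v \<noteq> 0" using True v by auto
    then have "proj (- D) v \<bullet> proj (- D) v > 0" by simp
    then show ?thesis unfolding eq True by simp
  next
    case False
    from metricD(3)[OF c x this] show ?thesis unfolding eq by (simp add: add_pos_nonneg)
  qed
qed

lemma density_N_pos: "c \<in> A \<Longrightarrow> x \<in> crange c \<Longrightarrow> density_N c D x > 0"
  unfolding density_N_def by (intro divide_pos_pos det_gH_pos) (simp_all add: det_metric_pos)

text \<open>
  In block form with respect to \<open>x', x''\<close>, the coordinate change on the conormal bundle has the diagonal
  blocks \<open>\<partial>y'/\<partial>x'\<close> and \<open>(\<partial>x''/\<partial>y'')\<^sup>T\<close>.
\<close>

lemma ctrans_derivative_blocks:
  assumes c: "c \<in> A" "c' \<in> A" and m: "m \<in> cdom c" "m \<in> cdom c'" and z: "fst z = cmap c m"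
    and D: "(ctrans c c' has_derivative F) (at z)"
  shows "fst (F h) = tmat c c' m *v fst h" "snd (F (0, b)) = transpose (tmat c' c m) *v b"
proof -
  have "((\<lambda>z. transition c c' (fst z)) has_derivative (\<lambda>h. tmat c c' m *v fst h)) (at z)"
    by (rule has_derivative_compose[OF bounded_linear_imp_has_derivative[OF bounded_linear_fst]])
      (use transition_has_derivative[OF c m] z in simp)
  moreover have "((\<lambda>z. transition c c' (fst z)) has_derivative (\<lambda>h. fst (F h))) (at z)"
    using has_derivative_fst[OF D] by (simp add: ctrans_def)
  ultimately show "fst (F h) = tmat c c' m *v fst h" using has_derivative_unique fun_cong by metis
  have 1: "((\<lambda>s. z + s *\<^sub>R (0, b)) has_derivative (\<lambda>s. s *\<^sub>R (0, b))) (at 0)"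
    by (auto intro!: derivative_eq_intros)
  have "(ctrans c c' has_derivative F) (at (z + 0 *\<^sub>R (0, b)))" using D by (simp add: zero_prod_def[symmetric])
  from has_derivative_snd[OF has_derivative_compose[OF 1 this]]
  have 2: "((\<lambda>s. snd (ctrans c c' (z + s *\<^sub>R (0, b)))) has_derivative (\<lambda>s. snd (F (s *\<^sub>R (0, b))))) (at 0)" .
  have e: "snd (ctrans c c' (z + s *\<^sub>R (0, b))) = transpose (tmat c' c m) *v snd z + s *\<^sub>R (transpose (tmat c' c m) *v b)" for s
    using z c m by (simp add: ctrans_def matrix_vector_right_distrib matrix_vector_mult_scaleR)
  have 3: "((\<lambda>s. snd (ctrans c c' (z + s *\<^sub>R (0, b)))) has_derivative (\<lambda>s. s *\<^sub>R (transpose (tmat c' c m) *v b))) (at 0)"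
    unfolding e by (auto intro!: derivative_eq_intros)
  from fun_cong[OF has_derivative_unique[OF 2 3], of 1]
  show "snd (F (0, b)) = transpose (tmat c' c m) *v b" by simp
qed

text \<open>
  Let \<open>a\<close> and \<open>b\<close> be the determinants of \<open>\<partial>y'/\<partial>x'\<close> and \<open>\<partial>y''/\<partial>x''\<close>. The coordinate change on the conormal
  bundle has determinant \<open>a / b\<close>, while \<open>det g\<^sub>H\<close> changes by the factor \<open>a\<^sup>2\<close> and \<open>\<surd>det g\<close> by \<open>\<bar>a b\<bar>\<close>.
\<close>

lemma density_change:
  assumes ad: "adapted H d c D" "adapted H d c' D'" and \<alpha>: "\<alpha> \<in> conormal_over c" "\<alpha> \<in> conormal_over c'"
    and F: "(ctrans c c' has_derivative F) (at (coord c \<alpha>))"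
  shows "density_N c D (cmap c (fst \<alpha>)) =
    \<bar>det (matrix (\<lambda>w. merge D' (F (conormal_param D w))))\<bar> * density_N c' D' (cmap c' (fst \<alpha>))"
proof -
  note c = adaptedD(1)[OF ad(1)] and c' = adaptedD(1)[OF ad(2)]
  note m = conormal_overD(3)[OF \<alpha>(1)] conormal_overD(3)[OF \<alpha>(2)] and mH = conormal_overD(5)[OF \<alpha>(1)]
  let ?m = "fst \<alpha>" and ?S = "tmat c c' (fst \<alpha>)" and ?T = "tmat c' c (fst \<alpha>)"
  let ?M = "matrix (\<lambda>w. merge D' (F (conormal_param D w)))"
  note bl = ctrans_derivative_blocks[OF c c' m _ F]
  have z: "fst (coord c \<alpha>) = cmap c ?m" by (rule fst_coord)
  have card: "card D = card D'" using adaptedD(2)[OF ad(1)] adaptedD(2)[OF ad(2)] by simp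
  then have cardc: "card (- D) = card (- D')" by (simp add: Compl_eq_Diff_UNIV card_Diff_subset)
  have pa: "conormal_param D (axis j 1) = (if j \<in> D then (axis j 1, 0) else (0, axis j 1))" for j
    by (auto simp: conormal_param_def proj_def vec_eq_iff axis_def)
  have M1: "?M $ i $ j = (if j \<in> D then ?S $ i $ j else 0)" if "i \<in> D'" for i j
    using that bl(1)[OF z] by (simp add: matrix_def merge_def split_beta pa matrix_vector_mult_basis column_def)
  have M2: "?M $ i $ j = ?T $ j $ i" if "i \<notin> D'" "j \<notin> D" for i j
    using that bl(2)[OF z] by (simp add: matrix_def merge_def split_beta pa matrix_vector_mult_basis column_def transpose_def)
  have S0: "?S $ i $ j = 0" if "i \<notin> D'" "j \<in> D" for i j
    using tmat_block[OF ad(2,1) mH m(2,1) that] .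
  have T0: "?T $ j $ i = 0" if "j \<notin> D" "i \<in> D'" for i j
    using tmat_block[OF ad mH m that] .
  define Md where "Md = (\<chi> i j. if i \<in> D' \<longleftrightarrow> j \<in> D then ?M $ i $ j else 0)"
  define Sd where "Sd = (\<chi> i j. if i \<in> D' \<longleftrightarrow> j \<in> D then ?S $ i $ j else 0)"
  have detM: "det Md = det ?M"
    unfolding Md_def by (rule det_block_triangular[OF card]) (simp add: M1)
  have detS: "det Sd = det ?S"
    using det_block_triangular[OF cardc, of ?S] S0 unfolding Sd_def by (simp add: Compl_iff)
  let ?g = "g c (cmap c ?m)" and ?g' = "g c' (cmap c' ?m)"
  let ?gH = "gH c D (cmap c ?m)" and ?gH' = "gH c' D' (cmap c' ?m)"
  have gtr: "?g = transpose ?S ** ?g' ** ?S" by (rule metric_transform[OF c' c m(2,1)])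
  have TS: "?T ** ?S = mat 1" by (rule tmat_inverse[OF c c' m])
  define X where "X = ?gH' ** Sd"
  have X: "X $ a $ k = (if (a \<in> D') = (k \<in> D) then if a \<in> D' then (?g' ** ?S) $ a $ k else ?S $ a $ k else 0)" for a k
  proof -
    have "X $ a $ k = (\<Sum>b\<in>UNIV. ?gH' $ a $ b * Sd $ b $ k)" by (simp add: X_def matrix_matrix_mult_def)
    also have "\<dots> = (\<Sum>b\<in>UNIV. if a \<in> D' then (if k \<in> D then ?g' $ a $ b * ?S $ b $ k else 0)
        else (if a = b then (if k \<in> D then 0 else ?S $ b $ k) else 0))"
      by (rule sum.cong) (auto simp: gH_def Sd_def S0)
    also have "\<dots> = (if (a \<in> D') = (k \<in> D) then if a \<in> D' then (?g' ** ?S) $ a $ k else ?S $ a $ k else 0)"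
      by (auto simp: matrix_matrix_mult_def)
    finally show ?thesis .
  qed
  have tr: "(transpose B ** Y) $ j $ k = (\<Sum>a\<in>UNIV. B $ a $ j * Y $ a $ k)" for B Y :: "real^'n^'n" and j k
    by (simp add: matrix_matrix_mult_def transpose_def)
  have "transpose Md ** X = ?gH"
  proof (rule vec_eq_iff[THEN iffD2], rule allI, rule vec_eq_iff[THEN iffD2], rule allI)
    fix j k
    have e: "(transpose Md ** X) $ j $ k = (\<Sum>a\<in>UNIV. Md $ a $ j * X $ a $ k)"
      by (rule tr)
    show "(transpose Md ** X) $ j $ k = ?gH $ j $ k"
    proof (cases "j \<in> D")
      case j: True
      show ?thesis
      proof (cases "k \<in> D")
        case k: True
        have "(\<Sum>a\<in>UNIV. Md $ a $ j * X $ a $ k) = (\<Sum>a\<in>UNIV. ?S $ a $ j * (?g' ** ?S) $ a $ k)"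
          using j k by (intro sum.cong) (auto simp: Md_def X M1 S0)
        also have "\<dots> = (transpose ?S ** (?g' ** ?S)) $ j $ k"
          by (simp only: tr)
        also have "\<dots> = ?g $ j $ k" by (simp add: gtr matrix_mul_assoc)
        finally show ?thesis using j k by (simp add: e gH_def)
      next
        case k: False
        have "(\<Sum>a\<in>UNIV. Md $ a $ j * X $ a $ k) = 0"
          using j k by (intro sum.neutral ballI) (auto simp: Md_def X)
        then show ?thesis using j k by (auto simp: e gH_def)
      qed
    next
      case j: False
      show ?thesis
      proof (cases "k \<in> D")
        case k: True
        have "(\<Sum>a\<in>UNIV. Md $ a $ j * X $ a $ k) = 0"
          using j k by (intro sum.neutral ballI) (auto simp: Md_def X)
        then show ?thesis using j k by (auto simp: e gH_def)
      next
        case k: False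
        have "(\<Sum>a\<in>UNIV. Md $ a $ j * X $ a $ k) = (\<Sum>a\<in>UNIV. ?T $ j $ a * ?S $ a $ k)"
          using j k by (intro sum.cong) (auto simp: Md_def X M2 T0)
        also have "\<dots> = (?T ** ?S) $ j $ k" by (simp add: matrix_matrix_mult_def)
        finally show ?thesis using j k by (simp add: e gH_def TS mat_def)
      qed
    qed
  qed
  then have "det Md * (det ?gH' * det Sd) = det ?gH"
    unfolding X_def by (metis det_mul det_transpose)
  then have 1: "det ?M * det ?gH' * det ?S = det ?gH" by (simp add: detM detS)
  have 2: "det ?g = (det ?S)\<^sup>2 * det ?g'"
    unfolding gtr by (simp add: det_mul power2_eq_square)
  have p: "det ?gH > 0" "det ?gH' > 0" "det ?g' > 0" "det ?g > 0"
    using det_gH_pos[OF c cmap_in[OF m(1)]] det_gH_pos[OF c' cmap_in[OF m(2)]] det_metric_pos[OF c' cmap_in[OF m(2)]]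
      det_metric_pos[OF c cmap_in[OF m(1)]] by (simp_all add: det_gH_eq)
  have S: "det ?S \<noteq> 0" using 1 p(1) by auto
  have "det ?gH = \<bar>det ?M * det ?gH' * det ?S\<bar>" using 1 p(1) by simp
  also have "\<dots> = \<bar>det ?M\<bar> * det ?gH' * \<bar>det ?S\<bar>" using p(2) by (simp add: abs_mult)
  finally have 3: "det ?gH = \<bar>det ?M\<bar> * det ?gH' * \<bar>det ?S\<bar>" .
  have 4: "sqrt (det ?g) = \<bar>det ?S\<bar> * sqrt (det ?g')" unfolding 2 by (simp add: real_sqrt_mult)
  show ?thesis
    unfolding density_N_def det_gH_eq 3 4 using S by simp
qed

lemma density_N_continuous:
  assumes c: "c \<in> A" shows "continuous_on (Zdom c D) (\<lambda>z. density_N c D (proj D z))"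
proof -
  have "Ck_on 0 (crange c) (g c)" using metricD(1)[OF c] unfolding smooth_on_def by blast
  then have g: "continuous_on (crange c) (g c)" by simp
  have "continuous_on (Zdom c D) (\<lambda>z. g c (proj D z))"
    by (rule continuous_on_compose2[OF g linear_continuous_on[OF bounded_linear_proj]]) (auto simp: Zdom_def)
  then have gij: "continuous_on (Zdom c D) (\<lambda>z. g c (proj D z) $ i $ j)" for i j
    by (rule bounded_linear.continuous_on[OF bounded_linear_compose[OF bounded_linear_vec_nth bounded_linear_vec_nth]])
  have 1: "continuous_on (Zdom c D) (\<lambda>z. det (gH c D (proj D z)))"
  proof (rule continuous_on_det)
    fix i j show "continuous_on (Zdom c D) (\<lambda>z. gH c D (proj D z) $ i $ j)"
      using gij[of i j] by (cases "i \<in> D \<and> j \<in> D") (auto simp: gH_def)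
  qed
  have 2: "continuous_on (Zdom c D) (\<lambda>z. sqrt (det (g c (proj D z))))"
    by (intro continuous_on_real_sqrt continuous_on_det gij)
  have "sqrt (det (g c (proj D z))) \<noteq> 0" if "z \<in> Zdom c D" for z
    using det_metric_pos[OF c, of "proj D z"] that by (simp add: Zdom_def)
  then show ?thesis unfolding density_N_def det_gH_eq by (intro continuous_on_divide 1 2) auto
qed

text \<open>
  The density is extended by 0 so that it is Borel measurable on the whole parameter space.
\<close>

definition dens :: "('a, 'n) chart \<Rightarrow> 'n set \<Rightarrow> real^'n \<Rightarrow> real" where
  "dens c D z = density_N c D (proj D z) * indicator (Zdom c D) z"

lemma dens_measurable:
  assumes c: "c \<in> A" shows "dens c D \<in> borel_measurable borel"
proof -
  have "(\<lambda>z. density_N c D (proj D z)) \<in> borel_measurable (restrict_space borel (Zdom c D))"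
    by (rule borel_measurable_continuous_on_restrict[OF density_N_continuous[OF c]])
  then have "(\<lambda>z. indicator (Zdom c D) z * density_N c D (proj D z)) \<in> borel_measurable borel"
    using open_Zdom[OF c] by (simp add: borel_measurable_restrict_space_iff)
  then show ?thesis unfolding dens_def[abs_def] by (simp add: mult.commute)
qed

lemma dens_nonneg: "c \<in> A \<Longrightarrow> dens c D z \<ge> 0"
  using density_N_pos[of c "proj D z" D] by (auto simp: dens_def indicator_def Zdom_def less_imp_le)

lemma dens_kap:
  assumes "adapted H d c D" "\<alpha> \<in> conormal_over c"
  shows "dens c D (kap c D \<alpha>) = density_N c D (cmap c (fst \<alpha>))"
proof -
  have "proj D (kap c D \<alpha>) = fst (coord c \<alpha>)"
    using param_kap[OF assms] unfolding conormal_param_def by (simp add: prod_eq_iff)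
  then show ?thesis using kap_in[OF assms] by (simp add: dens_def fst_coord)
qed

end

section \<open>The conormal measure\<close>

context compact_riemannian_submanifold
begin

lemma borel_sets_eq:
  assumes V: "V \<in> sets cot_borel" shows "borel_sets V = {S \<in> sets cot_borel. S \<subseteq> V}"
proof -
  have "{S. openin (subtopology cot_topology V) S} = (\<inter>) V ` {S. openin cot_topology S}"
    unfolding openin_subtopology image_def by (rule Collect_cong) (simp add: Int_commute)
  then have "borel_sets V = (\<inter>) V ` sets cot_borel"
    unfolding borel_sets_def sets_cot_borel
    using sigma_sets_Int[of V cotangent "{S. openin cot_topology S}"] V cot_borel_subset[OF V] by (simp add: sets_cot_borel)
  also have "\<dots> = {S \<in> sets cot_borel. S \<subseteq> V}"
  proof (intro equalityI subsetI)
    fix S assume "S \<in> {S \<in> sets cot_borel. S \<subseteq> V}"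
    then have "S \<in> sets cot_borel" "V \<inter> S = S" by auto
    then show "S \<in> (\<inter>) V ` sets cot_borel" by (intro image_eqI[of S _ S]) auto
  qed (use V in auto)
  finally show ?thesis .
qed

lemma conormal_over_borel:
  assumes ad: "adapted H d c D" shows "conormal_over c \<in> sets cot_borel"
proof -
  note c = adaptedD(1)[OF ad]
  let ?B = "{z :: (real^'n) \<times> (real^'n). conormal_param D (merge D z) = z} \<inter> {z. snd z \<noteq> 0}"
  have "closed {z :: (real^'n) \<times> (real^'n). conormal_param D (merge D z) = z}"
    by (intro closed_Collect_eq continuous_on_id linear_continuous_on
        bounded_linear_compose[OF bounded_linear_conormal_param bounded_linear_merge])
  moreover have "open {z :: (real^'n) \<times> (real^'n). snd z \<noteq> 0}"
    by (intro open_Collect_neq continuous_intros)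
  ultimately have B: "?B \<in> sets borel" by simp
  have "conormal_over c = {\<alpha> \<in> over c. coord c \<alpha> \<in> ?B}"
  proof (intro equalityI subsetI)
    fix \<alpha> assume a: "\<alpha> \<in> conormal_over c"
    have "snd (coord c \<alpha>) \<noteq> 0" using dot_cotangent_iff[OF conormal_overD(2)[OF a] c] conormal_overD(4)[OF a] by simp
    then show "\<alpha> \<in> {\<alpha> \<in> over c. coord c \<alpha> \<in> ?B}" using conormal_overD(2)[OF a] param_kap[OF ad a] by simp
  next
    fix \<alpha> assume a: "\<alpha> \<in> {\<alpha> \<in> over c. coord c \<alpha> \<in> ?B}"
    then have "coord c \<alpha> = conormal_param D (merge D (coord c \<alpha>))" by simp
    then have "coord c \<alpha> \<in> range (conormal_param D)" by (rule range_eqI)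
    then show "\<alpha> \<in> conormal_over c" unfolding range_conormal_param
      using a by (intro in_dot_conormalI[OF ad]) auto
  qed
  then show ?thesis using coord_vimage_borel[OF c B] by simp
qed

definition chart_partition where
  "chart_partition n ch sp P \<longleftrightarrow> (\<forall>i<n::nat. adapted H d (ch i) (sp i) \<and> P i \<in> sets cot_borel \<and> P i \<subseteq> conormal_over (ch i)) \<and>
     disjoint_family_on P {..<n} \<and> dot_conormal = (\<Union>i<n. P i)"

lemma chart_partitionD:
  assumes "chart_partition n ch sp P"
  shows "i < n \<Longrightarrow> adapted H d (ch i) (sp i)" "i < n \<Longrightarrow> P i \<in> sets cot_borel" "i < n \<Longrightarrow> P i \<subseteq> conormal_over (ch i)"
    "disjoint_family_on P {..<n}" "dot_conormal = (\<Union>i<n. P i)"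
  using assms unfolding chart_partition_def by blast+

text \<open>
  Finitely many adapted charts cover the compact set \<open>H\<close>; a point belongs to the first of them.
\<close>

lemma ex_chart_partition: "\<exists>n ch sp P. chart_partition n ch sp P"
proof -
  let ?C = "{x. adapted H d (fst x) (snd x)}"
  have "H \<subseteq> (\<Union>x\<in>?C. cdom (fst x))"
  proof
    fix m assume "m \<in> H"
    from submanifold[OF this] obtain c D where "adapted H d c D" "m \<in> cdom c" by blast
    then show "m \<in> (\<Union>x\<in>?C. cdom (fst x))" by (intro UN_I[of "(c, D)"]) simp_all
  qed
  from compactE_image[OF compact_H _ this] obtain C' where C': "C' \<subseteq> ?C" "finite C'" "H \<subseteq> (\<Union>x\<in>C'. cdom (fst x))"
    using adaptedD(1) chartD(1) by (metis (no_types, lifting) mem_Collect_eq)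
  from ex_bij_betw_nat_finite[OF C'(2)] obtain h where h: "bij_betw h {0..<card C'} C'" by blast
  let ?n = "card C'" and ?ch = "\<lambda>i. fst (h i)" and ?Q = "\<lambda>i. conormal_over (fst (h i))"
  have ad: "adapted H d (fst (h i)) (snd (h i))" if "i < ?n" for i
  proof -
    have "h i \<in> C'" using bij_betwE[OF h] that by simp
    from subsetD[OF C'(1) this] show ?thesis by simp
  qed
  define P where "P i = ?Q i - (\<Union>j<i. ?Q j)" for i
  have Pm: "P i \<in> sets cot_borel" if "i < ?n" for i
    unfolding P_def using conormal_over_borel[OF ad] that by (intro sets.Diff sets.finite_UN) auto
  have dis: "disjoint_family_on P {..<?n}"
    unfolding disjoint_family_on_def
  proof (intro ballI impI)
    fix i j :: nat assume "i \<noteq> j" then consider "i < j" | "j < i" by linarith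
    then show "P i \<inter> P j = {}" unfolding P_def by cases blast+
  qed
  have cov: "dot_conormal = (\<Union>i<?n. P i)"
  proof (intro equalityI subsetI)
    fix \<alpha> assume a: "\<alpha> \<in> dot_conormal"
    obtain x where x: "x \<in> C'" "fst \<alpha> \<in> cdom (fst x)" using C'(3) dot_conormalD(3)[OF a] by blast
    have "x \<in> h ` {0..<?n}" using x(1) bij_betw_imp_surj_on[OF h] by simp
    then obtain i where "i \<in> {0..<?n}" "x = h i" by blast
    then have i: "i < ?n" "h i = x" by simp_all
    have ex: "i < ?n \<and> \<alpha> \<in> ?Q i"
      using i x(2) a overI[OF dot_conormalD(2)[OF a]] by (simp add: conormal_over_def)
    let ?i = "LEAST i. i < ?n \<and> \<alpha> \<in> ?Q i"
    have L: "?i < ?n \<and> \<alpha> \<in> ?Q ?i" using LeastI[where P = "\<lambda>i. i < ?n \<and> \<alpha> \<in> ?Q i", OF ex] .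
    have "\<alpha> \<notin> ?Q j" if "j < ?i" for j using not_less_Least[OF that] that L by simp
    then have "\<alpha> \<in> P ?i" unfolding P_def using L by blast
    then show "\<alpha> \<in> (\<Union>i<?n. P i)" using L by blast
  next
    fix \<alpha> assume "\<alpha> \<in> (\<Union>i<?n. P i)"
    then show "\<alpha> \<in> dot_conormal" unfolding P_def conormal_over_def by blast
  qed
  have "chart_partition ?n ?ch (\<lambda>i. snd (h i)) P"
    unfolding chart_partition_def
  proof (intro conjI allI impI ad Pm dis cov)
    show "P i \<subseteq> ?Q i" for i unfolding P_def by blast
  qed
  then show ?thesis by blast
qed

definition chart_int :: "('a, 'n) chart \<Rightarrow> 'n set \<Rightarrow> ('a \<times> (('a, 'n) chart \<Rightarrow> real^'n)) set \<Rightarrow> ennreal" where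
  "chart_int c D S = (\<integral>\<^sup>+z. ennreal (dens c D z) * indicator (kap c D ` S) z \<partial>lborel)"

lemma dens_eq_density_N:
  assumes "adapted H d c D" "S \<subseteq> conormal_over c"
  shows "ennreal (dens c D z) * indicator (kap c D ` S) z = ennreal (density_N c D (proj D z)) * indicator (kap c D ` S) z"
  unfolding kap_image[OF assms] by (auto simp: dens_def indicator_def)

lemma chart_int_density:
  assumes ad: "adapted H d c D" and S: "S \<in> sets cot_borel" "S \<subseteq> conormal_over c"
  shows "chart_int c D S = emeasure (density lborel (\<lambda>z. ennreal (dens c D z))) (kap c D ` S)"
  unfolding chart_int_def using kap_image_borel[OF ad S] dens_measurable[OF adaptedD(1)[OF ad]]
  by (subst emeasure_density) auto

lemma chart_int_suminf:
  assumes ad: "adapted H d c D" and S: "\<And>k::nat. S k \<in> sets cot_borel" "\<And>k. S k \<subseteq> conormal_over c" and dis: "disjoint_family S"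
  shows "(\<Sum>k. chart_int c D (S k)) = chart_int c D (\<Union>k. S k)"
proof -
  let ?M = "density lborel (\<lambda>z. ennreal (dens c D z))"
  have U: "(\<Union>k. S k) \<in> sets cot_borel" "(\<Union>k. S k) \<subseteq> conormal_over c" using S by auto
  have "disjoint_family (\<lambda>k. kap c D ` S k)"
    unfolding disjoint_family_on_def
  proof (intro ballI impI)
    fix i j :: nat assume "i \<noteq> j"
    then have "S i \<inter> S j = {}" using dis by (simp add: disjoint_family_on_def)
    then show "kap c D ` S i \<inter> kap c D ` S j = {}"
      using inj_on_image_Int[OF inj_on_kap[OF ad subset_refl] S(2)[of i] S(2)[of j]] by simp
  qed
  then have "(\<Sum>k. emeasure ?M (kap c D ` S k)) = emeasure ?M (\<Union>k. kap c D ` S k)"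
    using kap_image_borel[OF ad S] by (intro suminf_emeasure) auto
  then show ?thesis unfolding chart_int_density[OF ad S] chart_int_density[OF ad U] image_UN .
qed

lemma coord_change_derivative:
  assumes c: "c \<in> A" "c' \<in> A" and \<alpha>: "\<alpha> \<in> over c" "\<alpha> \<in> over c'"
  obtains F where "(ctrans c c' has_derivative F) (at (coord c \<alpha>))"
    "((\<lambda>z. coord c' (of_coord c z)) has_derivative F) (at (coord c \<alpha>))"
proof -
  let ?O = "cmap c ` (cdom c \<inter> cdom c') \<times> (UNIV :: (real^'n) set)"
  have O: "open ?O" using open_chart_image[OF c(1) chartD(1)[OF c(2)]] by (simp add: open_Times)
  have z: "fst (coord c \<alpha>) \<in> cmap c ` (cdom c \<inter> cdom c')" using over_fst[OF \<alpha>(1)] over_fst[OF \<alpha>(2)] by (simp add: fst_coord)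
  from ctrans_differentiable[OF c z] obtain F where F: "(ctrans c c' has_derivative F) (at (coord c \<alpha>))"
    unfolding differentiable_def by blast
  have eq: "ctrans c c' z = coord c' (of_coord c z)" if "z \<in> ?O" for z
  proof -
    have "fst z \<in> cmap c ` (cdom c \<inter> cdom c')" using that by (simp add: mem_Times_iff)
    then show ?thesis using c by (intro coord_of_coord_ctrans[symmetric]) auto
  qed
  have "coord c \<alpha> \<in> ?O" using z by (simp add: mem_Times_iff)
  from has_derivative_transform_within_open[OF F O this eq] F show ?thesis by (rule that[rotated])
qed

lemma kap_derivative:
  assumes ad: "adapted H d c D" and \<alpha>: "\<alpha> \<in> conormal_over c"
    and L: "((\<lambda>z. coord c' (\<Phi> (of_coord c z))) has_derivative L) (at (coord c \<alpha>))"
  shows "((\<lambda>z. kap c' D' (\<Phi> (kinv c D z))) has_derivative (\<lambda>w. merge D' (L (conormal_param D w)))) (at (kap c D \<alpha>))"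
proof -
  have 1: "(conormal_param D has_derivative conormal_param D) (at (kap c D \<alpha>))"
    by (rule bounded_linear_imp_has_derivative[OF bounded_linear_conormal_param])
  have "((\<lambda>z. coord c' (\<Phi> (of_coord c z))) has_derivative L) (at (conormal_param D (kap c D \<alpha>)))"
    unfolding param_kap[OF ad \<alpha>] by (rule L)
  from bounded_linear.has_derivative[OF bounded_linear_merge has_derivative_compose[OF 1 this]]
  show ?thesis unfolding kinv_def .
qed

text \<open>
  Here \<open>j\<close> is the Jacobian of \<open>\<Phi>\<close> with respect to the natural densities. The identity, the flow and the
  dilations are the maps to which this is applied.
\<close>

lemma chart_int_image:
  assumes ad: "adapted H d c D" "adapted H d c' D'"
    and E: "E \<in> sets cot_borel" "E \<subseteq> conormal_over c" and \<Phi>E: "\<Phi> ` E \<in> sets cot_borel" "\<Phi> ` E \<subseteq> conormal_over c'"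
    and inj: "inj_on \<Phi> E"
    and der: "\<And>\<alpha>. \<alpha> \<in> E \<Longrightarrow> \<exists>F. ((\<lambda>z. kap c' D' (\<Phi> (kinv c D z))) has_derivative F) (at (kap c D \<alpha>)) \<and>
       \<bar>det (matrix F)\<bar> * dens c' D' (kap c' D' (\<Phi> \<alpha>)) = j \<alpha> * dens c D (kap c D \<alpha>)"
  shows "chart_int c' D' (\<Phi> ` E) = (\<integral>\<^sup>+z. ennreal (j (kinv c D z) * dens c D z) * indicator (kap c D ` E) z \<partial>lborel)"
proof -
  let ?Z = "kap c D ` E" and ?f = "\<lambda>z. kap c' D' (\<Phi> (kinv c D z))"
  have "\<forall>\<alpha>\<in>E. \<exists>F. (?f has_derivative F) (at (kap c D \<alpha>)) \<and>
      \<bar>det (matrix F)\<bar> * dens c' D' (kap c' D' (\<Phi> \<alpha>)) = j \<alpha> * dens c D (kap c D \<alpha>)"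
    using der by (intro ballI)
  from bchoice[OF this] obtain F where F: "\<forall>\<alpha>\<in>E. (?f has_derivative F \<alpha>) (at (kap c D \<alpha>)) \<and>
      \<bar>det (matrix (F \<alpha>))\<bar> * dens c' D' (kap c' D' (\<Phi> \<alpha>)) = j \<alpha> * dens c D (kap c D \<alpha>)" ..
  have kk: "kinv c D (kap c D \<alpha>) = \<alpha>" if "\<alpha> \<in> E" for \<alpha> by (rule kinv_kap[OF ad(1) subsetD[OF E(2) that]])
  have fZ: "?f ` ?Z = kap c' D' ` (\<Phi> ` E)"
    unfolding image_image using kk by (intro image_cong) simp_all
  have fder: "(?f has_derivative F (kinv c D z)) (at z within ?Z)" if "z \<in> ?Z" for z
  proof -
    obtain \<alpha> where a: "\<alpha> \<in> E" "z = kap c D \<alpha>" using \<open>z \<in> ?Z\<close> by (rule imageE)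
    show ?thesis unfolding a(2) kk[OF a(1)]
      by (rule has_derivative_at_withinI) (rule conjunct1[OF bspec[OF F a(1)]])
  qed
  have finj: "inj_on ?f ?Z"
  proof (rule inj_onI)
    fix x y assume x: "x \<in> ?Z" and y: "y \<in> ?Z" and eq: "?f x = ?f y"
    obtain \<alpha> where a: "\<alpha> \<in> E" "x = kap c D \<alpha>" using x by (rule imageE)
    obtain \<beta> where b: "\<beta> \<in> E" "y = kap c D \<beta>" using y by (rule imageE)
    have "\<Phi> \<alpha> = \<Phi> \<beta>" using eq inj_onD[OF inj_on_kap[OF ad(2) \<Phi>E(2)], of "\<Phi> \<alpha>" "\<Phi> \<beta>"] a b by (simp add: kk)
    from inj_onD[OF inj this a(1) b(1)] show "x = y" using a b by simp
  qed
  have "chart_int c' D' (\<Phi> ` E) = (\<integral>\<^sup>+z. ennreal (dens c' D' z) * indicator (?f ` ?Z) z \<partial>lborel)"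
    unfolding chart_int_def fZ ..
  also have "\<dots> = (\<integral>\<^sup>+z. ennreal (\<bar>det (matrix (F (kinv c D z)))\<bar> * dens c' D' (?f z)) * indicator ?Z z \<partial>lborel)"
    by (rule nn_integral_change_of_variables[OF kap_image_borel[OF ad(1) E] _ fder finj
          dens_measurable[OF adaptedD(1)[OF ad(2)]] dens_nonneg[OF adaptedD(1)[OF ad(2)]]])
       (use kap_image_borel[OF ad(2) \<Phi>E] fZ in simp_all)
  also have "\<dots> = (\<integral>\<^sup>+z. ennreal (j (kinv c D z) * dens c D z) * indicator ?Z z \<partial>lborel)"
  proof (rule nn_integral_cong)
    fix z
    show "ennreal (\<bar>det (matrix (F (kinv c D z)))\<bar> * dens c' D' (?f z)) * indicator ?Z z
        = ennreal (j (kinv c D z) * dens c D z) * indicator ?Z z"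
    proof (cases "z \<in> ?Z")
      case True
      then obtain \<alpha> where a: "\<alpha> \<in> E" "z = kap c D \<alpha>" by (rule imageE)
      show ?thesis unfolding a(2) kk[OF a(1)] using conjunct2[OF bspec[OF F a(1)]] by simp
    qed simp
  qed
  finally show ?thesis .
qed

lemma identity_derivative:
  assumes ad: "adapted H d c D" "adapted H d c' D'" and \<alpha>: "\<alpha> \<in> conormal_over c" "\<alpha> \<in> conormal_over c'"
  obtains F where "(ctrans c c' has_derivative F) (at (coord c \<alpha>))"
    "((\<lambda>z. coord c' (of_coord c z)) has_derivative F) (at (coord c \<alpha>))"
    "((\<lambda>z. kap c' D' (kinv c D z)) has_derivative (\<lambda>w. merge D' (F (conormal_param D w)))) (at (kap c D \<alpha>))"
    "\<bar>det (matrix (\<lambda>w. merge D' (F (conormal_param D w))))\<bar> * dens c' D' (kap c' D' \<alpha>) = dens c D (kap c D \<alpha>)"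
proof -
  note c = adaptedD(1)[OF ad(1)] adaptedD(1)[OF ad(2)]
  from coord_change_derivative[OF c conormal_overD(2)[OF \<alpha>(1)] conormal_overD(2)[OF \<alpha>(2)]]
  obtain F where F: "(ctrans c c' has_derivative F) (at (coord c \<alpha>))"
    "((\<lambda>z. coord c' (of_coord c z)) has_derivative F) (at (coord c \<alpha>))" .
  show ?thesis
  proof (rule that[OF F kap_derivative[OF ad(1) \<alpha>(1), of c' "\<lambda>\<alpha>. \<alpha>", OF F(2)]])
    show "\<bar>det (matrix (\<lambda>w. merge D' (F (conormal_param D w))))\<bar> * dens c' D' (kap c' D' \<alpha>) = dens c D (kap c D \<alpha>)"
      unfolding dens_kap[OF ad(1) \<alpha>(1)] dens_kap[OF ad(2) \<alpha>(2)] density_change[OF ad \<alpha> F(1)] ..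
  qed
qed

lemma chart_int_change:
  assumes ad: "adapted H d c D" "adapted H d c' D'"
    and E: "E \<in> sets cot_borel" "E \<subseteq> conormal_over c" "E \<subseteq> conormal_over c'"
  shows "chart_int c' D' E = chart_int c D E"
proof -
  have "chart_int c' D' ((\<lambda>\<alpha>. \<alpha>) ` E) = (\<integral>\<^sup>+z. ennreal (1 * dens c D z) * indicator (kap c D ` E) z \<partial>lborel)"
  proof (rule chart_int_image[OF ad E(1,2)])
    fix \<alpha> assume \<alpha>: "\<alpha> \<in> E"
    note a = subsetD[OF E(2) \<alpha>] subsetD[OF E(3) \<alpha>]
    from identity_derivative[OF ad a] obtain F where
      "((\<lambda>z. kap c' D' (kinv c D z)) has_derivative (\<lambda>w. merge D' (F (conormal_param D w)))) (at (kap c D \<alpha>))"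
      "\<bar>det (matrix (\<lambda>w. merge D' (F (conormal_param D w))))\<bar> * dens c' D' (kap c' D' \<alpha>) = dens c D (kap c D \<alpha>)" .
    then show "\<exists>F. ((\<lambda>z. kap c' D' (kinv c D z)) has_derivative F) (at (kap c D \<alpha>)) \<and>
        \<bar>det (matrix F)\<bar> * dens c' D' (kap c' D' \<alpha>) = 1 * dens c D (kap c D \<alpha>)"
      by (intro exI conjI) simp_all
  qed (use E in simp_all)
  then show ?thesis unfolding chart_int_def by simp
qed

definition is_conormal_measure :: "('a \<times> (('a, 'n) chart \<Rightarrow> real^'n)) measure \<Rightarrow> bool" where
  "is_conormal_measure \<mu> \<longleftrightarrow> space \<mu> = dot_conormal \<and> sets \<mu> = {S \<in> sets cot_borel. S \<subseteq> dot_conormal} \<and>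
     (\<forall>c D S. adapted H d c D \<longrightarrow> S \<in> sets cot_borel \<longrightarrow> S \<subseteq> conormal_over c \<longrightarrow> emeasure \<mu> S = chart_int c D S)"

lemma conormal_borel: "dot_conormal \<in> sets cot_borel"
proof -
  obtain n ch sp P where "chart_partition n ch sp P" using ex_chart_partition by blast
  note P = chart_partitionD[OF this]
  show ?thesis unfolding P(5) using P(2) by (intro sets.finite_UN) auto
qed

lemma conormal_over_iff: "S \<subseteq> dot_conormal \<Longrightarrow> fst ` S \<subseteq> cdom c \<longleftrightarrow> S \<subseteq> conormal_over c"
  unfolding conormal_over_def over_def using dot_conormalD(2) by blast

lemma is_conormal_measure_iff:
  "is_conormal_measure \<mu> \<longleftrightarrow> space \<mu> = dot_conormal \<and> sets \<mu> = borel_sets dot_conormal \<and>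
     (\<forall>c D. \<forall>S\<in>sets \<mu>. adapted H d c D \<and> fst ` S \<subseteq> cdom c \<longrightarrow>
        emeasure \<mu> S = (\<integral>\<^sup>+ z. ennreal (density_N c D (proj D z)) * indicator (kap c D ` S) z \<partial>lborel))"
  (is "_ \<longleftrightarrow> _ \<and> _ \<and> ?R")
proof -
  have "?R \<longleftrightarrow> (\<forall>c D S. adapted H d c D \<longrightarrow> S \<in> sets cot_borel \<longrightarrow> S \<subseteq> conormal_over c \<longrightarrow> emeasure \<mu> S = chart_int c D S)"
    (is "_ \<longleftrightarrow> ?R'") if s: "sets \<mu> = {S \<in> sets cot_borel. S \<subseteq> dot_conormal}"
  proof
    assume R: ?R
    show ?R'
    proof (intro allI impI)
      fix c D S assume ad: "adapted H d c D" and S: "S \<in> sets cot_borel" "S \<subseteq> conormal_over c"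
      then have S': "S \<subseteq> dot_conormal" unfolding conormal_over_def by blast
      have "emeasure \<mu> S = (\<integral>\<^sup>+ z. ennreal (density_N c D (proj D z)) * indicator (kap c D ` S) z \<partial>lborel)"
        using R[rule_format, of S c D] s S S' ad conormal_over_iff[OF S'] by simp
      then show "emeasure \<mu> S = chart_int c D S" unfolding chart_int_def dens_eq_density_N[OF ad S(2)] .
    qed
  next
    assume R: ?R'
    show ?R
    proof (intro allI ballI impI)
      fix c D S assume S: "S \<in> sets \<mu>" and ad: "adapted H d c D \<and> fst ` S \<subseteq> cdom c"
      then have S': "S \<in> sets cot_borel" "S \<subseteq> dot_conormal" using s by simp_all
      have S2: "S \<subseteq> conormal_over c" using conormal_over_iff[OF S'(2)] ad by simp
      show "emeasure \<mu> S = (\<integral>\<^sup>+ z. ennreal (density_N c D (proj D z)) * indicator (kap c D ` S) z \<partial>lborel)"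
        using R[rule_format, OF conjunct1[OF ad] S'(1) S2]
        unfolding chart_int_def dens_eq_density_N[OF conjunct1[OF ad] S2] .
    qed
  qed
  then show ?thesis unfolding is_conormal_measure_def borel_sets_eq[OF conormal_borel] by auto
qed

text \<open>
  The pieces of a chart partition are measured in their own charts and added up; by invariance of the
  density, the result agrees with the prescription in every chart.
\<close>

lemma ex_conormal_measure: "\<exists>\<mu>. is_conormal_measure \<mu>"
proof -
  obtain n ch sp P where "chart_partition n ch sp P" using ex_chart_partition by blast
  note P = chart_partitionD[OF this]
  define m where "m S = (\<Sum>i<n. chart_int (ch i) (sp i) (S \<inter> P i))" for S
  define \<mu> where "\<mu> = measure_of dot_conormal (borel_sets dot_conormal) m"
  have pow: "borel_sets dot_conormal \<subseteq> Pow dot_conormal" unfolding borel_sets_eq[OF conormal_borel] by blast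
  have sa: "sigma_algebra dot_conormal (borel_sets dot_conormal)"
    unfolding borel_sets_def by (rule sigma_algebra_sigma_sets, rule subsetI, simp, rule openin_imp_subset)
  have sets: "sets \<mu> = borel_sets dot_conormal"
    unfolding \<mu>_def using sigma_algebra.sets_measure_of_eq[OF sa] .
  have ca: "countably_additive (borel_sets dot_conormal) m"
  proof (rule countably_additiveI)
    fix S :: "nat \<Rightarrow> _" assume S: "range S \<subseteq> borel_sets dot_conormal" "disjoint_family S"
    have Sb: "S k \<in> sets cot_borel" for k using S(1) unfolding borel_sets_eq[OF conormal_borel] by blast
    have "(\<Sum>k. m (S k)) = (\<Sum>i<n. \<Sum>k. chart_int (ch i) (sp i) (S k \<inter> P i))"
      unfolding m_def by (rule suminf_sum) (rule summableI)
    also have "\<dots> = (\<Sum>i<n. chart_int (ch i) (sp i) ((\<Union>k. S k) \<inter> P i))"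
    proof (rule sum.cong[OF refl])
      fix i assume "i \<in> {..<n}" then have i: "i < n" by simp
      have "disjoint_family (\<lambda>k. S k \<inter> P i)" using S(2) unfolding disjoint_family_on_def by blast
      then have "(\<Sum>k. chart_int (ch i) (sp i) (S k \<inter> P i)) = chart_int (ch i) (sp i) (\<Union>k. S k \<inter> P i)"
        by (rule chart_int_suminf[OF P(1)[OF i], rotated 2]) (use Sb P(2)[OF i] P(3)[OF i] in auto)
      then show "(\<Sum>k. chart_int (ch i) (sp i) (S k \<inter> P i)) = chart_int (ch i) (sp i) ((\<Union>k. S k) \<inter> P i)" by simp
    qed
    finally show "(\<Sum>k. m (S k)) = m (\<Union>k. S k)" unfolding m_def .
  qed
  have em: "emeasure \<mu> S = m S" if "S \<in> borel_sets dot_conormal" for S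
    unfolding \<mu>_def by (rule emeasure_measure_of_sigma[OF sa _ ca that]) (simp add: positive_def m_def chart_int_def)
  have "emeasure \<mu> S = chart_int c D S"
    if ad: "adapted H d c D" and S: "S \<in> sets cot_borel" "S \<subseteq> conormal_over c" for c D S
  proof -
    have SN: "S \<subseteq> dot_conormal" using S(2) unfolding conormal_over_def by blast
    define S' where "S' k = (if k < n then S \<inter> P k else {})" for k
    have S': "S' k \<in> sets cot_borel" "S' k \<subseteq> conormal_over c" for k
      using S P(2) by (auto simp: S'_def)
    have dis: "disjoint_family S'"
      using P(4) unfolding disjoint_family_on_def S'_def by auto
    have U: "(\<Union>k. S' k) = S"
    proof (intro equalityI subsetI)
      fix \<alpha> assume "\<alpha> \<in> S"
      moreover from this obtain i where "i < n" "\<alpha> \<in> P i" using SN P(5) by blast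
      ultimately show "\<alpha> \<in> (\<Union>k. S' k)" by (intro UN_I[of i]) (simp_all add: S'_def)
    qed (auto simp: S'_def split: if_splits)
    have "emeasure \<mu> S = m S" using em S SN unfolding borel_sets_eq[OF conormal_borel] by blast
    also have "\<dots> = (\<Sum>i<n. chart_int c D (S' i))" unfolding m_def
    proof (rule sum.cong[OF refl])
      fix i assume "i \<in> {..<n}" then have i: "i < n" by simp
      show "chart_int (ch i) (sp i) (S \<inter> P i) = chart_int c D (S' i)"
        unfolding S'_def using i S P(2,3)[OF i]
        by (simp, intro chart_int_change[OF ad P(1)[OF i]]) auto
    qed
    also have "\<dots> = (\<Sum>i. chart_int c D (S' i))"
      by (rule suminf_finite[symmetric]) (auto simp: S'_def chart_int_def)
    also have "\<dots> = chart_int c D S" unfolding chart_int_suminf[OF ad S' dis] U ..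
    finally show ?thesis .
  qed
  then have "is_conormal_measure \<mu>"
    unfolding is_conormal_measure_def sets borel_sets_eq[OF conormal_borel]
    by (intro conjI allI impI refl) (simp_all add: \<mu>_def space_measure_of[OF pow])
  then show ?thesis by blast
qed

lemma is_conormal_measure_unique:
  assumes "is_conormal_measure \<mu>" "is_conormal_measure \<nu>" shows "\<mu> = \<nu>"
proof (rule measure_eqI)
  obtain n ch sp P where "chart_partition n ch sp P" using ex_chart_partition by blast
  note P = chart_partitionD[OF this]
  show "sets \<mu> = sets \<nu>" using assms by (simp add: is_conormal_measure_def)
  fix S assume "S \<in> sets \<mu>"
  then have S: "S \<in> sets cot_borel" "S \<subseteq> dot_conormal" using assms by (simp_all add: is_conormal_measure_def)
  have key: "emeasure \<kappa> S = (\<Sum>i<n. chart_int (ch i) (sp i) (S \<inter> P i))" if k: "is_conormal_measure \<kappa>" for \<kappa>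
  proof -
    have "S = (\<Union>i<n. S \<inter> P i)" using S(2) P(5) by blast
    then have "emeasure \<kappa> S = emeasure \<kappa> (\<Union>i<n. S \<inter> P i)" by (rule arg_cong)
    also have "\<dots> = (\<Sum>i<n. emeasure \<kappa> (S \<inter> P i))"
    proof (rule sum_emeasure[symmetric])
      show "disjoint_family_on (\<lambda>i. S \<inter> P i) {..<n}" using P(4) unfolding disjoint_family_on_def by blast
      show "(\<lambda>i. S \<inter> P i) ` {..<n} \<subseteq> sets \<kappa>" using k S P(2) by (auto simp: is_conormal_measure_def)
    qed simp
    also have "\<dots> = (\<Sum>i<n. chart_int (ch i) (sp i) (S \<inter> P i))"
    proof (rule sum.cong[OF refl])
      fix i assume "i \<in> {..<n}" then have i: "i < n" by simp
      show "emeasure \<kappa> (S \<inter> P i) = chart_int (ch i) (sp i) (S \<inter> P i)"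
        using k[unfolded is_conormal_measure_def, THEN conjunct2, THEN conjunct2, rule_format, OF P(1)[OF i], of "S \<inter> P i"]
          S(1) P(2)[OF i] P(3)[OF i] by blast
    qed
    finally show ?thesis .
  qed
  show "emeasure \<mu> S = emeasure \<nu> S" using key assms by simp
qed

lemma is_conormal_measure: "is_conormal_measure conormal_measure"
proof -
  obtain \<mu> where \<mu>: "is_conormal_measure \<mu>" using ex_conormal_measure by blast
  have "conormal_measure = \<mu>" unfolding conormal_measure_def is_conormal_measure_iff[symmetric]
  proof (rule the_equality)
    show "is_conormal_measure \<mu>" by (rule \<mu>)
    show "\<nu> = \<mu>" if "is_conormal_measure \<nu>" for \<nu> by (rule is_conormal_measure_unique[OF that \<mu>])
  qed
  then show ?thesis using \<mu> by simp
qed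

lemma space_conormal_measure [simp]: "space conormal_measure = dot_conormal"
  and sets_conormal_measure: "sets conormal_measure = {S \<in> sets cot_borel. S \<subseteq> dot_conormal}"
  using is_conormal_measure unfolding is_conormal_measure_def by blast+

lemma emeasure_conormal:
  assumes "adapted H d c D" "S \<in> sets cot_borel" "S \<subseteq> conormal_over c"
  shows "emeasure conormal_measure S = chart_int c D S"
  using is_conormal_measure[unfolded is_conormal_measure_def, THEN conjunct2, THEN conjunct2, rule_format, OF assms] .

text \<open>Up to the density, a piece of the conormal measure is the image of Lebesgue measure under the parametrization.\<close>

lemma nn_integral_conormal:
  assumes ad: "adapted H d c D" and S: "S \<in> sets cot_borel" "S \<subseteq> conormal_over c"
    and f: "f \<in> borel_measurable conormal_measure"
  shows "(\<integral>\<^sup>+\<alpha>. f \<alpha> * indicator S \<alpha> \<partial>conormal_measure) =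
     (\<integral>\<^sup>+z. f (kinv c D z) * (ennreal (dens c D z) * indicator (kap c D ` S) z) \<partial>lborel)"
proof (cases "S = {}")
  case False
  then obtain a0 where a0: "a0 \<in> S" by blast
  have SN: "S \<subseteq> dot_conormal" using S(2) unfolding conormal_over_def by blast
  have Ss: "S \<in> sets conormal_measure" using S SN by (simp add: sets_conormal_measure)
  note kb = kap_image_borel[OF ad S] and dm = dens_measurable[OF adaptedD(1)[OF ad]]
  define h where "h z = (if z \<in> kap c D ` S then kinv c D z else a0)" for z
  have kk: "kinv c D (kap c D \<alpha>) = \<alpha>" if "\<alpha> \<in> S" for \<alpha> by (rule kinv_kap[OF ad subsetD[OF S(2) that]])
  have hS: "h z \<in> S" for z unfolding h_def using kk a0 by auto
  have vi: "h -` T \<inter> kap c D ` S = kap c D ` (S \<inter> T)" for T unfolding h_def using kk by auto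
  have hm: "h \<in> lborel \<rightarrow>\<^sub>M conormal_measure"
  proof (rule measurableI)
    show "h z \<in> space conormal_measure" for z using hS SN by auto
    fix T assume "T \<in> sets conormal_measure"
    then have T: "T \<in> sets cot_borel" by (simp add: sets_conormal_measure)
    have "h -` T \<inter> space lborel = kap c D ` (S \<inter> T) \<union> (if a0 \<in> T then - (kap c D ` S) else {})"
      unfolding vi[symmetric] by (auto simp: h_def split: if_splits)
    moreover have "kap c D ` (S \<inter> T) \<in> sets borel" using kap_image_borel[OF ad, of "S \<inter> T"] S T by auto
    ultimately show "h -` T \<inter> space lborel \<in> sets lborel" using kb by simp
  qed
  let ?w = "\<lambda>z. ennreal (dens c D z) * indicator (kap c D ` S) z"
  have wm: "?w \<in> borel_measurable lborel" using dm kb by simp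
  have eq: "density conormal_measure (indicator S) = distr (density lborel ?w) conormal_measure h"
  proof (rule measure_eqI)
    fix T assume "T \<in> sets (density conormal_measure (indicator S))"
    then have Ts: "T \<in> sets conormal_measure" by simp
    then have T: "T \<in> sets cot_borel" by (simp add: sets_conormal_measure)
    have hv: "h -` T \<in> sets lborel" using measurable_sets[OF hm Ts] by simp
    have "emeasure (density conormal_measure (indicator S)) T = emeasure conormal_measure (S \<inter> T)"
      using Ss Ts by (subst emeasure_density) (auto simp: indicator_inter_arith[symmetric] nn_integral_indicator)
    also have "\<dots> = chart_int c D (S \<inter> T)" using S T by (intro emeasure_conormal[OF ad]) auto
    also have "\<dots> = (\<integral>\<^sup>+z. ?w z * indicator (h -` T) z \<partial>lborel)"
      unfolding chart_int_def vi[symmetric] by (intro nn_integral_cong) (simp add: indicator_inter_arith ac_simps)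
    also have "\<dots> = emeasure (density lborel ?w) (h -` T)" using wm hv by (subst emeasure_density) auto
    also have "\<dots> = emeasure (distr (density lborel ?w) conormal_measure h) T"
      using hm Ts by (subst emeasure_distr) auto
    finally show "emeasure (density conormal_measure (indicator S)) T = emeasure (distr (density lborel ?w) conormal_measure h) T" .
  qed simp
  have "(\<integral>\<^sup>+\<alpha>. f \<alpha> * indicator S \<alpha> \<partial>conormal_measure) = (\<integral>\<^sup>+\<alpha>. f \<alpha> \<partial>density conormal_measure (indicator S))"
    using Ss f by (subst nn_integral_density) (auto simp: mult.commute)
  also have "\<dots> = (\<integral>\<^sup>+z. f (h z) \<partial>density lborel ?w)" unfolding eq
    using hm f by (subst nn_integral_distr) auto
  also have "\<dots> = (\<integral>\<^sup>+z. ?w z * f (h z) \<partial>lborel)"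
    using wm measurable_compose[OF hm f] by (subst nn_integral_density) auto
  also have "\<dots> = (\<integral>\<^sup>+z. f (kinv c D z) * ?w z \<partial>lborel)"
    by (rule nn_integral_cong) (auto simp: h_def indicator_def mult.commute)
  finally show ?thesis .
qed simp

text \<open>
  The formula in charts, summed over the finitely many pieces on which both \<open>\<alpha>\<close> and \<open>\<Phi>(\<alpha>)\<close> stay in one
  piece of a chart partition.
\<close>

lemma emeasure_conormal_image:
  assumes E: "E \<in> sets conormal_measure" and \<Phi>: "\<And>S. S \<in> sets cot_borel \<Longrightarrow> S \<subseteq> E \<Longrightarrow> \<Phi> ` S \<in> sets cot_borel"
    and \<Phi>v: "\<And>S. S \<in> sets cot_borel \<Longrightarrow> {\<alpha> \<in> E. \<Phi> \<alpha> \<in> S} \<in> sets cot_borel" and \<Phi>N: "\<Phi> ` E \<subseteq> dot_conormal"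
    and inj: "inj_on \<Phi> E" and j: "(\<lambda>\<alpha>. indicator E \<alpha> * j \<alpha>) \<in> borel_measurable conormal_measure" "\<And>\<alpha>. \<alpha> \<in> E \<Longrightarrow> j \<alpha> \<ge> 0"
    and der: "\<And>\<alpha> c D c' D'. \<alpha> \<in> E \<Longrightarrow> adapted H d c D \<Longrightarrow> adapted H d c' D' \<Longrightarrow> \<alpha> \<in> conormal_over c \<Longrightarrow> \<Phi> \<alpha> \<in> conormal_over c' \<Longrightarrow>
       \<exists>F. ((\<lambda>z. kap c' D' (\<Phi> (kinv c D z))) has_derivative F) (at (kap c D \<alpha>)) \<and>
       \<bar>det (matrix F)\<bar> * dens c' D' (kap c' D' (\<Phi> \<alpha>)) = j \<alpha> * dens c D (kap c D \<alpha>)"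
  shows "emeasure conormal_measure (\<Phi> ` E) = (\<integral>\<^sup>+\<alpha>. ennreal (j \<alpha>) * indicator E \<alpha> \<partial>conormal_measure)"
proof -
  obtain n ch sp P where "chart_partition n ch sp P" using ex_chart_partition by blast
  note P = chart_partitionD[OF this]
  have Eb: "E \<in> sets cot_borel" "E \<subseteq> dot_conormal" using E by (simp_all add: sets_conormal_measure)
  define K where "K = (\<lambda>k. E \<inter> P (fst k) \<inter> {\<alpha> \<in> E. \<Phi> \<alpha> \<in> P (snd k)})"
  let ?I = "{..<n} \<times> {..<n}"
  have Kb: "K k \<in> sets cot_borel" if "k \<in> ?I" for k
    unfolding K_def using that P(2) by (intro sets.Int Eb \<Phi>v) auto
  have KE: "K k \<subseteq> E" for k unfolding K_def by blast
  have Kc: "K k \<subseteq> conormal_over (ch (fst k))" "\<Phi> ` K k \<subseteq> conormal_over (ch (snd k))" if "k \<in> ?I" for k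
    using that P(3)[of "fst k"] P(3)[of "snd k"] unfolding K_def by auto
  have dP: "a = b" if "x \<in> P a" "x \<in> P b" "a < n" "b < n" for a b x
    using P(4) that unfolding disjoint_family_on_def by blast
  have dK: "k = l" if "\<alpha> \<in> K k" "\<alpha> \<in> K l" "k \<in> ?I" "l \<in> ?I" for k l \<alpha>
    using that dP[of \<alpha> "fst k" "fst l"] dP[of "\<Phi> \<alpha>" "snd k" "snd l"] unfolding K_def by (auto simp: prod_eq_iff)
  have disK: "disjoint_family_on K ?I" unfolding disjoint_family_on_def using dK by blast
  have disPK: "disjoint_family_on (\<lambda>k. \<Phi> ` K k) ?I" unfolding disjoint_family_on_def
  proof (intro ballI impI)
    fix k l assume kl: "k \<in> ?I" "l \<in> ?I" "k \<noteq> l"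
    have "K k \<inter> K l = {}" using dK[of _ k l] kl by blast
    then show "\<Phi> ` K k \<inter> \<Phi> ` K l = {}" using inj_on_image_Int[OF inj KE[of k] KE[of l]] by simp
  qed
  have UK: "E = (\<Union>k\<in>?I. K k)"
  proof (intro equalityI subsetI)
    fix \<alpha> assume a: "\<alpha> \<in> E"
    obtain i where i: "i < n" "\<alpha> \<in> P i" using a Eb(2) P(5) by blast
    obtain l where l: "l < n" "\<Phi> \<alpha> \<in> P l" using a \<Phi>N P(5) by blast
    show "\<alpha> \<in> (\<Union>k\<in>?I. K k)" by (rule UN_I[of "(i, l)"]) (use i l a in \<open>simp_all add: K_def\<close>)
  qed (use KE in blast)
  have jE: "(\<lambda>\<alpha>. ennreal (indicator E \<alpha> * j \<alpha>)) \<in> borel_measurable conormal_measure" using j(1) by simp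
  have piece: "emeasure conormal_measure (\<Phi> ` K k) = (\<integral>\<^sup>+\<alpha>. ennreal (indicator E \<alpha> * j \<alpha>) * indicator (K k) \<alpha> \<partial>conormal_measure)"
    if k: "k \<in> ?I" for k
  proof -
    have ad: "adapted H d (ch (fst k)) (sp (fst k))" "adapted H d (ch (snd k)) (sp (snd k))" using k P(1) by auto
    let ?c = "ch (fst k)" and ?D = "sp (fst k)" and ?c' = "ch (snd k)" and ?D' = "sp (snd k)"
    have "emeasure conormal_measure (\<Phi> ` K k) = chart_int ?c' ?D' (\<Phi> ` K k)"
      by (rule emeasure_conormal[OF ad(2) \<Phi>[OF Kb[OF k] KE] Kc(2)[OF k]])
    also have "\<dots> = (\<integral>\<^sup>+z. ennreal (j (kinv ?c ?D z) * dens ?c ?D z) * indicator (kap ?c ?D ` K k) z \<partial>lborel)"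
    proof (rule chart_int_image[OF ad Kb[OF k] Kc(1)[OF k] \<Phi>[OF Kb[OF k] KE] Kc(2)[OF k] inj_on_subset[OF inj KE]])
      fix \<alpha> assume a: "\<alpha> \<in> K k"
      have "\<alpha> \<in> E" "\<alpha> \<in> conormal_over ?c" "\<Phi> \<alpha> \<in> conormal_over ?c'"
        using a KE[of k] Kc(1)[OF k] Kc(2)[OF k] by auto
      from der[OF this(1) ad this(2,3)]
      show "\<exists>F. ((\<lambda>z. kap ?c' ?D' (\<Phi> (kinv ?c ?D z))) has_derivative F) (at (kap ?c ?D \<alpha>)) \<and>
       \<bar>det (matrix F)\<bar> * dens ?c' ?D' (kap ?c' ?D' (\<Phi> \<alpha>)) = j \<alpha> * dens ?c ?D (kap ?c ?D \<alpha>)" .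
    qed
    also have "\<dots> = (\<integral>\<^sup>+z. ennreal (indicator E (kinv ?c ?D z) * j (kinv ?c ?D z)) *
        (ennreal (dens ?c ?D z) * indicator (kap ?c ?D ` K k) z) \<partial>lborel)"
    proof (rule nn_integral_cong)
      fix z
      show "ennreal (j (kinv ?c ?D z) * dens ?c ?D z) * indicator (kap ?c ?D ` K k) z =
        ennreal (indicator E (kinv ?c ?D z) * j (kinv ?c ?D z)) * (ennreal (dens ?c ?D z) * indicator (kap ?c ?D ` K k) z)"
      proof (cases "z \<in> kap ?c ?D ` K k")
        case True
        then have "kinv ?c ?D z \<in> E" using kap_image[OF ad(1) Kc(1)[OF k]] KE by blast
        then show ?thesis using True j(2) dens_nonneg[OF adaptedD(1)[OF ad(1)]] by (simp add: ennreal_mult)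
      qed simp
    qed
    also have "\<dots> = (\<integral>\<^sup>+\<alpha>. ennreal (indicator E \<alpha> * j \<alpha>) * indicator (K k) \<alpha> \<partial>conormal_measure)"
      by (rule nn_integral_conormal[OF ad(1) Kb[OF k] Kc(1)[OF k] jE, symmetric])
    finally show ?thesis .
  qed
  have Ks: "K k \<in> sets conormal_measure" if "k \<in> ?I" for k
    using Kb[OF that] KE[of k] Eb(2) by (auto simp: sets_conormal_measure)
  have "\<Phi> ` E = (\<Union>k\<in>?I. \<Phi> ` K k)" by (subst UK) (rule image_UN)
  then have "emeasure conormal_measure (\<Phi> ` E) = emeasure conormal_measure (\<Union>k\<in>?I. \<Phi> ` K k)" by simp
  also have "\<dots> = (\<Sum>k\<in>?I. emeasure conormal_measure (\<Phi> ` K k))"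
  proof (rule sum_emeasure[symmetric, OF _ disPK])
    show "(\<lambda>k. \<Phi> ` K k) ` ?I \<subseteq> sets conormal_measure"
    proof (rule image_subsetI)
      fix k assume "k \<in> ?I"
      then show "\<Phi> ` K k \<in> sets conormal_measure"
        using \<Phi>[OF Kb KE] image_mono[OF KE[of k], of \<Phi>] \<Phi>N by (auto simp: sets_conormal_measure)
    qed
  qed simp
  also have "\<dots> = (\<Sum>k\<in>?I. \<integral>\<^sup>+\<alpha>. ennreal (indicator E \<alpha> * j \<alpha>) * indicator (K k) \<alpha> \<partial>conormal_measure)"
    by (rule sum.cong[OF refl piece])
  also have "\<dots> = (\<integral>\<^sup>+\<alpha>. (\<Sum>k\<in>?I. ennreal (indicator E \<alpha> * j \<alpha>) * indicator (K k) \<alpha>) \<partial>conormal_measure)"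
    by (rule nn_integral_sum[symmetric]) (use jE Ks in simp)
  also have "\<dots> = (\<integral>\<^sup>+\<alpha>. ennreal (j \<alpha>) * indicator E \<alpha> \<partial>conormal_measure)"
  proof (rule nn_integral_cong)
    fix \<alpha>
    have "(\<Sum>k\<in>?I. indicator (K k) \<alpha>) = (indicator (\<Union>k\<in>?I. K k) \<alpha> :: ennreal)"
      by (rule indicator_UN_disjoint[symmetric]) (simp, rule disK)
    then have "(\<Sum>k\<in>?I. indicator (K k) \<alpha>) = (indicator E \<alpha> :: ennreal)" using UK by simp
    then show "(\<Sum>k\<in>?I. ennreal (indicator E \<alpha> * j \<alpha>) * indicator (K k) \<alpha>) = ennreal (j \<alpha>) * indicator E \<alpha>"
      by (auto simp: sum_distrib_left[symmetric] indicator_def)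
  qed
  finally show ?thesis .
qed

end

section \<open>The Jacobian of the flow along the conormal bundle\<close>

text \<open>The action of \<open>(x, \<xi>) \<mapsto> (x, s \<xi>)\<close> on the parameters of a conormal bundle.\<close>

definition dilate :: "'n set \<Rightarrow> real \<Rightarrow> real^'n \<Rightarrow> real^'n::finite" where
  "dilate D s w = (\<chi> i. if i \<in> D then w $ i else s * w $ i)"

lemma linear_dilate: "linear (dilate D s)"
  by (auto simp: linear_iff dilate_def vec_eq_iff algebra_simps)

lemma det_dilate:
  fixes D :: "'n::finite set"
  shows "det (matrix (dilate D s)) = s ^ (CARD('n) - card D)"
proof -
  have e: "matrix (dilate D s) $ i $ j = (if i = j then if i \<in> D then 1 else s else 0)" for i j
    by (auto simp: matrix_def dilate_def axis_def)
  have "det (matrix (dilate D s)) = (\<Prod>i\<in>UNIV. matrix (dilate D s) $ i $ i)" by (rule det_diagonal) (simp add: e)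
  also have "\<dots> = (\<Prod>i\<in>-D. s)" unfolding e by (simp add: prod.If_cases Compl_eq)
  also have "\<dots> = s ^ (CARD('n) - card D)" by (simp add: Compl_eq_Diff_UNIV card_Diff_subset)
  finally show ?thesis .
qed

lemma dilate_conormal_param: "(fst (conormal_param D w), s *\<^sub>R snd (conormal_param D w)) = conormal_param D (dilate D s w)"
  by (auto simp: conormal_param_def proj_def dilate_def vec_eq_iff)

lemma merge_dilate: "merge D (fst z, s *\<^sub>R snd z) = dilate D s (merge D z)"
  by (simp add: merge_def dilate_def vec_eq_iff split_beta)

lemma bounded_linear_fiber_scale:
  "bounded_linear (\<lambda>z :: (real^'n::finite) \<times> (real^'n). (fst z, s *\<^sub>R snd z))"
  by (intro bounded_linear_Pair bounded_linear_fst bounded_linear_const_scaleR bounded_linear_snd)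

lemma inj_conormal_param: "inj (conormal_param D)"
  by (rule inj_on_inverseI[of _ "merge D"]) simp

lemma bij_betw_conormal_param:
  fixes D D' :: "'n::finite set"
  assumes "\<And>w. L (conormal_param D w) = conormal_param D' (C w)"
  shows "bij_betw L (range (conormal_param D)) (range (conormal_param D')) \<longleftrightarrow> bij C"
proof -
  have b: "bij_betw (conormal_param D) UNIV (range (conormal_param D))" for D :: "'n set"
    using inj_conormal_param by (simp add: bij_betw_def)
  have "bij_betw L (range (conormal_param D)) (range (conormal_param D'))
      \<longleftrightarrow> bij_betw (L \<circ> conormal_param D) UNIV (range (conormal_param D'))"
    by (rule bij_betw_comp_iff[OF b])
  also have "L \<circ> conormal_param D = conormal_param D' \<circ> C" using assms by auto
  also have "bij_betw (conormal_param D' \<circ> C) UNIV (range (conormal_param D')) \<longleftrightarrow> bij C"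
    using bij_betw_comp_iff2[OF b[of D'], of C UNIV] by simp
  finally show ?thesis .
qed

lemma bij_if_det:
  fixes C :: "real^'n::finite \<Rightarrow> real^'n"
  assumes "linear C" "det (matrix C) \<noteq> 0" shows "bij C"
  using assms det_nz_iff_inj[of C] linear_injective_imp_surjective[of C] by (auto simp: bij_def)

lemma det_matrix_compose3:
  fixes f g h :: "real^'n::finite \<Rightarrow> real^'n"
  assumes "linear f" "linear g" "linear h"
  shows "det (matrix (\<lambda>w. f (g (h w)))) = det (matrix f) * det (matrix g) * det (matrix h)"
proof -
  have "(\<lambda>w. f (g (h w))) = f \<circ> (g \<circ> h)" by auto
  then have "matrix (\<lambda>w. f (g (h w))) = matrix f ** (matrix g ** matrix h)"
    using matrix_compose[OF linear_compose[OF assms(3,2)] assms(1)] matrix_compose[OF assms(3,2)] by simp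
  then show ?thesis by (simp add: det_mul)
qed

text \<open>
  The map induced on parameters by a linear map between tangent spaces of conormal bundles.
\<close>

abbreviation restr :: "'n set \<Rightarrow> 'n set \<Rightarrow> ((real^'n) \<times> (real^'n) \<Rightarrow> (real^'n) \<times> (real^'n::finite)) \<Rightarrow> real^'n \<Rightarrow> real^'n" where
  "restr D D' L \<equiv> (\<lambda>w. merge D' (L (conormal_param D w)))"

lemma linear_restr: "linear L \<Longrightarrow> linear (restr D D' L)"
  using linear_compose[OF linear_compose[OF _ _] , of "conormal_param D" L "merge D'"]
    bounded_linear.linear[OF bounded_linear_conormal_param[of D]] bounded_linear.linear[OF bounded_linear_merge[of D']]
  by (simp add: o_def)

context compact_riemannian_submanifold
begin

lemma over_dens_pos:
  assumes "adapted H d c D" "\<alpha> \<in> conormal_over c" shows "dens c D (kap c D \<alpha>) > 0"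
  unfolding dens_kap[OF assms] using conormal_overD(3)[OF assms(2)] by (intro density_N_pos adaptedD(1)[OF assms(1)] cmap_in)

text \<open>Coordinate changes preserve the tangent spaces of the conormal bundle, as they preserve the conormal bundle.\<close>

lemma ctrans_tangent:
  assumes ad: "adapted H d c D" "adapted H d c' D'" and \<alpha>: "\<alpha> \<in> conormal_over c" "\<alpha> \<in> conormal_over c'"
    and F: "((\<lambda>z. coord c' (of_coord c z)) has_derivative F) (at (coord c \<alpha>))"
  shows "F (conormal_param D w) = conormal_param D' (restr D D' F w)"
proof -
  note c = adaptedD(1)[OF ad(1)] and c' = adaptedD(1)[OF ad(2)]
  have 1: "(conormal_param D has_derivative conormal_param D) (at (kap c D \<alpha>))"
    by (rule bounded_linear_imp_has_derivative[OF bounded_linear_conormal_param])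
  have "((\<lambda>z. coord c' (of_coord c z)) has_derivative F) (at (conormal_param D (kap c D \<alpha>)))"
    unfolding param_kap[OF ad(1) \<alpha>(1)] by (rule F)
  from has_derivative_compose[OF 1 this]
  have d1: "((\<lambda>z. coord c' (kinv c D z)) has_derivative (\<lambda>w. F (conormal_param D w))) (at (kap c D \<alpha>))"
    unfolding kinv_def .
  have d2: "((\<lambda>z. conormal_param D' (kap c' D' (kinv c D z))) has_derivative (\<lambda>w. conormal_param D' (restr D D' F w))) (at (kap c D \<alpha>))"
    by (rule bounded_linear.has_derivative[OF bounded_linear_conormal_param kap_derivative[OF ad(1) \<alpha>(1), of c' "\<lambda>\<alpha>. \<alpha>", OF F]])
  let ?U = "Zdom c D \<inter> (conormal_param D -` (coord c ` (over c' \<inter> over c)))"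
  have U: "open ?U"
    by (intro open_Int open_Zdom[OF c] open_vimage open_coord_image[OF openin_over[OF c'] c]
        linear_continuous_on[OF bounded_linear_conormal_param])
  have "\<alpha> \<in> over c' \<inter> over c" using conormal_overD(2)[OF \<alpha>(1)] conormal_overD(2)[OF \<alpha>(2)] by simp
  then have "coord c \<alpha> \<in> coord c ` (over c' \<inter> over c)" by (rule imageI)
  then have aU: "kap c D \<alpha> \<in> ?U" using kap_in[OF ad(1) \<alpha>(1)] param_kap[OF ad(1) \<alpha>(1)] by simp
  have eq: "coord c' (kinv c D z) = conormal_param D' (kap c' D' (kinv c D z))" if z: "z \<in> ?U" for z
  proof -
    have zz: "z \<in> Zdom c D" "conormal_param D z \<in> coord c ` (over c' \<inter> over c)" using z by simp_all
    obtain \<beta> where b: "\<beta> \<in> over c' \<inter> over c" "conormal_param D z = coord c \<beta>" using zz(2) by (elim imageE)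
    have "kinv c D z = \<beta>" unfolding kinv_def b(2) using b(1) c by simp
    then have "kinv c D z \<in> conormal_over c'"
      using kinv_in[OF ad(1) zz(1)] b(1) unfolding conormal_over_def by simp
    from param_kap[OF ad(2) this] show ?thesis by simp
  qed
  from has_derivative_unique[OF has_derivative_transform_within_open[OF d1 U aU eq] d2]
  show ?thesis by (rule fun_cong)
qed

text \<open>The expression in the definition of \<open>J\<close>.\<close>

definition jac :: "real \<Rightarrow> 'a \<times> (('a, 'n) chart \<Rightarrow> real^'n) \<Rightarrow> ('a, 'n) chart \<Rightarrow> 'n set \<Rightarrow> ('a, 'n) chart \<Rightarrow> 'n set
     \<Rightarrow> ((real^'n) \<times> (real^'n) \<Rightarrow> (real^'n) \<times> (real^'n)) \<Rightarrow> real" where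
  "jac t \<alpha> c D c' D' L = density_N c' D' (cmap c' (fst (G t \<alpha>))) / density_N c D (cmap c (fst \<alpha>)) *
         \<bar>det (matrix (restr D D' L))\<bar>"

lemma transportsD:
  assumes "transports t \<alpha> c D c' D' L"
  shows "adapted H d c D" "adapted H d c' D'" "fst \<alpha> \<in> cdom c" "fst (G t \<alpha>) \<in> cdom c'"
    "((\<lambda>z. coord c' (G t (of_coord c z))) has_derivative L) (at (coord c \<alpha>))"
    "bij_betw L (range (conormal_param D)) (range (conormal_param D'))"
  using assms unfolding transports_def by blast+

lemma transports_param:
  assumes "transports t \<alpha> c D c' D' L"
  shows "L (conormal_param D w) = conormal_param D' (restr D D' L w)" "bij (restr D D' L)" "linear (restr D D' L)"
proof -
  show *: "L (conormal_param D w) = conormal_param D' (restr D D' L w)" for w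
  proof -
    have "L (conormal_param D w) \<in> range (conormal_param D')"
      using bij_betwE[OF transportsD(6)[OF assms]] by blast
    then obtain v where "L (conormal_param D w) = conormal_param D' v" by (rule imageE)
    then show ?thesis by simp
  qed
  show "bij (restr D D' L)" using transportsD(6)[OF assms] bij_betw_conormal_param[of L D D' "restr D D' L", OF *] by blast
  show "linear (restr D D' L)"
    by (rule linear_restr[OF has_derivative_linear[OF transportsD(5)[OF assms]]])
qed

lemma transports_over:
  assumes "transports t \<alpha> c D c' D' L" "\<alpha> \<in> dot_conormal" "G t \<alpha> \<in> dot_conormal"
  shows "\<alpha> \<in> conormal_over c" "G t \<alpha> \<in> conormal_over c'"
  unfolding conormal_over_def
  using assms(2,3) overI[OF dot_conormalD(2)[OF assms(2)] transportsD(3)[OF assms(1)]]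
    overI[OF dot_conormalD(2)[OF assms(3)] transportsD(4)[OF assms(1)]] by blast+

text \<open>
  Changing charts composes the differential with differentials of coordinate changes, whose determinants
  are quotients of densities.
\<close>

lemma transports_change:
  assumes T: "transports t \<alpha> c1 D1 c1' D1' L1" and aN: "\<alpha> \<in> dot_conormal" "G t \<alpha> \<in> dot_conormal"
    and ad: "adapted H d c D" "adapted H d c' D'" and \<alpha>: "\<alpha> \<in> conormal_over c" "G t \<alpha> \<in> conormal_over c'"
  obtains L where "transports t \<alpha> c D c' D' L" "jac t \<alpha> c D c' D' L = jac t \<alpha> c1 D1 c1' D1' L1"
proof -
  note ad1 = transportsD(1,2)[OF T] and \<alpha>1 = transports_over[OF T aN]
  note c = adaptedD(1)[OF ad(1)] adaptedD(1)[OF ad(2)] adaptedD(1)[OF ad1(1)] adaptedD(1)[OF ad1(2)]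
  obtain F1 where F1: "((\<lambda>z. coord c1 (of_coord c z)) has_derivative F1) (at (coord c \<alpha>))"
    "\<bar>det (matrix (restr D D1 F1))\<bar> * dens c1 D1 (kap c1 D1 \<alpha>) = dens c D (kap c D \<alpha>)"
    by (rule identity_derivative[OF ad(1) ad1(1) \<alpha>(1) \<alpha>1(1)])
  obtain F2 where F2: "((\<lambda>z. coord c' (of_coord c1' z)) has_derivative F2) (at (coord c1' (G t \<alpha>)))"
    "\<bar>det (matrix (restr D1' D' F2))\<bar> * dens c' D' (kap c' D' (G t \<alpha>)) = dens c1' D1' (kap c1' D1' (G t \<alpha>))"
    by (rule identity_derivative[OF ad1(2) ad(2) \<alpha>1(2) \<alpha>(2)])
  let ?A1 = "restr D D1 F1" and ?A2 = "restr D1' D' F2" and ?B = "restr D1 D1' L1"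
  let ?L = "\<lambda>z. F2 (L1 (F1 z))"
  have 1: "of_coord c (coord c \<alpha>) = \<alpha>" "of_coord c1 (coord c1 \<alpha>) = \<alpha>"
    using c conormal_overD(2)[OF \<alpha>(1)] conormal_overD(2)[OF \<alpha>1(1)] by simp_all
  have d1: "((\<lambda>z. coord c1' (G t (of_coord c1 z))) has_derivative L1) (at (coord c1 (of_coord c (coord c \<alpha>))))"
    unfolding 1 by (rule transportsD(5)[OF T])
  have d2: "((\<lambda>z. coord c' (of_coord c1' z)) has_derivative F2) (at (coord c1' (G t (of_coord c1 (coord c1 (of_coord c (coord c \<alpha>)))))))"
    unfolding 1 by (rule F2)
  have d3: "((\<lambda>z. coord c' (of_coord c1' (coord c1' (G t (of_coord c1 (coord c1 (of_coord c z))))))) has_derivative ?L) (at (coord c \<alpha>))"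
    by (rule has_derivative_compose[OF has_derivative_compose[OF F1(1) d1] d2])
  let ?V = "{\<gamma> \<in> dot_cotangent. G t \<gamma> \<in> over c1' \<inter> over c'} \<inter> over c1"
  have V: "openin cot_topology ?V"
    by (rule openin_Int[OF openin_G_vimage[OF openin_Int[OF openin_over[OF c(4)] openin_over[OF c(2)]]] openin_over[OF c(3)]])
  have W: "open (coord c ` (?V \<inter> over c))" by (rule open_coord_image[OF V c(1)])
  have "\<alpha> \<in> ?V \<inter> over c"
    using dot_conormalD(1)[OF aN(1)] conormal_overD(2)[OF \<alpha>(1)] conormal_overD(2)[OF \<alpha>1(1)]
      conormal_overD(2)[OF \<alpha>(2)] conormal_overD(2)[OF \<alpha>1(2)] by simp
  then have aW: "coord c \<alpha> \<in> coord c ` (?V \<inter> over c)" by (rule imageI)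
  have eq: "coord c' (of_coord c1' (coord c1' (G t (of_coord c1 (coord c1 (of_coord c z)))))) = coord c' (G t (of_coord c z))"
    if z: "z \<in> coord c ` (?V \<inter> over c)" for z
  proof -
    obtain \<gamma> where g: "\<gamma> \<in> ?V \<inter> over c" "z = coord c \<gamma>" using z by (elim imageE)
    have "of_coord c z = \<gamma>" unfolding g(2) using g(1) c by simp
    moreover have "of_coord c1 (coord c1 \<gamma>) = \<gamma>" "of_coord c1' (coord c1' (G t \<gamma>)) = G t \<gamma>" using g(1) c by simp_all
    ultimately show ?thesis by simp
  qed
  have d4: "((\<lambda>z. coord c' (G t (of_coord c z))) has_derivative ?L) (at (coord c \<alpha>))"
    by (rule has_derivative_transform_within_open[OF d3 W aW eq])
  have LC: "?L (conormal_param D w) = conormal_param D' (?A2 (?B (?A1 w)))" for w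
    using ctrans_tangent[OF ad(1) ad1(1) \<alpha>(1) \<alpha>1(1) F1(1), of w] transports_param(1)[OF T, of "?A1 w"]
      ctrans_tangent[OF ad1(2) ad(2) \<alpha>1(2) \<alpha>(2) F2(1), of "?B (?A1 w)"] by metis
  have lin: "linear ?A1" "linear ?A2" "linear ?B"
    using linear_restr[OF has_derivative_linear[OF F1(1)]] linear_restr[OF has_derivative_linear[OF F2(1)]] transports_param(3)[OF T] .
  note pos = over_dens_pos[OF ad(1) \<alpha>(1)] over_dens_pos[OF ad(2) \<alpha>(2)] over_dens_pos[OF ad1(1) \<alpha>1(1)] over_dens_pos[OF ad1(2) \<alpha>1(2)]
  have "det (matrix ?A1) \<noteq> 0" "det (matrix ?A2) \<noteq> 0" using F1(2) F2(2) pos by auto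
  then have "bij ?A1" "bij ?A2" using bij_if_det lin by blast+
  from bij_comp[OF this(1) bij_comp[OF transports_param(2)[OF T] this(2)]]
  have "bij (\<lambda>w. ?A2 (?B (?A1 w)))" unfolding o_def .
  then have bij: "bij_betw ?L (range (conormal_param D)) (range (conormal_param D'))"
    using bij_betw_conormal_param[of ?L D D', OF LC] by simp
  have T': "transports t \<alpha> c D c' D' ?L"
    unfolding transports_def using ad d4 bij conormal_overD(3)[OF \<alpha>(1)] conormal_overD(3)[OF \<alpha>(2)] by blast
  have "restr D D' ?L = (\<lambda>w. ?A2 (?B (?A1 w)))" unfolding LC by simp
  then have det: "\<bar>det (matrix (restr D D' ?L))\<bar> = \<bar>det (matrix ?A2)\<bar> * \<bar>det (matrix ?B)\<bar> * \<bar>det (matrix ?A1)\<bar>"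
    using det_matrix_compose3[OF lin(2,3,1)] by (simp add: abs_mult)
  have "jac t \<alpha> c D c' D' ?L = jac t \<alpha> c1 D1 c1' D1' L1"
    unfolding jac_def det dens_kap[OF ad(1) \<alpha>(1), symmetric] dens_kap[OF ad(2) \<alpha>(2), symmetric]
      dens_kap[OF ad1(1) \<alpha>1(1), symmetric] dens_kap[OF ad1(2) \<alpha>1(2), symmetric] F1(2)[symmetric] F2(2)[symmetric]
    using pos(3) \<open>det (matrix ?A1) \<noteq> 0\<close> by (simp add: field_simps)
  from that[OF T' this] show ?thesis .
qed

lemma Sigma_tD:
  assumes "\<alpha> \<in> Sigma_t t" shows "\<alpha> \<in> dot_conormal" "G t \<alpha> \<in> dot_conormal" "\<exists>c D c' D' L. transports t \<alpha> c D c' D' L"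
  using assms unfolding Sigma_t_def by blast+

text \<open>The choice of charts in the definition of \<open>J\<close> can be replaced by any other.\<close>

lemma J_eq:
  assumes \<alpha>: "\<alpha> \<in> Sigma_t t" and ad: "adapted H d c D" "adapted H d c' D'" and \<alpha>c: "\<alpha> \<in> conormal_over c" "G t \<alpha> \<in> conormal_over c'"
  obtains L where "transports t \<alpha> c D c' D' L" "J t \<alpha> = jac t \<alpha> c D c' D' L"
proof -
  \<comment> \<open>The choice in the definition of \<open>J\<close> picks some charts; the previous lemma moves to the given ones.\<close>
  let ?P = "\<lambda>r. \<exists>c D c' D' L. transports t \<alpha> c D c' D' L \<and> r = jac t \<alpha> c D c' D' L"
  have "\<exists>r. ?P r" using Sigma_tD(3)[OF \<alpha>] by blast
  then have "?P (J t \<alpha>)" unfolding J_def jac_def[symmetric] by (rule someI_ex)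
  then obtain c1 D1 c1' D1' L1 where T: "transports t \<alpha> c1 D1 c1' D1' L1" "J t \<alpha> = jac t \<alpha> c1 D1 c1' D1' L1" by blast
  from transports_change[OF T(1) Sigma_tD(1,2)[OF \<alpha>] ad \<alpha>c] obtain L where
    L: "transports t \<alpha> c D c' D' L" "jac t \<alpha> c D c' D' L = jac t \<alpha> c1 D1 c1' D1' L1" .
  show ?thesis by (rule that[OF L(1)]) (simp only: T(2) L(2))
qed

lemma J_nonneg:
  assumes \<alpha>: "\<alpha> \<in> Sigma_t t" shows "J t \<alpha> \<ge> 0"
proof -
  obtain c D c' D' L where T: "transports t \<alpha> c D c' D' L" using Sigma_tD(3)[OF \<alpha>] by blast
  note o = transports_over[OF T Sigma_tD(1,2)[OF \<alpha>]]
  from J_eq[OF \<alpha> transportsD(1,2)[OF T] o] obtain L' where "J t \<alpha> = jac t \<alpha> c D c' D' L'" .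
  moreover have "density_N c D (cmap c (fst \<alpha>)) > 0" "density_N c' D' (cmap c' (fst (G t \<alpha>))) > 0"
    using over_dens_pos[OF transportsD(1)[OF T] o(1)] over_dens_pos[OF transportsD(2)[OF T] o(2)]
      dens_kap[OF transportsD(1)[OF T] o(1)] dens_kap[OF transportsD(2)[OF T] o(2)] by simp_all
  ultimately show ?thesis by (simp add: jac_def)
qed

lemma scale_in_conormal:
  assumes \<alpha>: "\<alpha> \<in> dot_conormal" and r: "r > 0" shows "scale r \<alpha> \<in> dot_conormal"
  unfolding dot_conormal_def
proof (intro CollectI conjI allI impI ballI)
  show "scale r \<alpha> \<in> dot_cotangent" by (rule scale_in_dot[OF dot_conormalD(1)[OF \<alpha>] r])
  show "fst (scale r \<alpha>) \<in> H" using dot_conormalD(3)[OF \<alpha>] by simp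
  fix c D i assume "adapted H d c D \<and> fst (scale r \<alpha>) \<in> cdom c" "i \<in> D"
  then show "snd (scale r \<alpha>) c $ i = 0"
    using dot_conormalD(4)[OF \<alpha>, of c D i] by (simp add: scale_def coord_def)
qed

lemma scale_conormal_over: "\<alpha> \<in> conormal_over c \<Longrightarrow> r > 0 \<Longrightarrow> scale r \<alpha> \<in> conormal_over c"
  unfolding conormal_over_def using scale_in_conormal scale_over by blast

text \<open>
  The flow commutes with dilations. In the parameters a dilation has determinant \<open>r\<^sup>n\<^sup>-\<^sup>d\<close>, which occurs
  once at the end of the curve and once, inverted, at its beginning.
\<close>

lemma transports_scale:
  assumes T: "transports t \<alpha> c D c' D' L" and \<alpha>: "\<alpha> \<in> dot_conormal" "G t \<alpha> \<in> dot_conormal" and r: "r > 0"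
  obtains L' where "transports t (scale r \<alpha>) c D c' D' L'" "jac t (scale r \<alpha>) c D c' D' L' = jac t \<alpha> c D c' D' L"
proof -
  note ad = transportsD(1,2)[OF T] and o = transports_over[OF T \<alpha>]
  note c = adaptedD(1)[OF ad(1)] adaptedD(1)[OF ad(2)]
  note dot = dot_conormalD(1)[OF \<alpha>(1)]
  let ?S = "\<lambda>s z :: (real^'n) \<times> (real^'n). (fst z, s *\<^sub>R snd z)" and ?B = "restr D D' L"
  let ?f = "\<lambda>z. coord c' (G t (of_coord c z))" and ?L = "\<lambda>w. ?S r (L (?S (1/r) w))"
  have 1: "?S (1/r) (coord c (scale r \<alpha>)) = coord c \<alpha>" using r by (simp add: coord_scale)
  have "(?f has_derivative L) (at (?S (1/r) (coord c (scale r \<alpha>))))" unfolding 1 by (rule transportsD(5)[OF T])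
  from bounded_linear.has_derivative[OF bounded_linear_fiber_scale
      has_derivative_compose[OF bounded_linear_imp_has_derivative[OF bounded_linear_fiber_scale] this]]
  have d1: "((\<lambda>z. ?S r (?f (?S (1/r) z))) has_derivative ?L) (at (coord c (scale r \<alpha>)))" .
  have W: "open (coord c ` (dot_cotangent \<inter> over c))" by (rule open_coord_image[OF openin_dot_cotangent c(1)])
  have "scale r \<alpha> \<in> dot_cotangent \<inter> over c" using scale_in_dot[OF dot r] scale_over[OF conormal_overD(2)[OF o(1)]] by blast
  then have aW: "coord c (scale r \<alpha>) \<in> coord c ` (dot_cotangent \<inter> over c)" by (rule imageI)
  have eq: "?S r (?f (?S (1/r) z)) = ?f z" if z: "z \<in> coord c ` (dot_cotangent \<inter> over c)" for z
  proof -
    obtain \<gamma> where g: "\<gamma> \<in> dot_cotangent \<inter> over c" "z = coord c \<gamma>" using z by (elim imageE)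
    have s: "?S (1/r) z = coord c (scale (1/r) \<gamma>)" unfolding g(2) coord_scale ..
    have "of_coord c (?S (1/r) z) = scale (1/r) \<gamma>"
      unfolding s by (rule of_coord_coord[OF c(1) scale_over]) (use g(1) in blast)
    moreover have "G t (scale (1/r) \<gamma>) = scale (1/r) (G t \<gamma>)" by (rule G_scale) (use g(1) r in auto)
    moreover have "of_coord c z = \<gamma>" unfolding g(2) using g(1) c by simp
    ultimately show ?thesis using r by (simp add: coord_scale)
  qed
  have d2: "(?f has_derivative ?L) (at (coord c (scale r \<alpha>)))"
    by (rule has_derivative_transform_within_open[OF d1 W aW eq])
  have LC: "?L (conormal_param D w) = conormal_param D' (dilate D' r (?B (dilate D (1/r) w)))" for w
    unfolding dilate_conormal_param[of D w "1/r"]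
      dilate_conormal_param[of D' "?B (dilate D (1/r) w)" r, symmetric] transports_param(1)[OF T, of "dilate D (1/r) w", symmetric] ..
  have dd: "det (matrix (dilate D s)) = s ^ (CARD('n) - d)" "det (matrix (dilate D' s)) = s ^ (CARD('n) - d)" for s
    using det_dilate[of D s] det_dilate[of D' s] adaptedD(2)[OF ad(1)] adaptedD(2)[OF ad(2)] by simp_all
  have "bij (dilate D (1/r))" "bij (dilate D' r)" by (rule bij_if_det[OF linear_dilate], use dd r in simp)+
  from bij_comp[OF this(1) bij_comp[OF transports_param(2)[OF T] this(2)]]
  have "bij (\<lambda>w. dilate D' r (?B (dilate D (1/r) w)))" unfolding o_def .
  then have bij: "bij_betw ?L (range (conormal_param D)) (range (conormal_param D'))"
    using bij_betw_conormal_param[of ?L D D', OF LC] by simp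
  have fG: "fst (G t (scale r \<alpha>)) = fst (G t \<alpha>)" using G_scale[OF dot r] by simp
  have T': "transports t (scale r \<alpha>) c D c' D' ?L"
    unfolding transports_def fG fst_scale using ad d2 bij transportsD(3,4)[OF T] by blast
  have "restr D D' ?L = (\<lambda>w. dilate D' r (?B (dilate D (1/r) w)))" unfolding LC by simp
  then have "det (matrix (restr D D' ?L)) = r ^ (CARD('n) - d) * det (matrix ?B) * (1/r) ^ (CARD('n) - d)"
    using det_matrix_compose3[OF linear_dilate[of D' r] transports_param(3)[OF T] linear_dilate[of D "1/r"]] by (simp add: dd)
  also have "\<dots> = det (matrix ?B)" using r by (simp add: power_one_over)
  finally have "jac t (scale r \<alpha>) c D c' D' ?L = jac t \<alpha> c D c' D' L" unfolding jac_def fG fst_scale by simp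
  from that[OF T' this] show ?thesis .
qed

lemma scale_Sigma_t:
  assumes \<alpha>: "\<alpha> \<in> Sigma_t t" and r: "r > 0"
  shows "scale r \<alpha> \<in> Sigma_t t" "J t (scale r \<alpha>) = J t \<alpha>"
proof -
  note N = Sigma_tD(1,2)[OF \<alpha>]
  obtain c D c' D' L0 where T0: "transports t \<alpha> c D c' D' L0" using Sigma_tD(3)[OF \<alpha>] by blast
  note ad = transportsD(1,2)[OF T0] and o = transports_over[OF T0 N]
  obtain L where T: "transports t \<alpha> c D c' D' L" "J t \<alpha> = jac t \<alpha> c D c' D' L" by (rule J_eq[OF \<alpha> ad o])
  obtain L' where T': "transports t (scale r \<alpha>) c D c' D' L'" "jac t (scale r \<alpha>) c D c' D' L' = jac t \<alpha> c D c' D' L"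
    by (rule transports_scale[OF T(1) N r])
  have Gs: "G t (scale r \<alpha>) = scale r (G t \<alpha>)" by (rule G_scale[OF dot_conormalD(1)[OF N(1)] r])
  show S: "scale r \<alpha> \<in> Sigma_t t"
    unfolding Sigma_t_def
    by (rule CollectI, intro conjI scale_in_conormal[OF N(1) r], unfold Gs, rule scale_in_conormal[OF N(2) r])
      ((rule exI)+, rule T'(1))
  have o': "G t (scale r \<alpha>) \<in> conormal_over c'" unfolding Gs by (rule scale_conormal_over[OF o(2) r])
  obtain L'' where T'': "transports t (scale r \<alpha>) c D c' D' L''" "J t (scale r \<alpha>) = jac t (scale r \<alpha>) c D c' D' L''"
    by (rule J_eq[OF S ad scale_conormal_over[OF o(1) r] o'])
  have "L'' = L'" by (rule has_derivative_unique[OF transportsD(5)[OF T''(1)] transportsD(5)[OF T'(1)]])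
  then show "J t (scale r \<alpha>) = J t \<alpha>" using T T' T'' by simp
qed

lemma G_image_eq:
  assumes "S \<subseteq> dot_cotangent" shows "G t ` S = {\<beta> \<in> dot_cotangent. G (- t) \<beta> \<in> S}"
proof (intro equalityI subsetI)
  fix \<beta> assume "\<beta> \<in> G t ` S"
  then obtain \<alpha> where a: "\<alpha> \<in> S" "\<beta> = G t \<alpha>" by blast
  note da = subsetD[OF assms a(1)]
  show "\<beta> \<in> {\<beta> \<in> dot_cotangent. G (- t) \<beta> \<in> S}" using a G_dot[OF da] G_inverse(1)[OF da] by simp
next
  fix \<beta> assume "\<beta> \<in> {\<beta> \<in> dot_cotangent. G (- t) \<beta> \<in> S}"
  then have b: "\<beta> \<in> dot_cotangent" "G (- t) \<beta> \<in> S" by simp_all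
  show "\<beta> \<in> G t ` S" by (rule image_eqI[OF _ b(2)]) (simp add: G_inverse(2)[OF b(1)])
qed

lemma inj_on_G: "S \<subseteq> dot_cotangent \<Longrightarrow> inj_on (G t) S"
  using G_inverse(1) by (intro inj_on_inverseI[of _ "G (- t)"]) blast

lemma G_image_borel:
  assumes "S \<in> sets cot_borel" "S \<subseteq> dot_cotangent" shows "G t ` S \<in> sets cot_borel"
  unfolding G_image_eq[OF assms(2)] by (rule G_vimage_borel[OF assms(1)])

text \<open>
  In adapted charts the factor \<open>j\<close> of the change of variables formula is the expression that defines \<open>J\<close>.
\<close>

lemma emeasure_conormal_flow:
  assumes E: "E \<in> sets conormal_measure" "E \<subseteq> Sigma_t t" and J: "(\<lambda>\<alpha>. indicator E \<alpha> * J t \<alpha>) \<in> borel_measurable conormal_measure"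
  shows "emeasure conormal_measure (G t ` E) = (\<integral>\<^sup>+\<alpha>. ennreal (J t \<alpha>) * indicator E \<alpha> \<partial>conormal_measure)"
proof (rule emeasure_conormal_image[OF E(1) _ _ _ _ J])
  have Eb: "E \<in> sets cot_borel" "E \<subseteq> dot_conormal" using E by (simp_all add: sets_conormal_measure)
  have Ed: "E \<subseteq> dot_cotangent" using Eb(2) dot_conormalD(1) by blast
  show "G t ` S \<in> sets cot_borel" if "S \<in> sets cot_borel" "S \<subseteq> E" for S
    using that Ed by (intro G_image_borel) auto
  show "{\<alpha> \<in> E. G t \<alpha> \<in> S} \<in> sets cot_borel" if S: "S \<in> sets cot_borel" for S
  proof -
    have "{\<alpha> \<in> E. G t \<alpha> \<in> S} = E \<inter> {\<alpha> \<in> dot_cotangent. G t \<alpha> \<in> S}" using Ed by blast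
    then show ?thesis using Eb(1) G_vimage_borel[OF S] by simp
  qed
  show "G t ` E \<subseteq> dot_conormal" using E(2) Sigma_tD(2) by blast
  show "inj_on (G t) E" by (rule inj_on_G[OF Ed])
  show "J t \<alpha> \<ge> 0" if "\<alpha> \<in> E" for \<alpha> using J_nonneg subsetD[OF E(2) that] .
  fix \<alpha> c D c' D'
  assume a: "\<alpha> \<in> E" and ad: "adapted H d c D" "adapted H d c' D'" and o: "\<alpha> \<in> conormal_over c" "G t \<alpha> \<in> conormal_over c'"
  obtain L where L: "transports t \<alpha> c D c' D' L" "J t \<alpha> = jac t \<alpha> c D c' D' L"
    by (rule J_eq[OF subsetD[OF E(2) a] ad o])
  have "\<bar>det (matrix (restr D D' L))\<bar> * dens c' D' (kap c' D' (G t \<alpha>)) = J t \<alpha> * dens c D (kap c D \<alpha>)"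
    unfolding L(2) jac_def dens_kap[OF ad(1) o(1), symmetric] dens_kap[OF ad(2) o(2), symmetric]
    using over_dens_pos[OF ad(1) o(1)] by simp
  then show "\<exists>F. ((\<lambda>z. kap c' D' (G t (kinv c D z))) has_derivative F) (at (kap c D \<alpha>)) \<and>
       \<bar>det (matrix F)\<bar> * dens c' D' (kap c' D' (G t \<alpha>)) = J t \<alpha> * dens c D (kap c D \<alpha>)"
    by (intro exI[of _ "restr D D' L"] conjI) (rule kap_derivative[OF ad(1) o(1) transportsD(5)[OF L(1)]])
qed

lemma scale_image_eq:
  assumes "S \<subseteq> dot_cotangent" "s > 0" shows "scale s ` S = {\<beta> \<in> dot_cotangent. scale (1/s) \<beta> \<in> S}"
proof (intro equalityI subsetI)
  fix \<beta> assume "\<beta> \<in> scale s ` S"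
  then obtain \<alpha> where a: "\<alpha> \<in> S" "\<beta> = scale s \<alpha>" by blast
  show "\<beta> \<in> {\<beta> \<in> dot_cotangent. scale (1/s) \<beta> \<in> S}"
    using a scale_in_dot[OF subsetD[OF assms(1) a(1)] assms(2)] assms(2) by (simp add: scale_scale)
next
  fix \<beta> assume "\<beta> \<in> {\<beta> \<in> dot_cotangent. scale (1/s) \<beta> \<in> S}"
  then have b: "scale (1/s) \<beta> \<in> S" by simp
  show "\<beta> \<in> scale s ` S" by (rule image_eqI[OF _ b]) (use assms(2) in \<open>simp add: scale_scale\<close>)
qed

text \<open>The conormal measure is homogeneous of degree \<open>n - d\<close>, the dimension of the fibers.\<close>

lemma emeasure_conormal_scale:
  assumes E: "E \<in> sets conormal_measure" and s: "s > 0"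
  shows "scale s ` E \<in> sets conormal_measure"
    "emeasure conormal_measure (scale s ` E) = ennreal (s ^ (CARD('n) - d)) * emeasure conormal_measure E"
proof -
  have Eb: "E \<in> sets cot_borel" "E \<subseteq> dot_conormal" using E by (simp_all add: sets_conormal_measure)
  have Ed: "E \<subseteq> dot_cotangent" using Eb(2) dot_conormalD(1) by blast
  have im: "scale s ` S \<in> sets cot_borel" if "S \<in> sets cot_borel" "S \<subseteq> dot_cotangent" for S
    unfolding scale_image_eq[OF that(2) s] by (rule scale_vimage_borel[OF that(1), of "\<lambda>_. 1/s"]) simp
  have sN: "scale s ` E \<subseteq> dot_conormal" using Eb(2) scale_in_conormal[OF _ s] by blast
  show "scale s ` E \<in> sets conormal_measure" using im[OF Eb(1) Ed] sN by (simp add: sets_conormal_measure)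
  have "emeasure conormal_measure (scale s ` E) = (\<integral>\<^sup>+\<alpha>. ennreal (s ^ (CARD('n) - d)) * indicator E \<alpha> \<partial>conormal_measure)"
  proof (rule emeasure_conormal_image[OF E _ _ sN])
    show "scale s ` S \<in> sets cot_borel" if "S \<in> sets cot_borel" "S \<subseteq> E" for S
      using that Ed by (intro im) auto
    show "{\<alpha> \<in> E. scale s \<alpha> \<in> S} \<in> sets cot_borel" if S: "S \<in> sets cot_borel" for S
    proof -
      have "{\<alpha> \<in> E. scale s \<alpha> \<in> S} = E \<inter> {\<alpha> \<in> dot_cotangent. scale s \<alpha> \<in> S}" using Ed by blast
      then show ?thesis using Eb(1) scale_vimage_borel[OF S, of "\<lambda>_. s"] by simp
    qed
    show "inj_on (scale s) E" using s by (intro inj_on_inverseI[of _ "scale (1/s)"]) (simp add: scale_scale)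
    show "(\<lambda>\<alpha>. indicator E \<alpha> * s ^ (CARD('n) - d)) \<in> borel_measurable conormal_measure" using E by simp
    show "0 \<le> s ^ (CARD('n) - d)" using s by simp
    fix \<alpha> c D c' D'
    assume a: "\<alpha> \<in> E" and ad: "adapted H d c D" "adapted H d c' D'" and o: "\<alpha> \<in> conormal_over c" "scale s \<alpha> \<in> conormal_over c'"
    have o': "\<alpha> \<in> conormal_over c'"
      using overI[OF dot_conormalD(2), of \<alpha> c'] subsetD[OF Eb(2) a] conormal_overD(3)[OF o(2)] by (simp add: conormal_over_def)
    obtain F where F: "((\<lambda>z. coord c' (of_coord c z)) has_derivative F) (at (coord c \<alpha>))"
      "\<bar>det (matrix (restr D D' F))\<bar> * dens c' D' (kap c' D' \<alpha>) = dens c D (kap c D \<alpha>)"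
      by (rule identity_derivative[OF ad o(1) o'])
    let ?S = "\<lambda>z :: (real^'n) \<times> (real^'n). (fst z, s *\<^sub>R snd z)"
    have d1: "((\<lambda>z. coord c' (scale s (of_coord c z))) has_derivative (\<lambda>w. ?S (F w))) (at (coord c \<alpha>))"
      unfolding coord_scale by (rule bounded_linear.has_derivative[OF bounded_linear_fiber_scale F(1)])
    have "restr D D' (\<lambda>w. ?S (F w)) = dilate D' s \<circ> restr D D' F" unfolding merge_dilate o_def ..
    then have "det (matrix (restr D D' (\<lambda>w. ?S (F w)))) = s ^ (CARD('n) - d) * det (matrix (restr D D' F))"
      using matrix_compose[OF linear_restr[OF has_derivative_linear[OF F(1)]] linear_dilate[of D' s], of D' D]
        adaptedD(2)[OF ad(2)] by (simp add: det_mul det_dilate)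
    then have "\<bar>det (matrix (restr D D' (\<lambda>w. ?S (F w))))\<bar> * dens c' D' (kap c' D' (scale s \<alpha>)) = s ^ (CARD('n) - d) * dens c D (kap c D \<alpha>)"
      using F(2) s unfolding dens_kap[OF ad(2) o(2)] dens_kap[OF ad(2) o'] by (simp add: abs_mult)
    then show "\<exists>F. ((\<lambda>z. kap c' D' (scale s (kinv c D z))) has_derivative F) (at (kap c D \<alpha>)) \<and>
       \<bar>det (matrix F)\<bar> * dens c' D' (kap c' D' (scale s \<alpha>)) = s ^ (CARD('n) - d) * dens c D (kap c D \<alpha>)"
      by (intro exI[of _ "restr D D' (\<lambda>w. ?S (F w))"] conjI) (rule kap_derivative[OF ad(1) o(1) d1])
  qed
  also have "\<dots> = ennreal (s ^ (CARD('n) - d)) * emeasure conormal_measure E"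
    using E by (subst nn_integral_cmult) auto
  finally show "emeasure conormal_measure (scale s ` E) = ennreal (s ^ (CARD('n) - d)) * emeasure conormal_measure E" .
qed

end

section \<open>The Leray measure\<close>

context compact_riemannian_submanifold
begin

definition cone :: "real \<Rightarrow> ('a \<times> (('a, 'n) chart \<Rightarrow> real^'n)) set \<Rightarrow> ('a \<times> (('a, 'n) chart \<Rightarrow> real^'n)) set" where
  "cone s E = {scale r \<alpha> |r \<alpha>. 0 < r \<and> r \<le> s \<and> \<alpha> \<in> E}"

definition direction :: "'a \<times> (('a, 'n) chart \<Rightarrow> real^'n) \<Rightarrow> 'a \<times> (('a, 'n) chart \<Rightarrow> real^'n)" where
  "direction \<alpha> = scale (1 / p \<alpha>) \<alpha>"

lemma SN_dot: "\<alpha> \<in> SN \<Longrightarrow> \<alpha> \<in> dot_cotangent"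
  using SN_D(1) dot_conormalD(1) by blast

lemma SN_borel: "SN \<in> sets cot_borel"
proof -
  have "SN = dot_conormal \<inter> (p -` {1} \<inter> space cot_borel)"
    unfolding SN_def using dot_conormalD(2) by auto
  then show ?thesis using conormal_borel measurable_sets[OF measurable_p, of "{1}"] by simp
qed

lemma p_pos: "\<alpha> \<in> dot_conormal \<Longrightarrow> p \<alpha> > 0"
  using p_pos_iff dot_conormalD(1,2) by blast

lemma direction_in_SN:
  assumes \<alpha>: "\<alpha> \<in> dot_conormal" shows "direction \<alpha> \<in> SN"
  unfolding SN_def direction_def
  using scale_in_conormal[OF \<alpha>, of "1 / p \<alpha>"] p_scale[OF dot_conormalD(2)[OF \<alpha>], of "1 / p \<alpha>"] p_pos[OF \<alpha>] by simp

lemma scale_direction: "\<alpha> \<in> dot_conormal \<Longrightarrow> scale (p \<alpha>) (direction \<alpha>) = \<alpha>"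
  using p_pos[of \<alpha>] by (simp add: direction_def scale_scale)

lemma p_scale_SN: "\<alpha> \<in> SN \<Longrightarrow> r > 0 \<Longrightarrow> p (scale r \<alpha>) = r"
  using p_scale[of \<alpha> r] SN_D dot_conormalD(2) by simp

lemma direction_scale: "\<alpha> \<in> SN \<Longrightarrow> r > 0 \<Longrightarrow> direction (scale r \<alpha>) = \<alpha>"
  by (simp add: direction_def p_scale_SN scale_scale)

lemma cone_eq:
  assumes E: "E \<subseteq> SN" shows "cone s E = {\<alpha> \<in> dot_conormal. direction \<alpha> \<in> E \<and> p \<alpha> \<le> s}"
proof (intro equalityI subsetI)
  fix \<beta> assume "\<beta> \<in> cone s E"
  then obtain r \<alpha> where b: "\<beta> = scale r \<alpha>" "0 < r" "r \<le> s" "\<alpha> \<in> E" unfolding cone_def by blast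
  note S = subsetD[OF E b(4)]
  show "\<beta> \<in> {\<alpha> \<in> dot_conormal. direction \<alpha> \<in> E \<and> p \<alpha> \<le> s}"
    unfolding b(1) using b(2,3,4) scale_in_conormal[OF SN_D(1)[OF S] b(2)] by (simp add: direction_scale[OF S] p_scale_SN[OF S])
next
  fix \<alpha> assume "\<alpha> \<in> {\<alpha> \<in> dot_conormal. direction \<alpha> \<in> E \<and> p \<alpha> \<le> s}"
  then have a: "\<alpha> \<in> dot_conormal" "direction \<alpha> \<in> E" "p \<alpha> \<le> s" by simp_all
  show "\<alpha> \<in> cone s E" unfolding cone_def
    by (intro CollectI exI[of _ "p \<alpha>"] exI[of _ "direction \<alpha>"] conjI a p_pos[OF a(1)] scale_direction[OF a(1), symmetric])
qed

lemma space_leray [simp]: "space leray = SN" and sets_leray: "sets leray = {S \<in> sets cot_borel. S \<subseteq> SN}"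
proof -
  have "borel_sets SN \<subseteq> Pow SN" unfolding borel_sets_eq[OF SN_borel] by blast
  then show "space leray = SN" unfolding leray_def by (rule space_measure_of)
  have "sigma_algebra SN (borel_sets SN)"
    unfolding borel_sets_def by (rule sigma_algebra_sigma_sets, rule subsetI, simp, rule openin_imp_subset)
  from sigma_algebra.sets_measure_of_eq[OF this] show "sets leray = {S \<in> sets cot_borel. S \<subseteq> SN}"
    unfolding leray_def borel_sets_eq[OF SN_borel] .
qed

lemma direction_measurable: "direction \<in> conormal_measure \<rightarrow>\<^sub>M leray"
proof (rule measurableI)
  show "direction \<alpha> \<in> space leray" if "\<alpha> \<in> space conormal_measure" for \<alpha> using that direction_in_SN by simp
  fix E assume "E \<in> sets leray"
  then have E: "E \<in> sets cot_borel" by (simp add: sets_leray)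
  have "direction -` E \<inter> space conormal_measure = dot_conormal \<inter> {\<alpha> \<in> dot_cotangent. scale ((\<lambda>r. 1 / r) (p \<alpha>)) \<alpha> \<in> E}"
    using dot_conormalD(1) by (auto simp: direction_def)
  moreover have "{\<alpha> \<in> dot_cotangent. scale ((\<lambda>r. 1 / r) (p \<alpha>)) \<alpha> \<in> E} \<in> sets cot_borel"
    by (rule scale_vimage_borel[OF E]) (intro continuous_intros, auto)
  ultimately show "direction -` E \<inter> space conormal_measure \<in> sets conormal_measure"
    using conormal_borel by (auto simp: sets_conormal_measure)
qed

lemma cone_measurable:
  assumes E: "E \<in> sets leray" shows "cone s E \<in> sets conormal_measure"
proof -
  have "cone s E = (direction -` E \<inter> space conormal_measure) \<inter> (dot_conormal \<inter> (p -` {..s} \<inter> space cot_borel))"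
    using cone_eq[of E s] E dot_conormalD(2) by (auto simp: sets_leray)
  moreover have "dot_conormal \<inter> (p -` {..s} \<inter> space cot_borel) \<in> sets conormal_measure"
    using conormal_borel measurable_sets[OF measurable_p, of "{..s}"] by (auto simp: sets_conormal_measure)
  ultimately show ?thesis using measurable_sets[OF direction_measurable E] by simp
qed

lemma cone_scale: "s > 0 \<Longrightarrow> cone s E = scale s ` cone 1 E"
proof (intro equalityI subsetI)
  fix \<beta> assume s: "s > 0" and "\<beta> \<in> cone s E"
  then obtain r \<alpha> where b: "\<beta> = scale r \<alpha>" "0 < r" "r \<le> s" "\<alpha> \<in> E" unfolding cone_def by blast
  have "scale (r / s) \<alpha> \<in> cone 1 E" unfolding cone_def
    by (intro CollectI exI[of _ "r / s"] exI[of _ \<alpha>] conjI refl b(4)) (use b s in simp_all)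
  then show "\<beta> \<in> scale s ` cone 1 E" by (rule image_eqI[rotated]) (use s in \<open>simp add: b scale_scale\<close>)
next
  fix \<beta> assume s: "s > 0" and "\<beta> \<in> scale s ` cone 1 E"
  then obtain r \<alpha> where b: "\<beta> = scale s (scale r \<alpha>)" "0 < r" "r \<le> 1" "\<alpha> \<in> E" unfolding cone_def by blast
  show "\<beta> \<in> cone s E" unfolding cone_def
    by (intro CollectI exI[of _ "s * r"] exI[of _ \<alpha>] conjI b(4)) (use b s in \<open>simp_all add: scale_scale mult_left_le\<close>)
qed

text \<open>By homogeneity, the derivative in the definition of the Leray measure is \<open>n - d\<close> times the value at \<open>1\<close>.\<close>

lemma deriv_cone:
  assumes E: "E \<in> sets leray"
  shows "deriv (\<lambda>s. measure conormal_measure (cone s E)) 1 = real (CARD('n) - d) * measure conormal_measure (cone 1 E)"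
proof (rule DERIV_imp_deriv)
  let ?m = "measure conormal_measure (cone 1 E)"
  have "((\<lambda>s. s ^ (CARD('n) - d) * ?m) has_field_derivative real (CARD('n) - d) * ?m) (at 1)"
    by (auto intro!: derivative_eq_intros)
  then show "((\<lambda>s. measure conormal_measure (cone s E)) has_field_derivative real (CARD('n) - d) * ?m) (at 1)"
  proof (rule has_field_derivative_transform_within_open[of _ _ _ "{0<..}"])
    fix s :: real assume "s \<in> {0<..}"
    then have s: "s > 0" by simp
    show "s ^ (CARD('n) - d) * ?m = measure conormal_measure (cone s E)"
      unfolding cone_scale[OF s] measure_def emeasure_conormal_scale(2)[OF cone_measurable[OF E] s]
      using s by (simp add: enn2real_mult)
  qed auto
qed

text \<open>
  \<^const>\<open>measure_of\<close> yields the zero measure if the prescribed set function is not a measure, and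
  \<^const>\<open>measure\<close> turns an infinite volume into 0. If \<open>SN\<close> has nonzero measure, neither has happened.
\<close>

lemma emeasure_leray_cases:
  assumes nz: "emeasure leray SN \<noteq> 0"
  shows "emeasure conormal_measure (cone 1 SN) \<noteq> \<infinity>"
    "E \<in> sets leray \<Longrightarrow> emeasure leray E = ennreal (real (CARD('n) - d)) * emeasure conormal_measure (cone 1 E)"
proof -
  let ?f = "\<lambda>E. ennreal (deriv (\<lambda>s. measure conormal_measure (cone s E)) 1)"
  have lf: "leray = measure_of SN (borel_sets SN) ?f" unfolding leray_def cone_def ..
  have pow: "borel_sets SN \<subseteq> Pow SN" unfolding borel_sets_eq[OF SN_borel] by blast
  have ss: "sigma_sets SN (borel_sets SN) = borel_sets SN"
    by (rule sigma_algebra.sigma_sets_eq)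
       (unfold borel_sets_def, rule sigma_algebra_sigma_sets, rule subsetI, simp, rule openin_imp_subset)
  have SNs: "SN \<in> sets leray" using SN_borel by (simp add: sets_leray)
  have em: "emeasure leray E = (if measure_space SN (borel_sets SN) ?f then ?f E else 0)" if "E \<in> sets leray" for E
    unfolding lf using that pow
    by (simp add: emeasure_measure_of_conv ss) (simp add: borel_sets_eq[OF SN_borel] sets_leray)
  have ms: "measure_space SN (borel_sets SN) ?f" and f0: "?f SN \<noteq> 0"
    using nz em[OF SNs] by (auto split: if_splits)
  have "measure conormal_measure (cone 1 SN) \<noteq> 0" using f0 deriv_cone[OF SNs] by auto
  then show fin: "emeasure conormal_measure (cone 1 SN) \<noteq> \<infinity>" by (auto simp: measure_def)
  show "emeasure leray E = ennreal (real (CARD('n) - d)) * emeasure conormal_measure (cone 1 E)" if E: "E \<in> sets leray"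
  proof -
    have "cone 1 E \<subseteq> cone 1 SN" using E unfolding cone_def sets_leray by blast
    from emeasure_mono[OF this cone_measurable[OF SNs]]
    have "emeasure conormal_measure (cone 1 E) \<noteq> \<infinity>" using fin by (auto simp: top_unique)
    then have "emeasure conormal_measure (cone 1 E) = ennreal (measure conormal_measure (cone 1 E))"
      by (simp add: emeasure_eq_ennreal_measure)
    then show ?thesis using em[OF E] ms deriv_cone[OF E] by (simp add: ennreal_mult)
  qed
qed

text \<open>
  The Leray measure is the image of \<open>n - d\<close> times the conormal measure on \<open>{p \<le> 1}\<close> under the radial
  projection to \<open>SN\<close>.
\<close>

lemma nn_integral_leray:
  assumes nz: "emeasure leray SN \<noteq> 0" and f: "f \<in> borel_measurable leray"
  shows "(\<integral>\<^sup>+\<alpha>. f \<alpha> \<partial>leray) =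
    (\<integral>\<^sup>+\<alpha>. ennreal (real (CARD('n) - d)) * indicator (cone 1 SN) \<alpha> * f (direction \<alpha>) \<partial>conormal_measure)"
proof -
  let ?w = "\<lambda>\<alpha>. ennreal (real (CARD('n) - d)) * indicator (cone 1 SN) \<alpha>"
  have SNs: "SN \<in> sets leray" using SN_borel by (simp add: sets_leray)
  note cm = cone_measurable[OF SNs, of 1]
  have wm: "?w \<in> borel_measurable conormal_measure" using cm by simp
  have dm: "direction \<in> density conormal_measure ?w \<rightarrow>\<^sub>M leray" using direction_measurable by simp
  have "leray = distr (density conormal_measure ?w) leray direction"
  proof (rule measure_eqI)
    fix E assume E: "E \<in> sets leray"
    have v: "direction -` E \<inter> dot_conormal \<in> sets conormal_measure" using measurable_sets[OF direction_measurable E] by simp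
    have c: "cone 1 SN \<inter> (direction -` E \<inter> dot_conormal) = cone 1 E"
      using E cone_eq[of SN 1] cone_eq[of E 1] direction_in_SN by (auto simp: sets_leray)
    have "emeasure (distr (density conormal_measure ?w) leray direction) E = emeasure (density conormal_measure ?w) (direction -` E \<inter> dot_conormal)"
      using dm E by (subst emeasure_distr) auto
    also have "\<dots> = (\<integral>\<^sup>+\<alpha>. ?w \<alpha> * indicator (direction -` E \<inter> dot_conormal) \<alpha> \<partial>conormal_measure)"
      using wm v by (subst emeasure_density) auto
    also have "\<dots> = (\<integral>\<^sup>+\<alpha>. ennreal (real (CARD('n) - d)) * indicator (cone 1 E) \<alpha> \<partial>conormal_measure)"
      unfolding c[symmetric] by (intro nn_integral_cong) (simp add: indicator_inter_arith mult.assoc)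
    also have "\<dots> = emeasure leray E"
      using cone_measurable[OF E] by (subst nn_integral_cmult) (auto simp: emeasure_leray_cases(2)[OF nz E])
    finally show "emeasure leray E = emeasure (distr (density conormal_measure ?w) leray direction) E" ..
  qed simp
  then have "(\<integral>\<^sup>+\<alpha>. f \<alpha> \<partial>leray) = (\<integral>\<^sup>+\<alpha>. f \<alpha> \<partial>distr (density conormal_measure ?w) leray direction)" by simp
  also have "\<dots> = (\<integral>\<^sup>+\<alpha>. f (direction \<alpha>) \<partial>density conormal_measure ?w)"
    using dm f by (subst nn_integral_distr) auto
  also have "\<dots> = (\<integral>\<^sup>+\<alpha>. ?w \<alpha> * f (direction \<alpha>) \<partial>conormal_measure)"
    using wm measurable_compose[OF direction_measurable f] by (subst nn_integral_density) auto
  finally show ?thesis .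
qed

lemma SSigma_tD:
  assumes "\<alpha> \<in> SSigma_t t" shows "\<alpha> \<in> Sigma_t t" "\<alpha> \<in> SN" "G t \<alpha> \<in> SN" "G t \<alpha> \<in> dot_conormal"
proof -
  show *: "\<alpha> \<in> Sigma_t t" "\<alpha> \<in> SN" using assms unfolding SSigma_t_def by blast+
  show "G t \<alpha> \<in> dot_conormal" by (rule Sigma_tD(2)[OF *(1)])
  then show "G t \<alpha> \<in> SN" using p_G[OF SN_dot[OF *(2)]] SN_D(2)[OF *(2)] by (simp add: SN_def)
qed

text \<open>
  \<open>G\<^sup>t\<close> maps the unit cone over \<open>E\<close> onto the unit cone over \<open>G\<^sup>t(E)\<close>, and \<open>J\<^sub>t\<close> is constant along rays.
\<close>

lemma emeasure_leray_flow:
  assumes nz: "emeasure leray SN \<noteq> 0" and E: "E \<in> sets leray" "E \<subseteq> SSigma_t t"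
    and J: "(\<lambda>\<alpha>. indicator E \<alpha> * J t \<alpha>) \<in> borel_measurable leray"
  shows "G t ` E \<in> sets leray" "emeasure leray (G t ` E) = (\<integral>\<^sup>+\<alpha>. ennreal (J t \<alpha>) * indicator E \<alpha> \<partial>leray)"
proof -
  have Eb: "E \<in> sets cot_borel" "E \<subseteq> SN" using E by (simp_all add: sets_leray)
  have GSN: "G t ` E \<subseteq> SN" using SSigma_tD(3) E(2) by blast
  show Gs: "G t ` E \<in> sets leray"
    unfolding sets_leray using GSN G_image_borel[OF Eb(1)] Eb(2) SN_dot by blast
  have cG: "cone 1 (G t ` E) = G t ` cone 1 E"
  proof (intro equalityI subsetI)
    fix \<beta> assume "\<beta> \<in> cone 1 (G t ` E)"
    then obtain r \<alpha> where b: "\<beta> = scale r (G t \<alpha>)" "0 < r" "r \<le> 1" "\<alpha> \<in> E" unfolding cone_def by blast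
    have "\<beta> = G t (scale r \<alpha>)" using b G_scale[OF SN_dot[OF subsetD[OF Eb(2) b(4)]] b(2)] by simp
    moreover have "scale r \<alpha> \<in> cone 1 E" unfolding cone_def using b by blast
    ultimately show "\<beta> \<in> G t ` cone 1 E" by (rule image_eqI)
  next
    fix \<beta> assume "\<beta> \<in> G t ` cone 1 E"
    then obtain r \<alpha> where b: "\<beta> = G t (scale r \<alpha>)" "0 < r" "r \<le> 1" "\<alpha> \<in> E" unfolding cone_def by blast
    have "\<beta> = scale r (G t \<alpha>)" using b G_scale[OF SN_dot[OF subsetD[OF Eb(2) b(4)]] b(2)] by simp
    then show "\<beta> \<in> cone 1 (G t ` E)" unfolding cone_def using b by blast
  qed
  have cD: "direction \<alpha> \<in> E" "\<alpha> \<in> Sigma_t t" "J t \<alpha> = J t (direction \<alpha>)" "\<alpha> \<in> cone 1 SN" if "\<alpha> \<in> cone 1 E" for \<alpha>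
  proof -
    have a: "\<alpha> \<in> dot_conormal" "direction \<alpha> \<in> E" "p \<alpha> \<le> 1" using that unfolding cone_eq[OF Eb(2)] by simp_all
    show "direction \<alpha> \<in> E" by (rule a(2))
    have S: "direction \<alpha> \<in> Sigma_t t" using SSigma_tD(1) subsetD[OF E(2) a(2)] .
    show "\<alpha> \<in> Sigma_t t" "J t \<alpha> = J t (direction \<alpha>)"
      using scale_Sigma_t[OF S p_pos[OF a(1)]] unfolding scale_direction[OF a(1)] .
    show "\<alpha> \<in> cone 1 SN" using a direction_in_SN[OF a(1)] unfolding cone_eq[OF subset_refl] by simp
  qed
  have c2: "\<alpha> \<in> cone 1 E" if "\<alpha> \<in> cone 1 SN" "direction \<alpha> \<in> E" for \<alpha>
    using that unfolding cone_eq[OF Eb(2)] cone_eq[OF subset_refl] by simp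
  have SNs: "SN \<in> sets leray" using SN_borel by (simp add: sets_leray)
  have ind: "indicator (cone 1 E) \<alpha> = (indicator (cone 1 SN) \<alpha> * indicator E (direction \<alpha>) :: real)" for \<alpha>
    using cD(1,4)[of \<alpha>] c2[of \<alpha>] unfolding indicator_def by auto
  have "(\<lambda>\<alpha>. indicator (cone 1 E) \<alpha> * J t \<alpha>) = (\<lambda>\<alpha>. indicator (cone 1 SN) \<alpha> * (indicator E (direction \<alpha>) * J t (direction \<alpha>)))"
  proof
    fix \<alpha> show "indicator (cone 1 E) \<alpha> * J t \<alpha> = indicator (cone 1 SN) \<alpha> * (indicator E (direction \<alpha>) * J t (direction \<alpha>))"
      using cD(3)[of \<alpha>] unfolding mult.assoc[symmetric] ind[symmetric] by (cases "\<alpha> \<in> cone 1 E") simp_all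
  qed
  moreover have "(\<lambda>\<alpha>. indicator (cone 1 SN) \<alpha> * (indicator E (direction \<alpha>) * J t (direction \<alpha>))) \<in> borel_measurable conormal_measure"
    using cone_measurable[OF SNs, of 1] measurable_compose[OF direction_measurable J] by simp
  ultimately have Jm: "(\<lambda>\<alpha>. indicator (cone 1 E) \<alpha> * J t \<alpha>) \<in> borel_measurable conormal_measure" by simp
  let ?N = "ennreal (real (CARD('n) - d))"
  have J': "(\<lambda>\<alpha>. ennreal (indicator E \<alpha> * J t \<alpha>)) \<in> borel_measurable leray" using J by simp
  have "emeasure leray (G t ` E) = ?N * emeasure conormal_measure (G t ` cone 1 E)"
    unfolding emeasure_leray_cases(2)[OF nz Gs] cG ..
  also have "\<dots> = ?N * (\<integral>\<^sup>+\<alpha>. ennreal (J t \<alpha>) * indicator (cone 1 E) \<alpha> \<partial>conormal_measure)"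
    by (subst emeasure_conormal_flow[OF cone_measurable[OF E(1)] _ Jm]) (use cD(2) in blast, rule refl)
  also have "\<dots> = ?N * (\<integral>\<^sup>+\<alpha>. ennreal (indicator (cone 1 E) \<alpha> * J t \<alpha>) \<partial>conormal_measure)"
    by (intro arg_cong[where f = "\<lambda>x. ?N * x"] nn_integral_cong) (simp add: indicator_def)
  also have "\<dots> = (\<integral>\<^sup>+\<alpha>. ?N * ennreal (indicator (cone 1 E) \<alpha> * J t \<alpha>) \<partial>conormal_measure)"
    by (rule nn_integral_cmult[symmetric]) (rule measurable_compose[OF Jm measurable_ennreal])
  also have "\<dots> = (\<integral>\<^sup>+\<alpha>. ?N * indicator (cone 1 SN) \<alpha> * ennreal (indicator E (direction \<alpha>) * J t (direction \<alpha>)) \<partial>conormal_measure)"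
  proof (rule nn_integral_cong)
    fix \<alpha>
    show "?N * ennreal (indicator (cone 1 E) \<alpha> * J t \<alpha>) = ?N * indicator (cone 1 SN) \<alpha> * ennreal (indicator E (direction \<alpha>) * J t (direction \<alpha>))"
    proof (cases "\<alpha> \<in> cone 1 E")
      case True
      then show ?thesis using cD[OF True] by simp
    next
      case False
      then have "\<alpha> \<notin> cone 1 SN \<or> direction \<alpha> \<notin> E" using c2 by blast
      then show ?thesis using False by auto
    qed
  qed
  also have "\<dots> = (\<integral>\<^sup>+\<alpha>. ennreal (indicator E \<alpha> * J t \<alpha>) \<partial>leray)" by (rule nn_integral_leray[OF nz J', symmetric])
  also have "\<dots> = (\<integral>\<^sup>+\<alpha>. ennreal (J t \<alpha>) * indicator E \<alpha> \<partial>leray)"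
    by (intro nn_integral_cong) (simp add: indicator_def)
  finally show "emeasure leray (G t ` E) = (\<integral>\<^sup>+\<alpha>. ennreal (J t \<alpha>) * indicator E \<alpha> \<partial>leray)" .
qed

end

section \<open>Counting return times\<close>

text \<open>
  A half-open interval of length \<open>\<delta>\<close> contains at most one of the points.
\<close>

lemma card_separated_le:
  fixes T :: "real set"
  assumes T: "finite T" "T \<subseteq> {-R..R}" and \<delta>: "\<delta> > 0" and R: "R \<ge> 1"
    and sep: "\<And>s t. s \<in> T \<Longrightarrow> t \<in> T \<Longrightarrow> s \<noteq> t \<Longrightarrow> \<bar>s - t\<bar> \<ge> \<delta>"
  shows "real (card T) \<le> (2 / \<delta> + 1) * R"
proof -
  let ?f = "\<lambda>t. \<lfloor>(t + R) / \<delta>\<rfloor>"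
  have inj: "inj_on ?f T"
  proof (rule inj_onI, rule ccontr)
    fix s t assume st: "s \<in> T" "t \<in> T" "?f s = ?f t" "s \<noteq> t"
    have "\<bar>(s + R) / \<delta> - (t + R) / \<delta>\<bar> < 1" using st(3) by linarith
    also have "(s + R) / \<delta> - (t + R) / \<delta> = (s - t) / \<delta>" by (simp add: diff_divide_distrib add_divide_distrib)
    finally have "\<bar>s - t\<bar> < \<delta>" using \<delta> by (simp add: abs_divide)
    then show False using sep[OF st(1,2,4)] by simp
  qed
  have "?f ` T \<subseteq> {0..\<lfloor>2 * R / \<delta>\<rfloor>}"
  proof (rule image_subsetI)
    fix t assume "t \<in> T"
    then have "- R \<le> t" "t \<le> R" using T(2) by auto
    then show "?f t \<in> {0..\<lfloor>2 * R / \<delta>\<rfloor>}" using \<delta> by (auto intro!: floor_mono divide_right_mono)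
  qed
  then have "card (?f ` T) \<le> card {0..\<lfloor>2 * R / \<delta>\<rfloor>}" by (rule card_mono[rotated]) simp
  then have "card T \<le> nat (\<lfloor>2 * R / \<delta>\<rfloor> + 1)" using card_image[OF inj] by simp
  moreover have "0 \<le> 2 * R / \<delta>" using \<delta> R by simp
  ultimately have "real (card T) \<le> 2 * R / \<delta> + 1" by linarith
  also have "\<dots> \<le> (2 / \<delta> + 1) * R" using R by (simp add: field_simps)
  finally show ?thesis .
qed

context compact_riemannian_submanifold
begin

text \<open>
  Pull back a countable basis of the coordinate space by the finitely many charts of a partition.
\<close>

lemma countable_SN_basis:
  "\<exists>U :: nat \<Rightarrow> ('a \<times> (('a, 'n) chart \<Rightarrow> real^'n)) set. (\<forall>k. U k \<in> sets leray) \<and>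
    (\<forall>V \<alpha>. openin (subtopology cot_topology SN) V \<longrightarrow> \<alpha> \<in> V \<longrightarrow> (\<exists>k. \<alpha> \<in> U k \<and> U k \<subseteq> V))"
proof -
  obtain n ch sp P where "chart_partition n ch sp P" using ex_chart_partition by blast
  note P = chart_partitionD[OF this]
  obtain B :: "((real^'n) \<times> (real^'n)) set set" where B: "countable B" "topological_basis B"
    using ex_countable_basis by blast
  define u where "u x = {\<alpha> \<in> over (ch (fst x)). coord (ch (fst x)) \<alpha> \<in> snd x} \<inter> SN" for x
  define \<U> where "\<U> = insert {} (u ` ({..<n} \<times> B))"
  have cU: "countable \<U>" "\<U> \<noteq> {}" unfolding \<U>_def
    using countable_SIGMA[OF countable_finite[OF finite_lessThan[of n]], of "\<lambda>_. B"] B(1) by simp_all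
  have opU: "W \<in> sets leray" if "W \<in> \<U>" for W
  proof -
    have "W = {} \<or> W \<in> u ` ({..<n} \<times> B)" using that unfolding \<U>_def by (simp only: insert_iff)
    then show ?thesis
    proof
      assume "W \<in> u ` ({..<n} \<times> B)"
      then obtain x where x0: "W = u x" "x \<in> {..<n} \<times> B" by (rule imageE)
      then have x: "fst x < n" "snd x \<in> B" by (simp_all add: mem_Times_iff)
      have "{\<alpha> \<in> over (ch (fst x)). coord (ch (fst x)) \<alpha> \<in> snd x} \<in> sets cot_borel"
        by (rule openin_cot_borel[OF openin_coord_vimage[OF adaptedD(1)[OF P(1)[OF x(1)]] topological_basis_open[OF B(2) x(2)]]])
      from sets.Int[OF this SN_borel] show ?thesis unfolding x0(1) u_def sets_leray by blast
    qed simp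
  qed
  have ex: "\<exists>k. \<alpha> \<in> from_nat_into \<U> k \<and> from_nat_into \<U> k \<subseteq> V"
    if V: "openin (subtopology cot_topology SN) V" and a: "\<alpha> \<in> V" for V \<alpha>
  proof -
    obtain V' where V': "openin cot_topology V'" "V = V' \<inter> SN" using V unfolding openin_subtopology by blast
    have aS: "\<alpha> \<in> SN" "\<alpha> \<in> V'" using a V' by blast+
    have "\<alpha> \<in> (\<Union>i<n. P i)" using SN_D(1)[OF aS(1)] P(5) by simp
    then obtain i where i: "i < n" "\<alpha> \<in> P i" by blast
    have ao: "\<alpha> \<in> over (ch i)" by (rule conormal_overD(2)[OF subsetD[OF P(3)[OF i(1)] i(2)]])
    note c = adaptedD(1)[OF P(1)[OF i(1)]]
    have "coord (ch i) \<alpha> \<in> coord (ch i) ` (V' \<inter> over (ch i))" using aS ao by blast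
    from topological_basisE[OF B(2) open_coord_image[OF V'(1) c] this] obtain b where
      b: "b \<in> B" "coord (ch i) \<alpha> \<in> b" "b \<subseteq> coord (ch i) ` (V' \<inter> over (ch i))" .
    have ub: "u (i, b) \<subseteq> V"
    proof (rule subsetI)
      fix \<beta> assume "\<beta> \<in> u (i, b)"
      then have be: "\<beta> \<in> over (ch i)" "coord (ch i) \<beta> \<in> b" "\<beta> \<in> SN" unfolding u_def by simp_all
      have "\<beta> \<in> V'" by (rule in_if_coord_in_image[OF c be(1) subsetD[OF b(3) be(2)]])
      then show "\<beta> \<in> V" using be(3) V'(2) by blast
    qed
    have "u (i, b) \<in> \<U>" unfolding \<U>_def
      by (rule insertI2, rule imageI) (use i(1) b(1) in simp)
    from from_nat_into_surj[OF cU(1) this] obtain k where k: "from_nat_into \<U> k = u (i, b)" by blast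
    show ?thesis by (rule exI[of _ k]) (unfold k, rule conjI[OF _ ub], simp add: u_def ao b(2) aS(1))
  qed
  show ?thesis
    by (rule exI[of _ "from_nat_into \<U>"], intro conjI allI impI) (rule opU[OF from_nat_into[OF cU(2)]], rule ex)
qed

text \<open>
  The integral of a function that is not integrable is 0 by convention. So \<open>q t \<noteq> 0\<close> entails that the
  integrand is measurable, and then \<open>J\<close>, the square of its absolute value, is measurable as well.
\<close>

lemma q_nonzero_measurable:
  assumes q: "q t \<noteq> 0" and S: "SSigma_t t \<in> sets leray"
  shows "(\<lambda>\<alpha>. indicator (SSigma_t t) \<alpha> * J t \<alpha>) \<in> borel_measurable leray"
    "ennreal (norm (q t)) \<le> ennreal ((2 * pi) powi (- int CARD('n) + int d)) *
       (\<integral>\<^sup>+\<alpha>. ennreal (sqrt (J t \<alpha>)) * indicator (SSigma_t t) \<alpha> \<partial>leray)"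
proof -
  let ?f = "\<lambda>\<alpha>. indicator (SSigma_t t) \<alpha> *\<^sub>R (\<i> ^ maslov t \<alpha> * complex_of_real (sqrt (J t \<alpha>)))"
  let ?K = "(2 * pi) powi (- int CARD('n) + int d)"
  have q_eq: "q t = of_real ?K * (LINT \<alpha>|leray. ?f \<alpha>)" unfolding q_def set_lebesgue_integral_def ..
  then have int: "integrable leray ?f" using q not_integrable_integral_eq[of leray ?f] by auto
  have J0: "J t \<alpha> \<ge> 0" if "\<alpha> \<in> SSigma_t t" for \<alpha> using J_nonneg SSigma_tD(1)[OF that] .
  have nf: "norm (?f \<alpha>) = indicator (SSigma_t t) \<alpha> * sqrt (J t \<alpha>)" for \<alpha>
    using J0[of \<alpha>] by (auto simp: norm_mult norm_power indicator_def)
  have "(\<lambda>\<alpha>. (norm (?f \<alpha>))\<^sup>2) \<in> borel_measurable leray"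
    by (rule borel_measurable_power[OF measurable_compose[OF borel_measurable_integrable[OF int] borel_measurable_norm]])
  moreover have "(norm (?f \<alpha>))\<^sup>2 = indicator (SSigma_t t) \<alpha> * J t \<alpha>" for \<alpha>
    unfolding nf using J0[of \<alpha>] by (auto simp: indicator_def)
  ultimately show "(\<lambda>\<alpha>. indicator (SSigma_t t) \<alpha> * J t \<alpha>) \<in> borel_measurable leray" by simp
  have K: "?K \<ge> 0" by simp
  have "ennreal (norm (q t)) = ennreal ?K * ennreal (norm (LINT \<alpha>|leray. ?f \<alpha>))"
    unfolding q_eq norm_mult norm_of_real abs_of_nonneg[OF K] by (rule ennreal_mult[OF K norm_ge_zero])
  also have "\<dots> \<le> ennreal ?K * (\<integral>\<^sup>+\<alpha>. ennreal (norm (?f \<alpha>)) \<partial>leray)"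
    by (intro mult_left_mono integral_norm_bound_ennreal int) simp
  also have "(\<integral>\<^sup>+\<alpha>. ennreal (norm (?f \<alpha>)) \<partial>leray) = (\<integral>\<^sup>+\<alpha>. ennreal (sqrt (J t \<alpha>)) * indicator (SSigma_t t) \<alpha> \<partial>leray)"
    unfolding nf by (intro nn_integral_cong) (simp add: indicator_def)
  finally show "ennreal (norm (q t)) \<le> ennreal ?K * (\<integral>\<^sup>+\<alpha>. ennreal (sqrt (J t \<alpha>)) * indicator (SSigma_t t) \<alpha> \<partial>leray)" .
qed

text \<open>
  The abstract estimate, applied to the flow on \<open>SN\<close>: near a nonrecurrent direction there is a basic open
  set to which its orbit never returns.
\<close>

lemma sum_integrals_sublinear:
  assumes nz: "emeasure leray SN \<noteq> 0" and AE: "AE \<alpha> in leray. \<alpha> \<notin> recurrent" and \<epsilon>: "\<epsilon> > 0"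
  shows "\<exists>R0\<ge>1. \<forall>R\<ge>R0. \<forall>T. finite T \<longrightarrow> T \<subseteq> {t \<in> return_times. q t \<noteq> 0} \<inter> {-R..R} \<longrightarrow>
     (\<Sum>t\<in>T. \<integral>\<^sup>+\<alpha>. ennreal (sqrt (J t \<alpha>)) * indicator (SSigma_t t) \<alpha> \<partial>leray) \<le> ennreal (\<epsilon> * R)"
proof -
  let ?T = "{t \<in> return_times. q t \<noteq> 0}"
  obtain \<delta> where \<delta>: "\<delta> > 0" "\<forall>\<alpha>\<in>SN. \<forall>t. t \<noteq> 0 \<and> \<bar>t\<bar> < \<delta> \<longrightarrow> G t \<alpha> \<notin> dot_conormal" using return_gap by blast
  from countable_SN_basis obtain U :: "nat \<Rightarrow> ('a \<times> (('a, 'n) chart \<Rightarrow> real^'n)) set" where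
    U: "(\<forall>k. U k \<in> sets leray) \<and>
      (\<forall>V \<alpha>. openin (subtopology cot_topology SN) V \<longrightarrow> \<alpha> \<in> V \<longrightarrow> (\<exists>k. \<alpha> \<in> U k \<and> U k \<subseteq> V))" ..
  note U = U[THEN conjunct1, rule_format] U[THEN conjunct2, rule_format]
  define W where "W k = {\<alpha> \<in> U k. \<forall>t. t \<noteq> 0 \<longrightarrow> G t \<alpha> \<notin> U k}" for k :: nat
  obtain Z where Z: "{\<alpha> \<in> space leray. \<not> (\<alpha> \<notin> recurrent)} \<subseteq> Z" "emeasure leray Z = 0" "Z \<in> sets leray"
    using AE by (rule AE_E)
  have SNs: "SN \<in> sets leray" using SN_borel by (simp add: sets_leray)
  have S: "SSigma_t t \<in> sets leray" if "t \<in> ?T" for t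
    using that emeasure_notin_sets[of "SSigma_t t" leray] unfolding return_times_def by (cases "SSigma_t t \<in> sets leray") auto
  have Jm: "(\<lambda>\<alpha>. indicator (SSigma_t t) \<alpha> * J t \<alpha>) \<in> borel_measurable leray" if "t \<in> ?T" for t
    by (rule q_nonzero_measurable(1)[OF _ S[OF that]]) (use that in simp)
  have JE: "(\<lambda>\<alpha>. indicator E \<alpha> * J t \<alpha>) \<in> borel_measurable leray" if t: "t \<in> ?T" and E: "E \<in> sets leray" "E \<subseteq> SSigma_t t" for E t
  proof -
    have "(\<lambda>\<alpha>. indicator E \<alpha> * (indicator (SSigma_t t) \<alpha> * J t \<alpha>)) \<in> borel_measurable leray"
      by (rule borel_measurable_times[OF borel_measurable_indicator[OF E(1)] Jm[OF t]])
    moreover have "indicator E \<alpha> * (indicator (SSigma_t t) \<alpha> * J t \<alpha>) = indicator E \<alpha> * J t \<alpha>" for \<alpha>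
      using E(2) by (cases "\<alpha> \<in> E") auto
    ultimately show ?thesis by simp
  qed
  have gap: "\<bar>t - s\<bar> \<ge> \<delta>" if x: "\<alpha> \<in> dot_cotangent" "G s \<alpha> \<in> SN" "G t \<alpha> \<in> dot_conormal" "s \<noteq> t" for s t \<alpha>
  proof (rule ccontr)
    assume "\<not> \<bar>t - s\<bar> \<ge> \<delta>"
    then have "t - s \<noteq> 0 \<and> \<bar>t - s\<bar> < \<delta>" using x(4) by simp
    then have "G (t - s) (G s \<alpha>) \<notin> dot_conormal" using \<delta>(2) x(2) by blast
    then show False using G_add[OF x(1), of "t - s" s] x(3) by simp
  qed
  show ?thesis
  proof (rule sum_sqrt_jacobian_sublinear[where \<phi> = G and j = J and C = "2 / \<delta> + 1" and U = U and W = W and Z = Z, OF _ S])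
    show "finite_measure leray"
    proof (rule finite_measureI)
      show "emeasure leray (space leray) \<noteq> \<infinity>"
        using emeasure_leray_cases[OF nz] SNs by (simp add: ennreal_mult_eq_top_iff)
    qed
    show "{x \<in> SSigma_t t. G t x \<in> B} \<in> sets leray" if t: "t \<in> ?T" and B: "B \<in> sets leray" for t B
    proof -
      have Bb: "B \<in> sets cot_borel" using B by (simp add: sets_leray)
      have "{x \<in> SSigma_t t. G t x \<in> B} = SSigma_t t \<inter> {\<alpha> \<in> dot_cotangent. G t \<alpha> \<in> B}"
        using SSigma_tD(2) SN_dot by blast
      then show ?thesis using S[OF t] G_vimage_borel[OF Bb, of t] unfolding sets_leray by auto
    qed
    show "G t x \<in> space leray" if "t \<in> ?T" "x \<in> SSigma_t t" for t x using SSigma_tD(3)[OF that(2)] by simp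
    show "0 \<le> J t x" if "t \<in> ?T" "x \<in> SSigma_t t" for t x by (rule J_nonneg[OF SSigma_tD(1)[OF that(2)]])
    show "(\<lambda>x. indicator (SSigma_t t) x * J t x) \<in> borel_measurable leray" if "t \<in> ?T" for t by (rule Jm[OF that])
    show "G t ` E \<in> sets leray" if "t \<in> ?T" "E \<in> sets leray" "E \<subseteq> SSigma_t t" for t E
      by (rule emeasure_leray_flow(1)[OF nz that(2,3) JE[OF that]])
    show "emeasure leray (G t ` E) = (\<integral>\<^sup>+x. ennreal (J t x) * indicator E x \<partial>leray)"
      if "t \<in> ?T" "E \<in> sets leray" "E \<subseteq> SSigma_t t" for t E
      by (rule emeasure_leray_flow(2)[OF nz that(2,3) JE[OF that]])
    show "real (card {t \<in> T. x \<in> SSigma_t t}) \<le> (2 / \<delta> + 1) * R"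
      if "R \<ge> 1" "finite T" "T \<subseteq> ?T \<inter> {-R..R}" for x R T
    proof (rule card_separated_le[OF _ _ \<delta>(1) that(1)])
      show "finite {t \<in> T. x \<in> SSigma_t t}" "{t \<in> T. x \<in> SSigma_t t} \<subseteq> {-R..R}" using that by auto
      fix s t assume s: "s \<in> {t \<in> T. x \<in> SSigma_t t}" and t: "t \<in> {t \<in> T. x \<in> SSigma_t t}" and ne: "s \<noteq> t"
      then have x: "x \<in> SSigma_t s" "x \<in> SSigma_t t" by simp_all
      from gap[OF SN_dot[OF SSigma_tD(2)[OF x(1)]] SSigma_tD(3)[OF x(1)] SSigma_tD(4)[OF x(2)] ne]
      show "\<delta> \<le> \<bar>s - t\<bar>" by simp
    qed
    show "real (card {t \<in> T. x \<in> G t ` SSigma_t t}) \<le> (2 / \<delta> + 1) * R"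
      if "R \<ge> 1" "finite T" "T \<subseteq> ?T \<inter> {-R..R}" for x R T
    proof (rule card_separated_le[OF _ _ \<delta>(1) that(1)])
      show "finite {t \<in> T. x \<in> G t ` SSigma_t t}" "{t \<in> T. x \<in> G t ` SSigma_t t} \<subseteq> {-R..R}" using that by auto
      fix s t assume s: "s \<in> {t \<in> T. x \<in> G t ` SSigma_t t}" and t: "t \<in> {t \<in> T. x \<in> G t ` SSigma_t t}" and ne: "s \<noteq> t"
      obtain \<alpha> where a: "\<alpha> \<in> SSigma_t s" "x = G s \<alpha>" using s by blast
      obtain \<beta> where b: "\<beta> \<in> SSigma_t t" "x = G t \<beta>" using t by blast
      have x: "x \<in> dot_cotangent" unfolding a(2) by (rule SN_dot[OF SSigma_tD(3)[OF a(1)]])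
      have "G (- s) x = \<alpha>" unfolding a(2) by (rule G_inverse(1)[OF SN_dot[OF SSigma_tD(2)[OF a(1)]]])
      moreover have "G (- t) x = \<beta>" unfolding b(2) by (rule G_inverse(1)[OF SN_dot[OF SSigma_tD(2)[OF b(1)]]])
      ultimately have "G (- s) x \<in> SN" "G (- t) x \<in> dot_conormal"
        using SSigma_tD(2)[OF a(1)] SN_D(1)[OF SSigma_tD(2)[OF b(1)]] by simp_all
      from gap[OF x this] ne show "\<delta> \<le> \<bar>s - t\<bar>" by simp
    qed
    show "U k \<in> sets leray" for k by (rule U(1))
    show "W k \<subseteq> U k" for k unfolding W_def by blast
    show "G s x \<notin> W k" if "s \<noteq> t" "x \<in> SSigma_t s" "G t x \<in> U k" for s t x k
    proof
      assume "G s x \<in> W k"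
      then have "G (t - s) (G s x) \<notin> U k" using that(1) unfolding W_def by simp
      then show False using G_add[OF SN_dot[OF SSigma_tD(2)[OF that(2)]], of "t - s" s] that(3) by simp
    qed
    show "Z \<in> null_sets leray" using Z(2,3) by (rule null_setsI)
    show "space leray \<subseteq> Z \<union> (\<Union>k. W k)"
    proof (rule subsetI)
      fix \<alpha> assume a: "\<alpha> \<in> space leray"
      show "\<alpha> \<in> Z \<union> (\<Union>k. W k)"
      proof (cases "\<alpha> \<in> recurrent")
        case True
        then show ?thesis using Z(1) a by blast
      next
        case False
        have "\<exists>V. (openin (subtopology cot_topology SN) V \<and> \<alpha> \<in> V) \<and> \<not> (\<exists>t. t \<noteq> 0 \<and> G t \<alpha> \<in> V)"
          using False a unfolding recurrent_def by simp
        then obtain V where V: "openin (subtopology cot_topology SN) V" "\<alpha> \<in> V" "\<not> (\<exists>t. t \<noteq> 0 \<and> G t \<alpha> \<in> V)" by blast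
        from U(2)[OF V(1,2)] obtain k where k: "\<alpha> \<in> U k" "U k \<subseteq> V" by blast
        have "\<alpha> \<in> W k" unfolding W_def using k V(3) by blast
        then show ?thesis by blast
      qed
    qed
    show "\<epsilon> > 0" by (rule \<epsilon>)
  qed
qed

text \<open>
  An infinite sum of nonnegative extended reals is the supremum of its finite partial sums, so the bound for these suffices.
\<close>

lemma tendsto_return_sum:
  assumes AE: "AE \<alpha> in leray. \<alpha> \<notin> recurrent"
  shows "((\<lambda>T::real. ennreal (1 / T) * (\<Sum>\<^sub>\<infinity>t \<in> return_times \<inter> {-T..T}. ennreal (norm (q t)))) \<longlongrightarrow> 0) at_top"
proof (cases "emeasure leray SN = 0")
  case True
  have "emeasure leray S = 0" for S
    using emeasure_space[of leray S] True by simp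
  then have "return_times = {}" unfolding return_times_def by simp
  then show ?thesis by simp
next
  case nz: False
  let ?K = "(2 * pi) powi (- int CARD('n) + int d)" and ?T = "{t \<in> return_times. q t \<noteq> 0}"
  let ?I = "\<lambda>t. \<integral>\<^sup>+\<alpha>. ennreal (sqrt (J t \<alpha>)) * indicator (SSigma_t t) \<alpha> \<partial>leray"
  have K: "?K > 0" by simp
  have bound: "ennreal (norm (q t)) \<le> ennreal ?K * ?I t" if "t \<in> ?T" for t
  proof (rule q_nonzero_measurable(2))
    show "q t \<noteq> 0" using that by simp
    show "SSigma_t t \<in> sets leray"
      using that emeasure_notin_sets[of "SSigma_t t" leray] unfolding return_times_def by (cases "SSigma_t t \<in> sets leray") auto
  qed
  show ?thesis
  proof (rule order_tendstoI)
    fix a :: ennreal assume "a > 0"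
    then obtain e where e: "e > 0" "ennreal e < a"
    proof (cases a)
      case (real r)
      then show ?thesis using \<open>a > 0\<close> by (intro that[of "r / 2"]) (simp_all add: ennreal_less_iff)
    next
      case top
      then show ?thesis by (intro that[of 1]) simp_all
    qed
    have "e / ?K > 0" using e(1) K by simp
    from sum_integrals_sublinear[OF nz AE this] obtain R0 where R0: "R0 \<ge> 1"
      "\<forall>R\<ge>R0. \<forall>T. finite T \<longrightarrow> T \<subseteq> ?T \<inter> {-R..R} \<longrightarrow> (\<Sum>t\<in>T. ?I t) \<le> ennreal (e / ?K * R)" by blast
    have "ennreal (1 / R) * (\<Sum>\<^sub>\<infinity>t \<in> return_times \<inter> {-R..R}. ennreal (norm (q t))) < a" if R: "R \<ge> R0" for R
    proof -
      have R1: "R > 0" using R R0(1) by simp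
      have "(\<Sum>\<^sub>\<infinity>t \<in> return_times \<inter> {-R..R}. ennreal (norm (q t))) \<le> ennreal (e * R)"
        unfolding nonneg_infsum_complete[of "return_times \<inter> {-R..R}" "\<lambda>t. ennreal (norm (q t))", OF zero_le]
      proof (rule SUP_least)
        fix F assume "F \<in> {F. finite F \<and> F \<subseteq> return_times \<inter> {-R..R}}"
        then have F: "finite F" "F \<subseteq> return_times \<inter> {-R..R}" by simp_all
        let ?F = "{t \<in> F. q t \<noteq> 0}"
        have "(\<Sum>t\<in>F. ennreal (norm (q t))) = (\<Sum>t\<in>?F. ennreal (norm (q t)))"
          using F(1) by (intro sum.mono_neutral_right) auto
        also have "\<dots> \<le> (\<Sum>t\<in>?F. ennreal ?K * ?I t)" using F(2) by (intro sum_mono bound) auto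
        also have "\<dots> = ennreal ?K * (\<Sum>t\<in>?F. ?I t)" by (rule sum_distrib_left[symmetric])
        also have "\<dots> \<le> ennreal ?K * ennreal (e / ?K * R)"
        proof (rule mult_left_mono)
          have "?F \<subseteq> ?T \<inter> {-R..R}" using F(2) by blast
          then show "(\<Sum>t\<in>?F. ?I t) \<le> ennreal (e / ?K * R)" using R0(2) R F(1) by simp
        qed simp
        also have "\<dots> = ennreal (e * R)" using K e(1) R1 by (subst ennreal_mult[symmetric]) simp_all
        finally show "(\<Sum>t\<in>F. ennreal (norm (q t))) \<le> ennreal (e * R)" .
      qed
      then have "ennreal (1 / R) * (\<Sum>\<^sub>\<infinity>t \<in> return_times \<inter> {-R..R}. ennreal (norm (q t))) \<le> ennreal (1 / R) * ennreal (e * R)"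
        by (rule mult_left_mono) simp
      also have "\<dots> = ennreal e" using R1 e(1) by (subst ennreal_mult[symmetric]) simp_all
      finally show ?thesis using e(2) by (rule le_less_trans)
    qed
    then show "eventually (\<lambda>R. ennreal (1 / R) * (\<Sum>\<^sub>\<infinity>t \<in> return_times \<inter> {-R..R}. ennreal (norm (q t))) < a) at_top"
      unfolding eventually_at_top_linorder by blast
  qed simp
qed

end

theorem proposition1p7:
  fixes A :: "('a::t2_space, 'n::finite) chart set"
    and g :: "('a, 'n) chart \<Rightarrow> real^'n \<Rightarrow> real^'n^'n"
    and H :: "'a set" and d :: nat
  assumes "compact_riemannian_submanifold A g H d"
    and "AE \<alpha> in compact_riemannian_submanifold.leray A g H d.
           \<alpha> \<notin> compact_riemannian_submanifold.recurrent A g H d"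
  shows "((\<lambda>T::real. ennreal (1 / T) *
            (\<Sum>\<^sub>\<infinity>t \<in> compact_riemannian_submanifold.return_times A g H d \<inter> {-T..T}.
               ennreal (norm (compact_riemannian_submanifold.q A g H d t)))) \<longlongrightarrow> 0) at_top"
  by (rule compact_riemannian_submanifold.tendsto_return_sum[OF assms])

end
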